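(* Let $Y$ be the solution to a backward stochastic differential equation $$dY_t=-f(\omega,t,Y_{t-},Z_t)\,dt+Z_t^*\,dM_t$$ with Markovian terminal condition $Y_T=\phi(X_T)$, for some deterministic function $\phi:\mathbb{R}^N\to\mathbb{R}$. Suppose $f$ is Markovian, that is, $f(\omega,t,Y_t,Z_t)=\tilde f(X_t,t,Y_t,Z_t)$ $\mathbb{P}\times dt$-a.e. for some function $\tilde f:\mathbb{R}^N\times\mathbb{R}^+\times\mathbb{R}\times\mathbb{R}^N\to\mathbb{R}$. Then for all $t<T$, $Y_t=u(t,X_t)$ for a deterministic function $u$, where - $u(T,\cdot)=\phi(\cdot)$; - the associated vector $\mathbf{u}_t$, with elements $u(t,e_i)$, satisfies the ODE $$d\mathbf{u}_t=-\big(\mathbf{f}(t,\mathbf{u}_t)+A_t^*\mathbf{u}_t\big)\,dt,$$ where $\mathbf{f}(t,\mathbf{u}_t)$ is the column vector with elements $e_i^*\mathbf{f}(t,\mathbf{u}_t):=\tilde f(e_i,t,e_i^*\mathbf{u}_t,\mathbf{u}_t)$; and - the solution process $Z$ is given by $Z_t=\mathbf{u}_t$ (up to equivalence $\sim_M$). In particular, $Z$ is deterministic and continuous.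
   Context: $X$ is a continuous-time finite-state Markov chain on a probability space $(\Omega,\mathbb{P})$, a right-continuous pure jump process taking values in the standard basis vectors $e_1,\dots,e_N$ of $\mathbb{R}^N$, with $X_0$ deterministic. $[\cdot]^*$ denotes transposition. $\{\mathcal{F}_t\}$ is the completion of the filtration generated by $X$. $A_t$ is the rate matrix, deterministic and possibly varying in time: $(A_t)_{ij}$ is the rate of jumping from state $j$ to state $i$, so $(A_t)_{ij}\ge 0$ for $i\ne j$ and every column of $A_t$ sums to $0$; all components of $A$ are uniformly bounded in time. It is assumed that $\mathbb{P}(X_t=e_i)>0$ for every $t>0$ and every $i$. $M$ is the $\mathbb{R}^N$-valued locally-finite-variation pure-jump martingale defined by $X_t=X_0+\int_{]0,t]}A_uX_{u-}\,du+M_t$. For $z\in\mathbb{R}^N$ put $\|z\|_{M_t}^2=z^*\frac{d\langle M,M\rangle_t}{dt}z$, where $\frac{d\langle M,M\rangle_t}{dt}=\mathrm{diag}(A_tX_{t-})-A_t\,\mathrm{diag}(X_{t-})-\mathrm{diag}(X_{t-})A_t^*$. For predictable $\mathbb{R}^N$-valued processes, $Z\sim_M Z'$ means $\|Z_t-Z'_t\|_{M_t}=0$ $dt\times d\mathbb{P}$-a.s. In the equation, $f:\Omega\times\mathbb{R}^+\times\mathbb{R}\times\mathbb{R}^N\to\mathbb{R}$ is progressively measurable. The BSDE is posed with $T>0$ and $Y_T\in L^2(\mathcal{F}_T)$ given; its solution is a pair $(Y,Z)$ with $Y$ real and adapted, $E[\sup_{t<T}Y_t^2]<\infty$, and $Z$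 predictable with values in $\mathbb{R}^N$, where $Z$ is determined only up to $\sim_M$. Standing assumptions on $f$: if $Z\sim_M Z'$ then $f(\omega,t,y,Z)=f(\omega,t,y,Z')$ up to indistinguishability; and $f$ satisfies sufficient conditions for the equation of interest, here the BSDE, to have a unique solution (with $Z$ unique up to $\sim_M$). Equality $Y_t=u(t,X_t)$ is understood up to indistinguishability.
   Formalization: The ODE and continuity of u hold on ]0,T], and on [0,T] if f(t,u_t) is integrable there: for f=1{X_t=e_2}/t with X_0=e_1, u(t,e_2) is unbounded at 0. "f is Markovian" is required for all progressive Y and predictable Z, not only the solution. *)

theory Defs
  imports "HOL-Probability.Probability"
begin

subsection \<open>Filtrations and measurability of processes\<close>

definition natural_filtration ::
  "'a measure \<Rightarrow> (real \<Rightarrow> 'a \<Rightarrow> real^'n) \<Rightarrow> real \<Rightarrow> 'a measure" where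
  "natural_filtration P X t =
     sigma (space P) (\<Union>s\<in>{0..t}. {X s -` B \<inter> space P | B. B \<in> sets borel})"

text \<open>\<open>null_sets (completion P)\<close> consists of all subsets of \<open>P\<close>-null sets, so \<open>P\<close> itself need
  not be complete.\<close>

definition completed_filtration ::
  "'a measure \<Rightarrow> (real \<Rightarrow> 'a \<Rightarrow> real^'n) \<Rightarrow> real \<Rightarrow> 'a measure" where
  "completed_filtration P X t =
     sigma (space P) (sets (natural_filtration P X t) \<union> null_sets (completion P))"

definition predictable_sigma ::
  "'a measure \<Rightarrow> (real \<Rightarrow> 'a \<Rightarrow> real^'n) \<Rightarrow> (real \<times> 'a) measure" where
  "predictable_sigma P X =
     sigma ({0..} \<times> space P)
       ({{0} \<times> B | B. B \<in> sets (completed_filtration P X 0)} \<union>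
        {{s<..t} \<times> B | s t B. 0 \<le> s \<and> s \<le> t \<and> B \<in> sets (completed_filtration P X s)})"

definition predictable ::
  "'a measure \<Rightarrow> (real \<Rightarrow> 'a \<Rightarrow> real^'n) \<Rightarrow> (real \<Rightarrow> 'a \<Rightarrow> real^'n) \<Rightarrow> bool" where
  "predictable P X Z \<longleftrightarrow>
     (\<lambda>(t, \<omega>). Z t \<omega>) \<in> borel_measurable (predictable_sigma P X)"

definition progressive ::
  "'a measure \<Rightarrow> (real \<Rightarrow> 'a \<Rightarrow> real^'n) \<Rightarrow> (real \<Rightarrow> 'a \<Rightarrow> real) \<Rightarrow> bool" where
  "progressive P X Y \<longleftrightarrow>
     (\<forall>S\<ge>0. (\<lambda>(t, \<omega>). Y t \<omega>) \<in>
        borel_measurable (restrict_space borel {0..S} \<Otimes>\<^sub>M completed_filtration P X S))"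

definition progressive_driver ::
  "'a measure \<Rightarrow> (real \<Rightarrow> 'a \<Rightarrow> real^'n) \<Rightarrow> ('a \<Rightarrow> real \<Rightarrow> real \<Rightarrow> real^'n \<Rightarrow> real) \<Rightarrow> bool" where
  "progressive_driver P X f \<longleftrightarrow>
     (\<forall>S\<ge>0. (\<lambda>((t, \<omega>), y, z). f \<omega> t y z) \<in>
        borel_measurable ((restrict_space borel {0..S} \<Otimes>\<^sub>M completed_filtration P X S)
                          \<Otimes>\<^sub>M (borel \<Otimes>\<^sub>M borel)))"

definition dt_dP :: "'a measure \<Rightarrow> real \<Rightarrow> (real \<times> 'a) measure" where
  "dt_dP P S = restrict_space lborel {0<..S} \<Otimes>\<^sub>M P"

definition left_lim :: "(real \<Rightarrow> 'a \<Rightarrow> 'b::t2_space) \<Rightarrow> real \<Rightarrow> 'a \<Rightarrow> 'b" where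
  "left_lim V t \<omega> = Lim (at_left t) (\<lambda>s. V s \<omega>)"

subsection \<open>The Markov chain\<close>

text \<open>Since the state space is finite, a path with left and right limits is piecewise constant
  with finitely many jumps on bounded intervals.

  \<open>A t $ i $ j\<close> is the rate of jumping from state \<open>j\<close> to state \<open>i\<close>. As \<open>A\<close> is merely bounded and
  measurable in time, this is expressed by the integrated forward equation for the transition
  probabilities; that the process \<open>chain_mart\<close> below is a martingale is a consequence.\<close>

locale markov_chain = prob_space P
  for P :: "'a measure" +
  fixes X :: "real \<Rightarrow> 'a \<Rightarrow> real^'n" and A :: "real \<Rightarrow> real^'n^'n"
  assumes measurable_X: "\<And>t. 0 \<le> t \<Longrightarrow> X t \<in> borel_measurable P"
    and state_X: "\<And>t \<omega>. 0 \<le> t \<Longrightarrow> \<omega> \<in> space P \<Longrightarrow> X t \<omega> \<in> range (\<lambda>i. axis i 1)"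
    and right_continuous_X:
      "\<And>t \<omega>. 0 \<le> t \<Longrightarrow> \<omega> \<in> space P \<Longrightarrow> ((\<lambda>s. X s \<omega>) \<longlongrightarrow> X t \<omega>) (at_right t)"
    and left_limits_X:
      "\<And>t \<omega>. 0 < t \<Longrightarrow> \<omega> \<in> space P \<Longrightarrow> \<exists>l. ((\<lambda>s. X s \<omega>) \<longlongrightarrow> l) (at_left t)"
    and deterministic_X0: "\<exists>x0. \<forall>\<omega>\<in>space P. X 0 \<omega> = x0"
    and measurable_A: "set_borel_measurable borel {0..} A"
    and bounded_A: "\<exists>K. \<forall>t\<ge>0. \<forall>i j. \<bar>A t $ i $ j\<bar> \<le> K"
    and nonneg_A: "\<And>t i j. 0 \<le> t \<Longrightarrow> i \<noteq> j \<Longrightarrow> 0 \<le> A t $ i $ j"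
    and column_sum_A: "\<And>t j. 0 \<le> t \<Longrightarrow> (\<Sum>i\<in>UNIV. A t $ i $ j) = 0"
    and markov_property:
      "\<And>s t i. 0 \<le> s \<Longrightarrow> s \<le> t \<Longrightarrow>
         AE \<omega> in P.
           real_cond_exp P (natural_filtration P X s)
             (indicator {\<omega>\<in>space P. X t \<omega> = axis i 1}) \<omega> =
           real_cond_exp P (vimage_algebra (space P) (X s) borel)
             (indicator {\<omega>\<in>space P. X t \<omega> = axis i 1}) \<omega>"
    and transition_rates:
      "\<And>s t i j. 0 \<le> s \<Longrightarrow> s \<le> t \<Longrightarrow> \<P>(\<omega> in P. X s \<omega> = axis j 1) > 0 \<Longrightarrow>
         \<P>(\<omega> in P. X t \<omega> = axis i 1 \<bar> X s \<omega> = axis j 1) =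
           (if i = j then 1 else 0) +
           integral {s..t} (\<lambda>r. \<Sum>k\<in>UNIV.
             A r $ i $ k * \<P>(\<omega> in P. X r \<omega> = axis k 1 \<bar> X s \<omega> = axis j 1))"

subsection \<open>The martingale of the chain\<close>

definition chain_mart ::
  "(real \<Rightarrow> 'a \<Rightarrow> real^'n) \<Rightarrow> (real \<Rightarrow> real^'n^'n) \<Rightarrow> real \<Rightarrow> 'a \<Rightarrow> real^'n" where
  "chain_mart X A t \<omega> = X t \<omega> - X 0 \<omega> - integral {0..t} (\<lambda>u. A u *v left_lim X u \<omega>)"

definition diag :: "real^'n \<Rightarrow> real^'n^'n" where
  "diag v = (\<chi> i j. if i = j then v $ i else 0)"

definition bracket_density ::
  "(real \<Rightarrow> 'a \<Rightarrow> real^'n) \<Rightarrow> (real \<Rightarrow> real^'n^'n) \<Rightarrow> real \<Rightarrow> 'a \<Rightarrow> real^'n^'n" where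
  "bracket_density X A t \<omega> =
     diag (A t *v left_lim X t \<omega>) - A t ** diag (left_lim X t \<omega>)
       - diag (left_lim X t \<omega>) ** transpose (A t)"

definition M_norm_sq ::
  "(real \<Rightarrow> 'a \<Rightarrow> real^'n) \<Rightarrow> (real \<Rightarrow> real^'n^'n) \<Rightarrow> real \<Rightarrow> 'a \<Rightarrow> real^'n \<Rightarrow> real" where
  "M_norm_sq X A t \<omega> z = z \<bullet> (bracket_density X A t \<omega> *v z)"

definition M_equiv ::
  "'a measure \<Rightarrow> (real \<Rightarrow> 'a \<Rightarrow> real^'n) \<Rightarrow> (real \<Rightarrow> real^'n^'n) \<Rightarrow> real \<Rightarrow>
   (real \<Rightarrow> 'a \<Rightarrow> real^'n) \<Rightarrow> (real \<Rightarrow> 'a \<Rightarrow> real^'n) \<Rightarrow> bool" where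
  "M_equiv P X A S Z Z' \<longleftrightarrow>
     predictable P X Z \<and> predictable P X Z' \<and>
     (AE (t, \<omega>) in dt_dP P S. M_norm_sq X A t \<omega> (Z t \<omega> - Z' t \<omega>) = 0)"

text \<open>The paths of \<open>chain_mart X A\<close> have finite variation on bounded intervals: they are the sum of
  finitely many jumps and an absolutely continuous part with density \<open>- A r *v left_lim X r \<omega>\<close>.
  The integral over \<open>]s,t]\<close> is the pathwise Lebesgue--Stieltjes integral.\<close>

definition mart_integrable ::
  "(real \<Rightarrow> 'a \<Rightarrow> real^'n) \<Rightarrow> (real \<Rightarrow> real^'n^'n) \<Rightarrow> real \<Rightarrow>
   (real \<Rightarrow> 'a \<Rightarrow> real^'n) \<Rightarrow> 'a \<Rightarrow> bool" where
  "mart_integrable X A S Z \<omega> \<longleftrightarrow>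
     (\<lambda>r. Z r \<omega> \<bullet> (A r *v left_lim X r \<omega>)) absolutely_integrable_on {0..S}"

definition mart_integral ::
  "(real \<Rightarrow> 'a \<Rightarrow> real^'n) \<Rightarrow> (real \<Rightarrow> real^'n^'n) \<Rightarrow> real \<Rightarrow> real \<Rightarrow>
   (real \<Rightarrow> 'a \<Rightarrow> real^'n) \<Rightarrow> 'a \<Rightarrow> real" where
  "mart_integral X A s t Z \<omega> =
     (\<Sum>r | r \<in> {s<..t} \<and> chain_mart X A r \<omega> \<noteq> left_lim (chain_mart X A) r \<omega>.
        Z r \<omega> \<bullet> (chain_mart X A r \<omega> - left_lim (chain_mart X A) r \<omega>))
     - integral {s..t} (\<lambda>r. Z r \<omega> \<bullet> (A r *v left_lim X r \<omega>))"

subsection \<open>Backward stochastic differential equations\<close>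

definition bsde_solution ::
  "'a measure \<Rightarrow> (real \<Rightarrow> 'a \<Rightarrow> real^'n) \<Rightarrow> (real \<Rightarrow> real^'n^'n) \<Rightarrow>
   ('a \<Rightarrow> real \<Rightarrow> real \<Rightarrow> real^'n \<Rightarrow> real) \<Rightarrow> real \<Rightarrow> ('a \<Rightarrow> real) \<Rightarrow>
   (real \<Rightarrow> 'a \<Rightarrow> real) \<Rightarrow> (real \<Rightarrow> 'a \<Rightarrow> real^'n) \<Rightarrow> bool" where
  "bsde_solution P X A f S \<xi> Y Z \<longleftrightarrow>
     (\<forall>t\<in>{0..S}. Y t \<in> borel_measurable (completed_filtration P X t)) \<and>
     predictable P X Z \<and>
     (\<integral>\<^sup>+ \<omega>. (\<Squnion>t\<in>{0..<S}. ennreal ((Y t \<omega>)\<^sup>2)) \<partial>P) < \<infinity> \<and>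
     (AE \<omega> in P.
        (\<lambda>r. f \<omega> r (left_lim Y r \<omega>) (Z r \<omega>)) absolutely_integrable_on {0..S} \<and>
        mart_integrable X A S Z \<omega> \<and>
        (\<forall>t\<in>{0..S}. Y t \<omega> =
           \<xi> \<omega> + integral {t..S} (\<lambda>r. f \<omega> r (left_lim Y r \<omega>) (Z r \<omega>))
               - mart_integral X A t S Z \<omega>))"

definition square_integrable_data ::
  "'a measure \<Rightarrow> (real \<Rightarrow> 'a \<Rightarrow> real^'n) \<Rightarrow> real \<Rightarrow> ('a \<Rightarrow> real) \<Rightarrow> bool" where
  "square_integrable_data P X S \<xi> \<longleftrightarrow>
     \<xi> \<in> borel_measurable (completed_filtration P X S) \<and>
     (\<integral>\<^sup>+ \<omega>. ennreal ((\<xi> \<omega>)\<^sup>2) \<partial>P) < \<infinity>"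

definition bsde_uniquely_solvable ::
  "'a measure \<Rightarrow> (real \<Rightarrow> 'a \<Rightarrow> real^'n) \<Rightarrow> (real \<Rightarrow> real^'n^'n) \<Rightarrow>
   ('a \<Rightarrow> real \<Rightarrow> real \<Rightarrow> real^'n \<Rightarrow> real) \<Rightarrow> real \<Rightarrow> ('a \<Rightarrow> real) \<Rightarrow> bool" where
  "bsde_uniquely_solvable P X A f S \<xi> \<longleftrightarrow>
     (\<exists>Y Z. bsde_solution P X A f S \<xi> Y Z) \<and>
     (\<forall>Y Z Y' Z'. bsde_solution P X A f S \<xi> Y Z \<longrightarrow> bsde_solution P X A f S \<xi> Y' Z' \<longrightarrow>
        (AE \<omega> in P. \<forall>t\<in>{0..S}. Y t \<omega> = Y' t \<omega>) \<and> M_equiv P X A S Z Z')"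

text \<open>\<open>f\<close> sees \<open>Z\<close> only up to \<open>M_equiv\<close>. ``Up to indistinguishability'' has to be read as
  ``\<open>dt \<times> dP\<close>-a.e.'': equality at every time would force \<open>f\<close> not to depend on \<open>z\<close> at all,
  because \<open>M_equiv\<close> ignores single times.\<close>

definition respects_M_equiv ::
  "'a measure \<Rightarrow> (real \<Rightarrow> 'a \<Rightarrow> real^'n) \<Rightarrow> (real \<Rightarrow> real^'n^'n) \<Rightarrow>
   ('a \<Rightarrow> real \<Rightarrow> real \<Rightarrow> real^'n \<Rightarrow> real) \<Rightarrow> real \<Rightarrow> bool" where
  "respects_M_equiv P X A f S \<longleftrightarrow>
     (\<forall>Z Z'. M_equiv P X A S Z Z' \<longrightarrow>
        (AE (t, \<omega>) in dt_dP P S. \<forall>y. f \<omega> t y (Z t \<omega>) = f \<omega> t y (Z' t \<omega>)))"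

definition markovian_driver ::
  "'a measure \<Rightarrow> (real \<Rightarrow> 'a \<Rightarrow> real^'n) \<Rightarrow> ('a \<Rightarrow> real \<Rightarrow> real \<Rightarrow> real^'n \<Rightarrow> real) \<Rightarrow> real \<Rightarrow>
   (real^'n \<Rightarrow> real \<Rightarrow> real \<Rightarrow> real^'n \<Rightarrow> real) \<Rightarrow> bool" where
  "markovian_driver P X f S ft \<longleftrightarrow>
     (\<forall>Y Z. progressive P X Y \<longrightarrow> predictable P X Z \<longrightarrow>
        (AE (t, \<omega>) in dt_dP P S. f \<omega> t (Y t \<omega>) (Z t \<omega>) = ft (X t \<omega>) t (Y t \<omega>) (Z t \<omega>)))"

subsection \<open>The associated ordinary differential equation\<close>

definition driver_vec ::
  "(real^'n \<Rightarrow> real \<Rightarrow> real \<Rightarrow> real^'n \<Rightarrow> real) \<Rightarrow> real \<Rightarrow> real^'n \<Rightarrow> real^'n" where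
  "driver_vec ft t v = (\<chi> i. ft (axis i 1) t (v $ i) v)"

definition value_vec :: "(real \<Rightarrow> real^'n \<Rightarrow> real) \<Rightarrow> real \<Rightarrow> real^'n" where
  "value_vec u t = (\<chi> i. u t (axis i 1))"

text \<open>\<open>d v = -(driver_vec ft t v + A* v) dt\<close> in integrated form, as coefficients are only measurable in
  time. At time \<open>0\<close> the chain sits in one state, so the driver at the other states need not be
  integrable near \<open>0\<close> (e.g. \<open>f \<omega> t y z = 1/t\<close> off the initial state), and a solution may
  exist on \<open>]0,T]\<close> only; hence the parameter \<open>J\<close>.\<close>

definition solves_ode_on ::
  "real set \<Rightarrow> (real \<Rightarrow> real^'n^'n) \<Rightarrow>
   (real^'n \<Rightarrow> real \<Rightarrow> real \<Rightarrow> real^'n \<Rightarrow> real) \<Rightarrow> (real \<Rightarrow> real^'n) \<Rightarrow> bool" where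
  "solves_ode_on J A ft v \<longleftrightarrow>
     (\<forall>s\<in>J. \<forall>t\<in>J. s \<le> t \<longrightarrow>
        (\<lambda>r. driver_vec ft r (v r) + transpose (A r) *v v r) absolutely_integrable_on {s..t} \<and>
        v t - v s = - integral {s..t} (\<lambda>r. driver_vec ft r (v r) + transpose (A r) *v v r))"

end

theory Submission
  imports Defs
begin

text \<open>
  Let \<open>0 < S < T\<close>. After \<open>S\<close> the pair \<open>(Y, Z)\<close> is a functional of the path of \<open>X\<close> up to \<open>S\<close> and of the
  path after \<open>S\<close>. Given \<open>X\<^sub>S = e\<^sub>j\<close> these paths are independent, so by Fubini almost every fixed past \<open>p\<close>
  turns the functional into a solution on \<open>[S,T]\<close> over the event \<open>X\<^sub>S = e\<^sub>j\<close>. A solution on \<open>[0,S]\<close> ending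
  in the frozen values continues it to a solution on \<open>[0,T]\<close> with the same terminal value, and uniqueness
  shows that \<open>Y\<^sub>S\<close> depends on \<open>X\<^sub>S\<close> only.

  The paths of \<open>Y\<close> that sit in \<open>e\<^sub>i\<close> near a time \<open>t\<close> make \<open>u(\<cdot>, e\<^sub>i)\<close> continuous there. At a jump of \<open>X\<close>
  from \<open>e\<^sub>j\<close> to \<open>e\<^sub>i\<close> the equation gives \<open>Z\<^sub>i - Z\<^sub>j = u(t, e\<^sub>i) - u(t, e\<^sub>j)\<close>, and the compensator of the jumps
  turns this into \<open>Z \<sim>\<^sub>M u\<close>. Along a path without jumps the equation is then the differential equation
  of \<open>u(\<cdot>, e\<^sub>i)\<close>.
\<close>

section \<open>Pure jump paths\<close>

text \<open>Unique solvability is an abstract hypothesis: there is no Lipschitz bound, hence no a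
  priori estimate, no comparison and no Picard scheme that could carry the Markov property. What
  remains is to build another solution and compare. This is why a past is frozen rather than
  averaged (an average over pasts would not survive a nonlinear driver), and why the glued pair must
  meet every clause of the solution concept: adaptedness, predictability and a square integrable
  supremum. The last clause restricts the choice of the past and is carried through Fubini by a
  supremum over rational times. Freezing demands joint measurability in all arguments, but
  \<open>ft\<close> has none and \<open>f\<close> is measurable for the completed filtration only.
  So \<open>ft\<close> is replaced by a Borel function, and processes by versions for the natural
  filtration. Uniqueness yields one null set for each time. Rational times, right-continuous paths
  and the positive probability of every state at every positive time remedy this: to prove a
  deterministic statement near a time, one well-chosen path is enough.\<close>

definition step_path :: "(real \<Rightarrow> real^'n) \<Rightarrow> bool" where
  "step_path x \<longleftrightarrow> (\<forall>t\<ge>0. x t \<in> range (\<lambda>i. axis i 1)) \<and> (\<forall>t\<ge>0. (x \<longlongrightarrow> x t) (at_right t)) \<and>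
     (\<forall>t>0. \<exists>l. (x \<longlongrightarrow> l) (at_left t))"

abbreviation llim :: "(real \<Rightarrow> 'b::t2_space) \<Rightarrow> real \<Rightarrow> 'b" where
  "llim x t \<equiv> Lim (at_left t) x"

definition jumps :: "(real \<Rightarrow> real^'n) \<Rightarrow> real set" where
  "jumps x = {r. 0 < r \<and> x r \<noteq> llim x r}"

text \<open>In a T1 space the points of \<open>B\<close> other than \<open>l\<close> form a closed
  set, so a limit of values in a finite set is attained eventually. This turns one-sided limits of
  the chain into constancy.\<close>

lemma tendsto_finite_range:
  fixes f :: "'b \<Rightarrow> 'c::t1_space"
  assumes "finite B" "(f \<longlongrightarrow> l) F" "\<forall>\<^sub>F s in F. f s \<in> B" "F \<noteq> bot"
  shows "l \<in> B" "\<forall>\<^sub>F s in F. f s = l"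
proof -
  have "open (- (B - {l}))" using assms(1) by (intro open_Compl finite_imp_closed) auto
  with assms(2) have ev: "\<forall>\<^sub>F s in F. f s \<in> - (B - {l})"
    by (rule topological_tendstoD) auto
  show *: "\<forall>\<^sub>F s in F. f s = l"
    using ev assms(3) by eventually_elim auto
  from * assms(3) have "\<forall>\<^sub>F s in F. l \<in> B"
    by eventually_elim auto
  then show "l \<in> B"
    using assms(4) by (simp add: eventually_const_iff)
qed

lemma llim_eqI:
  fixes x :: "real \<Rightarrow> 'b::t2_space"
  assumes "a < t" "\<And>s. a < s \<Longrightarrow> s < t \<Longrightarrow> x s = c"
  shows "llim x t = c"
proof -
  have "\<forall>\<^sub>F s in at_left t. x s = c"
    unfolding eventually_at_left_field using assms by auto
  then have "(x \<longlongrightarrow> c) (at_left t)" by (rule tendsto_eventually)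
  then show ?thesis by (intro tendsto_Lim) auto
qed

lemma llim_cong:
  fixes x y :: "real \<Rightarrow> 'b::t2_space"
  assumes "a < t" "\<And>s. a < s \<Longrightarrow> s < t \<Longrightarrow> x s = y s"
  shows "llim x t = llim y t"
proof -
  have "\<forall>\<^sub>F s in at_left t. x s = y s"
    unfolding eventually_at_left_field using assms by auto
  then have "(x \<longlongrightarrow> l) (at_left t) = (y \<longlongrightarrow> l) (at_left t)" for l
    by (rule tendsto_cong)
  then show ?thesis by (simp add: Topological_Spaces.Lim_def)
qed

context
  fixes x :: "real \<Rightarrow> real^'n"
  assumes x: "step_path x"
begin

lemma step_path_right:
  assumes "0 \<le> t" shows "\<exists>d>0. \<forall>s\<in>{t..<t+d}. x s = x t"
proof -
  have "\<forall>\<^sub>F s in at_right t. x s \<in> range (\<lambda>i. axis i 1)"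
    unfolding eventually_at_right_field using assms x
    by (intro exI[of _ "t+1"]) (auto simp: step_path_def)
  then have "\<forall>\<^sub>F s in at_right t. x s = x t"
    using assms x by (intro tendsto_finite_range(2)[where B="range (\<lambda>i. axis i 1)"]) (auto simp: step_path_def)
  then obtain b where b: "b > t" "\<forall>y>t. y < b \<longrightarrow> x y = x t"
    unfolding eventually_at_right_field by auto
  then show ?thesis by (intro exI[of _ "b - t"]) (auto simp: less_eq_real_def)
qed

lemma step_path_left:
  assumes "0 < t"
  shows "\<exists>d>0. d \<le> t \<and> (\<forall>s\<in>{t-d<..<t}. x s = llim x t)" "llim x t \<in> range (\<lambda>i. axis i 1)"
    "(x \<longlongrightarrow> llim x t) (at_left t)"
proof -
  obtain l where l: "(x \<longlongrightarrow> l) (at_left t)" using x assms by (auto simp: step_path_def)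
  have L: "llim x t = l" using l by (intro tendsto_Lim) auto
  then show "(x \<longlongrightarrow> llim x t) (at_left t)" using l by simp
  have "\<forall>\<^sub>F s in at_left t. x s \<in> range (\<lambda>i. axis i 1)"
    unfolding eventually_at_left_field using assms x
    by (intro exI[of _ 0]) (auto simp: step_path_def)
  then have *: "l \<in> range (\<lambda>i. axis i 1)" "\<forall>\<^sub>F s in at_left t. x s = l"
    using l by (auto intro: tendsto_finite_range[where B="range (\<lambda>i. axis i 1)"])
  show "llim x t \<in> range (\<lambda>i. axis i 1)" using * L by simp
  from *(2) obtain b where b: "b < t" "\<forall>y>b. y < t \<longrightarrow> x y = l"
    unfolding eventually_at_left_field by auto
  then show "\<exists>d>0. d \<le> t \<and> (\<forall>s\<in>{t-d<..<t}. x s = llim x t)"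
    using assms L by (intro exI[of _ "min t (t-b)"]) (auto simp: min_def)
qed

text \<open>Both claims pass from adjacent intervals to their union, and on a short interval around
  \<open>c\<close> the only possible jump is \<open>c\<close> itself. Bolzano's bisection principle
  then gives the result without enumerating jump times.\<close>

lemma finite_jumps_telescope:
  assumes "0 \<le> a" "a \<le> b"
  shows "finite (jumps x \<inter> {a<..b}) \<and> (\<Sum>r\<in>jumps x \<inter> {a<..b}. x r - llim x r) = x b - x a"
proof -
  define Q where "Q \<equiv> \<lambda>a b. 0 \<le> a \<and> a \<le> b \<longrightarrow> finite (jumps x \<inter> {a<..b}) \<and> (\<Sum>r\<in>jumps x \<inter> {a<..b}. x r - llim x r) = x b - x a"
  have "Q a b"
    using \<open>a \<le> b\<close>
  proof (induction rule: Bolzano)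
    case (trans a b c)
    show ?case
      unfolding Q_def
    proof safe
      assume "0 \<le> a"
      have eq: "jumps x \<inter> {a<..c} = (jumps x \<inter> {a<..b}) \<union> (jumps x \<inter> {b<..c})"
        using trans by auto
      have f: "finite (jumps x \<inter> {a<..b})" "finite (jumps x \<inter> {b<..c})"
        using trans \<open>0 \<le> a\<close> by (auto simp: Q_def)
      then show "finite (jumps x \<inter> {a<..c})" using eq by simp
      show "(\<Sum>r\<in>jumps x \<inter> {a<..c}. x r - llim x r) = x c - x a"
        unfolding eq using trans f \<open>0 \<le> a\<close> by (subst sum.union_disjoint) (auto simp: Q_def)
    qed
  next
    case (local c)
    have "0 \<le> c" using local assms by auto
    obtain d1 where d1: "d1 > 0" "\<And>s. c \<le> s \<Longrightarrow> s < c + d1 \<Longrightarrow> x s = x c"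
      using step_path_right[OF \<open>0 \<le> c\<close>] by (auto simp only: atLeastLessThan_iff Ball_def)
    have right: "s \<notin> jumps x" if "s \<in> {c<..<c+d1}" for s
    proof -
      have "llim x s = x c" using that by (intro llim_eqI[of c] d1(2)) auto
      moreover have "x s = x c" using that by (intro d1(2)) auto
      ultimately show ?thesis by (simp add: jumps_def)
    qed
    \<comment> \<open>At \<open>c = 0\<close> there is no left side, so the left gap is required for
      positive \<open>c\<close> only.\<close>
    obtain d2 where d2: "d2 > 0" "c > 0 \<longrightarrow> d2 \<le> c \<and> (\<forall>s\<in>{c-d2<..<c}. x s = llim x c)"
      using step_path_left(1)[of c] \<open>0 \<le> c\<close> zero_less_one by (cases "c = 0") (blast, force)
    have left: "s \<notin> jumps x" if "s \<in> {c-d2<..<c}" "0 < s" for s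
    proof -
      have "x s = llim x c" "c > 0" using d2 that by auto
      moreover have "llim x s = llim x c" using d2 that \<open>c > 0\<close> by (intro llim_eqI[of "c-d2"]) auto
      ultimately show ?thesis by (auto simp: jumps_def)
    qed
    show ?case
    proof (rule exI[of _ "min d1 d2"], safe)
      fix a b assume ab: "a \<le> c" "c \<le> b" "b - a < min d1 d2"
      show "Q a b" unfolding Q_def
      proof (intro impI)
        assume a: "0 \<le> a \<and> a \<le> b"
        have sub: "jumps x \<inter> {a<..b} \<subseteq> {c}"
          using left right ab a by (force simp: not_less)
        have xb: "x b = x c" using ab by (intro d1(2)) auto
        show "finite (jumps x \<inter> {a<..b}) \<and> (\<Sum>r\<in>jumps x \<inter> {a<..b}. x r - llim x r) = x b - x a"
        proof (cases "a < c")
          case True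
          then have xa: "x a = llim x c" using d2 ab a by auto
          show ?thesis
          proof (cases "c \<in> jumps x")
            case True
            then have "jumps x \<inter> {a<..b} = {c}" using sub \<open>a < c\<close> ab by auto
            then show ?thesis using xa xb by simp
          next
            case False
            then have "jumps x \<inter> {a<..b} = {}" using sub by auto
            moreover have "x c = llim x c" using False \<open>a < c\<close> a by (auto simp: jumps_def)
            ultimately show ?thesis using xa xb by simp
          qed
        next
          case False
          then have "jumps x \<inter> {a<..b} = {}" using sub ab by auto
          then show ?thesis using False ab xb by simp
        qed
      qed
    qed (use d1 d2 in auto)
  qed
  then show ?thesis using assms by (simp add: Q_def)
qed

lemma finite_jumps: "0 \<le> a \<Longrightarrow> finite (jumps x \<inter> {a<..b})"
  by (cases "a \<le> b") (use finite_jumps_telescope[of a b] in blast, simp)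

lemma countable_jumps: "countable (jumps x)"
proof -
  have "jumps x \<subseteq> (\<Union>n::nat. jumps x \<inter> {0<..real n})"
    using real_arch_simple by (fastforce simp: jumps_def)
  moreover have "countable (jumps x \<inter> {0<..real n})" for n
    using finite_jumps[of 0 "real n"] by (simp add: countable_finite)
  ultimately show ?thesis by (meson countable_UN countable_subset countableI_type)
qed

lemma AE_not_jump: "AE r in lborel. r \<notin> jumps x"
  by (intro AE_not_in countable_imp_null_set_lborel countable_jumps)

lemma jumps_right_gap:
  assumes "0 \<le> t" shows "\<exists>d>0. jumps x \<inter> {t<..<t+d} = {}"
proof -
  obtain d1 where d1: "d1 > 0" "\<And>s. t \<le> s \<Longrightarrow> s < t + d1 \<Longrightarrow> x s = x t"
    using step_path_right[OF assms] by (auto simp only: atLeastLessThan_iff Ball_def)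
  have "s \<notin> jumps x" if "s \<in> {t<..<t+d1}" for s
  proof -
    have "llim x s = x t" using that by (intro llim_eqI[of t] d1(2)) auto
    moreover have "x s = x t" using that by (intro d1(2)) auto
    ultimately show ?thesis by (simp add: jumps_def)
  qed
  then show ?thesis using d1 by blast
qed

lemma jumps_left_gap:
  assumes "0 < t" shows "\<exists>d>0. d \<le> t \<and> jumps x \<inter> {t-d<..<t} = {}"
proof -
  obtain d where d: "d > 0" "d \<le> t" "\<forall>s\<in>{t-d<..<t}. x s = llim x t" using step_path_left(1)[OF assms] by auto
  have "s \<notin> jumps x" if "s \<in> {t-d<..<t}" for s
  proof -
    have "llim x s = llim x t" using d that by (intro llim_eqI[of "t-d"]) auto
    then show ?thesis using d that by (auto simp: jumps_def)
  qed
  then show ?thesis using d by blast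
qed

end

lemma constant_nearby:
  assumes x: "step_path x" and s: "0 < s" and c: "llim x s = c" "x s = c"
  obtains d where "0 < d" "d \<le> s" "\<And>r. \<bar>r - s\<bar> < d \<Longrightarrow> x r = c" "\<And>r. \<bar>r - s\<bar> < d \<Longrightarrow> llim x r = c"
proof -
  obtain d1 where d1: "0 < d1" "d1 \<le> s" "\<forall>r\<in>{s-d1<..<s}. x r = llim x s" using step_path_left(1)[OF x s] by blast
  obtain d2 where d2: "0 < d2" "\<forall>r\<in>{s..<s+d2}. x r = x s" using step_path_right[OF x less_imp_le[OF s]] by blast
  define d where "d = min d1 d2"
  have eq: "x r = c" if "\<bar>r - s\<bar> < d" for r
  proof (cases "r < s")
    case True
    then have "r \<in> {s-d1<..<s}" using that by (auto simp: d_def)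
    then show ?thesis using d1(3) c by metis
  next
    case False
    then have "r \<in> {s..<s+d2}" using that by (auto simp: d_def)
    then show ?thesis using d2(2) c by metis
  qed
  have "llim x r = c" if "\<bar>r - s\<bar> < d" for r
    by (rule llim_eqI[of "s - d"]) (use that in \<open>auto intro!: eq\<close>)
  then show thesis using eq d1 d2 by (intro that[of d]) (auto simp: d_def)
qed

section \<open>Sums over jumps and paths of solutions\<close>

definition jump_sum :: "(real \<Rightarrow> real^'n) \<Rightarrow> (real \<Rightarrow> real^'n) \<Rightarrow> real \<Rightarrow> real \<Rightarrow> real" where
  "jump_sum x g a b = (\<Sum>r\<in>jumps x \<inter> {a<..b}. g r \<bullet> (x r - llim x r))"

lemma jump_sum_self [simp]: "jump_sum x g a a = 0"
  by (simp add: jump_sum_def)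

lemma jump_sum_split:
  assumes "step_path x" "0 \<le> a" "a \<le> b" "b \<le> c"
  shows "jump_sum x g a c = jump_sum x g a b + jump_sum x g b c"
proof -
  have eq: "jumps x \<inter> {a<..c} = (jumps x \<inter> {a<..b}) \<union> (jumps x \<inter> {b<..c})"
    using assms by auto
  show ?thesis unfolding jump_sum_def eq
    using assms finite_jumps[OF assms(1)] by (subst sum.union_disjoint) auto
qed

lemma jump_sum_cong:
  assumes "\<And>r. r \<in> jumps x \<Longrightarrow> a < r \<Longrightarrow> r \<le> b \<Longrightarrow> g r \<bullet> (x r - llim x r) = h r \<bullet> (x r - llim x r)"
  shows "jump_sum x g a b = jump_sum x h a b"
  unfolding jump_sum_def using assms by (intro sum.cong) auto

lemma absolutely_integrable_on_vec_iff:
  fixes g :: "real \<Rightarrow> real^'n"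
  shows "g absolutely_integrable_on S \<longleftrightarrow> (\<forall>i. (\<lambda>x. g x $ i) absolutely_integrable_on S)"
proof -
  have "g absolutely_integrable_on S \<longleftrightarrow> (\<forall>b\<in>Basis. (\<lambda>x. g x \<bullet> b) absolutely_integrable_on S)"
    by (rule absolutely_integrable_componentwise_iff)
  also have "\<dots> \<longleftrightarrow> (\<forall>i. (\<lambda>x. g x $ i) absolutely_integrable_on S)"
    by (simp add: Basis_vec_def inner_axis)
  finally show ?thesis .
qed

lemma integrable_on_split_abs:
  fixes g :: "real \<Rightarrow> 'b::euclidean_space"
  assumes "g absolutely_integrable_on {a..c}" "a \<le> b" "b \<le> c"
  shows "integral {a..c} g = integral {a..b} g + integral {b..c} g"
  using Henstock_Kurzweil_Integration.integral_combine[OF assms(2,3), of g]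
    set_lebesgue_integral_eq_integral(1)[OF assms(1)] by simp

lemma absolutely_integrable_Icc_subset:
  fixes g :: "real \<Rightarrow> 'b::euclidean_space"
  assumes "g absolutely_integrable_on {a..b}" "a \<le> c" "d \<le> b"
  shows "g absolutely_integrable_on {c..d}"
  by (rule set_integrable_subset[OF assms(1)]) (use assms in auto)

text \<open>The form of every solution path: absolutely continuous between jumps of size \<open>h r \<bullet> \<Delta>x r\<close>.\<close>

definition sol_path :: "(real \<Rightarrow> real^'n) \<Rightarrow> (real \<Rightarrow> real) \<Rightarrow> (real \<Rightarrow> real^'n) \<Rightarrow> real \<Rightarrow> real \<Rightarrow> (real \<Rightarrow> real) \<Rightarrow> bool" where
  "sol_path x g h a b y \<longleftrightarrow> g absolutely_integrable_on {a..b} \<and>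
     (\<forall>t\<in>{a..b}. y t = y a - integral {a..t} g + jump_sum x h a t)"

context
  fixes x :: "real \<Rightarrow> real^'n" and g y :: "real \<Rightarrow> real" and h a b
  assumes x: "step_path x" and a: "0 \<le> a" and y: "sol_path x g h a b y"
begin

lemma sol_path_eq:
  assumes "a \<le> t" "t \<le> b"
  shows "y t = y a - integral {a..t} g + jump_sum x h a t"
  using y assms unfolding sol_path_def by (simp only: atLeastAtMost_iff)

lemma sol_path_abs: "g absolutely_integrable_on {a..b}"
  using y by (simp only: sol_path_def)

lemma sol_path_integrable: "g integrable_on {a..b}"
  using sol_path_abs by (rule set_lebesgue_integral_eq_integral(1))

lemma sol_path_diff:
  assumes "a \<le> s" "s \<le> t" "t \<le> b"
  shows "y t - y s = - integral {s..t} g + jump_sum x h s t"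
proof -
  have "g absolutely_integrable_on {a..t}"
    using sol_path_abs assms by (auto intro: absolutely_integrable_Icc_subset)
  then have "integral {a..t} g = integral {a..s} g + integral {s..t} g"
    using assms by (intro integrable_on_split_abs) auto
  moreover have "jump_sum x h a t = jump_sum x h a s + jump_sum x h s t"
    using assms a x by (intro jump_sum_split) auto
  moreover have "y t = y a - integral {a..t} g + jump_sum x h a t" "y s = y a - integral {a..s} g + jump_sum x h a s"
    using assms by (auto intro!: sol_path_eq simp del: diff_add_eq)
  ultimately show ?thesis by linarith
qed

lemma sol_path_right:
  assumes "a \<le> t" "t < b" shows "(y \<longlongrightarrow> y t) (at_right t)"
proof -
  obtain d where d: "d > 0" "jumps x \<inter> {t<..<t+d} = {}" using jumps_right_gap[OF x, of t] assms a by auto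
  have cont: "continuous_on {a..b} (\<lambda>s. integral {a..s} g)"
    using sol_path_integrable by (rule indefinite_integral_continuous_1)
  have "((\<lambda>s. y a - integral {a..s} g + jump_sum x h a t) \<longlongrightarrow> y a - integral {a..t} g + jump_sum x h a t) (at t within {t..b})"
    using continuous_on_subset[OF cont, of "{t..b}"] assms
    by (intro tendsto_intros) (auto simp: continuous_on_def)
  then have lim: "((\<lambda>s. y a - integral {a..s} g + jump_sum x h a t) \<longlongrightarrow> y t) (at_right t)"
    using sol_path_eq[of t] assms by (simp add: at_within_Icc_at_right)
  have "y s = y a - integral {a..s} g + jump_sum x h a t" if "t < s" "s < min b (t+d)" for s
  proof -
    have "jumps x \<inter> {t<..s} = {}" using d that by auto
    then have "jump_sum x h t s = 0" by (simp add: jump_sum_def)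
    then have "jump_sum x h a s = jump_sum x h a t"
      using jump_sum_split[OF x a, of t s h] assms that by simp
    then show ?thesis using sol_path_eq[of s] that assms by auto
  qed
  then have "\<forall>\<^sub>F s in at_right t. y a - integral {a..s} g + jump_sum x h a t = y s"
    unfolding eventually_at_right_field using assms d by (intro exI[of _ "min b (t+d)"]) auto
  then show ?thesis using lim by (rule Lim_transform_eventually[rotated])
qed

text \<open>Just before \<open>t\<close> the interval \<open>{s<..t}\<close> contains at most the
  jump at \<open>t\<close>, so the left limit lacks exactly that term. At a jump of the chain this
  equation will determine a difference of two components of the integrand.\<close>

lemma sol_path_left:
  assumes "a < t" "t \<le> b"
  shows "(y \<longlongrightarrow> y t - h t \<bullet> (x t - llim x t)) (at_left t)"
    "llim y t = y t - h t \<bullet> (x t - llim x t)"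
proof -
  have "0 < t" using a assms by auto
  obtain d where d: "d > 0" "d \<le> t" "jumps x \<inter> {t-d<..<t} = {}" using jumps_left_gap[OF x, of t] assms a by auto
  have cont: "continuous_on {a..b} (\<lambda>s. integral {a..s} g)"
    using sol_path_integrable by (rule indefinite_integral_continuous_1)
  have yt: "y t = y a - integral {a..t} g + jump_sum x h a t" using assms by (intro sol_path_eq) auto
  define c where "c = jump_sum x h a t - h t \<bullet> (x t - llim x t)"
  have "((\<lambda>s. y a - integral {a..s} g + c) \<longlongrightarrow> y a - integral {a..t} g + c) (at t within {a..t})"
    using continuous_on_subset[OF cont, of "{a..t}"] assms
    by (intro tendsto_intros) (auto simp: continuous_on_def)
  then have lim: "((\<lambda>s. y a - integral {a..s} g + c) \<longlongrightarrow> y t - h t \<bullet> (x t - llim x t)) (at_left t)"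
    using yt assms by (simp add: at_within_Icc_at_left c_def add_diff_eq)
  have "y s = y a - integral {a..s} g + c" if "max a (t-d) < s" "s < t" for s
  proof -
    have "jumps x \<inter> {s<..t} \<subseteq> {t}"
    proof
      fix r assume "r \<in> jumps x \<inter> {s<..t}"
      then have "r \<in> {t-d<..<t} \<or> r = t" using that by auto
      then show "r \<in> {t}" using d(3) \<open>r \<in> _\<close> by auto
    qed
    then have "jump_sum x h s t = h t \<bullet> (x t - llim x t)"
    proof (cases "t \<in> jumps x")
      case True
      then have "jumps x \<inter> {s<..t} = {t}" using \<open>jumps x \<inter> {s<..t} \<subseteq> {t}\<close> that by auto
      then show ?thesis by (simp add: jump_sum_def)
    next
      case False
      then have "jumps x \<inter> {s<..t} = {}" using \<open>jumps x \<inter> {s<..t} \<subseteq> {t}\<close> that by auto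
      moreover have "x t = llim x t" using False \<open>0 < t\<close> by (auto simp: jumps_def)
      ultimately show ?thesis by (simp add: jump_sum_def)
    qed
    then have "jump_sum x h a s = c"
      using jump_sum_split[OF x a, of s t h] assms that by (simp add: c_def)
    then show ?thesis using sol_path_eq[of s] that assms by auto
  qed
  then have "\<forall>\<^sub>F s in at_left t. y a - integral {a..s} g + c = y s"
    unfolding eventually_at_left_field using assms d by (intro exI[of _ "max a (t-d)"]) auto
  then show *: "(y \<longlongrightarrow> y t - h t \<bullet> (x t - llim x t)) (at_left t)"
    using lim by (rule Lim_transform_eventually[rotated])
  then show "llim y t = y t - h t \<bullet> (x t - llim x t)" by (intro tendsto_Lim) auto
qed

lemma sol_path_llim_eq:
  assumes "a < t" "t \<le> b" "t \<notin> jumps x"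
  shows "llim y t = y t"
proof -
  have "x t = llim x t" using assms a by (auto simp: jumps_def)
  then show ?thesis using sol_path_left(2)[OF assms(1,2)] by simp
qed

end

section \<open>Predictable and progressive processes\<close>

lemma choice_obtain:
  assumes "\<forall>i. \<exists>c\<in>S. Q i c"
  obtains C where "\<And>i. C i \<in> S" "\<And>i. Q i (C i)"
proof -
  have "\<forall>i. \<exists>c. c \<in> S \<and> Q i c" using assms by blast
  from choice[OF this] show thesis using that by blast
qed

text \<open>A real number is the infimum of the rationals above it, so representatives of the
  countably many sets {f < q} rebuild the function. The exceptional event is common to all times in
  \<open>I\<close>: a half-line gives versions of processes up to indistinguishability, a singleton
  gives versions of random variables.\<close>

lemma representative_fun:
  fixes f :: "'x \<Rightarrow> real"
  assumes f: "f \<in> borel_measurable N1"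
    and pos: "\<And>t \<omega>. t \<in> I \<Longrightarrow> \<omega> \<in> space P \<Longrightarrow> p t \<omega> \<in> space N1"
    and rep: "\<And>C. C \<in> sets N1 \<Longrightarrow> \<exists>C'\<in>sets N2. AE \<omega> in P. \<forall>t\<in>I. p t \<omega> \<in> C \<longleftrightarrow> \<theta> t \<omega> \<in> C'"
  shows "\<exists>f'\<in>borel_measurable N2. AE \<omega> in P. \<forall>t\<in>I. f (p t \<omega>) = f' (\<theta> t \<omega>)"
proof -
  have "\<exists>C'\<in>sets N2. AE \<omega> in P. \<forall>t\<in>I. p t \<omega> \<in> {x\<in>space N1. f x < of_rat q} \<longleftrightarrow> \<theta> t \<omega> \<in> C'" for q
    using f by (intro rep) measurable
  then have "\<exists>C. \<forall>q. C q \<in> sets N2 \<and>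
      (AE \<omega> in P. \<forall>t\<in>I. p t \<omega> \<in> {x\<in>space N1. f x < of_rat q} \<longleftrightarrow> \<theta> t \<omega> \<in> C q)"
    unfolding Bex_def by (intro choice allI)
  then obtain C where C: "\<And>q. C q \<in> sets N2"
    "\<And>q. AE \<omega> in P. \<forall>t\<in>I. p t \<omega> \<in> {x\<in>space N1. f x < of_rat q} \<longleftrightarrow> \<theta> t \<omega> \<in> C q"
    by blast
  \<comment> \<open>The infinite default makes the infimum run over those \<open>q\<close> whose set
    contains \<open>x\<close>. It is finite, and equal to \<open>f\<close>, at the points that
    matter.\<close>
  define f' where "f' x = real_of_ereal (INF q. if x \<in> C q then ereal (of_rat q) else \<infinity>)" for x
  have "f' \<in> borel_measurable N2"
    using C(1) unfolding f'_def by measurable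
  moreover have "AE \<omega> in P. \<forall>q. \<forall>t\<in>I. p t \<omega> \<in> {x\<in>space N1. f x < of_rat q} \<longleftrightarrow> \<theta> t \<omega> \<in> C q"
    using C(2) by (simp add: AE_all_countable)
  then have "AE \<omega> in P. \<forall>t\<in>I. f (p t \<omega>) = f' (\<theta> t \<omega>)"
    using AE_space
  proof eventually_elim
    case (elim \<omega>)
    show ?case
    proof
      fix t assume t: "t \<in> I"
      have iff: "\<theta> t \<omega> \<in> C q \<longleftrightarrow> f (p t \<omega>) < of_rat q" for q
        using elim t pos by auto
      have "(INF q. if \<theta> t \<omega> \<in> C q then ereal (of_rat q) else \<infinity>) = ereal (f (p t \<omega>))"
      proof (rule antisym)
        show "(INF q. if \<theta> t \<omega> \<in> C q then ereal (of_rat q) else \<infinity>) \<le> ereal (f (p t \<omega>))"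
        proof (rule dense_ge)
          fix z assume "ereal (f (p t \<omega>)) < z"
          then obtain r where r: "ereal (f (p t \<omega>)) < ereal r" "ereal r < z"
            using ereal_dense2 by blast
          obtain q where q: "f (p t \<omega>) < of_rat q" "of_rat q < r" using r of_rat_dense by auto
          show "(INF q. if \<theta> t \<omega> \<in> C q then ereal (of_rat q) else \<infinity>) \<le> z"
          proof (rule INF_lower2[of q])
            have "ereal (of_rat q) < ereal r" using q by simp
            then have "ereal (of_rat q) < z" using r(2) by (rule less_trans)
            then show "(if \<theta> t \<omega> \<in> C q then ereal (of_rat q) else \<infinity>) \<le> z"
              using q iff by simp
          qed simp
        qed
        show "ereal (f (p t \<omega>)) \<le> (INF q. if \<theta> t \<omega> \<in> C q then ereal (of_rat q) else \<infinity>)"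
          by (rule INF_greatest) (simp add: iff)
      qed
      then show "f (p t \<omega>) = f' (\<theta> t \<omega>)" by (simp add: f'_def)
    qed
  qed
  ultimately show ?thesis by blast
qed

section \<open>The predictable sigma-algebra of an arbitrary filtration\<close>

definition pred_sigma :: "'a set \<Rightarrow> (real \<Rightarrow> 'a measure) \<Rightarrow> (real \<times> 'a) measure" where
  "pred_sigma \<Omega> F = sigma ({0..} \<times> \<Omega>)
     ({{0} \<times> B | B. B \<in> sets (F 0)} \<union> {{s<..t} \<times> B | s t B. 0 \<le> s \<and> s \<le> t \<and> B \<in> sets (F s)})"

lemma predictable_sigma_eq: "predictable_sigma P X = pred_sigma (space P) (completed_filtration P X)"
  by (simp add: predictable_sigma_def pred_sigma_def)

text \<open>The grid point of mesh 2^-n strictly to the left of \<open>t\<close>. It is constant on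
  intervals that are open on the left and closed on the right, the shape of the predictable
  generators, and sampling there never looks at time \<open>t\<close> itself.\<close>

definition dyad :: "nat \<Rightarrow> real \<Rightarrow> real" where
  "dyad n t = (real_of_int \<lceil>t * 2^n\<rceil> - 1) / 2^n"

lemma dyad_less: "dyad n t < t"
proof -
  have "real_of_int \<lceil>t * 2^n\<rceil> - 1 < t * 2^n" by linarith
  then show ?thesis by (simp add: dyad_def divide_less_eq)
qed

lemma dyad_ge: "t - 1/2^n \<le> dyad n t"
proof -
  have "(t * 2^n - 1) / 2^n \<le> (real_of_int \<lceil>t * 2^n\<rceil> - 1) / 2^n"
    by (intro divide_right_mono) auto
  then show ?thesis by (simp add: dyad_def diff_divide_distrib)
qed

lemma dyad_tendsto: "(\<lambda>n. dyad n t) \<longlonglongrightarrow> t"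
proof (rule tendsto_sandwich)
  have "(\<lambda>n. t - (1/2)^n) \<longlonglongrightarrow> t - 0" by (intro tendsto_intros LIMSEQ_realpow_zero) auto
  then show "(\<lambda>n. t - 1/2^n) \<longlonglongrightarrow> t" by (simp add: power_divide)
  show "\<forall>\<^sub>F n in sequentially. t - 1/2^n \<le> dyad n t" by (simp add: dyad_ge)
  show "\<forall>\<^sub>F n in sequentially. dyad n t \<le> t" by (simp add: dyad_less less_imp_le)
qed auto

lemma dyad_at_left: "filterlim (\<lambda>n. dyad n t) (at_left t) sequentially"
  unfolding filterlim_at using dyad_tendsto dyad_less[of _ t] by (auto intro!: always_eventually dest: less_imp_neq)

lemma dyad_lim:
  fixes w :: "real \<Rightarrow> 'b::t2_space"
  assumes "(w \<longlongrightarrow> l) (at_left t)" shows "(\<lambda>n. w (dyad n t)) \<longlonglongrightarrow> l" "lim (\<lambda>n. w (dyad n t)) = l"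
  using filterlim_compose[OF assms dyad_at_left] by (auto intro: limI)

lemma dyad_eq:
  assumes "real k / 2^n < t" "t \<le> (real k + 1) / 2^n" shows "dyad n t = real k / 2^n"
proof -
  have "\<lceil>t * 2^n\<rceil> = int k + 1"
    using assms by (intro ceiling_unique) (auto simp: field_simps)
  then show ?thesis by (simp add: dyad_def)
qed

lemma dyad_cover:
  assumes "0 < t" obtains k :: nat where "real k / 2^n < t" "t \<le> (real k + 1) / 2^n"
proof -
  define k where "k = nat (\<lceil>t * 2^n\<rceil> - 1)"
  have "\<lceil>t * 2^n\<rceil> \<ge> 1" using assms by simp
  then have k: "real k = real_of_int \<lceil>t * 2^n\<rceil> - 1" by (simp add: k_def)
  have "real k < t * 2^n" "t * 2^n \<le> real k + 1" unfolding k by linarith+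
  then show ?thesis by (intro that[of k]) (auto simp: field_simps)
qed

locale filtered =
  fixes \<Omega> :: "'a set" and F :: "real \<Rightarrow> 'a measure"
  assumes space_F: "\<And>t. space (F t) = \<Omega>"
    and mono_F: "\<And>s t. 0 \<le> s \<Longrightarrow> s \<le> t \<Longrightarrow> sets (F s) \<subseteq> sets (F t)"
begin

lemma pred_gen: "{{0} \<times> B | B. B \<in> sets (F 0)} \<union> {{s<..t} \<times> B | s t B. 0 \<le> s \<and> s \<le> t \<and> B \<in> sets (F s)} \<subseteq> Pow ({0..} \<times> \<Omega>)"
proof -
  have "B \<subseteq> \<Omega>" if "B \<in> sets (F t)" for B t using sets.sets_into_space[OF that] by (simp add: space_F)
  then show ?thesis by auto
qed

lemma space_pred: "space (pred_sigma \<Omega> F) = {0..} \<times> \<Omega>"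
  unfolding pred_sigma_def using pred_gen by (rule space_measure_of)

lemma sets_pred: "sets (pred_sigma \<Omega> F) = sigma_sets ({0..} \<times> \<Omega>) ({{0} \<times> B | B. B \<in> sets (F 0)} \<union> {{s<..t} \<times> B | s t B. 0 \<le> s \<and> s \<le> t \<and> B \<in> sets (F s)})"
  unfolding pred_sigma_def using pred_gen by (rule sets_measure_of)

lemma pred_zero: "B \<in> sets (F 0) \<Longrightarrow> {0} \<times> B \<in> sets (pred_sigma \<Omega> F)"
  unfolding sets_pred by (rule sigma_sets.Basic) auto

lemma pred_rect: "0 \<le> s \<Longrightarrow> B \<in> sets (F s) \<Longrightarrow> {s<..t} \<times> B \<in> sets (pred_sigma \<Omega> F)"
proof (cases "s \<le> t")
  case True
  assume "0 \<le> s" "B \<in> sets (F s)"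
  then show ?thesis
    unfolding sets_pred using True by (intro sigma_sets.Basic) blast
qed simp

lemma pred_tail: assumes "0 \<le> s" "B \<in> sets (F s)" shows "{s<..} \<times> B \<in> sets (pred_sigma \<Omega> F)"
proof -
  have "{s<..} \<times> B = (\<Union>n::nat. {s<..s + real n} \<times> B)"
  proof safe
    fix t b assume "s < t" "b \<in> B"
    obtain n :: nat where "t - s \<le> real n" using real_arch_simple by blast
    then show "(t, b) \<in> (\<Union>n::nat. {s<..s + real n} \<times> B)" using \<open>s < t\<close> \<open>b \<in> B\<close> by (intro UN_I[of n]) auto
  qed auto
  then show ?thesis using assms by (auto intro!: sets.countable_UN pred_rect)
qed

lemma pred_measurable_time: "fst \<in> borel_measurable (pred_sigma \<Omega> F)"
proof (rule borel_measurableI_le)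
  fix y :: real
  have "\<Omega> \<in> sets (F 0)" using sets.top[of "F 0"] by (simp add: space_F)
  moreover have "{x \<in> space (pred_sigma \<Omega> F). fst x \<le> y} = (if y < 0 then {} else {0} \<times> \<Omega> \<union> {0<..y} \<times> \<Omega>)"
    by (auto simp: space_pred)
  ultimately show "{x \<in> space (pred_sigma \<Omega> F). fst x \<le> y} \<in> sets (pred_sigma \<Omega> F)"
    by (simp add: pred_zero pred_rect sets.Un)
qed

lemma pred_measurable_time_fun:
  assumes "y \<in> borel_measurable borel"
  shows "(\<lambda>(t, \<omega>). y t) \<in> measurable (pred_sigma \<Omega> F) borel"
  using measurable_compose[OF pred_measurable_time assms] by (simp add: case_prod_beta)

text \<open>On the grid interval that follows \<open>k / 2^n\<close> the sampled value is known at
  its left end. A preimage is therefore a countable union of generating rectangles, plus the slice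
  at time 0 when \<open>0\<close> lies in \<open>U\<close>.\<close>

lemma pred_sampling:
  fixes W :: "real \<Rightarrow> 'a \<Rightarrow> 'b::{banach, second_countable_topology}"
  assumes W: "\<And>t. 0 \<le> t \<Longrightarrow> W t \<in> borel_measurable (F t)"
  shows "(\<lambda>(t, \<omega>). if 0 < t then W (dyad n t) \<omega> else 0) \<in> borel_measurable (pred_sigma \<Omega> F)" (is "?f \<in> _")
proof (rule measurableI)
  fix U :: "'b set" assume U: "U \<in> sets borel"
  have "?f -` U \<inter> space (pred_sigma \<Omega> F) = (if 0 \<in> U then {0} \<times> \<Omega> else {}) \<union>
     (\<Union>k::nat. {real k / 2^n<..(real k + 1) / 2^n} \<times> (W (real k / 2^n) -` U \<inter> \<Omega>))" (is "?L = ?R")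
  proof (intro set_eqI iffI)
    fix x assume x: "x \<in> ?L"
    obtain t \<omega> where [simp]: "x = (t, \<omega>)" by (cases x)
    show "x \<in> ?R"
    proof (cases "t = 0")
      case True then show ?thesis using x by (auto simp: space_pred)
    next
      case False
      then have "0 < t" using x by (auto simp: space_pred)
      obtain k :: nat where k: "real k / 2^n < t" "t \<le> (real k + 1) / 2^n" using dyad_cover[OF \<open>0 < t\<close>] .
      have "\<omega> \<in> W (real k / 2^n) -` U \<inter> \<Omega>" using x \<open>0 < t\<close> dyad_eq[OF k] by (auto simp: space_pred)
      then show ?thesis using k by auto
    qed
  next
    fix x assume x: "x \<in> ?R"
    obtain t \<omega> where [simp]: "x = (t, \<omega>)" by (cases x)
    from x consider "0 \<in> U" "t = 0" "\<omega> \<in> \<Omega>" |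
      k :: nat where "real k / 2^n < t" "t \<le> (real k + 1) / 2^n" "W (real k / 2^n) \<omega> \<in> U" "\<omega> \<in> \<Omega>"
      by (auto split: if_splits)
    then show "x \<in> ?L"
    proof cases
      case 2
      have "0 \<le> real k / 2^n" by simp
      then have "0 < t" using 2(1) by linarith
      then show ?thesis using dyad_eq[OF 2(1,2)] 2 by (auto simp: space_pred)
    qed (auto simp: space_pred)
  qed
  also have "\<dots> \<in> sets (pred_sigma \<Omega> F)"
  proof -
    have "W (real k / 2^n) -` U \<inter> \<Omega> \<in> sets (F (real k / 2^n))" for k :: nat
      using measurable_sets[OF W U, of "real k / 2^n"] by (simp add: space_F)
    moreover have "\<Omega> \<in> sets (F 0)" using sets.top[of "F 0"] by (simp add: space_F)
    ultimately show ?thesis by (auto intro!: sets.Un sets.countable_UN pred_rect pred_zero)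
  qed
  finally show "?f -` U \<inter> space (pred_sigma \<Omega> F) \<in> sets (pred_sigma \<Omega> F)" .
qed auto

text \<open>Where the samples diverge, \<open>lim\<close> has a fixed default value and the limit
  function is still measurable. Paths with genuine left limits are brought in by
  \<open>dyad_lim\<close>.\<close>

lemma pred_left_limit:
  fixes W :: "real \<Rightarrow> 'a \<Rightarrow> 'b::{banach, second_countable_topology}"
  assumes W: "\<And>t. 0 \<le> t \<Longrightarrow> W t \<in> borel_measurable (F t)"
  shows "(\<lambda>(t, \<omega>). if 0 < t then lim (\<lambda>n. W (dyad n t) \<omega>) else 0) \<in> borel_measurable (pred_sigma \<Omega> F)"
proof -
  have *: "(\<lambda>x. lim (\<lambda>n. (case x of (t, \<omega>) \<Rightarrow> if 0 < t then W (dyad n t) \<omega> else 0))) \<in> borel_measurable (pred_sigma \<Omega> F)"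
    by (intro borel_measurable_lim_metric pred_sampling W)
  show ?thesis
    by (rule measurable_cong[THEN iffD1, OF _ *]) (auto intro: limI)
qed

text \<open>A generator that starts at \<open>s\<close> meets a time \<open>u\<close> in
  \<open>I\<close> only if s < u, and then its event already belongs to \<open>M\<close>. With
  \<open>I\<close> a bounded interval and \<open>M\<close> the sigma-algebra at its right end this
  is progressive measurability.\<close>

lemma pred_measurable_prod:
  fixes g :: "real \<times> 'a \<Rightarrow> 'b::{real_normed_vector, second_countable_topology}"
  assumes g: "g \<in> borel_measurable (pred_sigma \<Omega> F)" and I: "I \<in> sets borel" "I \<subseteq> {0..}"
    and M: "space M = \<Omega>" "\<And>s t. 0 \<le> s \<Longrightarrow> s \<le> t \<Longrightarrow> t \<in> I \<Longrightarrow> sets (F s) \<subseteq> sets M"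
  shows "(\<lambda>x. if fst x \<in> I then g x else 0) \<in> borel_measurable (borel \<Otimes>\<^sub>M M)"
proof -
  let ?R = "restrict_space (borel \<Otimes>\<^sub>M M) {x. fst x \<in> I}"
  have I': "{x \<in> space (borel \<Otimes>\<^sub>M M). fst x \<in> I} \<in> sets (borel \<Otimes>\<^sub>M M)"
    using I by measurable
  have sp: "space ?R = I \<times> \<Omega>" using M by (auto simp: space_restrict_space space_pair_measure)
  have "(\<lambda>x. x) \<in> measurable ?R (pred_sigma \<Omega> F)"
    unfolding pred_sigma_def
  proof (rule measurable_measure_of[OF pred_gen])
    show "(\<lambda>x. x) \<in> space ?R \<rightarrow> {0..} \<times> \<Omega>" using sp I by auto
    have rect: "(U \<times> B) \<inter> space ?R \<in> sets ?R" if "U \<in> sets borel" "\<And>t. t \<in> U \<inter> I \<Longrightarrow> B \<in> sets M" for U B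
    proof (cases "U \<inter> I = {}")
      case True
      then have "(U \<times> B) \<inter> space ?R = {}" using sp by auto
      then show ?thesis by simp
    next
      case False
      then have "U \<times> B \<in> sets (borel \<Otimes>\<^sub>M M)" using that by auto
      moreover have "(U \<times> B) \<inter> space ?R = {x. fst x \<in> I} \<inter> (U \<times> B)"
        using sp sets.sets_into_space[of B M] that False M by (auto simp: space_restrict_space)
      ultimately show ?thesis by (auto simp: sets_restrict_space)
    qed
    fix A assume "A \<in> {{0} \<times> B |B. B \<in> sets (F 0)} \<union> {{s<..t} \<times> B |s t B. 0 \<le> s \<and> s \<le> t \<and> B \<in> sets (F s)}"
    then consider B where "A = {0} \<times> B" "B \<in> sets (F 0)" |
      s t B where "A = {s<..t} \<times> B" "0 \<le> s" "B \<in> sets (F s)" by blast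
    then have "A \<inter> space ?R \<in> sets ?R"
    proof cases
      case 1
      then show ?thesis using M(2)[of 0 0] by (auto intro!: rect)
    next
      case 2
      show ?thesis unfolding 2
      proof (rule rect)
        fix u assume "u \<in> {s<..t} \<inter> I"
        then show "B \<in> sets M" using M(2)[of s u] 2 by auto
      qed simp
    qed
    then show "(\<lambda>x. x) -` A \<inter> space ?R \<in> sets ?R" by simp
  qed
  then have "(\<lambda>x. g x) \<in> borel_measurable ?R" by (rule measurable_compose[OF _ g])
  then show ?thesis by (subst measurable_If_restrict_space_iff[OF I']) auto
qed

lemma pred_section:
  assumes g: "g \<in> borel_measurable (pred_sigma \<Omega> F)" and \<omega>: "\<omega> \<in> \<Omega>"
  shows "(\<lambda>t. if 0 \<le> t then g (t, \<omega>) else 0 :: 'b::{real_normed_vector, second_countable_topology}) \<in> borel_measurable borel"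
proof -
  \<comment> \<open>A single sigma-algebra containing the whole filtration makes
    \<open>pred_measurable_prod\<close> applicable to all nonnegative times.\<close>
  let ?M = "sigma \<Omega> (\<Union>t\<in>{0..}. sets (F t))"
  have "B \<subseteq> \<Omega>" if "B \<in> sets (F t)" for B t using sets.sets_into_space[OF that] by (simp add: space_F)
  then have sub: "(\<Union>t\<in>{0..}. sets (F t)) \<subseteq> Pow \<Omega>" by blast
  have "(\<lambda>x. if fst x \<in> {0..} then g x else 0) \<in> borel_measurable (borel \<Otimes>\<^sub>M ?M)"
    by (rule pred_measurable_prod[OF g]) (use sub in \<open>auto simp: sets_measure_of\<close>)
  moreover have "(\<lambda>t. (t, \<omega>)) \<in> measurable borel (borel \<Otimes>\<^sub>M ?M)"
    using \<omega> sub by (intro measurable_Pair) (auto simp: space_measure_of)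
  ultimately have "(\<lambda>t. if fst (t, \<omega>) \<in> {0..} then g (t, \<omega>) else 0) \<in> borel_measurable borel"
    by (rule measurable_compose[rotated])
  then show ?thesis by simp
qed

end

section \<open>Natural filtration: past, future and splicing\<close>

text \<open>One definition for the past \<open>{0..t}\<close>, the future \<open>{S..}\<close> and
  the stretch \<open>{S..t}\<close> in between.\<close>

definition gen_sigma :: "'a measure \<Rightarrow> (real \<Rightarrow> 'a \<Rightarrow> real^'n) \<Rightarrow> real set \<Rightarrow> 'a measure" where
  "gen_sigma P X I = sigma (space P) (\<Union>s\<in>I. {X s -` B \<inter> space P | B. B \<in> sets borel})"

lemma natural_filtration_eq: "natural_filtration P X t = gen_sigma P X {0..t}"
  by (simp add: natural_filtration_def gen_sigma_def)

lemma gen_sigma_sub: "(\<Union>s\<in>I. {X s -` B \<inter> space P | B. B \<in> sets borel}) \<subseteq> Pow (space P)"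
  by auto

lemma space_gen_sigma [simp]: "space (gen_sigma P X I) = space P"
  unfolding gen_sigma_def using gen_sigma_sub by (rule space_measure_of)

lemma sets_gen_sigma: "sets (gen_sigma P X I) = sigma_sets (space P) (\<Union>s\<in>I. {X s -` B \<inter> space P | B. B \<in> sets borel})"
  unfolding gen_sigma_def using gen_sigma_sub by (rule sets_measure_of)

lemma gen_sigma_mono: "I \<subseteq> J \<Longrightarrow> sets (gen_sigma P X I) \<subseteq> sets (gen_sigma P X J)"
  unfolding sets_gen_sigma by (intro sigma_sets_mono') blast

lemma measurable_gen_sigma: "s \<in> I \<Longrightarrow> X s \<in> borel_measurable (gen_sigma P X I)"
  by (intro measurableI) (auto simp: sets_gen_sigma intro!: sigma_sets.Basic)

lemma gen_sigma_subset:
  assumes "\<And>s. s \<in> I \<Longrightarrow> X s \<in> borel_measurable M" "space M = space P"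
  shows "sets (gen_sigma P X I) \<subseteq> sets M"
proof -
  have "(\<Union>s\<in>I. {X s -` B \<inter> space P | B. B \<in> sets borel}) \<subseteq> sets M"
    using assms measurable_sets[OF assms(1)] by auto
  then show ?thesis unfolding sets_gen_sigma assms(2)[symmetric] by (rule sets.sigma_sets_subset)
qed

lemma measurable_from_subset:
  assumes "f \<in> measurable N L" "sets N \<subseteq> sets M" "space N = space M" shows "f \<in> measurable M L"
  using assms by (auto simp: measurable_def)

section \<open>Completed filtration and versions for the natural filtration\<close>

lemma completed_gen_sub:
  "sets (natural_filtration P X t) \<union> null_sets (completion P) \<subseteq> Pow (space P)"
  using sets.sets_into_space[of _ "natural_filtration P X t"] sets.sets_into_space[of _ "completion P"]
  by (auto simp: natural_filtration_eq null_sets_def)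

lemma space_completed [simp]: "space (completed_filtration P X t) = space P"
  unfolding completed_filtration_def using completed_gen_sub by (rule space_measure_of)

lemma sets_completed: "sets (completed_filtration P X t) = sigma_sets (space P) (sets (natural_filtration P X t) \<union> null_sets (completion P))"
  unfolding completed_filtration_def using completed_gen_sub by (rule sets_measure_of)

lemma space_natural [simp]: "space (natural_filtration P X t) = space P"
  by (simp add: natural_filtration_eq)

lemma natural_mono: "s \<le> t \<Longrightarrow> sets (natural_filtration P X s) \<subseteq> sets (natural_filtration P X t)"
  unfolding natural_filtration_eq by (intro gen_sigma_mono) auto

lemma natural_sub_completed: "sets (natural_filtration P X t) \<subseteq> sets (completed_filtration P X t)"
  unfolding sets_completed by auto

lemma completed_mono: "s \<le> t \<Longrightarrow> sets (completed_filtration P X s) \<subseteq> sets (completed_filtration P X t)"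
  unfolding sets_completed using natural_mono[of s t P X] by (intro sigma_sets_mono') blast

interpretation nat_filt: filtered "space P" "natural_filtration P X" for P X
  by (rule filtered.intro[OF space_natural natural_mono])

interpretation comp_filt: filtered "space P" "completed_filtration P X" for P X
  by (rule filtered.intro[OF space_completed completed_mono])

abbreviation nat_pred where "nat_pred P X \<equiv> pred_sigma (space P) (natural_filtration P X)"

lemma space_predictable: "space (predictable_sigma P X) = {0..} \<times> space P"
  by (simp add: predictable_sigma_eq comp_filt.space_pred)

lemma nat_pred_sub: "sets (nat_pred P X) \<subseteq> sets (predictable_sigma P X)"
  unfolding predictable_sigma_eq nat_filt.sets_pred comp_filt.sets_pred
  using natural_sub_completed[of P X] by (intro sigma_sets_mono') blast

lemma nat_pred_predictable:
  "f \<in> measurable (nat_pred P X) L \<Longrightarrow> f \<in> measurable (predictable_sigma P X) L"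
  by (erule measurable_from_subset) (simp_all add: nat_pred_sub space_predictable nat_filt.space_pred)

text \<open>Null sets are represented by the empty set; the property survives complements, and
  countable unions because countably many null sets may be united.\<close>

lemma completed_ex_natural:
  assumes "B \<in> sets (completed_filtration P X t)"
  shows "\<exists>B'\<in>sets (natural_filtration P X t). AE \<omega> in P. \<omega> \<in> B \<longleftrightarrow> \<omega> \<in> B'"
  using assms unfolding sets_completed
proof (induction rule: sigma_sets.induct)
  case (Basic B)
  then show ?case
  proof
    assume "B \<in> null_sets (completion P)"
    then have "AE \<omega> in completion P. \<omega> \<notin> B" by (rule AE_not_in)
    then have "AE \<omega> in P. \<omega> \<notin> B" by (simp add: AE_completion_iff)
    then show ?thesis by (intro bexI[of _ "{}"]) auto
  qed auto
next
  case Empty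
  show ?case by (intro bexI[of _ "{}"]) auto
next
  case (Compl B)
  then obtain B' where B': "B' \<in> sets (natural_filtration P X t)" "AE \<omega> in P. \<omega> \<in> B \<longleftrightarrow> \<omega> \<in> B'" by blast
  then show ?case
    using sets.compl_sets[OF B'(1)] by (intro bexI[of _ "space P - B'"]) auto
next
  case (Union B)
  have "\<forall>i. \<exists>c\<in>sets (natural_filtration P X t). AE \<omega> in P. \<omega> \<in> B i \<longleftrightarrow> \<omega> \<in> c" using Union.IH by (rule allI)
  then obtain B' where B': "\<And>i. B' i \<in> sets (natural_filtration P X t)" "\<And>i. AE \<omega> in P. \<omega> \<in> B i \<longleftrightarrow> \<omega> \<in> B' i" by (rule choice_obtain) (iprover intro: that)
  then have "AE \<omega> in P. \<forall>i. \<omega> \<in> B i \<longleftrightarrow> \<omega> \<in> B' i" by (simp add: AE_all_countable)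
  then have "AE \<omega> in P. \<omega> \<in> \<Union>(range B) \<longleftrightarrow> \<omega> \<in> \<Union>(range B')" by eventually_elim auto
  then show ?case using B'(1) by (intro bexI[of _ "\<Union>(range B')"]) auto
qed

lemma completed_ex_natural_fun:
  fixes f :: "'a \<Rightarrow> real"
  assumes "f \<in> borel_measurable (completed_filtration P X t)"
  shows "\<exists>f'\<in>borel_measurable (natural_filtration P X t). AE \<omega> in P. f \<omega> = f' \<omega>"
  using representative_fun[OF assms, of "{()}" P "\<lambda>_ \<omega>. \<omega>" "natural_filtration P X t" "\<lambda>_ \<omega>. \<omega>"] completed_ex_natural
  by force

text \<open>Only the event in a generator is changed, never its time interval, so one null set
  serves all times at once.\<close>

lemma predictable_ex_natural_set:
  assumes "C \<in> sets (predictable_sigma P X)"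
  shows "\<exists>C'\<in>sets (nat_pred P X). AE \<omega> in P. \<forall>t\<in>{0..}. (t, \<omega>) \<in> C \<longleftrightarrow> (t, \<omega>) \<in> C'"
  using assms unfolding predictable_sigma_eq comp_filt.sets_pred
proof (induction rule: sigma_sets.induct)
  case (Basic C)
  then consider B where "C = {0} \<times> B" "B \<in> sets (completed_filtration P X 0)" |
      s t B where "C = {s<..t} \<times> B" "0 \<le> s" "B \<in> sets (completed_filtration P X s)" by blast
  then show ?case
  proof cases
    case 1
    obtain B' where B': "B' \<in> sets (natural_filtration P X 0)" "AE \<omega> in P. \<omega> \<in> B \<longleftrightarrow> \<omega> \<in> B'"
      using completed_ex_natural[OF 1(2)] by blast
    show ?thesis
      by (rule bexI[OF _ nat_filt.pred_zero[OF B'(1)]]) (use B'(2) 1(1) in \<open>auto elim: eventually_mono\<close>)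
  next
    case 2
    obtain B' where B': "B' \<in> sets (natural_filtration P X s)" "AE \<omega> in P. \<omega> \<in> B \<longleftrightarrow> \<omega> \<in> B'"
      using completed_ex_natural[OF 2(3)] by blast
    show ?thesis
      by (rule bexI[OF _ nat_filt.pred_rect[OF 2(2) B'(1), of t]]) (use B'(2) 2(1) in \<open>auto elim: eventually_mono\<close>)
  qed
next
  case Empty
  show ?case by (intro bexI[of _ "{}"]) auto
next
  case (Compl C)
  then obtain C' where C': "C' \<in> sets (nat_pred P X)" "AE \<omega> in P. \<forall>t\<in>{0..}. (t, \<omega>) \<in> C \<longleftrightarrow> (t, \<omega>) \<in> C'" by blast
  have "AE \<omega> in P. \<forall>t\<in>{0..}. (t, \<omega>) \<in> {0..} \<times> space P - C \<longleftrightarrow> (t, \<omega>) \<in> {0..} \<times> space P - C'"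
    using C'(2) by eventually_elim auto
  then show ?case
    using sets.compl_sets[OF C'(1)] unfolding nat_filt.space_pred by blast
next
  case (Union C)
  have "\<forall>i. \<exists>c\<in>sets (nat_pred P X). AE \<omega> in P. \<forall>t\<in>{0..}. (t, \<omega>) \<in> C i \<longleftrightarrow> (t, \<omega>) \<in> c" using Union.IH by (rule allI)
  then obtain C' where C': "\<And>i. C' i \<in> sets (nat_pred P X)" "\<And>i. AE \<omega> in P. \<forall>t\<in>{0..}. (t, \<omega>) \<in> C i \<longleftrightarrow> (t, \<omega>) \<in> C' i" by (rule choice_obtain) (iprover intro: that)
  then have "AE \<omega> in P. \<forall>i. \<forall>t\<in>{0..}. (t, \<omega>) \<in> C i \<longleftrightarrow> (t, \<omega>) \<in> C' i" by (simp add: AE_all_countable)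
  then have "AE \<omega> in P. \<forall>t\<in>{0..}. (t, \<omega>) \<in> \<Union>(range C) \<longleftrightarrow> (t, \<omega>) \<in> \<Union>(range C')" by eventually_elim auto
  then show ?case using C'(1) by (intro bexI[of _ "\<Union>(range C')"]) auto
qed

lemma predictable_ex_natural:
  fixes f :: "real \<times> 'a \<Rightarrow> real"
  assumes "f \<in> borel_measurable (predictable_sigma P X)"
  shows "\<exists>g\<in>borel_measurable (nat_pred P X). AE \<omega> in P. \<forall>t\<in>{0..}. f (t, \<omega>) = g (t, \<omega>)"
  by (rule representative_fun[OF assms, of "{0..}" P Pair "nat_pred P X" Pair])
    (auto simp: space_predictable intro: predictable_ex_natural_set)

section \<open>Splitting the path at a time \<open>S\<close>\<close>

definition splice_alg :: "'a measure \<Rightarrow> (real \<Rightarrow> 'a \<Rightarrow> real^'n) \<Rightarrow> real \<Rightarrow> real \<Rightarrow> ('a \<times> 'a) measure" where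
  "splice_alg P X S t = natural_filtration P X S \<Otimes>\<^sub>M gen_sigma P X {S..t}"

text \<open>A predictable sigma-algebra on a doubled sample space: the first coordinate carries the
  path up to \<open>S\<close> and is known from the start, the second one gradually reveals the path
  after \<open>S\<close>.\<close>

definition splice_pred :: "'a measure \<Rightarrow> (real \<Rightarrow> 'a \<Rightarrow> real^'n) \<Rightarrow> real \<Rightarrow> (real \<times> 'a \<times> 'a) measure" where
  "splice_pred P X S = sigma ({S<..} \<times> (space P \<times> space P))
     {{a<..b} \<times> B | a b B. S \<le> a \<and> B \<in> sets (splice_alg P X S a)}"

lemma space_splice_alg [simp]: "space (splice_alg P X S t) = space P \<times> space P"
  by (simp add: splice_alg_def space_pair_measure)

lemma splice_gen_sub: "{{a<..b} \<times> B | a b B. S \<le> a \<and> B \<in> sets (splice_alg P X S a)} \<subseteq> Pow ({S<..} \<times> (space P \<times> space P))"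
proof -
  have "B \<subseteq> space P \<times> space P" if "B \<in> sets (splice_alg P X S a)" for a B
    using sets.sets_into_space[OF that] by simp
  then have "{a<..b} \<times> B \<subseteq> {S<..} \<times> (space P \<times> space P)" if "S \<le> a" "B \<in> sets (splice_alg P X S a)" for a b B
    using that by (intro Sigma_mono) auto
  then show ?thesis by blast
qed

lemma space_splice_pred [simp]: "space (splice_pred P X S) = {S<..} \<times> (space P \<times> space P)"
  unfolding splice_pred_def using splice_gen_sub by (rule space_measure_of)

lemma sets_splice_pred: "sets (splice_pred P X S) = sigma_sets ({S<..} \<times> (space P \<times> space P)) {{a<..b} \<times> B | a b B. S \<le> a \<and> B \<in> sets (splice_alg P X S a)}"
  unfolding splice_pred_def using splice_gen_sub by (rule sets_measure_of)

text \<open>An observation at a time up to \<open>S\<close> is read off the first coordinate, a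
  later one off the second. On the diagonal both give back the original event.\<close>

lemma natural_ex_splice:
  assumes "B \<in> sets (natural_filtration P X a)" "S \<le> a"
  shows "\<exists>B'\<in>sets (splice_alg P X S a). \<forall>\<omega>\<in>space P. \<omega> \<in> B \<longleftrightarrow> (\<omega>, \<omega>) \<in> B'"
  using assms(1) unfolding natural_filtration_eq sets_gen_sigma
proof (induction rule: sigma_sets.induct)
  case (Basic B)
  then obtain s U where s: "s \<in> {0..a}" "B = X s -` U \<inter> space P" "U \<in> sets borel" by auto
  show ?case
  proof (cases "s \<le> S")
    case True
    then have "B \<in> sets (natural_filtration P X S)"
      unfolding natural_filtration_eq sets_gen_sigma using s True by (intro sigma_sets.Basic UN_I[of s]) auto
    then have "B \<times> space P \<in> sets (splice_alg P X S a)"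
      unfolding splice_alg_def using sets.top[of "gen_sigma P X {S..a}"] by (intro pair_measureI) auto
    then show ?thesis by (intro bexI[of _ "B \<times> space P"]) auto
  next
    case False
    then have "B \<in> sets (gen_sigma P X {S..a})"
      unfolding sets_gen_sigma using s False by (intro sigma_sets.Basic UN_I[of s]) auto
    then have "space P \<times> B \<in> sets (splice_alg P X S a)"
      unfolding splice_alg_def using sets.top[of "natural_filtration P X S"] by (intro pair_measureI) auto
    then show ?thesis by (intro bexI[of _ "space P \<times> B"]) auto
  qed
next
  case Empty
  show ?case by (intro bexI[of _ "{}"]) auto
next
  case (Compl B)
  then obtain B' where B': "B' \<in> sets (splice_alg P X S a)" "\<forall>\<omega>\<in>space P. \<omega> \<in> B \<longleftrightarrow> (\<omega>, \<omega>) \<in> B'" by blast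
  then show ?case
    using sets.compl_sets[OF B'(1)] by (intro bexI[of _ "space P \<times> space P - B'"]) auto
next
  case (Union B)
  have "\<forall>i. \<exists>c\<in>sets (splice_alg P X S a). \<forall>\<omega>\<in>space P. \<omega> \<in> B i \<longleftrightarrow> (\<omega>, \<omega>) \<in> c" using Union.IH by (rule allI)
  then obtain B' where B': "\<And>i. B' i \<in> sets (splice_alg P X S a)" "\<And>i. \<forall>\<omega>\<in>space P. \<omega> \<in> B i \<longleftrightarrow> (\<omega>, \<omega>) \<in> B' i" by (rule choice_obtain) (iprover intro: that)
  then show ?case by (intro bexI[of _ "\<Union>(range B')"]) auto
qed

lemma nat_pred_ex_splice_set:
  assumes "C \<in> sets (nat_pred P X)" "0 \<le> S"
  shows "\<exists>C'\<in>sets (splice_pred P X S). \<forall>\<omega>\<in>space P. \<forall>t\<in>{S<..}. (t, \<omega>) \<in> C \<longleftrightarrow> (t, \<omega>, \<omega>) \<in> C'"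
  using assms(1) unfolding nat_filt.sets_pred
proof (induction rule: sigma_sets.induct)
  case (Basic C)
  then consider B where "C = {0} \<times> B" |
      s t B where "C = {s<..t} \<times> B" "0 \<le> s" "B \<in> sets (natural_filtration P X s)" by blast
  then show ?case
  proof cases
    case 1
    then show ?thesis using assms(2) by (intro bexI[of _ "{}"]) auto
  next
    case 2
    \<comment> \<open>A rectangle that starts before \<open>S\<close> is cut at \<open>S\<close>;
      its event is known at the new start.\<close>
    have "B \<in> sets (natural_filtration P X (max S s))" using 2(3) natural_mono[of s "max S s" P X] by auto
    from natural_ex_splice[OF this, of S] obtain B' where B': "B' \<in> sets (splice_alg P X S (max S s))" "\<forall>\<omega>\<in>space P. \<omega> \<in> B \<longleftrightarrow> (\<omega>, \<omega>) \<in> B'"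
      by auto
    have "{max S s<..t} \<times> B' \<in> sets (splice_pred P X S)"
      unfolding sets_splice_pred using B'(1) by (intro sigma_sets.Basic CollectI exI[of _ "max S s"] exI[of _ t] exI[of _ B']) simp
    then show ?thesis
      using B'(2) 2(1) by (intro bexI[of _ "{max S s<..t} \<times> B'"]) auto
  qed
next
  case Empty
  show ?case by (intro bexI[of _ "{}"]) auto
next
  case (Compl C)
  then obtain C' where C': "C' \<in> sets (splice_pred P X S)" "\<forall>\<omega>\<in>space P. \<forall>t\<in>{S<..}. (t, \<omega>) \<in> C \<longleftrightarrow> (t, \<omega>, \<omega>) \<in> C'" by blast
  then show ?case
    using sets.compl_sets[OF C'(1)] assms(2) by (intro bexI[of _ "({S<..} \<times> (space P \<times> space P)) - C'"]) auto
next
  case (Union C)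
  have "\<forall>i. \<exists>c\<in>sets (splice_pred P X S). \<forall>\<omega>\<in>space P. \<forall>t\<in>{S<..}. (t, \<omega>) \<in> C i \<longleftrightarrow> (t, \<omega>, \<omega>) \<in> c" using Union.IH by (rule allI)
  then obtain C' where C': "\<And>i. C' i \<in> sets (splice_pred P X S)" "\<And>i. \<forall>\<omega>\<in>space P. \<forall>t\<in>{S<..}. (t, \<omega>) \<in> C i \<longleftrightarrow> (t, \<omega>, \<omega>) \<in> C' i" by (rule choice_obtain) (iprover intro: that)
  then show ?case by (intro bexI[of _ "\<Union>(range C')"]) auto
qed

text \<open>Every predictable process factors through the diagonal into a functional of the path up to \<open>S\<close>
  and of the path after \<open>S\<close>; the past can then be frozen.\<close>

lemma predictable_ex_splice:
  fixes f :: "real \<times> 'a \<Rightarrow> real"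
  assumes "f \<in> borel_measurable (predictable_sigma P X)" "0 \<le> S"
  shows "\<exists>h\<in>borel_measurable (splice_pred P X S). AE \<omega> in P. \<forall>t\<in>{S<..}. f (t, \<omega>) = h (t, \<omega>, \<omega>)"
proof (rule representative_fun[OF assms(1), of "{S<..}" P Pair "splice_pred P X S" "\<lambda>t \<omega>. (t, \<omega>, \<omega>)"])
  fix C assume "C \<in> sets (predictable_sigma P X)"
  then obtain C' where C': "C' \<in> sets (nat_pred P X)" "AE \<omega> in P. \<forall>t\<in>{0..}. (t, \<omega>) \<in> C \<longleftrightarrow> (t, \<omega>) \<in> C'"
    using predictable_ex_natural_set by blast
  obtain C'' where C'': "C'' \<in> sets (splice_pred P X S)" "\<forall>\<omega>\<in>space P. \<forall>t\<in>{S<..}. (t, \<omega>) \<in> C' \<longleftrightarrow> (t, \<omega>, \<omega>) \<in> C''"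
    using nat_pred_ex_splice_set[OF C'(1) assms(2)] by blast
  have "AE \<omega> in P. \<forall>t\<in>{S<..}. (t, \<omega>) \<in> C \<longleftrightarrow> (t, \<omega>, \<omega>) \<in> C''"
    using C'(2) AE_space by eventually_elim (use C''(2) assms(2) in auto)
  then show "\<exists>C'\<in>sets (splice_pred P X S). AE \<omega> in P. \<forall>t\<in>{S<..}. (t, \<omega>) \<in> C \<longleftrightarrow> (t, \<omega>, \<omega>) \<in> C'"
    using C''(1) by blast
qed (use assms(2) in \<open>auto simp: space_predictable\<close>)

abbreviation "splice_all P X S \<equiv> natural_filtration P X S \<Otimes>\<^sub>M gen_sigma P X {S..}"

text \<open>Joint measurability in time, past and future, the form that Fubini's theorem asks
  for.\<close>

lemma splice_pred_prod:
  fixes h :: "real \<times> 'a \<times> 'a \<Rightarrow> 'b::{real_normed_vector, second_countable_topology}"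
  assumes h: "h \<in> borel_measurable (splice_pred P X S)"
  shows "(\<lambda>x. if S < fst x then h x else 0) \<in> borel_measurable (borel \<Otimes>\<^sub>M splice_all P X S)"
proof -
  let ?N = "borel \<Otimes>\<^sub>M splice_all P X S"
  let ?R = "restrict_space ?N {x. S < fst x}"
  have sp: "space ?R = {S<..} \<times> space P \<times> space P"
    by (auto simp: space_restrict_space space_pair_measure)
  have "(\<lambda>x. x) \<in> measurable ?R (splice_pred P X S)"
    unfolding splice_pred_def
  proof (rule measurable_measure_of[OF splice_gen_sub])
    fix C assume "C \<in> {{a<..b} \<times> B | a b B. S \<le> a \<and> B \<in> sets (splice_alg P X S a)}"
    then obtain a b B where C: "C = {a<..b} \<times> B" "S \<le> a" "B \<in> sets (splice_alg P X S a)" by blast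
    have "sets (splice_alg P X S a) \<subseteq> sets (splice_all P X S)"
    proof -
      have "(\<lambda>x. x) \<in> measurable (gen_sigma P X {S..}) (gen_sigma P X {S..a})"
        by (rule measurable_from_subset[OF measurable_ident[unfolded id_def] gen_sigma_mono]) auto
      from measurable_compose[OF measurable_snd this]
      have "(\<lambda>x. (fst x, snd x)) \<in> measurable (splice_all P X S) (splice_alg P X S a)"
        unfolding splice_alg_def by (intro measurable_Pair measurable_fst)
      then have *: "(\<lambda>x. x) \<in> measurable (splice_all P X S) (splice_alg P X S a)" by simp
      show ?thesis
      proof
        fix D assume D: "D \<in> sets (splice_alg P X S a)"
        from measurable_sets[OF * D] have "D \<inter> (space P \<times> space P) \<in> sets (splice_all P X S)"
          by (simp add: space_pair_measure)
        then show "D \<in> sets (splice_all P X S)"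
          using sets.sets_into_space[OF D] by (simp add: Int_absorb2)
      qed
    qed
    then have "{a<..b} \<times> B \<in> sets ?N" using C by auto
    then show "(\<lambda>x. x) -` C \<inter> space ?R \<in> sets ?R"
      using C sets.sets_into_space[of "{a<..b} \<times> B" ?N]
      by (auto simp: sets_restrict_space space_restrict_space intro!: image_eqI[where x="{a<..b} \<times> B"])
  qed (simp add: sp)
  then have "h \<in> borel_measurable ?R" using measurable_compose[OF _ h] by blast
  then show ?thesis by (subst measurable_If_restrict_space_iff) auto
qed

text \<open>The section of a product set at \<open>p\<close> lies in the future factor, generated by
  \<open>X\<close> on \<open>{S..a}\<close>, hence in the natural filtration at \<open>a\<close>.
  Freezing the past therefore leaves a process that is predictable in the original sense.\<close>

lemma splice_pred_section:
  fixes h :: "real \<times> 'a \<times> 'a \<Rightarrow> 'b::{real_normed_vector, second_countable_topology}"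
  assumes h: "h \<in> borel_measurable (splice_pred P X S)" and p: "p \<in> space P" and S: "0 \<le> S"
  shows "(\<lambda>x. if S < fst x then h (fst x, p, snd x) else 0) \<in> borel_measurable (nat_pred P X)"
proof -
  let ?N = "nat_pred P X"
  let ?R = "restrict_space ?N {x. S < fst x}"
  have S': "{x \<in> space ?N. S < fst x} \<in> sets ?N"
    using nat_filt.pred_measurable_time[of P X] by measurable
  have sp: "space ?R = {S<..} \<times> space P"
    using S by (auto simp: space_restrict_space nat_filt.space_pred)
  have "(\<lambda>x. (fst x, p, snd x)) \<in> measurable ?R (splice_pred P X S)"
    unfolding splice_pred_def
  proof (rule measurable_measure_of[OF splice_gen_sub])
    fix C assume "C \<in> {{a<..b} \<times> B | a b B. S \<le> a \<and> B \<in> sets (splice_alg P X S a)}"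
    then obtain a b B where C: "C = {a<..b} \<times> B" "S \<le> a" "B \<in> sets (splice_alg P X S a)" by blast
    have "Pair p -` B \<in> sets (gen_sigma P X {S..a})"
      using C(3) unfolding splice_alg_def by (rule sets_Pair1)
    then have B: "Pair p -` B \<in> sets (natural_filtration P X a)"
      using gen_sigma_mono[of "{S..a}" "{0..a}" P X] S by (auto simp: natural_filtration_eq)
    have "{a<..b} \<times> (Pair p -` B) \<in> sets ?N" using C S B by (intro nat_filt.pred_rect) auto
    moreover have "(\<lambda>x. (fst x, p, snd x)) -` C \<inter> space ?R = {x. S < fst x} \<inter> ({a<..b} \<times> (Pair p -` B))"
      using C sets.sets_into_space[OF B] S sp by auto
    ultimately show "(\<lambda>x. (fst x, p, snd x)) -` C \<inter> space ?R \<in> sets ?R"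
      by (auto simp: sets_restrict_space)
  qed (use p in \<open>auto simp: sp\<close>)
  then have "(\<lambda>x. h (fst x, p, snd x)) \<in> borel_measurable ?R" by (rule measurable_compose[OF _ h])
  then show ?thesis by (subst measurable_If_restrict_space_iff[OF S']) auto
qed

section \<open>Measurability of sums over jumps\<close>

lemma measurable_vec_nth [measurable (raw)]:
  fixes f :: "'w \<Rightarrow> ('b::euclidean_space)^'n"
  assumes [measurable]: "f \<in> borel_measurable M"
  shows "(\<lambda>x. f x $ i) \<in> borel_measurable M"
  by (rule measurable_compose[OF assms borel_measurable_continuous_onI]) (intro continuous_intros)

lemma jump_total:
  assumes "step_path x" "0 \<le> a" "a \<le> b"
  shows "(\<Sum>r\<in>jumps x \<inter> {a<..b}. (x r - llim x r) $ i) = x b $ i - x a $ i"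
proof -
  have "(\<Sum>r\<in>jumps x \<inter> {a<..b}. (x r - llim x r) $ i) = (\<Sum>r\<in>jumps x \<inter> {a<..b}. x r - llim x r) $ i"
    by simp
  then show ?thesis using finite_jumps_telescope[OF assms] by simp
qed

context
  fixes X :: "real \<Rightarrow> 'w \<Rightarrow> real^'n" and M :: "'w measure" and a b :: real
  assumes path: "\<And>\<omega>. \<omega> \<in> space M \<Longrightarrow> step_path (\<lambda>t. X t \<omega>)"
    and ab: "0 \<le> a" "a \<le> b"
    and X: "\<And>r. a \<le> r \<Longrightarrow> r \<le> b \<Longrightarrow> X r \<in> borel_measurable M"
begin

private abbreviation "J \<omega> \<equiv> jumps (\<lambda>t. X t \<omega>) \<inter> {a<..b}"
private abbreviation "D i r \<omega> \<equiv> (X r \<omega> - llim (\<lambda>t. X t \<omega>) r) $ i"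

text \<open>Jump times are never enumerated measurably. Instead, for fixed \<open>i\<close>, the
  component \<open>D i r\<close> is a signed weight at the jump, and the weight of a set
  \<open>A\<close> behaves like a signed measure; this and the next lemmas are the steps of a Dynkin
  argument.\<close>

lemma jump_sum_measurable_Union:
  fixes A :: "nat \<Rightarrow> (real \<times> 'w) set"
  assumes "disjoint_family A" "\<And>n. (\<lambda>\<omega>. \<Sum>r\<in>J \<omega>. indicator (A n) (r, \<omega>) * D i r \<omega>) \<in> borel_measurable M"
  shows "(\<lambda>\<omega>. \<Sum>r\<in>J \<omega>. indicator (\<Union>(range A)) (r, \<omega>) * D i r \<omega> :: real) \<in> borel_measurable M"
proof (rule borel_measurable_LIMSEQ_real)
  show "(\<lambda>n. \<Sum>k<n. \<Sum>r\<in>J \<omega>. indicator (A k) (r, \<omega>) * D i r \<omega>)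
      \<longlonglongrightarrow> (\<Sum>r\<in>J \<omega>. indicator (\<Union>(range A)) (r, \<omega>) * D i r \<omega>)" for \<omega>
  proof -
    have "(\<lambda>n. \<Sum>r\<in>J \<omega>. indicator (A n) (r, \<omega>) * D i r \<omega>) sums (\<Sum>r\<in>J \<omega>. indicator (\<Union>(range A)) (r, \<omega>) * D i r \<omega>)"
      using assms(1) by (intro sums_sum sums_mult2 indicator_sums) (auto simp: disjoint_family_on_def)
    then show ?thesis by (simp add: sums_def)
  qed
qed (use assms(2) in measurable)

text \<open>The total weight telescopes to an increment of \<open>X\<close>, which takes the part of
  the total mass in the complement step.\<close>

lemma jump_sum_measurable_Compl:
  assumes "(\<lambda>\<omega>. \<Sum>r\<in>J \<omega>. indicator A (r, \<omega>) * D i r \<omega>) \<in> borel_measurable M"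
    and "\<And>r \<omega>. \<omega> \<in> space M \<Longrightarrow> (r, \<omega>) \<in> A' \<longleftrightarrow> (r, \<omega>) \<notin> A"
  shows "(\<lambda>\<omega>. \<Sum>r\<in>J \<omega>. indicator A' (r, \<omega>) * D i r \<omega> :: real) \<in> borel_measurable M"
proof -
  have "(\<lambda>\<omega>. (X b \<omega> $ i - X a \<omega> $ i) - (\<Sum>r\<in>J \<omega>. indicator A (r, \<omega>) * D i r \<omega>)) \<in> borel_measurable M"
    using assms(1) X[of a] X[of b] ab by measurable
  moreover have "(X b \<omega> $ i - X a \<omega> $ i) - (\<Sum>r\<in>J \<omega>. indicator A (r, \<omega>) * D i r \<omega>) = (\<Sum>r\<in>J \<omega>. indicator A' (r, \<omega>) * D i r \<omega>)"
    if "\<omega> \<in> space M" for \<omega>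
    unfolding jump_total[OF path[OF that] ab, symmetric] sum_subtractf[symmetric]
    using assms(2)[OF that] by (intro sum.cong) (auto simp: indicator_def)
  ultimately show ?thesis by (rule measurable_cong[THEN iffD1, rotated])
qed

lemma jump_sum_measurable_rect:
  assumes "U \<in> sets borel" "B \<in> sets M"
  shows "(\<lambda>\<omega>. \<Sum>r\<in>J \<omega>. indicator (U \<times> B) (r, \<omega>) * D i r \<omega> :: real) \<in> borel_measurable M"
proof -
  have "(\<lambda>\<omega>. \<Sum>r\<in>J \<omega>. indicator (U \<times> space M) (r, \<omega>) * D i r \<omega> :: real) \<in> borel_measurable M"
  proof -
    have U: "U \<in> sigma_sets UNIV (range atMost)" using assms(1) by (simp add: borel_eq_atMost)
    have stable: "Int_stable (range (atMost :: real \<Rightarrow> _))" by (auto simp: Int_stable_def)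
    have closed: "range atMost \<subseteq> Pow (UNIV :: real set)" by simp
    show ?thesis
      using stable closed U
    proof (induction rule: sigma_sets_induct_disjoint)
      case (basic U)
      then obtain c where U: "U = {..c}" by auto
      \<comment> \<open>For a half-line the sum telescopes as well; the clipped end point stays in
        \<open>{a..b}\<close> for every \<open>c\<close>.\<close>
      have eq: "(\<Sum>r\<in>J \<omega>. indicator (U \<times> space M) (r, \<omega>) * D i r \<omega>) = X (max a (min b c)) \<omega> $ i - X a \<omega> $ i"
        if "\<omega> \<in> space M" for \<omega>
      proof -
        have "(\<Sum>r\<in>J \<omega>. indicator (U \<times> space M) (r, \<omega>) * D i r \<omega>) = (\<Sum>r\<in>jumps (\<lambda>t. X t \<omega>) \<inter> {a<..max a (min b c)}. D i r \<omega>)"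
          using finite_jumps[OF path[OF that], of a b] ab that
          by (intro sum.mono_neutral_cong_right) (auto simp: U indicator_def max_def min_def split: if_splits)
        also have "\<dots> = X (max a (min b c)) \<omega> $ i - X a \<omega> $ i"
          using ab by (intro jump_total[OF path[OF that]]) auto
        finally show ?thesis .
      qed
      have "(\<lambda>\<omega>. X (max a (min b c)) \<omega> $ i - X a \<omega> $ i) \<in> borel_measurable M"
        by (intro borel_measurable_diff measurable_vec_nth X) (use ab in auto)
      then show ?case using eq by (subst measurable_cong) auto
    next
      case empty show ?case by simp
    next
      case (compl U)
      show ?case by (rule jump_sum_measurable_Compl[OF compl(2)]) auto
    next
      case (union U)
      have "disjoint_family (\<lambda>n. U n \<times> space M)" using union(1) by (auto simp: disjoint_family_on_def)
      moreover have "\<Union>(range U) \<times> space M = (\<Union>n. U n \<times> space M)" by auto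
      ultimately show ?case using jump_sum_measurable_Union[of "\<lambda>n. U n \<times> space M"] union by simp
    qed
  qed
  then have "(\<lambda>\<omega>. indicator B \<omega> * (\<Sum>r\<in>J \<omega>. indicator (U \<times> space M) (r, \<omega>) * D i r \<omega> :: real)) \<in> borel_measurable M"
    using assms(2) by measurable
  moreover have "indicator B \<omega> * (\<Sum>r\<in>J \<omega>. indicator (U \<times> space M) (r, \<omega>) * D i r \<omega> :: real) = (\<Sum>r\<in>J \<omega>. indicator (U \<times> B) (r, \<omega>) * D i r \<omega>)"
    if "\<omega> \<in> space M" for \<omega>
    using that unfolding sum_distrib_left by (intro sum.cong) (auto simp: indicator_def)
  ultimately show ?thesis by (rule measurable_cong[THEN iffD1, rotated])
qed

lemma jump_sum_measurable_set:
  assumes "C \<in> sets (borel \<Otimes>\<^sub>M M)"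
  shows "(\<lambda>\<omega>. \<Sum>r\<in>J \<omega>. indicator C (r, \<omega>) * D i r \<omega> :: real) \<in> borel_measurable M"
  using Int_stable_pair_measure_generator[of borel M] pair_measure_closed[of borel M] assms
  unfolding sets_pair_measure
proof (induction rule: sigma_sets_induct_disjoint)
  case (basic C)
  then show ?case using jump_sum_measurable_rect by auto
next
  case empty show ?case by simp
next
  case (compl C)
  show ?case by (rule jump_sum_measurable_Compl[OF compl(2)]) (auto simp: space_borel)
next
  case (union C)
  then show ?case using jump_sum_measurable_Union by simp
qed

lemma jump_sum_measurable_nonneg:
  fixes g :: "real \<times> 'w \<Rightarrow> real"
  assumes "g \<in> borel_measurable (borel \<Otimes>\<^sub>M M)" "\<And>x. 0 \<le> g x"
  shows "(\<lambda>\<omega>. \<Sum>r\<in>J \<omega>. g (r, \<omega>) * D i r \<omega>) \<in> borel_measurable M"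
  using assms
proof (induction rule: borel_measurable_induct_real)
  case (set A)
  then show ?case by (rule jump_sum_measurable_set)
next
  case (mult u c)
  have "(\<lambda>\<omega>. c * (\<Sum>r\<in>J \<omega>. u (r, \<omega>) * D i r \<omega>)) \<in> borel_measurable M" using mult by measurable
  then show ?case by (simp add: sum_distrib_left mult.assoc)
next
  case (add u v)
  have "(\<lambda>\<omega>. (\<Sum>r\<in>J \<omega>. v (r, \<omega>) * D i r \<omega>) + (\<Sum>r\<in>J \<omega>. u (r, \<omega>) * D i r \<omega>)) \<in> borel_measurable M" using add by measurable
  then show ?case by (simp add: sum.distrib[symmetric] distrib_right)
next
  case (seq U)
  show ?case
  proof (rule borel_measurable_LIMSEQ_real)
    show "(\<lambda>n. \<Sum>r\<in>J \<omega>. U n (r, \<omega>) * D i r \<omega>) \<longlonglongrightarrow> (\<Sum>r\<in>J \<omega>. g (r, \<omega>) * D i r \<omega>)" if "\<omega> \<in> space M" for \<omega>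
    proof -
      have "(\<lambda>n. U n (r, \<omega>)) \<longlonglongrightarrow> g (r, \<omega>)" for r
        using seq that by (auto simp: space_pair_measure)
      then show ?thesis by (intro tendsto_sum tendsto_mult tendsto_const)
    qed
  qed (use seq in auto)
qed

lemma jump_sum_measurable_real:
  fixes g :: "real \<times> 'w \<Rightarrow> real"
  assumes [measurable]: "g \<in> borel_measurable (borel \<Otimes>\<^sub>M M)"
  shows "(\<lambda>\<omega>. \<Sum>r\<in>J \<omega>. g (r, \<omega>) * D i r \<omega>) \<in> borel_measurable M"
proof -
  have "(\<lambda>\<omega>. \<Sum>r\<in>J \<omega>. max 0 (g (r, \<omega>)) * D i r \<omega>) \<in> borel_measurable M"
    by (rule jump_sum_measurable_nonneg) auto
  moreover have "(\<lambda>\<omega>. \<Sum>r\<in>J \<omega>. max 0 (- g (r, \<omega>)) * D i r \<omega>) \<in> borel_measurable M"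
    by (rule jump_sum_measurable_nonneg) auto
  ultimately have "(\<lambda>\<omega>. (\<Sum>r\<in>J \<omega>. max 0 (g (r, \<omega>)) * D i r \<omega>) - (\<Sum>r\<in>J \<omega>. max 0 (- g (r, \<omega>)) * D i r \<omega>)) \<in> borel_measurable M"
    by measurable
  moreover have "max 0 x * y - max 0 (- x) * y = x * y" for x y :: real by (auto simp: max_def)
  ultimately show ?thesis by (simp add: sum_subtractf[symmetric])
qed

lemma jump_sum_measurable:
  fixes g :: "real \<times> 'w \<Rightarrow> real^'n"
  assumes [measurable]: "g \<in> borel_measurable (borel \<Otimes>\<^sub>M M)"
  shows "(\<lambda>\<omega>. jump_sum (\<lambda>t. X t \<omega>) (\<lambda>r. g (r, \<omega>)) a b) \<in> borel_measurable M"
proof -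
  have "(\<lambda>\<omega>. \<Sum>i\<in>UNIV. \<Sum>r\<in>J \<omega>. g (r, \<omega>) $ i * D i r \<omega>) \<in> borel_measurable M"
    by (intro borel_measurable_sum jump_sum_measurable_real) measurable
  moreover have "(\<Sum>i\<in>UNIV. \<Sum>r\<in>J \<omega>. g (r, \<omega>) $ i * D i r \<omega>) = jump_sum (\<lambda>t. X t \<omega>) (\<lambda>r. g (r, \<omega>)) a b" for \<omega>
    unfolding jump_sum_def inner_vec_def by (subst sum.swap) simp
  ultimately show ?thesis by simp
qed

end

text \<open>The upper limit becomes part of the sample point: over pairs of a time and a path the
  integrand is switched off after that time, and the version with fixed limits applies.\<close>

lemma jump_sum_measurable_joint:
  fixes X :: "real \<Rightarrow> 'w \<Rightarrow> real^'n" and g :: "real \<times> 'w \<Rightarrow> real^'n"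
  assumes path: "\<And>\<omega>. \<omega> \<in> space M \<Longrightarrow> step_path (\<lambda>t. X t \<omega>)"
    and ab: "0 \<le> a" "a \<le> b"
    and X: "\<And>r. a \<le> r \<Longrightarrow> r \<le> b \<Longrightarrow> X r \<in> borel_measurable M"
    and g[measurable]: "g \<in> borel_measurable (borel \<Otimes>\<^sub>M M)"
  shows "(\<lambda>(t, \<omega>). jump_sum (\<lambda>t. X t \<omega>) (\<lambda>r. g (r, \<omega>)) a (min b t)) \<in> borel_measurable (borel \<Otimes>\<^sub>M M)"
proof -
  have "(\<lambda>z. jump_sum (\<lambda>t. X t (snd z)) (\<lambda>r. (\<lambda>(r, t, \<omega>). if r \<le> t then g (r, \<omega>) else 0) (r, z)) a b) \<in> borel_measurable (borel \<Otimes>\<^sub>M M)"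
  proof (rule jump_sum_measurable)
    show "step_path (\<lambda>t. X t (snd z))" if "z \<in> space (borel \<Otimes>\<^sub>M M)" for z :: "real \<times> 'w"
      using that path by (auto simp: space_pair_measure)
    show "(\<lambda>z. X r (snd z)) \<in> borel_measurable (borel \<Otimes>\<^sub>M M)" if "a \<le> r" "r \<le> b" for r
      using measurable_compose[OF measurable_snd X[OF that]] .
  qed (use ab in \<open>auto, measurable\<close>)
  moreover have "jump_sum (\<lambda>t. X t (snd z)) (\<lambda>r. (\<lambda>(r, t, \<omega>). if r \<le> t then g (r, \<omega>) else 0) (r, z)) a b =
    (\<lambda>(t, \<omega>). jump_sum (\<lambda>t. X t \<omega>) (\<lambda>r. g (r, \<omega>)) a (min b t)) z" if "z \<in> space (borel \<Otimes>\<^sub>M M)" for z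
    unfolding jump_sum_def
    using finite_jumps[OF path, of "snd z" a b] ab that
    by (cases z) (auto simp: space_pair_measure intro!: sum.mono_neutral_cong_right split: if_splits)
  ultimately show ?thesis by (rule measurable_cong[THEN iffD1, rotated])
qed

lemma integral_measurable_joint:
  fixes g :: "real \<times> 'w \<Rightarrow> real"
  assumes [measurable]: "g \<in> borel_measurable (borel \<Otimes>\<^sub>M M)"
  shows "(\<lambda>(t, \<omega>). LINT r|lborel. indicator {a..t} r * g (r, \<omega>)) \<in> borel_measurable (borel \<Otimes>\<^sub>M M)"
proof -
  have "(\<lambda>z. LINT r|lborel. (\<lambda>(z, r). (if a \<le> r \<and> r \<le> fst z then 1 else 0) * g (r, snd z)) (z, r)) \<in> borel_measurable (borel \<Otimes>\<^sub>M M)"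
    by (rule lborel.borel_measurable_lebesgue_integral) measurable
  then show ?thesis by (simp add: case_prod_beta indicator_def)
qed

section \<open>Conditional independence of past and future\<close>

context markov_chain
begin

lemma step_path_X: "\<omega> \<in> space P \<Longrightarrow> step_path (\<lambda>t. X t \<omega>)"
  unfolding step_path_def using state_X right_continuous_X left_limits_X by blast

definition ev :: "real \<Rightarrow> 'n \<Rightarrow> 'a set" where
  "ev t i = {\<omega>\<in>space P. X t \<omega> = axis i 1}"

lemma ev_sets [measurable]: "0 \<le> t \<Longrightarrow> ev t i \<in> sets P"
  unfolding ev_def using measurable_X[of t] by measurable

lemma ev_natural: "0 \<le> s \<Longrightarrow> s \<le> t \<Longrightarrow> ev s i \<in> sets (natural_filtration P X t)"
  using measurable_sets[OF measurable_gen_sigma[of s "{0..t}" X P], of "{axis i 1}"]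
  by (simp add: ev_def natural_filtration_eq vimage_def Int_def conj_commute)

lemma natural_sub: "sets (natural_filtration P X t) \<subseteq> sets P"
  unfolding natural_filtration_eq by (rule gen_sigma_subset) (use measurable_X in auto)

lemma natural_in_P: "B \<in> sets (natural_filtration P X t) \<Longrightarrow> B \<in> sets P"
  using natural_sub by blast

lemma gen_sub: "I \<subseteq> {0..} \<Longrightarrow> sets (gen_sigma P X I) \<subseteq> sets P"
  by (rule gen_sigma_subset) (use measurable_X in auto)

lemma ev_partition: "0 \<le> t \<Longrightarrow> \<omega> \<in> space P \<Longrightarrow> \<exists>!i. \<omega> \<in> ev t i"
  using state_X[of t \<omega>] by (auto simp: ev_def axis_eq_axis)

text \<open>The conditional probability given \<open>X s\<close> is measurable for the sigma-algebra
  of \<open>X s\<close>, hence constant on \<open>ev s j\<close>; \<open>q\<close> is this constant,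
  the transition probability. The product form also covers a null event
  \<open>ev s j\<close>.\<close>

lemma markov_factor:
  assumes st: "0 \<le> s" "s \<le> t"
  shows "\<exists>q. \<forall>B\<in>sets (natural_filtration P X s). prob (B \<inter> ev s j \<inter> ev t i) = q * prob (B \<inter> ev s j)"
proof -
  let ?F = "natural_filtration P X s"
  let ?V = "vimage_algebra (space P) (X s) borel"
  define g where "g = real_cond_exp P ?V (indicator (ev t i))"
  have g: "g \<in> borel_measurable ?V" unfolding g_def by (rule borel_measurable_cond_exp)
  have const: "g \<omega>1 = g \<omega>2" if "\<omega>1 \<in> ev s j" "\<omega>2 \<in> ev s j" for \<omega>1 \<omega>2
  proof -
    \<comment> \<open>Level sets of \<open>g\<close> are preimages under \<open>X s\<close>, and
      \<open>X s\<close> takes a single value on \<open>ev s j\<close>.\<close>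
    have "{\<omega>\<in>space ?V. g \<omega> = g \<omega>1} \<in> sets ?V" using g by measurable
    then obtain U where U: "{\<omega>\<in>space P. g \<omega> = g \<omega>1} = X s -` U \<inter> space P"
      by (auto simp: sets_vimage_algebra2)
    have "\<omega>1 \<in> X s -` U \<inter> space P" unfolding U[symmetric] using that by (auto simp: ev_def)
    then have "\<omega>2 \<in> X s -` U \<inter> space P" using that by (auto simp: ev_def)
    then show ?thesis unfolding U[symmetric] by auto
  qed
  interpret F: finite_measure_subalgebra P ?F
    by unfold_locales (simp add: subalgebra_def natural_sub)
  define q where "q = (if ev s j = {} then 0 else g (SOME \<omega>. \<omega> \<in> ev s j))"
  have gq: "g \<omega> = q" if "\<omega> \<in> ev s j" for \<omega>
    using that someI[of "\<lambda>\<omega>. \<omega> \<in> ev s j" \<omega>] by (auto simp: q_def intro: const)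
  have ev_t: "ev t i \<in> sets P" using st by simp
  have "prob (B \<inter> ev s j \<inter> ev t i) = q * prob (B \<inter> ev s j)" if B: "B \<in> sets ?F" for B
  proof -
    have C: "B \<inter> ev s j \<in> sets ?F" using B ev_natural[OF st(1) order_refl] by auto
    then have CP: "B \<inter> ev s j \<in> sets P" using natural_in_P by blast
    have "prob (B \<inter> ev s j \<inter> ev t i) = (\<integral>\<omega>\<in>B \<inter> ev s j. indicator (ev t i) \<omega> \<partial>P)"
      using CP ev_t by (simp add: set_lebesgue_integral_def flip: indicator_inter_arith)
    also have "\<dots> = (\<integral>\<omega>\<in>B \<inter> ev s j. real_cond_exp P ?F (indicator (ev t i)) \<omega> \<partial>P)"
      using C ev_t by (intro F.real_cond_exp_intA) (auto simp: integrable_indicator_iff less_top[symmetric])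
    also have "\<dots> = (\<integral>\<omega>\<in>B \<inter> ev s j. q \<partial>P)"
    proof (rule set_lebesgue_integral_cong_AE)
      show "AE \<omega>\<in>B \<inter> ev s j in P. real_cond_exp P ?F (indicator (ev t i)) \<omega> = q"
        using markov_property[OF st, of i] gq unfolding ev_def[symmetric] g_def by auto
      show "real_cond_exp P ?F (indicator (ev t i)) \<in> borel_measurable P" by simp
    qed (use CP in auto)
    also have "\<dots> = q * prob (B \<inter> ev s j)" using CP by (simp add: set_lebesgue_integral_def)
    finally show ?thesis .
  qed
  then show ?thesis by blast
qed

definition cyl :: "(real \<times> 'n) list \<Rightarrow> 'a set" where
  "cyl l = {\<omega>\<in>space P. \<forall>(t, i)\<in>set l. X t \<omega> = axis i 1}"

text \<open>Induction along increasing times: at the head time \<open>t\<close> the event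
  \<open>B \<inter> ev s j\<close> belongs to the past, so the induction hypothesis applies to it
  and the factors multiply.\<close>

lemma cyl_factor:
  assumes "sorted_wrt (\<lambda>a b. fst a \<le> fst b) l" "\<forall>(t, i)\<in>set l. s \<le> t" "0 \<le> s"
  shows "\<exists>q. \<forall>B\<in>sets (natural_filtration P X s). prob (B \<inter> ev s j \<inter> cyl l) = q * prob (B \<inter> ev s j)"
  using assms
proof (induction l arbitrary: s j)
  case Nil
  have "B \<inter> ev s j \<inter> cyl [] = B \<inter> ev s j" for B by (auto simp: cyl_def ev_def)
  then show ?case by (intro exI[of _ 1]) simp
next
  case (Cons a l)
  obtain t i where a: "a = (t, i)" by (cases a)
  have t: "s \<le> t" "0 \<le> t" using Cons.prems a by auto
  obtain q' where q': "\<forall>B\<in>sets (natural_filtration P X t). prob (B \<inter> ev t i \<inter> cyl l) = q' * prob (B \<inter> ev t i)"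
  proof -
    have "\<forall>(ta, i)\<in>set l. t \<le> ta" using Cons.prems(1) by (auto simp: a)
    moreover have "sorted_wrt (\<lambda>a b. fst a \<le> fst b) l" using Cons.prems(1) by simp
    ultimately show ?thesis using Cons.IH[of t i] t that by blast
  qed
  obtain q where q: "\<forall>B\<in>sets (natural_filtration P X s). prob (B \<inter> ev s j \<inter> ev t i) = q * prob (B \<inter> ev s j)"
    using markov_factor[OF Cons.prems(3) t(1), of j i] by blast
  show ?case
  proof (rule exI[of _ "q' * q"], rule)
    fix B assume B: "B \<in> sets (natural_filtration P X s)"
    have "B \<inter> ev s j \<in> sets (natural_filtration P X t)"
      using B ev_natural[OF Cons.prems(3) t(1)] natural_mono[OF t(1), of P X] by auto
    then have "prob ((B \<inter> ev s j) \<inter> ev t i \<inter> cyl l) = q' * prob ((B \<inter> ev s j) \<inter> ev t i)"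
      using q' by blast
    moreover have "(B \<inter> ev s j) \<inter> ev t i \<inter> cyl l = B \<inter> ev s j \<inter> cyl (a # l)"
      by (auto simp: cyl_def ev_def a)
    ultimately show "prob (B \<inter> ev s j \<inter> cyl (a # l)) = q' * q * prob (B \<inter> ev s j)"
      using q B by simp
  qed
qed

lemma cyl_sort: "cyl (sort_key fst l) = cyl l"
  by (simp add: cyl_def)

text \<open>The factor \<open>q\<close> is the same for all \<open>B\<close>; comparing
  \<open>B\<close> with the whole space eliminates it.\<close>

lemma cond_indep_cyl:
  assumes "\<forall>(t, i)\<in>set l. S \<le> t" "0 \<le> S" "B \<in> sets (natural_filtration P X S)"
  shows "prob (B \<inter> ev S j \<inter> cyl l) * prob (ev S j) = prob (B \<inter> ev S j) * prob (ev S j \<inter> cyl l)"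
proof -
  have "sorted_wrt (\<lambda>a b. fst a \<le> fst b) (sort_key fst l)"
    using sorted_sort_key[of fst l] by (simp add: sorted_wrt_map)
  from cyl_factor[OF this _ assms(2), of j] assms(1)
  obtain q where q: "\<forall>B\<in>sets (natural_filtration P X S). prob (B \<inter> ev S j \<inter> cyl l) = q * prob (B \<inter> ev S j)"
    unfolding cyl_sort by auto
  have top: "space P \<in> sets (natural_filtration P X S)" using sets.top[of "natural_filtration P X S"] by simp
  have "space P \<inter> ev S j = ev S j" by (auto simp: ev_def)
  then have "prob (ev S j \<inter> cyl l) = q * prob (ev S j)" using bspec[OF q top] by simp
  then show ?thesis using q assms(3) by simp
qed

lemma cyl_sets: "\<forall>(t, i)\<in>set l. 0 \<le> t \<Longrightarrow> cyl l \<in> sets P"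
proof (induction l)
  case Nil then show ?case by (simp add: cyl_def)
next
  case (Cons a l)
  have "cyl (a # l) = ev (fst a) (snd a) \<inter> cyl l" by (cases a) (auto simp: cyl_def ev_def)
  moreover have "0 \<le> fst a" "cyl l \<in> sets P" using Cons by (auto simp: case_prod_beta)
  ultimately show ?case by simp
qed

lemma future_cyl:
  assumes "0 \<le> S"
  shows "sets (gen_sigma P X {S..}) \<subseteq> sigma_sets (space P) {cyl l | l. \<forall>(t, i)\<in>set l. S \<le> t}"
  unfolding sets_gen_sigma
proof (rule sigma_sets_mono, rule subsetI)
  fix C assume "C \<in> (\<Union>s\<in>{S..}. {X s -` B \<inter> space P | B. B \<in> sets borel})"
  then obtain s U where s: "s \<in> {S..}" "C = X s -` U \<inter> space P" by blast
  have "X s -` U \<inter> space P = (\<Union>i\<in>{i. axis i 1 \<in> U}. cyl [(s, i)])"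
    using state_X[of s] s assms by (force simp: cyl_def)
  moreover have "cyl [(s, i)] \<in> sigma_sets (space P) {cyl l | l. \<forall>(t, i)\<in>set l. S \<le> t}" for i
    using s by (intro sigma_sets.Basic CollectI exI[of _ "[(s, i)]"]) auto
  ultimately show "C \<in> sigma_sets (space P) {cyl l | l. \<forall>(t, i)\<in>set l. S \<le> t}"
    unfolding s(2) by (auto intro!: sigma_sets_UNION countable_finite)
qed

text \<open>For fixed \<open>B\<close> both sides are finite measures in \<open>D\<close>, and they
  agree on cylinders, which are stable under intersection.\<close>

lemma cond_indep:
  assumes S: "0 \<le> S" and B: "B \<in> sets (natural_filtration P X S)" and D: "D \<in> sets (gen_sigma P X {S..})"
  shows "prob (B \<inter> ev S j \<inter> D) * prob (ev S j) = prob (B \<inter> ev S j) * prob (ev S j \<inter> D)"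
proof -
  let ?G = "{cyl l | l. \<forall>(t, i)\<in>set l. S \<le> t}"
  have BP: "B \<in> sets P" using B by (rule natural_in_P)
  have EP: "ev S j \<in> sets P" using S by simp
  have stable: "Int_stable ?G"
  proof (rule Int_stableI)
    fix a b assume "a \<in> ?G" "b \<in> ?G"
    then obtain l k where l: "a = cyl l" "\<forall>(t, i)\<in>set l. S \<le> t" and k: "b = cyl k" "\<forall>(t, i)\<in>set k. S \<le> t" by blast
    have "a \<inter> b = cyl (l @ k)" unfolding l k by (auto simp: cyl_def)
    then show "a \<inter> b \<in> ?G" using l k by (intro CollectI exI[of _ "l @ k"]) auto
  qed
  have closed: "?G \<subseteq> Pow (space P)" by (auto simp: cyl_def)
  have "?G \<subseteq> sets P" using S by (auto intro!: cyl_sets)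
  then have subP: "sigma_sets (space P) ?G \<subseteq> sets P" by (rule sets.sigma_sets_subset)
  have D': "D \<in> sigma_sets (space P) ?G" using D future_cyl[OF S] by blast
  show ?thesis
    using stable closed D'
  proof (induction rule: sigma_sets_induct_disjoint)
    case (basic D)
    then show ?case using cond_indep_cyl[OF _ S B] by blast
  next
    case empty then show ?case by simp
  next
    case (compl D)
    have DP: "D \<in> sets P" using compl subP by blast
    have "prob (B \<inter> ev S j \<inter> (space P - D)) = prob (B \<inter> ev S j) - prob (B \<inter> ev S j \<inter> D)"
    proof -
      have "B \<inter> ev S j \<inter> (space P - D) = B \<inter> ev S j - B \<inter> ev S j \<inter> D" by (auto simp: ev_def)
      then show ?thesis using BP EP DP by (simp only:) (subst finite_measure_Diff, auto)
    qed
    moreover have "prob (ev S j \<inter> (space P - D)) = prob (ev S j) - prob (ev S j \<inter> D)"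
    proof -
      have "ev S j \<inter> (space P - D) = ev S j - ev S j \<inter> D" by (auto simp: ev_def)
      then show ?thesis using EP DP by (simp only:) (subst finite_measure_Diff, auto)
    qed
    ultimately show ?case using compl(2) by (simp only: left_diff_distrib right_diff_distrib)
  next
    case (union D)
    have DP: "D n \<in> sets P" for n using union(2) subP by blast
    have s1: "(\<lambda>n. prob (B \<inter> ev S j \<inter> D n)) sums prob (\<Union>n. B \<inter> ev S j \<inter> D n)"
      using BP EP DP union(1) by (intro finite_measure_UNION) (auto simp: disjoint_family_on_def)
    have s2: "(\<lambda>n. prob (ev S j \<inter> D n)) sums prob (\<Union>n. ev S j \<inter> D n)"
      using EP DP union(1) by (intro finite_measure_UNION) (auto simp: disjoint_family_on_def)
    have "(\<lambda>n. prob (B \<inter> ev S j \<inter> D n) * prob (ev S j)) sums (prob (\<Union>n. B \<inter> ev S j \<inter> D n) * prob (ev S j))"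
      using s1 by (rule sums_mult2)
    moreover have "(\<lambda>n. prob (B \<inter> ev S j) * prob (ev S j \<inter> D n)) sums (prob (B \<inter> ev S j) * prob (\<Union>n. ev S j \<inter> D n))"
      using s2 by (rule sums_mult)
    ultimately have "prob (\<Union>n. B \<inter> ev S j \<inter> D n) * prob (ev S j) = prob (B \<inter> ev S j) * prob (\<Union>n. ev S j \<inter> D n)"
      using union(3) sums_unique2 by simp
    then show ?case by (simp only: Int_UN_distrib)
  qed
qed

text \<open>Conditional independence in measure form: on \<open>ev S j\<close>, independent copies
  of past and future have the law of the pair (\<omega>, \<omega>), up to the factor
  \<open>prob (ev S j)\<close>. What holds almost surely on the diagonal thus holds for almost all
  unrelated pairs (p, \<omega>).\<close>

lemma diagonal_law:
  fixes j :: 'n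
  assumes S: "0 \<le> S"
  defines "M1 \<equiv> density (restr_to_subalg P (natural_filtration P X S)) (indicator (ev S j))"
    and "M2 \<equiv> restr_to_subalg (density P (indicator (ev S j))) (gen_sigma P X {S..})"
  shows "M1 \<Otimes>\<^sub>M M2 = scale_measure (ennreal (prob (ev S j)))
           (distr (density P (indicator (ev S j))) (splice_all P X S) (\<lambda>\<omega>. (\<omega>, \<omega>)))"
proof -
  let ?E = "ev S j"
  let ?Q = "density P (indicator ?E)"
  have E: "?E \<in> sets P" using S by simp
  have EF: "?E \<in> sets (natural_filtration P X S)" using ev_natural[OF S order_refl] .
  have subF: "subalgebra P (natural_filtration P X S)" by (simp add: subalgebra_def natural_sub)
  have G: "sets (gen_sigma P X {S..}) \<subseteq> sets P" using S by (intro gen_sub) auto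
  then have subG: "subalgebra ?Q (gen_sigma P X {S..})" by (simp add: subalgebra_def)
  have s1: "sets M1 = sets (natural_filtration P X S)" unfolding M1_def using subF by (simp add: sets_restr_to_subalg)
  have s2: "sets M2 = sets (gen_sigma P X {S..})" unfolding M2_def using subG by (simp add: sets_restr_to_subalg)
  have e1: "emeasure M1 B = ennreal (prob (B \<inter> ?E))" if "B \<in> sets (natural_filtration P X S)" for B
    unfolding M1_def using that EF subF
    by (subst emeasure_density) (auto simp: sets_restr_to_subalg borel_measurable_indicator nn_integral_indicator
        emeasure_restr_to_subalg emeasure_eq_measure Int_commute simp flip: indicator_inter_arith)
  have e2: "emeasure M2 D = ennreal (prob (?E \<inter> D))" if "D \<in> sets (gen_sigma P X {S..})" for D
  proof -
    have "D \<in> sets P" using that G by blast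
    then show ?thesis unfolding M2_def using that subG E
      by (simp add: emeasure_restr_to_subalg emeasure_density emeasure_eq_measure flip: indicator_inter_arith)
  qed
  have sp: "space M1 = space P" "space M2 = space P"
    using sets_eq_imp_space_eq[OF s1] sets_eq_imp_space_eq[OF s2] by auto
  have f1: "sigma_finite_measure M1"
  proof (rule finite_measure.axioms(1)[OF finite_measureI], simp only: sp)
    show "emeasure M1 (space P) \<noteq> \<infinity>"
      using e1[of "space P"] sets.top[of "natural_filtration P X S"] by simp
  qed
  have f2: "sigma_finite_measure M2"
  proof (rule finite_measure.axioms(1)[OF finite_measureI], simp only: sp)
    show "emeasure M2 (space P) \<noteq> \<infinity>"
      using e2[of "space P"] sets.top[of "gen_sigma P X {S..}"] by simp
  qed
  have diag: "(\<lambda>\<omega>. (\<omega>, \<omega>)) \<in> measurable ?Q (splice_all P X S)"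
    by (intro measurable_Pair measurable_from_subset[OF measurable_ident[unfolded id_def]])
      (use G natural_sub in auto)
  show ?thesis
  proof (rule pair_measure_eqI[OF f1 f2])
    show "sets (M1 \<Otimes>\<^sub>M M2) = sets (scale_measure (ennreal (prob ?E)) (distr ?Q (splice_all P X S) (\<lambda>\<omega>. (\<omega>, \<omega>))))"
      by (simp add: s1 s2 cong: sets_pair_measure_cong)
    fix B D assume "B \<in> sets M1" "D \<in> sets M2"
    then have BD: "B \<in> sets (natural_filtration P X S)" "D \<in> sets (gen_sigma P X {S..})" by (simp_all add: s1 s2)
    have P: "B \<in> sets P" "D \<in> sets P" using BD G natural_sub by blast+
    have "(\<lambda>\<omega>. (\<omega>, \<omega>)) -` (B \<times> D) \<inter> space ?Q = B \<inter> D"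
      using sets.sets_into_space[OF P(1)] by auto
    then have "emeasure (distr ?Q (splice_all P X S) (\<lambda>\<omega>. (\<omega>, \<omega>))) (B \<times> D) = emeasure ?Q (B \<inter> D)"
      using BD diag by (subst emeasure_distr) auto
    also have "\<dots> = ennreal (prob (B \<inter> ?E \<inter> D))"
      using P E by (simp add: emeasure_density emeasure_eq_measure Int_ac flip: indicator_inter_arith)
    finally have "emeasure (scale_measure (ennreal (prob ?E)) (distr ?Q (splice_all P X S) (\<lambda>\<omega>. (\<omega>, \<omega>)))) (B \<times> D)
        = ennreal (prob ?E * prob (B \<inter> ?E \<inter> D))"
      by (simp add: ennreal_mult)
    then show "emeasure M1 B * emeasure M2 D = emeasure (scale_measure (ennreal (prob ?E)) (distr ?Q (splice_all P X S) (\<lambda>\<omega>. (\<omega>, \<omega>)))) (B \<times> D)"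
      using cond_indep[OF S BD, of j] e1[OF BD(1)] e2[OF BD(2)] by (simp add: ennreal_mult[symmetric] mult.commute)
  qed
qed

end

section \<open>The compensator of the jumps\<close>

text \<open>Bridge from the gauge integral of the definitions to the Lebesgue integral, for which
  Fubini and dominated convergence are stated.\<close>

lemma bounded_absolutely_integrable:
  fixes f :: "real \<Rightarrow> real"
  assumes [measurable]: "f \<in> borel_measurable borel" and K: "\<And>r. a \<le> r \<Longrightarrow> r \<le> b \<Longrightarrow> \<bar>f r\<bar> \<le> K"
  shows "set_integrable lborel {a..b} f" "f absolutely_integrable_on {a..b}"
    "integral {a..b} f = (LINT r|lborel. indicator {a..b} r * f r)"
proof -
  show *: "set_integrable lborel {a..b} f"
    unfolding set_integrable_def
  proof (rule integrableI_bounded_set[where A="{a..b}" and B="\<bar>K\<bar>"])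
    show "AE x in lborel. x \<in> {a..b} \<longrightarrow> norm (indicat_real {a..b} x *\<^sub>R f x) \<le> \<bar>K\<bar>"
    proof (intro AE_I2 impI)
      fix x assume "x \<in> {a..b}"
      then show "norm (indicat_real {a..b} x *\<^sub>R f x) \<le> \<bar>K\<bar>" using K[of x] by simp
    qed
  qed (auto simp: emeasure_lborel_Icc_eq)
  then show "f absolutely_integrable_on {a..b}"
    by (simp add: set_integrable_def integrable_completion)
  show "integral {a..b} f = (LINT r|lborel. indicator {a..b} r * f r)"
    using set_borel_integral_eq_integral(2)[OF *] by (simp add: set_lebesgue_integral_def)
qed

section \<open>Joint measurability of the chain and of its rates\<close>

context markov_chain
begin

text \<open>At time 0 \<open>left_lim X\<close> depends on \<open>X\<close> at negative times, which
  is unrestricted. The value 0 there makes \<open>XL\<close> predictable and jointly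
  measurable.\<close>

definition XL :: "real \<Rightarrow> 'a \<Rightarrow> real^'n" where
  "XL t \<omega> = (if 0 < t then left_lim X t \<omega> else 0)"

lemma XL_eq: "0 < t \<Longrightarrow> XL t \<omega> = llim (\<lambda>s. X s \<omega>) t"
  by (simp add: XL_def left_lim_def)

lemma XL_state: "0 < t \<Longrightarrow> \<omega> \<in> space P \<Longrightarrow> \<exists>i. XL t \<omega> = axis i 1"
  using step_path_left(2)[OF step_path_X] by (force simp: XL_eq)

lemma AE_XL: "\<omega> \<in> space P \<Longrightarrow> AE r in lborel. 0 < r \<longrightarrow> XL r \<omega> = X r \<omega>"
  using AE_not_jump[OF step_path_X] by (rule AE_mp) (auto simp: jumps_def XL_eq)

lemma XL_nat_pred: "(\<lambda>(t, \<omega>). XL t \<omega>) \<in> borel_measurable (nat_pred P X)"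
proof -
  have "(\<lambda>(t, \<omega>). if 0 < t then lim (\<lambda>n. X (dyad n t) \<omega>) else 0) \<in> borel_measurable (nat_pred P X)"
    by (rule nat_filt.pred_left_limit) (simp add: natural_filtration_eq measurable_gen_sigma)
  moreover have "(\<lambda>(t, \<omega>). if 0 < t then lim (\<lambda>n. X (dyad n t) \<omega>) else 0) z = (\<lambda>(t, \<omega>). XL t \<omega>) z"
    if "z \<in> space (nat_pred P X)" for z
    using that dyad_lim(2)[OF step_path_left(3)[OF step_path_X]]
    by (cases z) (auto simp: nat_filt.space_pred XL_def left_lim_def)
  ultimately show ?thesis by (rule measurable_cong[THEN iffD1, rotated])
qed

lemma nat_pred_joint:
  fixes g :: "real \<times> 'a \<Rightarrow> 'b::{real_normed_vector, second_countable_topology}"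
  assumes "g \<in> borel_measurable (nat_pred P X)"
  shows "(\<lambda>x. if fst x \<in> {0..} then g x else 0) \<in> borel_measurable (borel \<Otimes>\<^sub>M P)"
  by (rule nat_filt.pred_measurable_prod[OF assms]) (use natural_sub in auto)

lemma XL_joint [measurable]: "(\<lambda>z. XL (fst z) (snd z)) \<in> borel_measurable (borel \<Otimes>\<^sub>M P)"
proof -
  have "(\<lambda>z. if fst z \<in> {0..} then (\<lambda>(t, \<omega>). XL t \<omega>) z else 0) = (\<lambda>z. XL (fst z) (snd z))"
    by (auto simp: XL_def)
  then show ?thesis using nat_pred_joint[OF XL_nat_pred] by simp
qed

lemma X_joint [measurable]: "(\<lambda>z. if 0 \<le> fst z then X (fst z) (snd z) else 0) \<in> borel_measurable (borel \<Otimes>\<^sub>M P)"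
proof -
  \<comment> \<open>The grid point strictly to the right of \<open>t\<close>, so that
    right-continuity gives convergence.\<close>
  define e where "e n t = (real_of_int \<lfloor>t * 2^n\<rfloor> + 1) / 2^n" for n :: nat and t :: real
  have e_gt: "t < e n t" for n t
  proof -
    have "t * 2^n < real_of_int \<lfloor>t * 2^n\<rfloor> + 1" by linarith
    then show ?thesis by (simp add: e_def less_divide_eq)
  qed
  have e_le: "e n t \<le> t + 1/2^n" for n t
  proof -
    have "(real_of_int \<lfloor>t * 2^n\<rfloor> + 1) / 2^n \<le> (t * 2^n + 1) / 2^n" by (intro divide_right_mono) auto
    then show ?thesis by (simp add: e_def add_divide_distrib)
  qed
  have e_lim: "(\<lambda>n. e n t) \<longlonglongrightarrow> t" for t
  proof (rule tendsto_sandwich)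
    show "\<forall>\<^sub>F n in sequentially. t \<le> e n t" by (simp add: e_gt less_imp_le)
    show "\<forall>\<^sub>F n in sequentially. e n t \<le> t + 1/2^n" by (simp add: e_le)
    have "(\<lambda>n. t + (1/2)^n) \<longlonglongrightarrow> t + 0" by (intro tendsto_intros LIMSEQ_realpow_zero) auto
    then show "(\<lambda>n. t + 1/2^n) \<longlonglongrightarrow> t" by (simp add: power_divide)
  qed auto
  have e_right: "filterlim (\<lambda>n. e n t) (at_right t) sequentially" for t
    unfolding filterlim_at using e_lim e_gt[of t] by (auto intro!: always_eventually simp: less_imp_neq[symmetric])
  let ?f = "\<lambda>n z. if 0 \<le> fst z then X (e n (fst z)) (snd z) else 0"
  have meas: "?f n \<in> borel_measurable (borel \<Otimes>\<^sub>M P)" for n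
  proof -
    have [measurable]: "X ((real k + 1) / 2^n) \<in> borel_measurable P" for k :: nat by (rule measurable_X) auto
    have "(\<lambda>z :: real \<times> 'a. (\<lambda>k z. if 0 \<le> fst z then X ((real k + 1) / 2^n) (snd z) else 0) (nat \<lfloor>fst z * 2^n\<rfloor>) z) \<in> borel_measurable (borel \<Otimes>\<^sub>M P)"
      by (rule measurable_compose_countable[where g="\<lambda>z. nat \<lfloor>fst z * 2^n\<rfloor>"]) measurable
    moreover have "(\<lambda>z :: real \<times> 'a. (\<lambda>k z. if 0 \<le> fst z then X ((real k + 1) / 2^n) (snd z) else 0) (nat \<lfloor>fst z * 2^n\<rfloor>) z) = ?f n"
      by (auto simp: e_def fun_eq_iff)
    ultimately show ?thesis by simp
  qed
  show ?thesis
  proof (rule borel_measurable_LIMSEQ_metric[OF meas])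
    fix z :: "real \<times> 'a" assume "z \<in> space (borel \<Otimes>\<^sub>M P)"
    then have "snd z \<in> space P" by (auto simp: space_pair_measure)
    show "(\<lambda>n. ?f n z) \<longlonglongrightarrow> (if 0 \<le> fst z then X (fst z) (snd z) else 0)"
    proof (cases "0 \<le> fst z")
      case True
      then show ?thesis
        using filterlim_compose[OF right_continuous_X[OF True \<open>snd z \<in> space P\<close>] e_right] by simp
    qed simp
  qed
qed

text \<open>Cutting \<open>A\<close> off at negative times turns its measurability on
  \<open>{0..}\<close> into Borel measurability on the line.\<close>

definition rate :: "'n \<Rightarrow> 'n \<Rightarrow> real \<Rightarrow> real" where
  "rate i j r = (if 0 \<le> r then A r $ i $ j else 0)"

lemma rate_measurable [measurable]: "rate i j \<in> borel_measurable borel"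
proof -
  have [measurable]: "(\<lambda>r. indicator {0..} r *\<^sub>R A r) \<in> borel_measurable borel"
    using measurable_A by (simp add: set_borel_measurable_def)
  have "(\<lambda>r. (indicator {0..} r *\<^sub>R A r) $ i $ j) \<in> borel_measurable borel" by measurable
  moreover have "(\<lambda>r. (indicator {0..} r *\<^sub>R A r) $ i $ j) = rate i j"
    by (auto simp: rate_def fun_eq_iff indicator_def)
  ultimately show ?thesis by simp
qed

definition K where "K = (SOME K. \<forall>t\<ge>0. \<forall>i j. \<bar>A t $ i $ j\<bar> \<le> K)"

lemma A_bound: "0 \<le> t \<Longrightarrow> \<bar>A t $ i $ j\<bar> \<le> K"
  unfolding K_def using someI_ex[OF bounded_A] by blast

lemma K_nonneg: "0 \<le> K"
  using A_bound[of 0 undefined undefined] by linarith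

lemma rate_bound: "\<bar>rate i j r\<bar> \<le> K"
  using A_bound[of r i j] K_nonneg by (auto simp: rate_def)

lemma matrix_axis: "((B :: real^'m^'k) *v axis j 1) $ i = B $ i $ j"
  by (simp add: matrix_vector_mult_basis column_def)

lemma inner_AXL:
  assumes "XL r \<omega> = axis j 1" "0 < r"
  shows "z \<bullet> (A r *v left_lim X r \<omega>) = (\<Sum>i\<in>UNIV. z $ i * A r $ i $ j)"
  using assms by (simp add: XL_def inner_vec_def matrix_axis)

text \<open>Density of the compensator of the \<open>i\<close>-th component of \<open>X\<close>; it
  is \<open>rate i j\<close> while the chain sits in \<open>j\<close>.\<close>

definition drift_rate :: "'n \<Rightarrow> real \<times> 'a \<Rightarrow> real" where
  "drift_rate i z = (\<Sum>k\<in>UNIV. rate i k (fst z) * XL (fst z) (snd z) $ k)"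

lemma drift_rate_measurable [measurable]: "drift_rate i \<in> borel_measurable (borel \<Otimes>\<^sub>M P)"
  unfolding drift_rate_def by measurable

lemma drift_rate_eq: "0 < r \<Longrightarrow> drift_rate i (r, \<omega>) = (A r *v left_lim X r \<omega>) $ i"
  by (simp add: drift_rate_def rate_def XL_def matrix_vector_mult_def)

lemma drift_rate_eq_rate:
  assumes "XL r \<omega> = axis j 1" shows "drift_rate i (r, \<omega>) = rate i j r"
  using assms by (simp add: drift_rate_def axis_def if_distrib cong: if_cong)

lemma drift_rate_bound: assumes "snd z \<in> space P" shows "\<bar>drift_rate i z\<bar> \<le> K"
proof (cases "0 < fst z")
  case True
  then obtain j where "XL (fst z) (snd z) = axis j 1" using XL_state[OF _ assms] by blast
  then show ?thesis using drift_rate_eq_rate[of "fst z" "snd z" j i] rate_bound by simp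
next
  case False
  then show ?thesis using K_nonneg by (simp add: drift_rate_def XL_def)
qed

abbreviation "LP \<equiv> lborel \<Otimes>\<^sub>M P"

sublocale LP: pair_sigma_finite lborel P ..

lemma drift_rate_integrable:
  assumes [measurable]: "H \<in> borel_measurable (borel \<Otimes>\<^sub>M P)" and H: "\<And>z. \<bar>H z\<bar> \<le> 1"
  shows "integrable LP (\<lambda>z. indicator {0..T} (fst z) * (H z * drift_rate i z))"
proof (rule integrableI_bounded_set[where A="{0..T} \<times> space P" and B=K])
  show "emeasure LP ({0..T} \<times> space P) < \<infinity>"
    by (subst emeasure_pair_measure_Times) (auto simp: ennreal_mult_less_top emeasure_space_1 emeasure_lborel_Icc_eq)
  show "AE x in LP. x \<in> {0..T} \<times> space P \<longrightarrow> norm (indicat_real {0..T} (fst x) * (H x * drift_rate i x)) \<le> K"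
  proof (rule AE_I2, rule impI)
    fix x :: "real \<times> 'a" assume "x \<in> {0..T} \<times> space P"
    then have "\<bar>H x\<bar> * \<bar>drift_rate i x\<bar> \<le> 1 * K" using H drift_rate_bound[of x i] by (intro mult_mono) auto
    then show "norm (indicat_real {0..T} (fst x) * (H x * drift_rate i x)) \<le> K"
      using K_nonneg by (auto simp: abs_mult indicator_def)
  qed
qed (auto simp: indicator_def space_pair_measure)

section \<open>Laws at fixed times and the forward equation\<close>

definition mass :: "'a set \<Rightarrow> 'n \<Rightarrow> real \<Rightarrow> real" where
  "mass B k r = (if 0 \<le> r then prob (B \<inter> ev r k) else 0)"

lemma X_indicator: "0 \<le> r \<Longrightarrow> \<omega> \<in> space P \<Longrightarrow> X r \<omega> $ k = indicator (ev r k) \<omega>"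
  using state_X[of r \<omega>] by (auto simp: ev_def axis_def indicator_def vec_eq_iff split: if_splits)

lemma mass_eq:
  assumes "B \<in> sets P" "0 \<le> r" shows "mass B k r = (\<integral>\<omega>. indicator B \<omega> * X r \<omega> $ k \<partial>P)"
proof -
  have "(\<integral>\<omega>. indicator B \<omega> * X r \<omega> $ k \<partial>P) = (\<integral>\<omega>. indicator (B \<inter> ev r k) \<omega> \<partial>P)"
    using assms by (intro Bochner_Integration.integral_cong) (auto simp: X_indicator indicator_def)
  then show ?thesis using assms by (simp add: mass_def)
qed

lemma mass_measurable [measurable]:
  assumes [measurable]: "B \<in> sets P" shows "mass B k \<in> borel_measurable borel"
proof -
  have "(\<lambda>r. \<integral>\<omega>. (\<lambda>z. indicator B (snd z) * (if 0 \<le> fst z then X (fst z) (snd z) else 0) $ k) (r, \<omega>) \<partial>P) \<in> borel_measurable borel"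
    by (rule borel_measurable_lebesgue_integral) measurable
  moreover have "(\<lambda>r. \<integral>\<omega>. (\<lambda>z. indicator B (snd z) * (if 0 \<le> fst z then X (fst z) (snd z) else 0) $ k) (r, \<omega>) \<partial>P) = mass B k"
    using mass_eq[OF assms] by (auto simp: fun_eq_iff mass_def)
  ultimately show ?thesis by simp
qed

lemma mass_bound: "0 \<le> mass B k r" "mass B k r \<le> 1"
  by (auto simp: mass_def)

text \<open>By the Markov property \<open>mass B k r\<close> is the sum over \<open>j\<close> of
  \<open>prob (B \<inter> ev s j)\<close> times the transition probability from \<open>j\<close> to
  \<open>k\<close>. The integrated forward equation is linear and can be summed with these
  weights.\<close>

lemma forward_equation:
  assumes B: "B \<in> sets (natural_filtration P X s)" and st: "0 \<le> s" "s \<le> t"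
  shows "mass B i t - mass B i s = integral {s..t} (\<lambda>r. \<Sum>k\<in>UNIV. rate i k r * mass B k r)"
proof -
  have BP: "B \<in> sets P" using B by (rule natural_in_P)
  \<comment> \<open>Transition probability from \<open>j\<close> to \<open>k\<close>. Division by
    zero gives 0 when \<open>ev s j\<close> is null, and there the weight in front vanishes
    too.\<close>
  define c where "c j k r = (if 0 \<le> r then prob (ev s j \<inter> ev r k) / prob (ev s j) else 0)" for j k r
  have c_mass: "c j k r = mass (ev s j) k r / prob (ev s j)" for j k r by (simp add: c_def mass_def)
  have [measurable]: "c j k \<in> borel_measurable borel" for j k
    unfolding c_mass using st by measurable
  have c_bound: "0 \<le> c j k r" "c j k r \<le> 1" for j k r
  proof -
    have "prob (ev s j \<inter> ev r k) \<le> prob (ev s j)" using st by (intro finite_measure_mono) auto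
    then show "c j k r \<le> 1" by (cases "prob (ev s j) = 0") (simp_all add: c_def divide_le_eq_1 zero_less_measure_iff)
  qed (simp add: c_def)
  have split: "mass B k r = (\<Sum>j\<in>UNIV. prob (B \<inter> ev s j) * c j k r)" if sr: "s \<le> r" for k r
  proof -
    have r: "0 \<le> r" using st sr by simp
    have "B \<inter> ev r k = (\<Union>j\<in>UNIV. B \<inter> ev s j \<inter> ev r k)"
    proof -
      have "\<exists>j. x \<in> ev s j" if "x \<in> ev r k" for x
        using ev_partition[OF st(1), of x] that by (auto simp: ev_def)
      then show ?thesis by auto
    qed
    moreover have "prob (\<Union>j\<in>UNIV. B \<inter> ev s j \<inter> ev r k) = (\<Sum>j\<in>UNIV. prob (B \<inter> ev s j \<inter> ev r k))"
    proof (rule finite_measure_finite_Union)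
      have "ev s j \<inter> ev s k = {}" if "j \<noteq> k" for j k using that by (auto simp: ev_def axis_eq_axis)
      then show "disjoint_family_on (\<lambda>j. B \<inter> ev s j \<inter> ev r k) UNIV"
        unfolding disjoint_family_on_def by blast
    qed (use BP st r in auto)
    ultimately have "prob (B \<inter> ev r k) = (\<Sum>j\<in>UNIV. prob (B \<inter> ev s j \<inter> ev r k))" by simp
    also have "\<dots> = (\<Sum>j\<in>UNIV. prob (B \<inter> ev s j) * c j k r)"
    proof (rule sum.cong[OF refl])
      fix j
      obtain q where q: "\<forall>B\<in>sets (natural_filtration P X s). prob (B \<inter> ev s j \<inter> ev r k) = q * prob (B \<inter> ev s j)"
        using markov_factor[OF st(1) sr] by blast
      have top: "space P \<in> sets (natural_filtration P X s)" using sets.top[of "natural_filtration P X s"] by simp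
      have "space P \<inter> ev s j = ev s j" by (auto simp: ev_def)
      then have q1: "prob (ev s j \<inter> ev r k) = q * prob (ev s j)" using bspec[OF q top] by simp
      show "prob (B \<inter> ev s j \<inter> ev r k) = prob (B \<inter> ev s j) * c j k r"
      proof (cases "prob (ev s j) = 0")
        case True
        have "prob (B \<inter> ev s j) \<le> prob (ev s j)" using st BP by (intro finite_measure_mono) auto
        then have "prob (B \<inter> ev s j) = 0" using True by (simp add: measure_le_0_iff)
        then show ?thesis using bspec[OF q B] by simp
      next
        case False
        then have "c j k r = q" using q1 r by (simp add: c_def)
        then show ?thesis using bspec[OF q B] by simp
      qed
    qed
    finally show ?thesis using r by (simp add: mass_def)
  qed
  have trans: "prob (B \<inter> ev s j) * c j i t = prob (B \<inter> ev s j) * (if i = j then 1 else 0) +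
      integral {s..t} (\<lambda>r. prob (B \<inter> ev s j) * (\<Sum>k\<in>UNIV. rate i k r * c j k r))" for j
  proof (cases "prob (ev s j) = 0")
    case True
    have "prob (B \<inter> ev s j) \<le> prob (ev s j)" using st BP by (intro finite_measure_mono) auto
    then have "prob (B \<inter> ev s j) = 0" using True by (simp add: measure_le_0_iff)
    then show ?thesis by simp
  next
    case False
    have cp: "\<P>(\<omega> in P. X r \<omega> = axis k 1 \<bar> X s \<omega> = axis j 1) = c j k r" if "s \<le> r" for r k
    proof -
      have "{\<omega> \<in> space P. X r \<omega> = axis k 1 \<and> X s \<omega> = axis j 1} = ev s j \<inter> ev r k" by (auto simp: ev_def)
      then show ?thesis using that st by (simp add: cond_prob_def c_def ev_def)
    qed
    have "prob (ev s j) > 0" using False by (simp add: zero_less_measure_iff)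
    then have "\<P>(\<omega> in P. X t \<omega> = axis i 1 \<bar> X s \<omega> = axis j 1) = (if i = j then 1 else 0) +
           integral {s..t} (\<lambda>r. \<Sum>k\<in>UNIV. A r $ i $ k * \<P>(\<omega> in P. X r \<omega> = axis k 1 \<bar> X s \<omega> = axis j 1))"
      unfolding ev_def by (rule transition_rates[OF st])
    moreover have "integral {s..t} (\<lambda>r. \<Sum>k\<in>UNIV. A r $ i $ k * \<P>(\<omega> in P. X r \<omega> = axis k 1 \<bar> X s \<omega> = axis j 1)) =
        integral {s..t} (\<lambda>r. \<Sum>k\<in>UNIV. rate i k r * c j k r)"
      using st by (intro Henstock_Kurzweil_Integration.integral_cong) (simp add: cp rate_def)
    ultimately have "c j i t = (if i = j then 1 else 0) + integral {s..t} (\<lambda>r. \<Sum>k\<in>UNIV. rate i k r * c j k r)"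
      using cp[OF st(2)] by simp
    then show ?thesis by (simp add: distrib_left)
  qed
  have int: "(\<lambda>r. prob (B \<inter> ev s j) * (\<Sum>k\<in>UNIV. rate i k r * c j k r)) integrable_on {s..t}" for j
  proof -
    have "(\<lambda>r. prob (B \<inter> ev s j) * (\<Sum>k\<in>UNIV. rate i k r * c j k r)) absolutely_integrable_on {s..t}"
    proof (rule bounded_absolutely_integrable(2)[where K="1 * (\<Sum>k\<in>(UNIV::'n set). K * 1)"])
      fix r
      have "\<bar>\<Sum>k\<in>UNIV. rate i k r * c j k r\<bar> \<le> (\<Sum>k\<in>(UNIV::'n set). K * 1)"
        by (rule order_trans[OF sum_abs sum_mono]) (auto simp: abs_mult c_bound rate_bound K_nonneg intro!: mult_mono simp del: mult_1_right)
      then show "\<bar>prob (B \<inter> ev s j) * (\<Sum>k\<in>UNIV. rate i k r * c j k r)\<bar> \<le> 1 * (\<Sum>k\<in>(UNIV::'n set). K * 1)"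
        unfolding abs_mult by (intro mult_mono) auto
    qed measurable
    then show ?thesis by (rule set_lebesgue_integral_eq_integral(1))
  qed
  have "mass B i t = (\<Sum>j\<in>UNIV. prob (B \<inter> ev s j) * (if i = j then 1 else 0)) +
      (\<Sum>j\<in>UNIV. integral {s..t} (\<lambda>r. prob (B \<inter> ev s j) * (\<Sum>k\<in>UNIV. rate i k r * c j k r)))"
    unfolding split[OF st(2)] trans by (rule sum.distrib)
  also have "(\<Sum>j\<in>UNIV. prob (B \<inter> ev s j) * (if i = j then 1 else 0)) = mass B i s"
    using st by (simp add: mass_def if_distrib cong: if_cong)
  also have "(\<Sum>j\<in>UNIV. integral {s..t} (\<lambda>r. prob (B \<inter> ev s j) * (\<Sum>k\<in>UNIV. rate i k r * c j k r))) =
      integral {s..t} (\<lambda>r. \<Sum>j\<in>UNIV. prob (B \<inter> ev s j) * (\<Sum>k\<in>UNIV. rate i k r * c j k r))"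
    using int by (intro integral_sum[symmetric]) auto
  also have "\<dots> = integral {s..t} (\<lambda>r. \<Sum>k\<in>UNIV. rate i k r * mass B k r)"
  proof (rule Henstock_Kurzweil_Integration.integral_cong)
    fix r assume "r \<in> {s..t}"
    then have "(\<Sum>k\<in>UNIV. rate i k r * mass B k r) = (\<Sum>k\<in>UNIV. \<Sum>j\<in>UNIV. prob (B \<inter> ev s j) * (rate i k r * c j k r))"
      by (simp add: split sum_distrib_left algebra_simps)
    also have "\<dots> = (\<Sum>j\<in>UNIV. prob (B \<inter> ev s j) * (\<Sum>k\<in>UNIV. rate i k r * c j k r))"
      by (subst sum.swap) (simp add: sum_distrib_left)
    finally show "(\<Sum>j\<in>UNIV. prob (B \<inter> ev s j) * (\<Sum>k\<in>UNIV. rate i k r * c j k r)) = (\<Sum>k\<in>UNIV. rate i k r * mass B k r)" by simp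
  qed
  finally show ?thesis by simp
qed

text \<open>The compensator formula on a generating rectangle. The increment on the left is a
  telescoped jump sum; the right side comes from \<open>forward_equation\<close> and Fubini.\<close>

lemma compensator_rect:
  assumes B: "B \<in> sets (natural_filtration P X s)" and st: "0 \<le> s" "s \<le> t" "t \<le> T"
  shows "(\<integral>\<omega>. indicator B \<omega> * (X t \<omega> $ i - X s \<omega> $ i) \<partial>P) =
    (\<integral>z. indicator {0..T} (fst z) * (indicator ({s<..t} \<times> B) z * drift_rate i z) \<partial>LP)"
proof -
  have BP[measurable]: "B \<in> sets P" using B by (rule natural_in_P)
  have i1: "integrable P (\<lambda>\<omega>. indicator B \<omega> * X r \<omega> $ k)" if "0 \<le> r" for r k
  proof (rule integrable_const_bound[where B=1])
    show "AE \<omega> in P. norm (indicat_real B \<omega> * X r \<omega> $ k) \<le> 1"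
      using that by (intro AE_I2) (auto simp: X_indicator indicator_def)
    show "(\<lambda>\<omega>. indicat_real B \<omega> * X r \<omega> $ k) \<in> borel_measurable P" using measurable_X[OF that] by measurable
  qed
  have "(\<integral>\<omega>. indicator B \<omega> * (X t \<omega> $ i - X s \<omega> $ i) \<partial>P) = mass B i t - mass B i s"
    using st i1 by (simp add: mass_eq[OF BP] right_diff_distrib)
  also have "\<dots> = integral {s..t} (\<lambda>r. \<Sum>k\<in>UNIV. rate i k r * mass B k r)"
    by (rule forward_equation[OF B st(1,2)])
  also have "\<dots> = (LINT r|lborel. indicator {s..t} r * (\<Sum>k\<in>UNIV. rate i k r * mass B k r))"
  proof (rule bounded_absolutely_integrable(3)[where K="\<Sum>k\<in>(UNIV::'n set). K * 1"])
    show "\<bar>\<Sum>k\<in>UNIV. rate i k r * mass B k r\<bar> \<le> (\<Sum>k\<in>(UNIV::'n set). K * 1)" for r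
      by (rule order_trans[OF sum_abs sum_mono]) (auto simp: abs_mult mass_bound rate_bound K_nonneg intro!: mult_mono simp del: mult_1_right)
  qed measurable
  also have "\<dots> = (LINT r|lborel. \<integral>\<omega>. indicator {0..T} r * (indicator ({s<..t} \<times> B) (r, \<omega>) * drift_rate i (r, \<omega>)) \<partial>P)"
  proof (rule integral_cong_AE)
    \<comment> \<open>On each path \<open>XL\<close> and \<open>X\<close> differ at countably many
      jump times only; Fubini turns this into almost sure equality at almost every fixed
      time.\<close>
    have "AE r in lborel. AE \<omega> in P. 0 < r \<longrightarrow> XL r \<omega> = X r \<omega>"
    proof (rule LP.AE_commute[THEN iffD2])
      show "AE \<omega> in P. AE r in lborel. 0 < r \<longrightarrow> XL r \<omega> = X r \<omega>" using AE_XL by auto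
      have "{z \<in> space LP. 0 < fst z \<longrightarrow> XL (fst z) (snd z) = (if 0 \<le> fst z then X (fst z) (snd z) else 0)} \<in> sets LP"
        by measurable
      moreover have "{z \<in> space LP. 0 < fst z \<longrightarrow> XL (fst z) (snd z) = (if 0 \<le> fst z then X (fst z) (snd z) else 0)}
        = {z \<in> space LP. 0 < fst z \<longrightarrow> XL (fst z) (snd z) = X (fst z) (snd z)}" by auto
      ultimately show "{z \<in> space LP. 0 < fst z \<longrightarrow> XL (fst z) (snd z) = X (fst z) (snd z)} \<in> sets LP" by simp
    qed
    moreover have "AE r in lborel. r \<noteq> s" by (rule AE_lborel_singleton)
    ultimately show "AE r in lborel. indicator {s..t} r * (\<Sum>k\<in>UNIV. rate i k r * mass B k r) =
        (\<integral>\<omega>. indicator {0..T} r * (indicator ({s<..t} \<times> B) (r, \<omega>) * drift_rate i (r, \<omega>)) \<partial>P)"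
    proof eventually_elim
      case (elim r)
      show ?case
      proof (cases "r \<in> {s<..t}")
        case True
        then have r: "0 < r" "r \<in> {s..t}" "r \<in> {0..T}" using st by auto
        have "(\<integral>\<omega>. indicator {0..T} r * (indicator ({s<..t} \<times> B) (r, \<omega>) * drift_rate i (r, \<omega>)) \<partial>P) =
            (\<integral>\<omega>. (\<Sum>k\<in>UNIV. rate i k r * (indicator B \<omega> * X r \<omega> $ k)) \<partial>P)"
        proof (rule integral_cong_AE)
          have X_r: "X r \<in> borel_measurable P" using r by (intro measurable_X) auto
          have "(\<lambda>\<omega>. (\<lambda>z. indicator {0..T} (fst z) * (indicator ({s<..t} \<times> B) z * drift_rate i z)) (r, \<omega>)) \<in> borel_measurable P"
            by (rule measurable_compose[OF measurable_Pair1'[of r borel P]]) (auto, measurable)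
          then show "(\<lambda>\<omega>. indicator {0..T} r * (indicator ({s<..t} \<times> B) (r, \<omega>) * drift_rate i (r, \<omega>))) \<in> borel_measurable P" by simp
          show "(\<lambda>\<omega>. \<Sum>k\<in>UNIV. rate i k r * (indicator B \<omega> * X r \<omega> $ k)) \<in> borel_measurable P"
            using X_r by measurable
          show "AE \<omega> in P. indicator {0..T} r * (indicator ({s<..t} \<times> B) (r, \<omega>) * drift_rate i (r, \<omega>)) = (\<Sum>k\<in>UNIV. rate i k r * (indicator B \<omega> * X r \<omega> $ k))"
            using elim(1) by eventually_elim (use r True in \<open>auto simp: drift_rate_def indicator_def sum_distrib_left\<close>)
        qed
        also have "\<dots> = (\<Sum>k\<in>UNIV. rate i k r * mass B k r)"
          using i1[of r] r by (simp add: mass_eq[OF BP])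
        finally show ?thesis using r by simp
      next
        case False
        then have "r \<notin> {s..t}" using elim by auto
        moreover have "indicator ({s<..t} \<times> B) (r, \<omega>) = (0::real)" for \<omega> using False by auto
        ultimately show ?thesis by simp
      qed
    qed
    have "(\<lambda>r. \<integral>\<omega>. (\<lambda>z. indicator {0..T} (fst z) * (indicator ({s<..t} \<times> B) z * drift_rate i z)) (r, \<omega>) \<partial>P) \<in> borel_measurable borel"
      by (rule borel_measurable_lebesgue_integral) measurable
    then show "(\<lambda>r. \<integral>\<omega>. indicator {0..T} r * (indicator ({s<..t} \<times> B) (r, \<omega>) * drift_rate i (r, \<omega>)) \<partial>P) \<in> borel_measurable lborel" by simp
  qed measurable
  also have "\<dots> = (\<integral>z. indicator {0..T} (fst z) * (indicator ({s<..t} \<times> B) z * drift_rate i z) \<partial>LP)"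
    using LP.integral_fst'[OF drift_rate_integrable[of "indicator ({s<..t} \<times> B)" T i]] by (auto simp: indicator_def)
  finally show ?thesis .
qed

section \<open>The expected number of jumps\<close>

abbreviation "JT T \<omega> \<equiv> jumps (\<lambda>t. X t \<omega>) \<inter> {0<..T}"
abbreviation "\<Delta> r \<omega> \<equiv> X r \<omega> - llim (\<lambda>t. X t \<omega>) r"

text \<open>The chain leaves the state \<open>XL r \<omega>\<close>, so pairing a jump with
  \<open>- XL r \<omega>\<close> gives 1: jump sums with this integrand count jumps.\<close>

lemma jump_norm:
  assumes "\<omega> \<in> space P" "r \<in> jumps (\<lambda>t. X t \<omega>)"
  shows "XL r \<omega> \<bullet> \<Delta> r \<omega> = -1" "\<bar>\<Delta> r \<omega> $ i\<bar> \<le> 1"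
proof -
  have r: "0 < r" "X r \<omega> \<noteq> XL r \<omega>" using assms(2) by (auto simp: jumps_def XL_eq)
  obtain j where j: "XL r \<omega> = axis j 1" using XL_state[OF r(1) assms(1)] by blast
  obtain k where k: "X r \<omega> = axis k 1" using state_X[of r \<omega>] r assms(1) by auto
  have jk: "j \<noteq> k" using r j k by auto
  have "\<Delta> r \<omega> = axis k 1 - axis j 1" using j k r by (simp add: XL_eq)
  then show "XL r \<omega> \<bullet> \<Delta> r \<omega> = -1" "\<bar>\<Delta> r \<omega> $ i\<bar> \<le> 1"
    using j jk by (simp_all add: inner_diff_right inner_axis_axis) (simp add: axis_def)
qed

text \<open>On a grid interval the integrand is frozen at the left end and the jumps telescope. Each
  summand on the right is 1 if the states at the two ends differ and 0 otherwise.\<close>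

lemma dyadic_jump_sum:
  assumes x: "step_path x"
  shows "jump_sum x (\<lambda>r. - x (dyad n r)) 0 (real m / 2^n) = (\<Sum>k<m. 1 - x (real k / 2^n) \<bullet> x (real (Suc k) / 2^n))"
proof (induction m)
  case (Suc m)
  have le: "real m / 2^n \<le> real (Suc m) / 2^n" by (simp add: divide_right_mono)
  have "jump_sum x (\<lambda>r. - x (dyad n r)) (real m / 2^n) (real (Suc m) / 2^n) =
      (\<Sum>r\<in>jumps x \<inter> {real m / 2^n<..real (Suc m) / 2^n}. - x (real m / 2^n) \<bullet> (x r - llim x r))"
    unfolding jump_sum_def
  proof (intro sum.cong refl)
    fix r assume "r \<in> jumps x \<inter> {real m / 2^n<..real (Suc m) / 2^n}"
    then have "dyad n r = real m / 2^n" by (intro dyad_eq) (auto simp: add.commute)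
    then show "- x (dyad n r) \<bullet> (x r - llim x r) = - x (real m / 2^n) \<bullet> (x r - llim x r)" by simp
  qed
  also have "\<dots> = - x (real m / 2^n) \<bullet> (x (real (Suc m) / 2^n) - x (real m / 2^n))"
    using finite_jumps_telescope[OF x, of "real m / 2^n" "real (Suc m) / 2^n"] le
    by (simp only: inner_sum_right[symmetric]) simp
  also have "\<dots> = 1 - x (real m / 2^n) \<bullet> x (real (Suc m) / 2^n)"
  proof -
    have "x (real m / 2^n) \<in> range (\<lambda>i. axis i 1)" using x by (simp add: step_path_def)
    then show ?thesis by (auto simp: inner_diff_right inner_axis_axis)
  qed
  finally show ?case
    using Suc.IH jump_sum_split[OF x order_refl _ le, of "\<lambda>r. - x (dyad n r)"] by simp
qed simp

text \<open>The integrand is the indicator of {X s \<noteq> X t}. On \<open>ev s j\<close> it is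
  minus the increment of the \<open>j\<close>-th component, whose compensator grows at a speed of at
  most \<open>K\<close>.\<close>

lemma expected_mismatch:
  assumes st: "0 \<le> s" "s \<le> t"
  shows "integrable P (\<lambda>\<omega>. 1 - X s \<omega> \<bullet> X t \<omega>)"
    "(\<integral>\<omega>. 1 - X s \<omega> \<bullet> X t \<omega> \<partial>P) \<le> real CARD('n) * K * (t - s)"
proof -
  have [measurable]: "X s \<in> borel_measurable P" "X t \<in> borel_measurable P" using st by (auto intro: measurable_X)
  have eq: "1 - X s \<omega> \<bullet> X t \<omega> = (\<Sum>j\<in>UNIV. - (indicator (ev s j) \<omega> * (X t \<omega> $ j - X s \<omega> $ j)))" if "\<omega> \<in> space P" for \<omega>
  proof -
    have "(\<Sum>j\<in>UNIV. - (indicator (ev s j) \<omega> * (X t \<omega> $ j - X s \<omega> $ j))) = X s \<omega> \<bullet> X s \<omega> - X s \<omega> \<bullet> X t \<omega>"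
      using st that by (simp add: X_indicator[symmetric] inner_vec_def sum_subtractf[symmetric] algebra_simps)
    moreover have "X s \<omega> \<bullet> X s \<omega> = 1" using state_X[OF st(1) that] by (auto simp: inner_axis_axis)
    ultimately show ?thesis by simp
  qed
  have i: "integrable P (\<lambda>\<omega>. indicator (ev s j) \<omega> * (X t \<omega> $ j - X s \<omega> $ j))" for j
  proof (rule integrable_const_bound[where B=1])
    show "AE \<omega> in P. norm (indicat_real (ev s j) \<omega> * (X t \<omega> $ j - X s \<omega> $ j)) \<le> 1"
      using st by (intro AE_I2) (auto simp: X_indicator indicator_def)
  qed (use st in measurable)
  have "integrable P (\<lambda>\<omega>. \<Sum>j\<in>UNIV. - (indicator (ev s j) \<omega> * (X t \<omega> $ j - X s \<omega> $ j)))"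
    by (intro Bochner_Integration.integrable_sum Bochner_Integration.integrable_minus i)
  then show "integrable P (\<lambda>\<omega>. 1 - X s \<omega> \<bullet> X t \<omega>)"
    by (rule Bochner_Integration.integrable_cong[THEN iffD1, rotated 2]) (auto simp: eq)
  have b: "- (\<integral>\<omega>. indicator (ev s j) \<omega> * (X t \<omega> $ j - X s \<omega> $ j) \<partial>P) \<le> K * (t - s)" for j
  proof -
    have fin: "emeasure LP ({s<..t} \<times> space P) = ennreal (t - s)"
      using st by (subst emeasure_pair_measure_Times) (auto simp: emeasure_space_1)
    have "- (\<integral>\<omega>. indicator (ev s j) \<omega> * (X t \<omega> $ j - X s \<omega> $ j) \<partial>P) =
        (\<integral>z. - (indicator {0..t} (fst z) * (indicator ({s<..t} \<times> ev s j) z * drift_rate j z)) \<partial>LP)"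
      using compensator_rect[OF ev_natural[OF st(1) order_refl] st order_refl, of j j] by simp
    also have "\<dots> \<le> (\<integral>z. K * indicator ({s<..t} \<times> space P) z \<partial>LP)"
    proof (rule integral_mono)
      have "(indicator ({s<..t} \<times> ev s j) :: real \<times> 'a \<Rightarrow> real) \<in> borel_measurable (borel \<Otimes>\<^sub>M P)"
        using st by measurable
      then show "integrable LP (\<lambda>z. - (indicator {0..t} (fst z) * (indicator ({s<..t} \<times> ev s j) z * drift_rate j z)))"
        by (intro Bochner_Integration.integrable_minus drift_rate_integrable) (assumption, simp add: indicator_def)
      show "integrable LP (\<lambda>z. K * indicator ({s<..t} \<times> space P) z)"
        using fin by (intro integrable_mult_right integrable_real_indicator) auto
      fix z :: "real \<times> 'a" assume "z \<in> space LP"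
      then have "snd z \<in> space P" by (auto simp: space_pair_measure)
      then show "- (indicator {0..t} (fst z) * (indicator ({s<..t} \<times> ev s j) z * drift_rate j z)) \<le> K * indicator ({s<..t} \<times> space P) z"
        using drift_rate_bound[of z j] K_nonneg by (cases z) (auto simp: indicator_def abs_le_iff)
    qed
    also have "\<dots> = K * (t - s)" using fin st by (simp add: measure_def)
    finally show ?thesis .
  qed
  have "(\<integral>\<omega>. 1 - X s \<omega> \<bullet> X t \<omega> \<partial>P) = (\<integral>\<omega>. (\<Sum>j\<in>UNIV. - (indicator (ev s j) \<omega> * (X t \<omega> $ j - X s \<omega> $ j))) \<partial>P)"
    by (rule Bochner_Integration.integral_cong) (auto simp: eq)
  also have "\<dots> = (\<Sum>j\<in>UNIV. - (\<integral>\<omega>. indicator (ev s j) \<omega> * (X t \<omega> $ j - X s \<omega> $ j) \<partial>P))"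
    using i by (subst Bochner_Integration.integral_sum) auto
  also have "\<dots> \<le> (\<Sum>j\<in>(UNIV::'n set). K * (t - s))" by (intro sum_mono b)
  finally show "(\<integral>\<omega>. 1 - X s \<omega> \<bullet> X t \<omega> \<partial>P) \<le> real CARD('n) * K * (t - s)" by simp
qed

text \<open>The dyadic mismatch counts converge to the number of jumps on every path, and their
  expectations are bounded uniformly in the mesh, so Fatou's lemma applies. The number of jumps will
  be the dominating function in \<open>compensator\<close>.\<close>

lemma integrable_jump_count: "integrable P (\<lambda>\<omega>. real (card (JT (real T) \<omega>)))" for T :: nat
proof -
  \<comment> \<open>\<open>T\<close> is a natural number here, hence a point of every dyadic
    grid.\<close>
  define u where "u n \<omega> = (\<Sum>k<T * 2^n. 1 - X (real k / 2^n) \<omega> \<bullet> X (real (Suc k) / 2^n) \<omega>)" for n \<omega>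
  have u_meas [measurable]: "u n \<in> borel_measurable P" for n
    unfolding u_def by (intro borel_measurable_sum borel_measurable_diff borel_measurable_inner measurable_X) auto
  have u_eq: "u n \<omega> = jump_sum (\<lambda>t. X t \<omega>) (\<lambda>r. - X (dyad n r) \<omega>) 0 (real T)" if "\<omega> \<in> space P" for n \<omega>
    using dyadic_jump_sum[OF step_path_X[OF that], of n "T * 2^n"] by (simp add: u_def)
  have u_nonneg: "0 \<le> u n \<omega>" if "\<omega> \<in> space P" for n \<omega>
    unfolding u_def
  proof (rule sum_nonneg)
    fix k
    have "X (real k / 2^n) \<omega> \<in> range (\<lambda>i. axis i 1)" "X (real (Suc k) / 2^n) \<omega> \<in> range (\<lambda>i. axis i 1)"
      using state_X[OF _ that] by auto
    then show "0 \<le> 1 - X (real k / 2^n) \<omega> \<bullet> X (real (Suc k) / 2^n) \<omega>" by (auto simp: inner_axis_axis)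
  qed
  have lim: "(\<lambda>n. u n \<omega>) \<longlonglongrightarrow> real (card (JT (real T) \<omega>))" if w: "\<omega> \<in> space P" for \<omega>
  proof -
    have "(\<lambda>n. \<Sum>r\<in>JT (real T) \<omega>. - X (dyad n r) \<omega> \<bullet> \<Delta> r \<omega>) \<longlonglongrightarrow> (\<Sum>r\<in>JT (real T) \<omega>. - XL r \<omega> \<bullet> \<Delta> r \<omega>)"
    proof (intro tendsto_sum tendsto_inner tendsto_minus tendsto_const)
      fix r assume "r \<in> JT (real T) \<omega>"
      then have "0 < r" by auto
      then show "(\<lambda>n. X (dyad n r) \<omega>) \<longlonglongrightarrow> XL r \<omega>"
        using dyad_lim(1)[OF step_path_left(3)[OF step_path_X[OF w]]] by (simp add: XL_eq)
    qed
    moreover have "(\<Sum>r\<in>JT (real T) \<omega>. - XL r \<omega> \<bullet> \<Delta> r \<omega>) = (\<Sum>r\<in>JT (real T) \<omega>. 1)"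
      using jump_norm(1)[OF w] by (intro sum.cong) auto
    ultimately show ?thesis by (simp add: u_eq[OF w] jump_sum_def)
  qed
  show ?thesis
  proof (rule integrableI_nonneg)
    show meas: "(\<lambda>\<omega>. real (card (JT (real T) \<omega>))) \<in> borel_measurable P"
      by (rule borel_measurable_LIMSEQ_real[OF lim u_meas])
    have "(\<integral>\<^sup>+\<omega>. ennreal (real (card (JT (real T) \<omega>))) \<partial>P) = (\<integral>\<^sup>+\<omega>. liminf (\<lambda>n. ennreal (u n \<omega>)) \<partial>P)"
      by (intro nn_integral_cong lim_imp_Liminf[symmetric] tendsto_ennrealI lim) auto
    also have "\<dots> \<le> liminf (\<lambda>n. \<integral>\<^sup>+\<omega>. ennreal (u n \<omega>) \<partial>P)"
      by (rule nn_integral_liminf) measurable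
    also have "\<dots> \<le> ennreal (real CARD('n) * K * real T)"
    proof (rule order_trans[OF Liminf_le_Limsup Limsup_bounded], simp, rule always_eventually, rule allI)
      fix n
      have "(\<integral>\<^sup>+\<omega>. ennreal (u n \<omega>) \<partial>P) = ennreal (\<integral>\<omega>. u n \<omega> \<partial>P)"
        using u_nonneg by (intro nn_integral_eq_integral) (auto simp: u_def intro!: Bochner_Integration.integrable_sum expected_mismatch divide_right_mono)
      also have "(\<integral>\<omega>. u n \<omega> \<partial>P) = (\<Sum>k<T * 2^n. \<integral>\<omega>. 1 - X (real k / 2^n) \<omega> \<bullet> X (real (Suc k) / 2^n) \<omega> \<partial>P)"
        unfolding u_def by (intro Bochner_Integration.integral_sum expected_mismatch divide_right_mono) auto
      also have "\<dots> \<le> (\<Sum>k<T * 2^n. real CARD('n) * K * (real (Suc k) / 2^n - real k / 2^n))"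
        by (intro sum_mono expected_mismatch divide_right_mono) auto
      also have "\<dots> = (\<Sum>k<T * 2^n. real CARD('n) * K * (1 / 2^n))"
        by (intro sum.cong refl) (simp add: field_simps)
      also have "\<dots> = real CARD('n) * K * real T" by simp
      finally show "(\<integral>\<^sup>+\<omega>. ennreal (u n \<omega>) \<partial>P) \<le> ennreal (real CARD('n) * K * real T)"
        by (simp add: ennreal_leI)
    qed
    finally show "(\<integral>\<^sup>+\<omega>. ennreal (real (card (JT (real T) \<omega>))) \<partial>P) < \<infinity>"
      by (auto simp: less_top[symmetric] top_unique)
  qed auto
qed

text \<open>A signed count: an entry into \<open>i\<close> at a point of \<open>C\<close>
  contributes 1, an exit from \<open>i\<close> contributes -1.\<close>

definition jcount :: "real \<Rightarrow> 'n \<Rightarrow> (real \<times> 'a) set \<Rightarrow> 'a \<Rightarrow> real" where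
  "jcount T i C \<omega> = (\<Sum>r\<in>JT T \<omega>. indicator C (r, \<omega>) * \<Delta> r \<omega> $ i)"

lemma nat_pred_sets_joint: "C \<in> sets (nat_pred P X) \<Longrightarrow> C \<in> sets (borel \<Otimes>\<^sub>M P)"
proof -
  assume C: "C \<in> sets (nat_pred P X)"
  have sub: "C \<subseteq> {0..} \<times> space P" using sets.sets_into_space[OF C] by (simp add: nat_filt.space_pred)
  have "(\<lambda>x. if fst x \<in> {0..} then indicator C x else 0 :: real) \<in> borel_measurable (borel \<Otimes>\<^sub>M P)"
    using C by (intro nat_pred_joint borel_measurable_indicator)
  moreover have "(\<lambda>x. if fst x \<in> {0..} then indicator C x else 0 :: real) = indicator C"
    using sub by (auto simp: fun_eq_iff indicator_def)
  ultimately have "C \<inter> space (borel \<Otimes>\<^sub>M P) \<in> sets (borel \<Otimes>\<^sub>M P)"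
    by (simp add: borel_measurable_indicator_iff)
  moreover have "C \<inter> space (borel \<Otimes>\<^sub>M P) = C" using sub by (auto simp: space_pair_measure)
  ultimately show ?thesis by simp
qed

lemma jcount_measurable:
  assumes "C \<in> sets (borel \<Otimes>\<^sub>M P)" "0 \<le> T" shows "jcount T i C \<in> borel_measurable P"
  unfolding jcount_def
  by (rule jump_sum_measurable_set[OF step_path_X order_refl assms(2) measurable_X assms(1)])

lemma jcount_abs_le:
  assumes "\<omega> \<in> space P" "T \<le> real T'" "\<And>r. \<bar>f r\<bar> \<le> 1"
  shows "\<bar>\<Sum>r\<in>JT T \<omega>. f r * \<Delta> r \<omega> $ i\<bar> \<le> real (card (JT (real T') \<omega>))"
proof -
  have "\<bar>\<Sum>r\<in>JT T \<omega>. f r * \<Delta> r \<omega> $ i\<bar> \<le> (\<Sum>r\<in>JT T \<omega>. \<bar>f r\<bar> * \<bar>\<Delta> r \<omega> $ i\<bar>)"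
    by (rule order_trans[OF sum_abs]) (simp add: abs_mult)
  also have "\<dots> \<le> (\<Sum>r\<in>JT T \<omega>. 1 * 1)"
    using jump_norm(2)[OF assms(1)] assms(3) by (intro sum_mono mult_mono) auto
  also have "\<dots> \<le> real (card (JT (real T') \<omega>))"
    using assms(2) finite_jumps[OF step_path_X[OF assms(1)] order_refl] by (auto intro!: card_mono)
  finally show ?thesis .
qed

lemma jcount_rect:
  assumes "0 \<le> s" "\<omega> \<in> space P" "0 \<le> T"
  shows "jcount T i ({s<..t} \<times> B) \<omega> = indicator B \<omega> * (X (max (min s T) (min t T)) \<omega> $ i - X (min s T) \<omega> $ i)"
proof -
  let ?a = "min s T" and ?b = "max (min s T) (min t T)"
  have "jcount T i ({s<..t} \<times> B) \<omega> = (\<Sum>r\<in>jumps (\<lambda>t. X t \<omega>) \<inter> {?a<..?b}. indicator B \<omega> * \<Delta> r \<omega> $ i)"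
    unfolding jcount_def using finite_jumps[OF step_path_X[OF assms(2)], of 0 T] assms
    by (intro sum.mono_neutral_cong_right) (auto simp: indicator_def min_def max_def split: if_splits)
  also have "\<dots> = indicator B \<omega> * (X ?b \<omega> $ i - X ?a \<omega> $ i)"
    unfolding sum_distrib_left[symmetric] using assms
    by (subst jump_total[OF step_path_X[OF assms(2)]]) auto
  finally show ?thesis .
qed

text \<open>Both sides are finite signed measures in \<open>C\<close>, so that it is enough to compare them on the
  generating rectangles.\<close>

theorem compensator:
  assumes C: "C \<in> sets (nat_pred P X)" and T: "0 \<le> T"
  shows "integrable P (jcount T i C) \<and>
    (\<integral>\<omega>. jcount T i C \<omega> \<partial>P) = (\<integral>z. indicator {0..T} (fst z) * (indicator C z * drift_rate i z) \<partial>LP)"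
proof -
  let ?G = "{{0} \<times> B | B. B \<in> sets (natural_filtration P X 0)} \<union> {{s<..t} \<times> B | s t B. 0 \<le> s \<and> s \<le> t \<and> B \<in> sets (natural_filtration P X s)}"
  let ?N = "\<lambda>\<omega>. real (card (JT (real (nat \<lceil>T\<rceil>)) \<omega>))"
  let ?R = "\<lambda>C. \<integral>z. indicator {0..T} (fst z) * (indicator C z * drift_rate i z) \<partial>LP"
  have T': "T \<le> real (nat \<lceil>T\<rceil>)" by linarith
  have int: "integrable P (jcount T i C)" if "C \<in> sets (borel \<Otimes>\<^sub>M P)" for C
  proof (rule Bochner_Integration.integrable_bound[OF integrable_jump_count[of "nat \<lceil>T\<rceil>"] jcount_measurable[OF that T]])
    show "AE \<omega> in P. norm (jcount T i C \<omega>) \<le> norm (?N \<omega>)"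
      unfolding jcount_def using jcount_abs_le[OF _ T'] by (intro AE_I2) (simp add: indicator_def)
  qed
  have intR: "integrable LP (\<lambda>z. indicator {0..T} (fst z) * (indicator C z * drift_rate i z))" if "C \<in> sets (borel \<Otimes>\<^sub>M P)" for C
    using that by (intro drift_rate_integrable) (auto simp: indicator_def)
  have rect: "(\<integral>\<omega>. jcount T i ({s<..t} \<times> B) \<omega> \<partial>P) = ?R ({s<..t} \<times> B)" if B: "0 \<le> s" "B \<in> sets (natural_filtration P X s)" for s t B
  proof (cases "s < min t T")
    case True
    have "(\<integral>\<omega>. jcount T i ({s<..t} \<times> B) \<omega> \<partial>P) = (\<integral>\<omega>. indicator B \<omega> * (X (min t T) \<omega> $ i - X s \<omega> $ i) \<partial>P)"
      using True B T by (intro Bochner_Integration.integral_cong) (auto simp: jcount_rect)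
    also have "\<dots> = (\<integral>z. indicator {0..T} (fst z) * (indicator ({s<..min t T} \<times> B) z * drift_rate i z) \<partial>LP)"
      using True B by (intro compensator_rect) auto
    also have "\<dots> = ?R ({s<..t} \<times> B)"
      by (intro Bochner_Integration.integral_cong) (auto simp: indicator_def)
    finally show ?thesis .
  next
    case False
    have "(\<integral>\<omega>. jcount T i ({s<..t} \<times> B) \<omega> \<partial>P) = (\<integral>\<omega>. 0 \<partial>P)"
      using False B T by (intro Bochner_Integration.integral_cong) (auto simp: jcount_rect max_def min_def)
    moreover have z: "indicator {0..T} (fst z) * (indicator ({s<..t} \<times> B) z * drift_rate i z) = 0" for z
      using False by (auto simp: indicator_def)
    have "?R ({s<..t} \<times> B) = 0" unfolding z by simp
    ultimately show ?thesis by simp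
  qed
  have zero_slice: "AE z in LP. fst z \<noteq> (c::real)" for c
  proof (rule LP.AE_pair_measure)
    show "{x \<in> space LP. fst x \<noteq> c} \<in> sets LP" by measurable
    show "AE x in lborel. AE y in P. fst (x, y) \<noteq> c" using AE_lborel_singleton[of c] by auto
  qed
  have GP: "?G \<subseteq> sets (nat_pred P X)"
    by (auto intro: nat_filt.pred_zero nat_filt.pred_rect)
  have sigP: "sigma_sets ({0..} \<times> space P) ?G \<subseteq> sets (borel \<Otimes>\<^sub>M P)"
    using nat_pred_sets_joint unfolding nat_filt.sets_pred by blast
  have stable: "Int_stable ?G"
  proof (rule Int_stableI)
    fix a b assume ab: "a \<in> ?G" "b \<in> ?G"
    have G0: "{0} \<times> B \<in> ?G" if "B \<in> sets (natural_filtration P X 0)" for B using that by blast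
    have G1: "{s<..t} \<times> B \<in> ?G" if "0 \<le> s" "s \<le> t" "B \<in> sets (natural_filtration P X s)" for s t B using that by blast
    have G_empty: "{} \<in> ?G" using G0[of "{}"] by simp
    from ab(1) consider B where "a = {0} \<times> B" "B \<in> sets (natural_filtration P X 0)" |
      s t B where "a = {s<..t} \<times> B" "0 \<le> s" "B \<in> sets (natural_filtration P X s)" by blast
    then show "a \<inter> b \<in> ?G"
    proof cases
      case a: 1
      from ab(2) consider B where "b = {0} \<times> B" "B \<in> sets (natural_filtration P X 0)" |
        s t B where "b = {s<..t} \<times> B" "0 \<le> s" "B \<in> sets (natural_filtration P X s)" by blast
      then show ?thesis
      proof cases
        case b: (1 B')
        have "a \<inter> b = {0} \<times> (B \<inter> B')" unfolding a b by auto
        then show ?thesis using G0[OF sets.Int[OF a(2) b(2)]] by simp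
      next
        case b: 2
        have "a \<inter> b = {}" unfolding a b using b(2) by auto
        then show ?thesis using G_empty by simp
      qed
    next
      case a: 2
      from ab(2) consider B where "b = {0} \<times> B" "B \<in> sets (natural_filtration P X 0)" |
        s t B where "b = {s<..t} \<times> B" "0 \<le> s" "B \<in> sets (natural_filtration P X s)" by blast
      then show ?thesis
      proof cases
        case b: 1
        have "a \<inter> b = {}" unfolding a b using a(2) by auto
        then show ?thesis using G_empty by simp
      next
        case b: (2 s' t' B')
        have eq: "a \<inter> b = {max s s'<..max (max s s') (min t t')} \<times> (B \<inter> B')" unfolding a b by (auto simp: max_def)
        have "B \<inter> B' \<in> sets (natural_filtration P X (max s s'))"
          using a(3) b(3) natural_mono[of s "max s s'" P X] natural_mono[of s' "max s s'" P X] by (intro sets.Int) auto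
        then show ?thesis unfolding eq using a(2) by (intro G1) auto
      qed
    qed
  qed
  \<comment> \<open>The complement step needs the total mass. \<open>{0..}\<close> and
    \<open>{0<..T}\<close> give the same values, because only jumps in \<open>{0<..T}\<close> are
    counted and the slice at 0 is null.\<close>
  have total: "(\<integral>\<omega>. jcount T i ({0..} \<times> space P) \<omega> \<partial>P) = ?R ({0..} \<times> space P)"
  proof -
    have "space P \<in> sets (natural_filtration P X 0)" using sets.top[of "natural_filtration P X 0"] by simp
    from rect[OF order_refl this, of T] have "(\<integral>\<omega>. jcount T i ({0<..T} \<times> space P) \<omega> \<partial>P) = ?R ({0<..T} \<times> space P)" .
    moreover have "(\<integral>\<omega>. jcount T i ({0<..T} \<times> space P) \<omega> \<partial>P) = (\<integral>\<omega>. jcount T i ({0..} \<times> space P) \<omega> \<partial>P)"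
      by (intro Bochner_Integration.integral_cong) (auto simp: jcount_def indicator_def intro!: sum.cong)
    moreover have "?R ({0<..T} \<times> space P) = ?R ({0..} \<times> space P)"
    proof (rule integral_cong_AE)
      show "AE z in LP. indicat_real {0..T} (fst z) * (indicator ({0<..T} \<times> space P) z * drift_rate i z) = indicat_real {0..T} (fst z) * (indicator ({0..} \<times> space P) z * drift_rate i z)"
        using zero_slice[of 0] by eventually_elim (auto simp: indicator_def)
    qed measurable
    ultimately show ?thesis by simp
  qed
  have "(\<integral>\<omega>. jcount T i C \<omega> \<partial>P) = ?R C"
    using stable nat_filt.pred_gen C unfolding nat_filt.sets_pred
  proof (induction rule: sigma_sets_induct_disjoint)
    case (basic C)
    then consider B where "C = {0} \<times> B" "B \<in> sets (natural_filtration P X 0)" |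
      s t B where "C = {s<..t} \<times> B" "0 \<le> s" "B \<in> sets (natural_filtration P X s)" by blast
    then show ?case
    proof cases
      case 1
      have "(\<integral>\<omega>. jcount T i C \<omega> \<partial>P) = (\<integral>\<omega>. 0 \<partial>P)"
        unfolding 1 by (intro Bochner_Integration.integral_cong) (auto simp: jcount_def indicator_def intro!: sum.neutral)
      moreover have "?R C = 0"
      proof (rule integral_eq_zero_AE)
        show "AE z in LP. indicat_real {0..T} (fst z) * (indicator C z * drift_rate i z) = 0"
          using zero_slice[of 0] by eventually_elim (auto simp: 1 indicator_def)
      qed
      ultimately show ?thesis by simp
    next
      case 2
      then show ?thesis using rect by simp
    qed
  next
    case empty
    show ?case by (simp add: jcount_def)
  next
    case (compl C)
    have C: "C \<in> sets (borel \<Otimes>\<^sub>M P)" using compl(1) sigP by blast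
    have sub: "C \<subseteq> {0..} \<times> space P" using sigma_sets_into_sp[OF nat_filt.pred_gen compl(1)] .
    have tot: "{0::real..} \<times> space P \<in> sets (borel \<Otimes>\<^sub>M P)" by (intro pair_measureI) auto
    have ind: "indicator ({0..} \<times> space P - C) z = indicator ({0..} \<times> space P) z - (indicator C z :: real)" for z
      using sub by (auto simp: indicator_def)
    have "(\<integral>\<omega>. jcount T i ({0..} \<times> space P - C) \<omega> \<partial>P) = (\<integral>\<omega>. jcount T i ({0..} \<times> space P) \<omega> - jcount T i C \<omega> \<partial>P)"
      by (simp add: jcount_def ind left_diff_distrib sum_subtractf)
    also have "\<dots> = ?R ({0..} \<times> space P) - ?R C"
      using int[OF C] int[OF tot] total compl(2) by simp
    also have "\<dots> = ?R ({0..} \<times> space P - C)"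
      using intR[OF C] intR[OF tot] by (simp add: ind left_diff_distrib right_diff_distrib)
    finally show ?case .
  next
    case (union C)
    have C: "C n \<in> sets (borel \<Otimes>\<^sub>M P)" for n using union(2) sigP by blast
    then have UC: "\<Union>(range C) \<in> sets (borel \<Otimes>\<^sub>M P)" by auto
    \<comment> \<open>For disjoint sets a partial sum of indicators is itself an indicator, so the
      number of jumps dominates all partial sums.\<close>
    have part: "(\<Sum>k<n. indicator (C k) z) = (indicator (\<Union>k<n. C k) z :: real)" for n z
      using union(1) by (intro indicator_UN_disjoint[symmetric]) (auto simp: disjoint_family_on_def)
    have lims: "(\<lambda>n. \<Sum>k<n. indicator (C k) z) \<longlonglongrightarrow> (indicator (\<Union>(range C)) z :: real)" for z
      using indicator_sums[of C z] union(1) by (auto simp: sums_def disjoint_family_on_def)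
    have j: "(\<Sum>k<n. jcount T i (C k) \<omega>) = (\<Sum>r\<in>JT T \<omega>. (\<Sum>k<n. indicator (C k) (r, \<omega>)) * \<Delta> r \<omega> $ i)" for n \<omega>
      unfolding jcount_def by (subst sum.swap) (simp add: sum_distrib_right)
    have "(\<lambda>n. \<integral>\<omega>. (\<Sum>k<n. jcount T i (C k) \<omega>) \<partial>P) \<longlonglongrightarrow> (\<integral>\<omega>. jcount T i (\<Union>(range C)) \<omega> \<partial>P)"
    proof (rule integral_dominated_convergence[OF _ _ integrable_jump_count[of "nat \<lceil>T\<rceil>"]])
      show "AE \<omega> in P. (\<lambda>n. \<Sum>k<n. jcount T i (C k) \<omega>) \<longlonglongrightarrow> jcount T i (\<Union>(range C)) \<omega>"
        unfolding j unfolding jcount_def by (intro AE_I2 tendsto_sum tendsto_mult tendsto_const lims)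
      show "AE \<omega> in P. norm (\<Sum>k<n. jcount T i (C k) \<omega>) \<le> ?N \<omega>" for n
        unfolding j part real_norm_def by (intro AE_I2 jcount_abs_le T') (auto simp: indicator_def)
    qed (use int[OF C] int[OF UC] in auto)
    then have l1: "(\<lambda>n. \<Sum>k<n. \<integral>\<omega>. jcount T i (C k) \<omega> \<partial>P) \<longlonglongrightarrow> (\<integral>\<omega>. jcount T i (\<Union>(range C)) \<omega> \<partial>P)"
      using int[OF C] by simp
    have "(\<lambda>n. \<integral>z. (\<Sum>k<n. indicator {0..T} (fst z) * (indicator (C k) z * drift_rate i z)) \<partial>LP) \<longlonglongrightarrow> ?R (\<Union>(range C))"
    proof (rule integral_dominated_convergence[OF _ _ integrable_abs[OF drift_rate_integrable[of "\<lambda>_. 1" T i]]])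
      have e: "(\<Sum>k<n. indicator {0..T} (fst z) * (indicator (C k) z * drift_rate i z)) = indicator {0..T} (fst z) * ((\<Sum>k<n. indicator (C k) z) * drift_rate i z)" for n z
      proof -
        have "(\<Sum>k<n. a * (c k * d)) = a * ((\<Sum>k<n. c k) * d)" for a d :: real and c
          by (simp add: sum_distrib_left sum_distrib_right)
        then show ?thesis .
      qed
      show "AE z in LP. (\<lambda>n. \<Sum>k<n. indicator {0..T} (fst z) * (indicator (C k) z * drift_rate i z)) \<longlonglongrightarrow> indicator {0..T} (fst z) * (indicator (\<Union>(range C)) z * drift_rate i z)"
        unfolding e by (intro AE_I2 tendsto_mult tendsto_const lims)
      show "AE z in LP. norm (\<Sum>k<n. indicator {0..T} (fst z) * (indicator (C k) z * drift_rate i z)) \<le> \<bar>indicat_real {0..T} (fst z) * (1 * drift_rate i z)\<bar>" for n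
        unfolding e part by (intro AE_I2) (auto simp: indicator_def)
      show "(\<lambda>z. indicator {0..T} (fst z) * (indicator (\<Union>(range C)) z * drift_rate i z)) \<in> borel_measurable LP"
        by (rule borel_measurable_integrable[OF intR[OF UC]])
      show "(\<lambda>z. \<Sum>k<n. indicator {0..T} (fst z) * (indicator (C k) z * drift_rate i z)) \<in> borel_measurable LP" for n
        by (intro borel_measurable_sum borel_measurable_integrable[OF intR[OF C]])
    qed simp_all
    moreover have "(\<integral>z. (\<Sum>k<n. indicator {0..T} (fst z) * (indicator (C k) z * drift_rate i z)) \<partial>LP) = (\<Sum>k<n. ?R (C k))" for n
      by (rule Bochner_Integration.integral_sum) (rule intR[OF C])
    ultimately have l2: "(\<lambda>n. \<Sum>k<n. ?R (C k)) \<longlonglongrightarrow> ?R (\<Union>(range C))"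
      by (simp only:)
    show ?case using LIMSEQ_unique[OF l1[unfolded union(3)] l2] .
  qed
  then show ?thesis by (rule conjI[OF int[OF nat_pred_sets_joint[OF C]]])
qed

lemma XL_eq_set: "{z \<in> space (nat_pred P X). 0 < fst z \<and> XL (fst z) (snd z) = axis j 1} \<in> sets (nat_pred P X)"
proof -
  have [measurable]: "(\<lambda>z. XL (fst z) (snd z)) \<in> borel_measurable (nat_pred P X)" "fst \<in> borel_measurable (nat_pred P X)"
    using XL_nat_pred nat_filt.pred_measurable_time[of P X] by (simp_all add: case_prod_unfold)
  show ?thesis by measurable
qed

lemma AE_LP_0: "AE z in LP. fst z \<noteq> (c::real)"
proof (rule LP.AE_pair_measure)
  show "{x \<in> space LP. fst x \<noteq> c} \<in> sets LP" by measurable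
  show "AE x in lborel. AE y in P. fst (x, y) \<noteq> c" using AE_lborel_singleton[of c] by auto
qed

text \<open>On \<open>C\<close> the left limit is the state \<open>j\<close>, so
  \<open>jcount\<close> counts only jumps from \<open>j\<close> to \<open>i\<close>. If there are
  none, the compensator has integral zero; its density is the nonnegative rate from \<open>j\<close>
  to \<open>i\<close> and vanishes almost everywhere.\<close>

lemma compensator_null:
  assumes D: "D \<in> sets (nat_pred P X)" and ij: "i \<noteq> j" and T: "0 \<le> T"
    and no: "AE \<omega> in P. \<forall>r\<in>JT T \<omega>. (r, \<omega>) \<in> D \<longrightarrow> XL r \<omega> = axis j 1 \<longrightarrow> X r \<omega> \<noteq> axis i 1"
  shows "AE z in LP. 0 < fst z \<longrightarrow> fst z \<le> T \<longrightarrow> z \<in> D \<longrightarrow> XL (fst z) (snd z) = axis j 1 \<longrightarrow> A (fst z) $ i $ j = 0"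
proof -
  define C where "C = D \<inter> {z \<in> space (nat_pred P X). 0 < fst z \<and> XL (fst z) (snd z) = axis j 1}"
  have C: "C \<in> sets (nat_pred P X)" unfolding C_def using D XL_eq_set by auto
  have CP: "C \<in> sets (borel \<Otimes>\<^sub>M P)" using C by (rule nat_pred_sets_joint)
  have "AE \<omega> in P. jcount T i C \<omega> = 0"
    using no AE_space
  proof eventually_elim
    case (elim \<omega>)
    show ?case
      unfolding jcount_def
    proof (intro sum.neutral ballI)
      fix r assume r: "r \<in> JT T \<omega>"
      show "indicator C (r, \<omega>) * \<Delta> r \<omega> $ i = 0"
      proof (cases "(r, \<omega>) \<in> C")
        case True
        then have *: "(r, \<omega>) \<in> D" "0 < r" "XL r \<omega> = axis j 1" by (auto simp: C_def)
        obtain k where k: "X r \<omega> = axis k 1" using state_X[of r \<omega>] *(2) elim(2) by auto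
        have "k \<noteq> i" using elim(1) r * k by auto
        then show ?thesis using k * ij by (simp add: XL_eq axis_def)
      qed simp
    qed
  qed
  then have "(\<integral>\<omega>. jcount T i C \<omega> \<partial>P) = 0"
    by (rule integral_eq_zero_AE)
  then have "(\<integral>z. indicator {0..T} (fst z) * (indicator C z * drift_rate i z) \<partial>LP) = 0"
    using compensator[OF C T, of i] by simp
  moreover have eq: "indicator C z * drift_rate i z = indicator C z * A (fst z) $ i $ j" for z
    using drift_rate_eq_rate[of "fst z" "snd z" j i] by (auto simp: C_def indicator_def rate_def)
  moreover have "0 \<le> indicator {0..T} (fst z) * (indicator C z * drift_rate i z)" for z
    unfolding eq using nonneg_A[of "fst z" i j] ij by (auto simp: C_def indicator_def)
  moreover have "integrable LP (\<lambda>z. indicator {0..T} (fst z) * (indicator C z * drift_rate i z))"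
    using CP by (intro drift_rate_integrable borel_measurable_indicator) (simp_all add: indicator_def)
  ultimately have "AE z in LP. indicator {0..T} (fst z) * (indicator C z * drift_rate i z) = 0"
    by (simp only: integral_nonneg_eq_0_iff_AE AE_I2)
  then have "AE z in LP. indicator {0..T} (fst z) * (indicator C z * A (fst z) $ i $ j) = 0"
    unfolding eq .
  then show ?thesis
    using AE_space
  proof eventually_elim
    case (elim z)
    then show ?case by (cases z) (auto simp: C_def nat_filt.space_pred space_pair_measure)
  qed
qed

text \<open>The slice of all points with time \<open>t\<close> is predictable and null for dt
  \<times> dP, so the expected number of jumps from \<open>j\<close> to \<open>i\<close> at the
  fixed time \<open>t\<close> is zero.\<close>

lemma no_fixed_jump:
  assumes t: "0 < t" shows "AE \<omega> in P. XL t \<omega> = X t \<omega>"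
proof -
  have ij: "AE \<omega> in P. \<not> (XL t \<omega> = axis j 1 \<and> X t \<omega> = axis i 1)" if ij: "i \<noteq> j" for i j
  proof -
    define C where "C = {z \<in> space (nat_pred P X). 0 < fst z \<and> XL (fst z) (snd z) = axis j 1} \<inter> {z \<in> space (nat_pred P X). fst z = t}"
    have [measurable]: "fst \<in> borel_measurable (nat_pred P X)" by (rule nat_filt.pred_measurable_time)
    have C: "C \<in> sets (nat_pred P X)" unfolding C_def by (intro sets.Int XL_eq_set) measurable
    have "AE z in LP. indicator {0..t} (fst z) * (indicator C z * drift_rate i z) = 0"
      using AE_LP_0[of t] by eventually_elim (auto simp: C_def)
    then have "(\<integral>z. indicator {0..t} (fst z) * (indicator C z * drift_rate i z) \<partial>LP) = 0"
      by (rule integral_eq_zero_AE)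
    then have zero: "(\<integral>\<omega>. jcount t i C \<omega> \<partial>P) = 0" "integrable P (jcount t i C)"
      using compensator[OF C, of t i] t by auto
    have eq: "jcount t i C \<omega> = (if XL t \<omega> = axis j 1 \<and> X t \<omega> = axis i 1 then 1 else 0)" if w: "\<omega> \<in> space P" for \<omega>
    proof -
      have "jcount t i C \<omega> = (\<Sum>r\<in>JT t \<omega> \<inter> {t}. indicator C (r, \<omega>) * \<Delta> r \<omega> $ i)"
        unfolding jcount_def using finite_jumps[OF step_path_X[OF w] order_refl]
        by (intro sum.mono_neutral_right) (auto simp: C_def)
      also have "\<dots> = (if t \<in> jumps (\<lambda>t. X t \<omega>) then indicator C (t, \<omega>) * \<Delta> t \<omega> $ i else 0)"
      proof -
        have "JT t \<omega> \<inter> {t} = (if t \<in> jumps (\<lambda>t. X t \<omega>) then {t} else {})" using t by auto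
        moreover have "sum f (if b then {t} else {}) = (if b then f t else 0)" for f :: "real \<Rightarrow> real" and b by simp
        ultimately show ?thesis by (simp only:)
      qed
      also have "\<dots> = (if XL t \<omega> = axis j 1 \<and> X t \<omega> = axis i 1 then 1 else 0)"
      proof -
        obtain k where k: "X t \<omega> = axis k 1" using state_X[of t \<omega>] t w by auto
        show ?thesis using t w ij k
          by (auto simp: C_def nat_filt.space_pred jumps_def XL_eq indicator_def) (auto simp: axis_def axis_eq_axis vec_eq_iff split: if_splits)
      qed
      finally show ?thesis .
    qed
    have "AE \<omega> in P. jcount t i C \<omega> = 0"
      using zero by (subst (asm) integral_nonneg_eq_0_iff_AE) (auto simp: eq)
    then show ?thesis using AE_space by eventually_elim (auto simp: eq split: if_splits)
  qed
  have "AE \<omega> in P. \<forall>i\<in>UNIV. \<forall>j\<in>UNIV. i \<noteq> j \<longrightarrow> \<not> (XL t \<omega> = axis j 1 \<and> X t \<omega> = axis i 1)"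
    using ij by (intro AE_finite_allI) auto
  then show ?thesis
    using AE_space
  proof eventually_elim
    case (elim \<omega>)
    obtain k where k: "X t \<omega> = axis k 1" using state_X[of t \<omega>] t elim by auto
    obtain j where j: "XL t \<omega> = axis j 1" using XL_state[OF t elim(2)] by blast
    show ?case using elim(1) k j by (metis UNIV_I)
  qed
qed

end

section \<open>A Borel version of the driver\<close>

lemma sigma_finite_restrict_lborel: "A \<in> sets borel \<Longrightarrow> sigma_finite_measure (restrict_space lborel A)"
  by (rule sigma_finite_measure_restrict_space) (auto intro: sigma_finite_lborel)

context prob_space
begin

lemma dt_dP_pair: "pair_sigma_finite (restrict_space lborel {0<..S::real}) M"
  by (intro pair_sigma_finite.intro sigma_finite_restrict_lborel sigma_finite_measure_axioms) auto

text \<open>\<open>Q\<close> need not be measurable, so Fubini is applied to a measurable null set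
  that contains the exceptional points.\<close>

lemma AE_dt_dP_sections:
  assumes "AE (t, \<omega>) in dt_dP M S. Q t \<omega>"
  shows "AE t in lborel. 0 < t \<longrightarrow> t \<le> S \<longrightarrow> (AE \<omega> in M. Q t \<omega>)"
    "AE \<omega> in M. AE t in lborel. 0 < t \<longrightarrow> t \<le> S \<longrightarrow> Q t \<omega>"
proof -
  interpret D: pair_sigma_finite "restrict_space lborel {0<..S}" M by (rule dt_dP_pair)
  have "AE t in restrict_space lborel {0<..S}. AE \<omega> in M. Q t \<omega>"
    using D.AE_pair[OF assms[unfolded dt_dP_def]] by simp
  then show "AE t in lborel. 0 < t \<longrightarrow> t \<le> S \<longrightarrow> (AE \<omega> in M. Q t \<omega>)"
    by (simp add: AE_restrict_space_iff imp_conjL)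
  obtain N where N: "{x \<in> space (dt_dP M S). \<not> (case x of (t, \<omega>) \<Rightarrow> Q t \<omega>)} \<subseteq> N" "emeasure (dt_dP M S) N = 0" "N \<in> sets (dt_dP M S)"
    using AE_E[OF assms] by auto
  have "AE x in dt_dP M S. x \<notin> N" using N(2,3) by (intro AE_not_in) auto
  from D.AE_pair[OF this[unfolded dt_dP_def]]
  have "AE t in restrict_space lborel {0<..S}. AE \<omega> in M. (t, \<omega>) \<notin> N" .
  moreover have "{x \<in> space (restrict_space lborel {0<..S} \<Otimes>\<^sub>M M). (fst x, snd x) \<notin> N} \<in> sets (restrict_space lborel {0<..S} \<Otimes>\<^sub>M M)"
    using N(3) unfolding dt_dP_def by simp
  ultimately have "AE \<omega> in M. AE t in restrict_space lborel {0<..S}. (t, \<omega>) \<notin> N"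
    by (subst (asm) D.AE_commute)
  then have "AE \<omega> in M. AE t in lborel. 0 < t \<longrightarrow> t \<le> S \<longrightarrow> (t, \<omega>) \<notin> N"
    by (simp add: AE_restrict_space_iff imp_conjL)
  then show "AE \<omega> in M. AE t in lborel. 0 < t \<longrightarrow> t \<le> S \<longrightarrow> Q t \<omega>"
    using AE_space
  proof eventually_elim
    case (elim \<omega>)
    from elim(1) show ?case
    proof eventually_elim
      case (elim t)
      show ?case
      proof (intro impI)
        assume t: "0 < t" "t \<le> S"
        then have "(t, \<omega>) \<in> space (dt_dP M S)" using \<open>\<omega> \<in> space M\<close>
          by (simp add: dt_dP_def space_pair_measure space_restrict_space)
        then show "Q t \<omega>" using N(1) elim t by auto
      qed
    qed
  qed
qed

lemma AE_dt_dP_I: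
  assumes Q: "{z \<in> space (borel \<Otimes>\<^sub>M M). Q (fst z) (snd z)} \<in> sets (borel \<Otimes>\<^sub>M M)"
    and ae: "AE z in lborel \<Otimes>\<^sub>M M. 0 < fst z \<longrightarrow> fst z \<le> S \<longrightarrow> Q (fst z) (snd z)"
  shows "AE (t, \<omega>) in dt_dP M S. Q t \<omega>"
proof -
  interpret D: pair_sigma_finite "restrict_space lborel {0<..S}" M by (rule dt_dP_pair)
  interpret L: pair_sigma_finite lborel M ..
  have id: "(\<lambda>x. (fst x, snd x)) \<in> measurable (restrict_space lborel {0<..S} \<Otimes>\<^sub>M M) (borel \<Otimes>\<^sub>M M)"
    by (intro measurable_Pair measurable_snd measurable_compose[OF measurable_fst] measurable_restrict_space1) auto
  have "{x \<in> space (restrict_space lborel {0<..S} \<Otimes>\<^sub>M M). Q (fst x) (snd x)} \<in> sets (restrict_space lborel {0<..S} \<Otimes>\<^sub>M M)"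
  proof -
    have "{x \<in> space (restrict_space lborel {0<..S} \<Otimes>\<^sub>M M). Q (fst x) (snd x)} =
      (\<lambda>x. (fst x, snd x)) -` {z \<in> space (borel \<Otimes>\<^sub>M M). Q (fst z) (snd z)} \<inter> space (restrict_space lborel {0<..S} \<Otimes>\<^sub>M M)"
      by (auto simp: space_pair_measure space_restrict_space)
    then show ?thesis using measurable_sets[OF id Q] by simp
  qed
  then have "AE x in restrict_space lborel {0<..S} \<Otimes>\<^sub>M M. Q (fst x) (snd x)"
  proof (rule D.AE_pair_measure)
    have "AE t in lborel. AE \<omega> in M. 0 < t \<longrightarrow> t \<le> S \<longrightarrow> Q t \<omega>"
      using L.AE_pair[OF ae] by simp
    then show "AE x in restrict_space lborel {0<..S}. AE y in M. Q (fst (x, y)) (snd (x, y))"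
      by (simp add: AE_restrict_space_iff imp_conjL)
  qed
  then show ?thesis unfolding dt_dP_def by (simp add: case_prod_beta)
qed

end

lemma pred_progressive:
  assumes "(\<lambda>(t, \<omega>). W t \<omega>) \<in> borel_measurable (predictable_sigma P X)"
  shows "progressive P X W"
  unfolding progressive_def
proof (intro allI impI)
  fix S :: real assume "0 \<le> S"
  let ?F = "completed_filtration P X S"
  have "(\<lambda>x. if fst x \<in> {0..S} then (\<lambda>(t, \<omega>). W t \<omega>) x else 0) \<in> borel_measurable (borel \<Otimes>\<^sub>M ?F)"
  proof (rule comp_filt.pred_measurable_prod[OF assms[unfolded predictable_sigma_eq]])
    fix s t :: real assume "s \<le> t" "t \<in> {0..S}"
    then show "sets (completed_filtration P X s) \<subseteq> sets ?F" by (intro completed_mono) auto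
  qed auto
  moreover have "(\<lambda>x. (fst x, snd x)) \<in> measurable (restrict_space borel {0..S} \<Otimes>\<^sub>M ?F) (borel \<Otimes>\<^sub>M ?F)"
    by (intro measurable_Pair measurable_snd measurable_compose[OF measurable_fst] measurable_restrict_space1) auto
  ultimately have "(\<lambda>x. if fst (fst x, snd x) \<in> {0..S} then (\<lambda>(t, \<omega>). W t \<omega>) (fst x, snd x) else 0) \<in> borel_measurable (restrict_space borel {0..S} \<Otimes>\<^sub>M ?F)"
    by (rule measurable_compose[rotated])
  then show "(\<lambda>(t, \<omega>). W t \<omega>) \<in> borel_measurable (restrict_space borel {0..S} \<Otimes>\<^sub>M ?F)"
    by (rule measurable_cong[THEN iffD1, rotated]) (auto simp: space_pair_measure space_restrict_space)
qed

lemma progressive_section: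
  assumes "progressive P X W" "0 \<le> T" "\<omega> \<in> space P"
  shows "(\<lambda>t. if 0 \<le> t \<and> t \<le> T then W t \<omega> else 0) \<in> borel_measurable borel"
proof -
  have W: "(\<lambda>(t, \<omega>). W t \<omega>) \<in> borel_measurable (restrict_space borel {0..T} \<Otimes>\<^sub>M completed_filtration P X T)"
    using assms by (simp add: progressive_def)
  have "(\<lambda>t. (t, \<omega>)) \<in> measurable (restrict_space borel {0..T}) (restrict_space borel {0..T} \<Otimes>\<^sub>M completed_filtration P X T)"
    using assms(3) by (intro measurable_Pair) auto
  from measurable_compose[OF this W] have "(\<lambda>t. W t \<omega>) \<in> borel_measurable (restrict_space borel {t. 0 \<le> t \<and> t \<le> T})"
    by (simp add: atLeastAtMost_def Int_def atLeast_def atMost_def)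
  then show ?thesis by (subst measurable_If_restrict_space_iff) auto
qed

context markov_chain
begin

lemma completed_sub: "sets (completed_filtration P X t) \<subseteq> sets (completion P)"
proof -
  have "sets (natural_filtration P X t) \<union> null_sets (completion P) \<subseteq> sets (completion P)"
    using natural_sub[of t] by auto
  then show ?thesis unfolding sets_completed using sets.sigma_sets_subset[of _ "completion P"] by simp
qed

end

locale markov_bsde = markov_chain P X A
  for P :: "'a measure" and X :: "real \<Rightarrow> 'a \<Rightarrow> real^'n" and A +
  fixes f :: "'a \<Rightarrow> real \<Rightarrow> real \<Rightarrow> real^'n \<Rightarrow> real"
    and ft :: "real^'n \<Rightarrow> real \<Rightarrow> real \<Rightarrow> real^'n \<Rightarrow> real"
    and T :: real
  assumes positive: "\<And>t i. 0 < t \<Longrightarrow> \<P>(\<omega> in P. X t \<omega> = axis i 1) > 0"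
    and T_pos: "0 < T"
    and progressive_f: "progressive_driver P X f"
    and invariant: "respects_M_equiv P X A f T"
    and well_posed: "\<And>S \<xi>. 0 < S \<Longrightarrow> S \<le> T \<Longrightarrow> square_integrable_data P X S \<xi> \<Longrightarrow>
                       bsde_uniquely_solvable P X A f S \<xi>"
    and markovian: "markovian_driver P X f T ft"
begin

lemma ev_pos: "0 < t \<Longrightarrow> 0 < prob (ev t i)"
  using positive by (simp add: ev_def)

text \<open>\<open>f\<close> is recovered from its conditional expectation given \<open>X t = e\<^sub>i\<close>; the arctangent makes
  it integrable.\<close>

definition drv_arc :: "'n \<Rightarrow> real \<times> real \<times> (real^'n) \<Rightarrow> 'a \<Rightarrow> real" where
  "drv_arc i x \<omega> = (case x of (t, y, z) \<Rightarrow> if 0 \<le> t \<and> t \<le> T then X t \<omega> $ i * arctan (f \<omega> t y z) else 0)"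

lemma drv_arc_measurable: "(\<lambda>(x, \<omega>). drv_arc i x \<omega>) \<in> borel_measurable ((borel \<Otimes>\<^sub>M borel \<Otimes>\<^sub>M borel) \<Otimes>\<^sub>M completion P)"
proof -
  let ?N = "(borel \<Otimes>\<^sub>M borel \<Otimes>\<^sub>M borel) \<Otimes>\<^sub>M completion P :: ((real \<times> real \<times> (real^'n)) \<times> 'a) measure"
  let ?R = "restrict_space ?N {x. 0 \<le> fst (fst x) \<and> fst (fst x) \<le> T}"
  have meas: "{x \<in> space ?N. 0 \<le> fst (fst x) \<and> fst (fst x) \<le> T} \<in> sets ?N" by measurable
  have idc: "(\<lambda>\<omega>. \<omega>) \<in> measurable (completion P) (completed_filtration P X T)"
    by (rule measurable_from_subset[OF measurable_ident[unfolded id_def] completed_sub]) auto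
  have "(\<lambda>x. ((fst (fst x), snd x), snd (fst x))) \<in> measurable ?R ((restrict_space borel {0..T} \<Otimes>\<^sub>M completed_filtration P X T) \<Otimes>\<^sub>M (borel \<Otimes>\<^sub>M borel))"
  proof (intro measurable_Pair)
    show "(\<lambda>x. fst (fst x)) \<in> measurable ?R (restrict_space borel {0..T})"
      by (intro measurable_restrict_space2 measurable_restrict_space1) (auto simp: space_restrict_space)
    show "(\<lambda>x. snd x) \<in> measurable ?R (completed_filtration P X T)"
      by (intro measurable_restrict_space1 measurable_compose[OF measurable_snd idc])
    show "(\<lambda>x. snd (fst x)) \<in> measurable ?R (borel \<Otimes>\<^sub>M borel)"
      by (intro measurable_restrict_space1) measurable
  qed
  then have 1: "(\<lambda>x. ((fst (fst x), snd x), snd (fst x))) \<in> measurable ?R ((restrict_space borel {0..T} \<Otimes>\<^sub>M completed_filtration P X T) \<Otimes>\<^sub>M (borel \<Otimes>\<^sub>M borel))" .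
  have 2: "(\<lambda>((t, \<omega>), y, z). f \<omega> t y z) \<in> borel_measurable ((restrict_space borel {0..T} \<Otimes>\<^sub>M completed_filtration P X T) \<Otimes>\<^sub>M (borel \<Otimes>\<^sub>M borel))"
    using progressive_f T_pos by (simp add: progressive_driver_def)
  have f: "(\<lambda>x. f (snd x) (fst (fst x)) (fst (snd (fst x))) (snd (snd (fst x)))) \<in> borel_measurable ?R"
    using measurable_compose[OF 1 2] by (simp add: case_prod_beta)
  have "(\<lambda>x. (fst (fst x), snd x)) \<in> measurable ?N (borel \<Otimes>\<^sub>M P)"
    by (intro measurable_Pair measurable_compose[OF measurable_snd measurable_completion[OF measurable_ident[unfolded id_def]]]) measurable
  from measurable_compose[OF this X_joint]
  have "(\<lambda>x. (if 0 \<le> fst (fst x) then X (fst (fst x)) (snd x) else 0) $ i) \<in> borel_measurable ?R"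
    by (intro measurable_restrict_space1 measurable_vec_nth) (simp cong: if_cong)
  moreover have "(\<lambda>x. arctan (f (snd x) (fst (fst x)) (fst (snd (fst x))) (snd (snd (fst x))))) \<in> borel_measurable ?R"
  proof (rule measurable_compose[OF f])
    show "(arctan :: real \<Rightarrow> real) \<in> borel_measurable borel"
      by (rule borel_measurable_continuous_onI) (intro continuous_intros)
  qed
  ultimately have "(\<lambda>x. (if 0 \<le> fst (fst x) then X (fst (fst x)) (snd x) else 0) $ i * arctan (f (snd x) (fst (fst x)) (fst (snd (fst x))) (snd (snd (fst x))))) \<in> borel_measurable ?R"
    by (rule borel_measurable_times)
  then have "(\<lambda>x. if 0 \<le> fst (fst x) \<and> fst (fst x) \<le> T then (if 0 \<le> fst (fst x) then X (fst (fst x)) (snd x) else 0) $ i * arctan (f (snd x) (fst (fst x)) (fst (snd (fst x))) (snd (snd (fst x)))) else 0) \<in> borel_measurable ?N"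
    by (subst measurable_If_restrict_space_iff[OF meas]) auto
  moreover have "(\<lambda>x. if 0 \<le> fst (fst x) \<and> fst (fst x) \<le> T then (if 0 \<le> fst (fst x) then X (fst (fst x)) (snd x) else 0) $ i * arctan (f (snd x) (fst (fst x)) (fst (snd (fst x))) (snd (snd (fst x)))) else 0)
     = (\<lambda>(x, \<omega>). drv_arc i x \<omega>)"
    by (auto simp: drv_arc_def fun_eq_iff)
  ultimately show ?thesis by (simp only:)
qed

text \<open>The integral is taken under the completion because \<open>f\<close> is measurable for
  the completed filtration only; the tangent undoes the arctangent.\<close>

definition drv_state :: "'n \<Rightarrow> real \<times> real \<times> (real^'n) \<Rightarrow> real" where
  "drv_state i x = tan ((\<integral>\<omega>. drv_arc i x \<omega> \<partial>completion P) / prob (ev (fst x) i))"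

definition drv :: "real^'n \<Rightarrow> real \<Rightarrow> real \<Rightarrow> real^'n \<Rightarrow> real" where
  "drv x t y z = (\<Sum>i\<in>UNIV. x $ i * drv_state i (t, y, z))"

lemma drv_axis: "drv (axis i 1) t y z = drv_state i (t, y, z)"
proof -
  have "axis i 1 $ k * drv_state k (t, y, z) = (if k = i then drv_state k (t, y, z) else 0)" for k
    by (simp add: axis_def)
  then show ?thesis by (simp add: drv_def)
qed

lemma drv_measurable [measurable (raw)]:
  assumes [measurable]: "x \<in> borel_measurable M" "t \<in> borel_measurable M" "y \<in> borel_measurable M" "z \<in> borel_measurable M"
  shows "(\<lambda>w. drv (x w) (t w) (y w) (z w)) \<in> borel_measurable M"
proof -
  have [measurable]: "(\<lambda>x. \<integral>\<omega>. drv_arc i x \<omega> \<partial>completion P) \<in> borel_measurable (borel \<Otimes>\<^sub>M borel \<Otimes>\<^sub>M borel)" for i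
  proof -
    interpret C: prob_space "completion P" by (rule prob_space_completion)
    show ?thesis by (rule C.borel_measurable_lebesgue_integral[OF drv_arc_measurable])
  qed
  have m: "mass (space P) i \<in> borel_measurable borel" for i by (rule mass_measurable) auto
  have [measurable]: "drv_state i \<in> borel_measurable (borel \<Otimes>\<^sub>M borel \<Otimes>\<^sub>M borel)" for i
  proof -
    \<comment> \<open>\<open>mass\<close> provides the denominator as a Borel function of time. At
      negative times the numerator is 0, and so is its tangent.\<close>
    have "(\<lambda>x. if 0 \<le> fst x then tan ((\<integral>\<omega>. drv_arc i x \<omega> \<partial>completion P) / mass (space P) i (fst x)) else 0) \<in> borel_measurable (borel \<Otimes>\<^sub>M borel \<Otimes>\<^sub>M borel)"
      unfolding tan_def using measurable_compose[OF measurable_fst m[of i]] by measurable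
    moreover have "(\<lambda>x. if 0 \<le> fst x then tan ((\<integral>\<omega>. drv_arc i x \<omega> \<partial>completion P) / mass (space P) i (fst x)) else 0) = drv_state i"
    proof
      fix x :: "real \<times> real \<times> (real^'n)"
      have "space P \<inter> ev t i = ev t i" for t by (auto simp: ev_def)
      then show "(if 0 \<le> fst x then tan ((\<integral>\<omega>. drv_arc i x \<omega> \<partial>completion P) / mass (space P) i (fst x)) else 0) = drv_state i x"
      proof (cases "0 \<le> fst x")
        case False
        then have "drv_arc i x \<omega> = 0" for \<omega> by (auto simp: drv_arc_def split: prod.splits)
        then show ?thesis using False by (simp add: drv_state_def)
      qed (simp add: drv_state_def mass_def \<open>\<And>t. space P \<inter> ev t i = ev t i\<close>)
    qed
    ultimately show ?thesis by simp
  qed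
  show ?thesis unfolding drv_def by measurable
qed

text \<open>\<open>ft\<close> need not be measurable, but along deterministic processes it agrees with the Borel function
  \<open>drv\<close>. Applied to the sections of a process at each fixed \<open>\<omega>\<close>, this gives agreement along all processes.\<close>

lemma ft_eq_drv_deterministic:
  assumes y: "y \<in> borel_measurable borel" and z: "z \<in> borel_measurable borel"
  shows "AE t in lborel. 0 < t \<longrightarrow> t \<le> T \<longrightarrow> (\<forall>i. ft (axis i 1) t (y t) (z t) = drv (axis i 1) t (y t) (z t))"
proof -
  have "predictable P X (\<lambda>t \<omega>. z t)"
    unfolding predictable_def predictable_sigma_eq by (rule comp_filt.pred_measurable_time_fun[OF z])
  moreover have "progressive P X (\<lambda>t \<omega>. y t)"
    by (rule pred_progressive) (unfold predictable_sigma_eq, rule comp_filt.pred_measurable_time_fun[OF y])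
  ultimately have "AE (t, \<omega>) in dt_dP P T. f \<omega> t (y t) (z t) = ft (X t \<omega>) t (y t) (z t)"
    using markovian unfolding markovian_driver_def by blast
  from AE_dt_dP_sections(1)[OF this] show ?thesis
  proof eventually_elim
    case (elim t)
    show ?case
    proof (intro impI allI)
      fix i assume t: "0 < t" "t \<le> T"
      let ?c = "ft (axis i 1) t (y t) (z t)"
      \<comment> \<open>On {X t = e_i} the driver is almost surely the constant \<open>?c\<close>,
        so the conditional mean of its arctangent is \<open>arctan ?c\<close>.\<close>
      have ae: "AE \<omega> in P. drv_arc i (t, y t, z t) \<omega> = indicator (ev t i) \<omega> * arctan ?c"
        using elim[rule_format, OF t] AE_space
        by eventually_elim (use t in \<open>auto simp: drv_arc_def X_indicator indicator_def ev_def\<close>)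
      have "(\<integral>\<omega>. drv_arc i (t, y t, z t) \<omega> \<partial>completion P) = (\<integral>\<omega>. indicator (ev t i) \<omega> * arctan ?c \<partial>completion P)"
      proof (rule integral_cong_AE)
        show "(\<lambda>\<omega>. drv_arc i (t, y t, z t) \<omega>) \<in> borel_measurable (completion P)"
          using measurable_compose[OF measurable_Pair1' drv_arc_measurable, of "(t, y t, z t)"] by (simp add: space_pair_measure)
        show "(\<lambda>\<omega>. indicator (ev t i) \<omega> * arctan ?c) \<in> borel_measurable (completion P)"
          using t by (intro measurable_completion) measurable
        show "AE \<omega> in completion P. drv_arc i (t, y t, z t) \<omega> = indicator (ev t i) \<omega> * arctan ?c"
          by (rule AE_completion[OF ae])
      qed
      also have "\<dots> = (\<integral>\<omega>. indicator (ev t i) \<omega> * arctan ?c \<partial>P)"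
        using t by (intro integral_completion) measurable
      also have "\<dots> = prob (ev t i) * arctan ?c" using t by simp
      finally have "(\<integral>\<omega>. drv_arc i (t, y t, z t) \<omega> \<partial>completion P) / prob (ev t i) = arctan ?c"
        using ev_pos[OF t(1), of i] by simp
      then show "ft (axis i 1) t (y t) (z t) = drv (axis i 1) t (y t) (z t)"
        by (simp add: drv_axis drv_state_def tan_arctan)
    qed
  qed
qed

lemma ft_eq_drv:
  assumes Y: "progressive P X Y" and Z: "predictable P X Z" and w: "\<omega> \<in> space P"
  shows "AE t in lborel. 0 < t \<longrightarrow> t \<le> T \<longrightarrow> (\<forall>i. ft (axis i 1) t (Y t \<omega>) (Z t \<omega>) = drv (axis i 1) t (Y t \<omega>) (Z t \<omega>))"
proof -
  have y: "(\<lambda>t. if 0 \<le> t \<and> t \<le> T then Y t \<omega> else 0) \<in> borel_measurable borel"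
    using T_pos by (intro progressive_section[OF Y _ w]) simp
  have z: "(\<lambda>t. if 0 \<le> t then (\<lambda>(t, \<omega>). Z t \<omega>) (t, \<omega>) else 0) \<in> borel_measurable borel"
    by (rule comp_filt.pred_section[OF _ w]) (use Z in \<open>simp add: predictable_def predictable_sigma_eq\<close>)
  show ?thesis using ft_eq_drv_deterministic[OF y z] by eventually_elim auto
qed

lemma f_eq_drv:
  assumes Y: "progressive P X Y" and Z: "predictable P X Z"
  shows "AE \<omega> in P. AE t in lborel. 0 < t \<longrightarrow> t \<le> T \<longrightarrow> f \<omega> t (Y t \<omega>) (Z t \<omega>) = drv (XL t \<omega>) t (Y t \<omega>) (Z t \<omega>)"
proof -
  have "AE (t, \<omega>) in dt_dP P T. f \<omega> t (Y t \<omega>) (Z t \<omega>) = ft (X t \<omega>) t (Y t \<omega>) (Z t \<omega>)"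
    using markovian Y Z unfolding markovian_driver_def by blast
  from AE_dt_dP_sections(2)[OF this] AE_space show ?thesis
  proof eventually_elim
    case (elim \<omega>)
    from elim(1) AE_XL[OF elim(2)] ft_eq_drv[OF Y Z elim(2)] show ?case
    proof eventually_elim
      case (elim t)
      show ?case
      proof (intro impI)
        assume t: "0 < t" "t \<le> T"
        then obtain i where "X t \<omega> = axis i 1" using state_X[of t \<omega>] \<open>\<omega> \<in> space P\<close> by auto
        then show "f \<omega> t (Y t \<omega>) (Z t \<omega>) = drv (XL t \<omega>) t (Y t \<omega>) (Z t \<omega>)" using elim t by simp
      qed
    qed
  qed
qed

end

section \<open>Solutions as paths\<close>

context markov_chain
begin

definition drift :: "(real \<Rightarrow> real^'n) \<Rightarrow> 'a \<Rightarrow> real \<Rightarrow> real" where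
  "drift z \<omega> r = z r \<bullet> (A r *v left_lim X r \<omega>)"

lemma drift_eq_sum: "0 < r \<Longrightarrow> drift z \<omega> r = (\<Sum>i\<in>UNIV. z r $ i * drift_rate i (r, \<omega>))"
  by (simp add: drift_def inner_vec_def drift_rate_eq)

lemma A_left_lim_continuous:
  assumes w: "\<omega> \<in> space P" and T: "0 \<le> T"
  shows "continuous_on {0..T} (\<lambda>t. integral {0..t} (\<lambda>u. A u *v left_lim X u \<omega>))"
proof -
  have comp: "(\<lambda>r. drift_rate i (r, \<omega>)) \<in> borel_measurable borel" for i
    using measurable_compose[OF measurable_Pair2' drift_rate_measurable, OF w] by simp
  have "(\<lambda>r. drift_rate i (r, \<omega>)) integrable_on {0..T}" for i
    by (rule set_lebesgue_integral_eq_integral(1)[OF bounded_absolutely_integrable(2)[OF comp, where K=K]])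
      (use drift_rate_bound[of "(_, \<omega>)"] w in auto)
  from integrable_spike[OF this, of "{0}"]
  have "(\<lambda>r. (A r *v left_lim X r \<omega>) $ i) integrable_on {0..T}" for i
    by (simp add: drift_rate_eq)
  then have "(\<lambda>u. A u *v left_lim X u \<omega>) integrable_on {0..T}"
    by (subst integrable_componentwise_iff) (auto simp: Basis_vec_def inner_axis)
  then show ?thesis by (rule indefinite_integral_continuous_1)
qed

text \<open>The integral part of the martingale is continuous in time, so the martingale has exactly
  the jumps of the chain.\<close>

lemma chain_mart_jump:
  assumes w: "\<omega> \<in> space P" and t: "0 < t"
  shows "chain_mart X A t \<omega> - left_lim (chain_mart X A) t \<omega> = X t \<omega> - llim (\<lambda>s. X s \<omega>) t"
proof -
  let ?I = "\<lambda>t. integral {0..t} (\<lambda>u. A u *v left_lim X u \<omega>)"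
  have "(?I \<longlongrightarrow> ?I t) (at t within {0..t})"
    using A_left_lim_continuous[OF w, of t] t by (simp add: continuous_on_def)
  then have "(?I \<longlongrightarrow> ?I t) (at_left t)" using t by (simp add: at_within_Icc_at_left)
  then have "((\<lambda>s. X s \<omega> - X 0 \<omega> - ?I s) \<longlongrightarrow> llim (\<lambda>s. X s \<omega>) t - X 0 \<omega> - ?I t) (at_left t)"
    using step_path_left(3)[OF step_path_X[OF w] t] by (intro tendsto_intros)
  then have "left_lim (chain_mart X A) t \<omega> = llim (\<lambda>s. X s \<omega>) t - X 0 \<omega> - ?I t"
    unfolding left_lim_def[of "chain_mart X A"] chain_mart_def by (intro tendsto_Lim) auto
  then show ?thesis by (simp add: chain_mart_def)
qed

lemma mart_integral_eq:
  assumes w: "\<omega> \<in> space P" and s: "0 \<le> s"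
  shows "mart_integral X A s t Z \<omega> = jump_sum (\<lambda>t. X t \<omega>) (\<lambda>r. Z r \<omega>) s t - integral {s..t} (drift (\<lambda>r. Z r \<omega>) \<omega>)"
proof -
  have "{r. r \<in> {s<..t} \<and> chain_mart X A r \<omega> \<noteq> left_lim (chain_mart X A) r \<omega>} = jumps (\<lambda>t. X t \<omega>) \<inter> {s<..t}"
  proof -
    have "chain_mart X A r \<omega> \<noteq> left_lim (chain_mart X A) r \<omega> \<longleftrightarrow> X r \<omega> \<noteq> llim (\<lambda>t. X t \<omega>) r" if "0 < r" for r
      using chain_mart_jump[OF w that] by (metis right_minus_eq)
    then show ?thesis using s by (auto simp: jumps_def)
  qed
  moreover have "(\<Sum>r\<in>jumps (\<lambda>t. X t \<omega>) \<inter> {s<..t}. Z r \<omega> \<bullet> (chain_mart X A r \<omega> - left_lim (chain_mart X A) r \<omega>)) =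
     (\<Sum>r\<in>jumps (\<lambda>t. X t \<omega>) \<inter> {s<..t}. Z r \<omega> \<bullet> (X r \<omega> - llim (\<lambda>t. X t \<omega>) r))"
  proof (intro sum.cong refl)
    fix r assume "r \<in> jumps (\<lambda>t. X t \<omega>) \<inter> {s<..t}"
    then have "0 < r" using s by auto
    then show "Z r \<omega> \<bullet> (chain_mart X A r \<omega> - left_lim (chain_mart X A) r \<omega>) = Z r \<omega> \<bullet> (X r \<omega> - llim (\<lambda>t. X t \<omega>) r)"
      by (simp only: chain_mart_jump[OF w])
  qed
  ultimately show ?thesis by (simp add: mart_integral_def jump_sum_def drift_def[abs_def])
qed

text \<open>The equation along a single path, in forward form. Driver and drift of the martingale
  are merged into one density, which makes the calculus of \<open>sol_path\<close>
  available.\<close>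

definition bsde_path where
  "bsde_path f S \<xi> Y Z \<omega> \<longleftrightarrow>
     (\<lambda>r. f \<omega> r (left_lim Y r \<omega>) (Z r \<omega>)) absolutely_integrable_on {0..S} \<and>
     drift (\<lambda>r. Z r \<omega>) \<omega> absolutely_integrable_on {0..S} \<and> Y S \<omega> = \<xi> \<and>
     sol_path (\<lambda>t. X t \<omega>) (\<lambda>r. f \<omega> r (left_lim Y r \<omega>) (Z r \<omega>) + drift (\<lambda>r. Z r \<omega>) \<omega> r) (\<lambda>r. Z r \<omega>) 0 S (\<lambda>t. Y t \<omega>)"

text \<open>Splitting the integrals and the jump sum at \<open>t\<close> converts the backward
  equation into the forward one and back.\<close>

lemma bsde_path_iff:
  assumes w: "\<omega> \<in> space P" and S: "0 \<le> S"
  shows "((\<lambda>r. f \<omega> r (left_lim Y r \<omega>) (Z r \<omega>)) absolutely_integrable_on {0..S} \<and>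
        mart_integrable X A S Z \<omega> \<and>
        (\<forall>t\<in>{0..S}. Y t \<omega> = \<xi> + integral {t..S} (\<lambda>r. f \<omega> r (left_lim Y r \<omega>) (Z r \<omega>)) - mart_integral X A t S Z \<omega>))
     \<longleftrightarrow> bsde_path f S \<xi> Y Z \<omega>"
proof -
  let ?x = "\<lambda>t. X t \<omega>" and ?b = "\<lambda>r. f \<omega> r (left_lim Y r \<omega>) (Z r \<omega>)" and ?z = "\<lambda>r. Z r \<omega>"
  let ?m = "drift ?z \<omega>"
  have x: "step_path ?x" using w by (rule step_path_X)
  have mi: "mart_integrable X A S Z \<omega> \<longleftrightarrow> ?m absolutely_integrable_on {0..S}"
    by (simp add: mart_integrable_def drift_def[abs_def])
  have "(\<forall>t\<in>{0..S}. Y t \<omega> = \<xi> + integral {t..S} ?b - mart_integral X A t S Z \<omega>) \<longleftrightarrow>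
      Y S \<omega> = \<xi> \<and> sol_path ?x (\<lambda>r. ?b r + ?m r) ?z 0 S (\<lambda>t. Y t \<omega>)"
    if b: "?b absolutely_integrable_on {0..S}" and m: "?m absolutely_integrable_on {0..S}"
  proof -
    have bm: "(\<lambda>r. ?b r + ?m r) absolutely_integrable_on {0..S}"
      using b m by (rule set_integral_add(1))
    have I: "integral {s..t} (\<lambda>r. ?b r + ?m r) = integral {s..t} ?b + integral {s..t} ?m"
      if "0 \<le> s" "t \<le> S" for s t
    proof -
      have "?b absolutely_integrable_on {s..t}" "?m absolutely_integrable_on {s..t}"
        using that b m by (auto intro: absolutely_integrable_Icc_subset)
      then show ?thesis by (intro Henstock_Kurzweil_Integration.integral_add set_lebesgue_integral_eq_integral(1))
    qed
    have J: "integral {0..S} (\<lambda>r. ?b r + ?m r) = integral {0..t} (\<lambda>r. ?b r + ?m r) + integral {t..S} (\<lambda>r. ?b r + ?m r)"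
      if "0 \<le> t" "t \<le> S" for t using integrable_on_split_abs[OF bm that] .
    have K: "jump_sum ?x ?z 0 S = jump_sum ?x ?z 0 t + jump_sum ?x ?z t S" if "0 \<le> t" "t \<le> S" for t
      using jump_sum_split[OF x order_refl that] .
    have M: "mart_integral X A t S Z \<omega> = jump_sum ?x ?z t S - integral {t..S} ?m" if "0 \<le> t" for t
      using mart_integral_eq[OF w that] .
    show ?thesis
    proof
      assume eq: "\<forall>t\<in>{0..S}. Y t \<omega> = \<xi> + integral {t..S} ?b - mart_integral X A t S Z \<omega>"
      have *: "Y t \<omega> = \<xi> + integral {t..S} (\<lambda>r. ?b r + ?m r) - jump_sum ?x ?z t S" if "0 \<le> t" "t \<le> S" for t
        using bspec[OF eq, of t] I[of t S] M[of t] that by simp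
      show "Y S \<omega> = \<xi> \<and> sol_path ?x (\<lambda>r. ?b r + ?m r) ?z 0 S (\<lambda>t. Y t \<omega>)"
        unfolding sol_path_def
      proof (intro conjI ballI)
        show "Y S \<omega> = \<xi>" using *[of S] S by simp
        show "(\<lambda>r. ?b r + ?m r) absolutely_integrable_on {0..S}" by (rule bm)
        fix t assume "t \<in> {0..S}"
        then have t: "0 \<le> t" "t \<le> S" by auto
        show "Y t \<omega> = Y 0 \<omega> - integral {0..t} (\<lambda>r. ?b r + ?m r) + jump_sum ?x ?z 0 t"
          using *[OF t] *[OF order_refl S] J[OF t] K[OF t] by linarith
      qed
    next
      assume eq: "Y S \<omega> = \<xi> \<and> sol_path ?x (\<lambda>r. ?b r + ?m r) ?z 0 S (\<lambda>t. Y t \<omega>)"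
      show "\<forall>t\<in>{0..S}. Y t \<omega> = \<xi> + integral {t..S} ?b - mart_integral X A t S Z \<omega>"
      proof
        fix t assume "t \<in> {0..S}"
        then have t: "0 \<le> t" "t \<le> S" by auto
        have "Y S \<omega> - Y t \<omega> = - integral {t..S} (\<lambda>r. ?b r + ?m r) + jump_sum ?x ?z t S"
          using sol_path_diff[OF x order_refl conjunct2[OF eq] t order_refl] .
        then show "Y t \<omega> = \<xi> + integral {t..S} ?b - mart_integral X A t S Z \<omega>"
          using eq I[of t S] M[of t] t by simp
      qed
    qed
  qed
  then show ?thesis unfolding bsde_path_def mi by blast
qed

lemma bsde_solution_iff:
  assumes "0 \<le> S"
  shows "bsde_solution P X A f S \<xi> Y Z \<longleftrightarrow>
     (\<forall>t\<in>{0..S}. Y t \<in> borel_measurable (completed_filtration P X t)) \<and> predictable P X Z \<and>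
     (\<integral>\<^sup>+ \<omega>. (\<Squnion>t\<in>{0..<S}. ennreal ((Y t \<omega>)\<^sup>2)) \<partial>P) < \<infinity> \<and>
     (AE \<omega> in P. bsde_path f S (\<xi> \<omega>) Y Z \<omega>)"
proof -
  have "(AE \<omega> in P. (\<lambda>r. f \<omega> r (left_lim Y r \<omega>) (Z r \<omega>)) absolutely_integrable_on {0..S} \<and>
        mart_integrable X A S Z \<omega> \<and>
        (\<forall>t\<in>{0..S}. Y t \<omega> = \<xi> \<omega> + integral {t..S} (\<lambda>r. f \<omega> r (left_lim Y r \<omega>) (Z r \<omega>)) - mart_integral X A t S Z \<omega>))
     \<longleftrightarrow> (AE \<omega> in P. bsde_path f S (\<xi> \<omega>) Y Z \<omega>)"
    using bsde_path_iff[OF _ assms] by (intro AE_cong) auto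
  then show ?thesis unfolding bsde_solution_def by simp
qed

end

section \<open>Freezing the past\<close>

lemma AE_lborel_negligible:
  assumes "AE r in lborel. Q r"
  obtains N :: "real set" where "negligible N" "\<And>r. r \<notin> N \<Longrightarrow> Q r"
proof -
  obtain N where N: "{x \<in> space lborel. \<not> Q x} \<subseteq> N" "emeasure lborel N = 0" "N \<in> sets lborel"
    using AE_E[OF assms] by auto
  then have "N \<in> null_sets lborel" by auto
  then have "negligible N" by (simp add: negligible_iff_null_sets null_sets_completionI)
  then show thesis using N(1) by (intro that[of N]) auto
qed

lemma absolutely_integrable_AE_cong:
  fixes g g' :: "real \<Rightarrow> real"
  assumes "g absolutely_integrable_on {a..b}" "AE r in lborel. a < r \<longrightarrow> r \<le> b \<longrightarrow> g r = g' r"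
  shows "g' absolutely_integrable_on {a..b}" "integral {a..b} g' = integral {a..b} g"
proof -
  obtain N where N: "negligible N" "\<And>r. r \<notin> N \<Longrightarrow> a < r \<longrightarrow> r \<le> b \<longrightarrow> g r = g' r"
    using AE_lborel_negligible[OF assms(2)] by blast
  have N': "negligible (insert a N)" using N(1) by simp
  have eq: "\<And>r. r \<in> {a..b} - insert a N \<Longrightarrow> g' r = g r" using N(2) by auto
  show "g' absolutely_integrable_on {a..b}"
    by (rule absolutely_integrable_spike[OF assms(1) N' eq])
  show "integral {a..b} g' = integral {a..b} g"
    by (rule integral_spike[OF N']) (use eq in auto)
qed

lemma absolutely_integrable_Icc_combine:
  fixes g :: "real \<Rightarrow> real"
  assumes "g absolutely_integrable_on {a..b}" "g absolutely_integrable_on {b..c}" "a \<le> b" "b \<le> c"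
  shows "g absolutely_integrable_on {a..c}"
proof -
  have "{a..c} = {a..b} \<union> {b..c}" using assms by auto
  then show ?thesis using assms by (auto intro: set_integrable_Un)
qed

text \<open>A path sees its density up to null sets and its jump integrand at the jumps
  only.\<close>

lemma sol_path_cong:
  assumes sp: "sol_path x g h a b y"
    and g: "AE r in lborel. a < r \<longrightarrow> r \<le> b \<longrightarrow> g r = g' r"
    and h: "\<And>r. r \<in> jumps x \<Longrightarrow> a < r \<Longrightarrow> r \<le> b \<Longrightarrow> h r = h' r"
    and y: "\<And>t. a \<le> t \<Longrightarrow> t \<le> b \<Longrightarrow> y t = y' t"
  shows "sol_path x g' h' a b y'"
  unfolding sol_path_def
proof (intro conjI ballI)
  have abs: "g absolutely_integrable_on {a..b}" using sp by (simp only: sol_path_def)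
  show "g' absolutely_integrable_on {a..b}" by (rule absolutely_integrable_AE_cong(1)[OF abs g])
  fix t assume "t \<in> {a..b}"
  then have t: "a \<le> t" "t \<le> b" by auto
  have "AE r in lborel. a < r \<longrightarrow> r \<le> t \<longrightarrow> g r = g' r" using g by eventually_elim (use t in auto)
  then have "integral {a..t} g' = integral {a..t} g"
    using t by (intro absolutely_integrable_AE_cong(2) absolutely_integrable_Icc_subset[OF abs]) auto
  moreover have "jump_sum x h a t = jump_sum x h' a t" using h t by (intro jump_sum_cong) auto
  moreover have "y t = y a - integral {a..t} g + jump_sum x h a t"
    using sp \<open>t \<in> {a..b}\<close> unfolding sol_path_def by blast
  moreover have "y t = y' t" "y a = y' a" using y t by auto
  ultimately show "y' t = y' a - integral {a..t} g' + jump_sum x h' a t" by linarith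
qed

lemma sol_path_combine:
  assumes x: "step_path x" and ab: "0 \<le> a" "a \<le> b" "b \<le> c"
    and 1: "sol_path x g h a b y" and 2: "sol_path x g h b c y"
  shows "sol_path x g h a c y"
  unfolding sol_path_def
proof (intro conjI ballI)
  have g: "g absolutely_integrable_on {a..b}" "g absolutely_integrable_on {b..c}" using 1 2 by (simp_all only: sol_path_def)
  then show abs: "g absolutely_integrable_on {a..c}" using ab by (intro absolutely_integrable_Icc_combine[OF g])
  fix t assume t: "t \<in> {a..c}"
  show "y t = y a - integral {a..t} g + jump_sum x h a t"
  proof (cases "t \<le> b")
    case True
    then have "t \<in> {a..b}" using t by auto
    then show ?thesis using 1 unfolding sol_path_def by blast
  next
    case False
    then have "t \<in> {b..c}" "b \<in> {a..b}" using t ab by auto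
    then have "y t = y b - integral {b..t} g + jump_sum x h b t" "y b = y a - integral {a..b} g + jump_sum x h a b"
      using 1 2 unfolding sol_path_def by blast+
    moreover have "integral {a..t} g = integral {a..b} g + integral {b..t} g"
      using t ab False by (intro integrable_on_split_abs absolutely_integrable_Icc_subset[OF abs]) auto
    moreover have "jump_sum x h a t = jump_sum x h a b + jump_sum x h b t"
      using False ab by (intro jump_sum_split[OF x]) auto
    ultimately show ?thesis by linarith
  qed
qed

text \<open>\<open>F\<close> may be a supremum over uncountably many times and need not be measurable.\<close>

lemma nn_integral_add_le:
  assumes G[measurable]: "G \<in> borel_measurable M"
  shows "(\<integral>\<^sup>+x. F x + G x \<partial>M) \<le> (\<integral>\<^sup>+x. F x \<partial>M) + (\<integral>\<^sup>+x. G x \<partial>M)"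
  unfolding nn_integral_def[of M "\<lambda>x. F x + G x"]
proof (rule SUP_least, clarsimp)
  fix s assume s: "simple_function M s" "s \<le> (\<lambda>x. F x + G x)"
  have [measurable]: "s \<in> borel_measurable M" using s(1) by (rule borel_measurable_simple_function)
  \<comment> \<open>Where \<open>G\<close> is infinite nothing has to be covered by
    \<open>F\<close>; elsewhere the excess of the simple function over \<open>G\<close> stays below
    \<open>F\<close>.\<close>
  define d where "d x = (if G x = \<infinity> then 0 else s x - G x)" for x
  have [measurable]: "d \<in> borel_measurable M" unfolding d_def[abs_def] by measurable
  have le: "s x \<le> d x + G x" for x
    using ennreal_minus_le_iff[of "s x" "G x" "s x - G x"] by (auto simp: d_def add.commute)
  have F: "d x \<le> F x" for x
    using s(2) by (auto simp: d_def le_fun_def ennreal_minus_le_iff add.commute)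
  have "integral\<^sup>S M s = (\<integral>\<^sup>+x. s x \<partial>M)" using s(1) by (rule nn_integral_eq_simple_integral[symmetric])
  also have "\<dots> \<le> (\<integral>\<^sup>+x. d x + G x \<partial>M)" by (rule nn_integral_mono) (rule le)
  also have "\<dots> = (\<integral>\<^sup>+x. d x \<partial>M) + (\<integral>\<^sup>+x. G x \<partial>M)" by (rule nn_integral_add) measurable
  also have "\<dots> \<le> (\<integral>\<^sup>+x. F x \<partial>M) + (\<integral>\<^sup>+x. G x \<partial>M)" by (intro add_mono nn_integral_mono F order_refl)
  finally show "integral\<^sup>S M s \<le> (\<integral>\<^sup>+x. F x \<partial>M) + (\<integral>\<^sup>+x. G x \<partial>M)" .
qed

lemma AE_scale_measure_I: "AE x in M. Q x \<Longrightarrow> AE x in scale_measure r M. Q x"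
  unfolding eventually_ae_filter by (auto simp: null_sets_def space_scale_measure)

lemma measurable_if_differ:
  fixes u v g :: "'x \<Rightarrow> real"
  assumes [measurable]: "u \<in> borel_measurable N" "v \<in> borel_measurable N" "g \<in> borel_measurable N"
  shows "(\<lambda>x. if S < g x \<and> g x \<le> T \<and> u x \<noteq> v x then 1 else 0 :: ennreal) \<in> borel_measurable N"
  by measurable

lemma sets_Collect_conj4:
  fixes F1 F2 F3 :: "'x \<Rightarrow> ennreal" and u v :: "'x \<Rightarrow> real"
  assumes [measurable]: "F1 \<in> borel_measurable N" "F2 \<in> borel_measurable N" "u \<in> borel_measurable N"
    "v \<in> borel_measurable N" "F3 \<in> borel_measurable N"
  shows "{w \<in> space N. F1 w < \<infinity> \<and> F2 w < \<infinity> \<and> u w = v w \<and> F3 w = 0} \<in> sets N"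
  by measurable

lemma borel_measurable_vec_lambda:
  fixes h :: "'n::finite \<Rightarrow> 'x \<Rightarrow> real"
  assumes "\<And>i. h i \<in> borel_measurable M"
  shows "(\<lambda>x. \<chi> i. h i x) \<in> borel_measurable M"
  unfolding borel_measurable_euclidean_space[where f="\<lambda>x. \<chi> i. h i x"]
  using assms by (auto simp: Basis_vec_def inner_axis)

context markov_chain
begin

text \<open>By \<open>diagonal_law\<close> both assumptions on the diagonal become statements about
  the product of the past and future laws. By Fubini almost every past satisfies both, and the past
  law has mass \<open>prob (ev S j)\<close>, so such a past exists.\<close>

lemma freeze_past:
  assumes S: "0 \<le> S" and pos: "0 < prob (ev S j)"
    and D: "D \<in> sets (splice_all P X S)" and \<rho>: "\<rho> \<in> borel_measurable (splice_all P X S)"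
    and diag_D: "AE \<omega> in P. \<omega> \<in> ev S j \<longrightarrow> (\<omega>, \<omega>) \<in> D"
    and diag_\<rho>: "(\<integral>\<^sup>+\<omega>. indicator (ev S j) \<omega> * \<rho> (\<omega>, \<omega>) \<partial>P) < \<infinity>"
  shows "\<exists>p\<in>space P. (AE \<omega> in P. \<omega> \<in> ev S j \<longrightarrow> (p, \<omega>) \<in> D) \<and> (\<integral>\<^sup>+\<omega>. indicator (ev S j) \<omega> * \<rho> (p, \<omega>) \<partial>P) < \<infinity>"
proof -
  let ?E = "ev S j" and ?F = "natural_filtration P X S" and ?G = "gen_sigma P X {S..}"
  let ?Q = "density P (indicator ?E)"
  define M1 where "M1 = density (restr_to_subalg P ?F) (indicator ?E)"
  define M2 where "M2 = restr_to_subalg ?Q ?G"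
  note law = diagonal_law[OF S, of j, folded M1_def M2_def]
  have E: "?E \<in> sets P" using S by simp
  have EF: "?E \<in> sets ?F" using ev_natural[OF S order_refl] .
  have subF: "subalgebra P ?F" by (simp add: subalgebra_def natural_sub)
  have GP: "sets ?G \<subseteq> sets P" using S by (intro gen_sub) auto
  then have subG: "subalgebra ?Q ?G" by (simp add: subalgebra_def)
  have s1: "sets M1 = sets ?F" unfolding M1_def using subF by (simp add: sets_restr_to_subalg)
  have s2: "sets M2 = sets ?G" unfolding M2_def using subG by (simp add: sets_restr_to_subalg)
  have sp: "space M1 = space P" "space M2 = space P"
    using sets_eq_imp_space_eq[OF s1] sets_eq_imp_space_eq[OF s2] by auto
  have s12: "sets (M1 \<Otimes>\<^sub>M M2) = sets (splice_all P X S)" by (simp add: s1 s2 cong: sets_pair_measure_cong)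
  have diag: "(\<lambda>\<omega>. (\<omega>, \<omega>)) \<in> measurable ?Q (splice_all P X S)"
    by (intro measurable_Pair measurable_from_subset[OF measurable_ident[unfolded id_def]])
      (use GP natural_sub in auto)
  have m1: "emeasure M1 (space M1) = ennreal (prob ?E)"
    unfolding sp M1_def using EF subF sets.top[of ?F] sets.sets_into_space[OF E]
    by (subst emeasure_density) (auto simp: sets_restr_to_subalg space_restr_to_subalg nn_integral_indicator
        emeasure_restr_to_subalg emeasure_eq_measure Int_absorb2 simp flip: indicator_inter_arith intro: borel_measurable_indicator)
  have m2: "emeasure M2 (space M2) \<noteq> \<infinity>"
    unfolding sp(2) unfolding M2_def using subG sets.top[of ?G] E
    by (simp add: emeasure_restr_to_subalg emeasure_density emeasure_eq_measure flip: indicator_inter_arith)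
  interpret M1: finite_measure M1 by (rule finite_measureI) (simp add: m1)
  interpret M2: finite_measure M2 by (rule finite_measureI) (rule m2)
  interpret M12: pair_sigma_finite M1 M2 ..
  have ae12: "AE w in M1 \<Otimes>\<^sub>M M2. w \<in> D"
  proof -
    have "AE \<omega> in ?Q. (\<omega>, \<omega>) \<in> D" using diag_D E by (subst AE_density) auto
    then have "AE w in distr ?Q (splice_all P X S) (\<lambda>\<omega>. (\<omega>, \<omega>)). w \<in> D"
      using D diag by (subst AE_distr_iff) auto
    then show ?thesis unfolding law by (rule AE_scale_measure_I)
  qed
  have nn12: "(\<integral>\<^sup>+w. \<rho> w \<partial>(M1 \<Otimes>\<^sub>M M2)) < \<infinity>"
  proof -
    have "(\<integral>\<^sup>+w. \<rho> w \<partial>distr ?Q (splice_all P X S) (\<lambda>\<omega>. (\<omega>, \<omega>))) = (\<integral>\<^sup>+\<omega>. \<rho> (\<omega>, \<omega>) \<partial>?Q)"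
      using \<rho> diag by (intro nn_integral_distr) simp_all
    also have "\<dots> = (\<integral>\<^sup>+\<omega>. indicator ?E \<omega> * \<rho> (\<omega>, \<omega>) \<partial>P)"
      using measurable_compose[OF diag \<rho>] E by (intro nn_integral_density) auto
    finally show ?thesis unfolding law using diag_\<rho> \<rho>
      by (subst nn_integral_scale_measure) (auto simp: ennreal_mult_less_top)
  qed
  have a1: "AE p in M1. AE \<omega> in M2. (p, \<omega>) \<in> D" using M12.AE_pair[OF ae12] .
  have \<rho>12: "\<rho> \<in> borel_measurable (M1 \<Otimes>\<^sub>M M2)" using \<rho> s12 by (simp cong: measurable_cong_sets)
  have "(\<integral>\<^sup>+p. \<integral>\<^sup>+\<omega>. \<rho> (p, \<omega>) \<partial>M2 \<partial>M1) < \<infinity>" using nn12 M2.nn_integral_fst[OF \<rho>12] by simp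
  then have a2: "AE p in M1. (\<integral>\<^sup>+\<omega>. \<rho> (p, \<omega>) \<partial>M2) \<noteq> \<infinity>"
    using \<rho>12 by (intro nn_integral_PInf_AE) (auto intro: M2.borel_measurable_nn_integral_fst)
  have "ae_filter M1 \<noteq> bot" using m1 pos by (simp add: ae_filter_eq_bot_iff)
  moreover have ae: "AE p in M1. (AE \<omega> in M2. (p, \<omega>) \<in> D) \<and> (\<integral>\<^sup>+\<omega>. \<rho> (p, \<omega>) \<partial>M2) \<noteq> \<infinity> \<and> p \<in> space M1"
    using a1 a2 AE_space by eventually_elim auto
  ultimately have "\<exists>p. (AE \<omega> in M2. (p, \<omega>) \<in> D) \<and> (\<integral>\<^sup>+\<omega>. \<rho> (p, \<omega>) \<partial>M2) \<noteq> \<infinity> \<and> p \<in> space M1"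
    by (rule eventually_happens')
  then obtain p where p: "AE \<omega> in M2. (p, \<omega>) \<in> D" "(\<integral>\<^sup>+\<omega>. \<rho> (p, \<omega>) \<partial>M2) \<noteq> \<infinity>" "p \<in> space P"
    unfolding sp by (elim exE conjE)
  have "AE \<omega> in ?Q. (p, \<omega>) \<in> D" using p(1) unfolding M2_def by (rule AE_restr_to_subalg[OF subG])
  then have "AE \<omega> in P. \<omega> \<in> ?E \<longrightarrow> (p, \<omega>) \<in> D" using E by (subst (asm) AE_density) auto
  moreover have "(\<integral>\<^sup>+\<omega>. \<rho> (p, \<omega>) \<partial>M2) = (\<integral>\<^sup>+\<omega>. indicator ?E \<omega> * \<rho> (p, \<omega>) \<partial>P)"
  proof -
    have m: "(\<lambda>\<omega>. \<rho> (p, \<omega>)) \<in> borel_measurable ?G"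
      using measurable_compose[OF measurable_Pair1' \<rho>, of p] p(3) by simp
    have "(\<integral>\<^sup>+\<omega>. \<rho> (p, \<omega>) \<partial>M2) = (\<integral>\<^sup>+\<omega>. \<rho> (p, \<omega>) \<partial>?Q)"
      unfolding M2_def by (rule nn_integral_subalgebra2[OF subG m])
    also have "\<dots> = (\<integral>\<^sup>+\<omega>. indicator ?E \<omega> * \<rho> (p, \<omega>) \<partial>P)"
      using E measurable_from_subset[OF m GP] by (intro nn_integral_density) auto
    finally show ?thesis .
  qed
  ultimately show ?thesis using p(2,3) by (intro bexI[of _ p]) (auto simp: less_top[symmetric])
qed

text \<open>Sampling at the maximum of \<open>S\<close> and the dyadic point uses observations from
  \<open>S\<close> on only. In the limit the maximum is inactive, as the dyadic points approach a
  time beyond \<open>S\<close>.\<close>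

lemma XL_future:
  assumes S: "0 \<le> S"
  shows "(\<lambda>z. if S < fst z then XL (fst z) (snd z) else 0) \<in> borel_measurable (borel \<Otimes>\<^sub>M gen_sigma P X {S..})"
proof (rule borel_measurable_LIMSEQ_metric)
  let ?f = "\<lambda>n z. if S < fst z then X (max S (dyad n (fst z))) (snd z) else 0"
  show "?f n \<in> borel_measurable (borel \<Otimes>\<^sub>M gen_sigma P X {S..})" for n
  proof -
    have [measurable]: "X (max S (real_of_int k / 2^n)) \<in> borel_measurable (gen_sigma P X {S..})" for k
      by (rule measurable_gen_sigma) auto
    have "(\<lambda>z. (\<lambda>k z. if S < fst z then X (max S (real_of_int k / 2^n)) (snd z) else 0) (\<lceil>fst z * 2^n\<rceil> - 1) z) \<in> borel_measurable (borel \<Otimes>\<^sub>M gen_sigma P X {S..})"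
      by (rule measurable_compose_countable[where g="\<lambda>z. \<lceil>fst z * 2^n\<rceil> - 1"]) measurable
    then show ?thesis by (simp add: dyad_def cong: if_cong)
  qed
  fix z :: "real \<times> 'a" assume "z \<in> space (borel \<Otimes>\<^sub>M gen_sigma P X {S..})"
  then have w: "snd z \<in> space P" by (auto simp: space_pair_measure)
  show "(\<lambda>n. ?f n z) \<longlonglongrightarrow> (if S < fst z then XL (fst z) (snd z) else 0)"
  proof (cases "S < fst z")
    case True
    then have pos: "0 < fst z" using S by simp
    have "(\<lambda>n. X (dyad n (fst z)) (snd z)) \<longlonglongrightarrow> XL (fst z) (snd z)"
      using dyad_lim(1)[OF step_path_left(3)[OF step_path_X[OF w] pos]] pos by (simp add: XL_eq)
    moreover have "\<forall>\<^sub>F n in sequentially. S < dyad n (fst z)"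
      using order_tendstoD(1)[OF dyad_tendsto True] .
    then have "\<forall>\<^sub>F n in sequentially. X (dyad n (fst z)) (snd z) = ?f n z"
      by eventually_elim (use True in \<open>simp add: max_def\<close>)
    ultimately have "(\<lambda>n. ?f n z) \<longlonglongrightarrow> XL (fst z) (snd z)" by (rule Lim_transform_eventually)
    then show ?thesis using True by simp
  qed simp
qed

end

context markov_bsde
begin

text \<open>The arguments \<open>(t, p, \<omega>)\<close> consist of a time, a point \<open>p\<close> for the path up to \<open>S\<close> and a point \<open>\<omega>\<close>
  for the path after \<open>S\<close>. The functionals \<open>c\<close>, \<open>y\<close>, \<open>h\<close> represent \<open>Y\<^sub>S\<close>, the left limits of \<open>Y\<close> and
  \<open>Z\<close>. \<open>frozen_solves\<close> says in a measurable way that they satisfy the equation on \<open>[S,T]\<close>.\<close>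

definition frozen_driver :: "real \<Rightarrow> (real \<times> 'a \<times> 'a \<Rightarrow> real) \<Rightarrow> (real \<times> 'a \<times> 'a \<Rightarrow> real^'n) \<Rightarrow> real \<times> 'a \<times> 'a \<Rightarrow> real" where
  "frozen_driver S y h z = (if S < fst z \<and> fst z \<le> T then drv (XL (fst z) (snd (snd z))) (fst z) (y z) (h z) else 0)"

definition frozen_drift :: "real \<Rightarrow> (real \<times> 'a \<times> 'a \<Rightarrow> real^'n) \<Rightarrow> real \<times> 'a \<times> 'a \<Rightarrow> real" where
  "frozen_drift S h z = (if S < fst z \<and> fst z \<le> T then \<Sum>i\<in>UNIV. h z $ i * drift_rate i (fst z, snd (snd z)) else 0)"

definition frozen_value where
  "frozen_value S c y h z = c (fst (snd z)) - (LINT r|lborel. indicator {S..fst z} r * (frozen_driver S y h (r, snd z) + frozen_drift S h (r, snd z)))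
     + jump_sum (\<lambda>t. X t (snd (snd z))) (\<lambda>r. if S < r then h (r, snd z) else 0) S (min T (fst z))"

text \<open>\<open>y\<close> is fed into the driver, and the last conjunct closes the circle: the
  path produced from it is \<open>y\<close> again at almost every time.\<close>

definition frozen_solves where
  "frozen_solves S \<phi> c y h w \<longleftrightarrow> (\<integral>\<^sup>+r. ennreal \<bar>frozen_driver S y h (r, w)\<bar> \<partial>lborel) < \<infinity> \<and> (\<integral>\<^sup>+r. ennreal \<bar>frozen_drift S h (r, w)\<bar> \<partial>lborel) < \<infinity> \<and>
     frozen_value S c y h (T, w) = \<phi> (X T (snd w)) \<and>
     (\<integral>\<^sup>+r. (if S < r \<and> r \<le> T \<and> frozen_value S c y h (r, w) \<noteq> y (r, w) then 1 else 0) \<partial>lborel) = 0"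

context
  fixes S :: real and c :: "'a \<Rightarrow> real" and y :: "real \<times> 'a \<times> 'a \<Rightarrow> real" and h :: "real \<times> 'a \<times> 'a \<Rightarrow> real^'n"
  assumes S: "0 < S" "S < T"
    and c: "c \<in> borel_measurable (natural_filtration P X S)"
    and y: "y \<in> borel_measurable (splice_pred P X S)"
    and h: "h \<in> borel_measurable (splice_pred P X S)"
begin

abbreviation (input) "MM \<equiv> splice_all P X S"

lemma frozen_coefficients_measurable:
  "frozen_driver S y h \<in> borel_measurable (borel \<Otimes>\<^sub>M MM)" "frozen_drift S h \<in> borel_measurable (borel \<Otimes>\<^sub>M MM)"
proof -
  note [measurable] = splice_pred_prod[OF y] splice_pred_prod[OF h]
  have "(\<lambda>z. (fst z, snd (snd z))) \<in> measurable (borel \<Otimes>\<^sub>M MM) (borel \<Otimes>\<^sub>M gen_sigma P X {S..})" by measurable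
  from measurable_compose[OF this XL_future] S
  have XLm [measurable]: "(\<lambda>z. if S < fst z then XL (fst z) (snd (snd z)) else 0) \<in> borel_measurable (borel \<Otimes>\<^sub>M MM)"
    by (simp cong: if_cong)
  have "(\<lambda>z. if S < fst z \<and> fst z \<le> T then drv (if S < fst z then XL (fst z) (snd (snd z)) else 0) (fst z) (if S < fst z then y z else 0) (if S < fst z then h z else 0) else 0) \<in> borel_measurable (borel \<Otimes>\<^sub>M MM)"
    by measurable
  moreover have "(\<lambda>z. if S < fst z \<and> fst z \<le> T then drv (if S < fst z then XL (fst z) (snd (snd z)) else 0) (fst z) (if S < fst z then y z else 0) (if S < fst z then h z else 0) else 0) = frozen_driver S y h"
    by (auto simp: frozen_driver_def fun_eq_iff)
  ultimately show "frozen_driver S y h \<in> borel_measurable (borel \<Otimes>\<^sub>M MM)" by (simp only:)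
  have "(\<lambda>z. if S < fst z \<and> fst z \<le> T then \<Sum>i\<in>UNIV. (if S < fst z then h z else 0) $ i * (\<Sum>k\<in>UNIV. rate i k (fst z) * (if S < fst z then XL (fst z) (snd (snd z)) else 0) $ k) else 0) \<in> borel_measurable (borel \<Otimes>\<^sub>M MM)"
    by measurable
  moreover have "(\<lambda>z. if S < fst z \<and> fst z \<le> T then \<Sum>i\<in>UNIV. (if S < fst z then h z else 0) $ i * (\<Sum>k\<in>UNIV. rate i k (fst z) * (if S < fst z then XL (fst z) (snd (snd z)) else 0) $ k) else 0) = frozen_drift S h"
    by (auto simp: frozen_drift_def drift_rate_def fun_eq_iff)
  ultimately show "frozen_drift S h \<in> borel_measurable (borel \<Otimes>\<^sub>M MM)" by (simp only:)
qed

lemma XS_measurable: "S \<le> r \<Longrightarrow> (\<lambda>w. X r (snd w)) \<in> borel_measurable MM"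
  by (rule measurable_compose[OF measurable_snd measurable_gen_sigma]) auto

lemma frozen_value_measurable: "frozen_value S c y h \<in> borel_measurable (borel \<Otimes>\<^sub>M MM)"
proof -
  note [measurable] = frozen_coefficients_measurable splice_pred_prod[OF h]
  have 1: "(\<lambda>z. c (fst (snd z))) \<in> borel_measurable (borel \<Otimes>\<^sub>M MM)"
    using c by measurable
  have 2: "(\<lambda>(t, w). LINT r|lborel. indicator {S..t} r * (\<lambda>z. frozen_driver S y h z + frozen_drift S h z) (r, w)) \<in> borel_measurable (borel \<Otimes>\<^sub>M MM)"
    by (rule integral_measurable_joint) measurable
  have 3: "(\<lambda>(t, w). jump_sum (\<lambda>t. X t (snd w)) (\<lambda>r. (\<lambda>z. if S < fst z then h z else 0) (r, w)) S (min T t)) \<in> borel_measurable (borel \<Otimes>\<^sub>M MM)"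
  proof (rule jump_sum_measurable_joint)
    show "step_path (\<lambda>t. X t (snd w))" if "w \<in> space MM" for w
      using that by (intro step_path_X) (auto simp: space_pair_measure)
  qed (use S XS_measurable splice_pred_prod[OF h] in auto)
  show ?thesis
    using borel_measurable_add[OF borel_measurable_diff[OF 1 2] 3]
    by (rule measurable_cong[THEN iffD1, rotated]) (auto simp: frozen_value_def split: prod.splits cong: if_cong)
qed

text \<open>The chain has finitely many states, so an arbitrary \<open>\<phi>\<close> is measurable
  along it.\<close>

lemma \<phi>_measurable: "(\<lambda>w. \<phi> (X T (snd w)) :: real) \<in> borel_measurable MM"
proof -
  have [measurable]: "(\<lambda>w. X T (snd w)) \<in> borel_measurable MM" using S by (intro XS_measurable) simp
  have "(\<lambda>w. \<Sum>i\<in>UNIV. X T (snd w) $ i * \<phi> (axis i 1)) \<in> borel_measurable MM" by measurable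
  moreover have "(\<Sum>i\<in>UNIV. X T (snd w) $ i * \<phi> (axis i 1)) = \<phi> (X T (snd w))" if w: "w \<in> space MM" for w
  proof -
    have "snd w \<in> space P" using w by (auto simp: space_pair_measure)
    then obtain k where k: "X T (snd w) = axis k 1" using state_X[of T "snd w"] T_pos by auto
    have "axis k 1 $ i * \<phi> (axis i 1) = (if i = k then \<phi> (axis i 1) else 0)" for i by (simp add: axis_def)
    then show ?thesis by (simp add: k)
  qed
  ultimately show ?thesis by (rule measurable_cong[THEN iffD1, rotated])
qed

lemma frozen_solves_sets: "{w \<in> space MM. frozen_solves S \<phi> c y h w} \<in> sets MM"
proof -
  note [measurable] = frozen_coefficients_measurable frozen_value_measurable splice_pred_prod[OF y] \<phi>_measurable
  have sw: "(\<lambda>(w, r). (r, w)) \<in> measurable (MM \<Otimes>\<^sub>M lborel) (borel \<Otimes>\<^sub>M MM)" by measurable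
  have F12: "(\<lambda>w. \<integral>\<^sup>+r. ennreal \<bar>frozen_driver S y h (r, w)\<bar> \<partial>lborel) \<in> borel_measurable MM"
    "(\<lambda>w. \<integral>\<^sup>+r. ennreal \<bar>frozen_drift S h (r, w)\<bar> \<partial>lborel) \<in> borel_measurable MM"
    using measurable_compose[OF sw frozen_coefficients_measurable(1)] measurable_compose[OF sw frozen_coefficients_measurable(2)]
    by (auto intro!: lborel.borel_measurable_nn_integral simp: case_prod_beta)
  have F3: "(\<lambda>w. \<integral>\<^sup>+r. (if S < r \<and> r \<le> T \<and> frozen_value S c y h (r, w) \<noteq> y (r, w) then 1 else 0) \<partial>lborel) \<in> borel_measurable MM"
  proof (rule lborel.borel_measurable_nn_integral)
    have VY: "(\<lambda>x. frozen_value S c y h (snd x, fst x)) \<in> borel_measurable (MM \<Otimes>\<^sub>M lborel)"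
      "(\<lambda>x. if S < snd x then y (snd x, fst x) else 0) \<in> borel_measurable (MM \<Otimes>\<^sub>M lborel)"
      using measurable_compose[OF sw frozen_value_measurable] measurable_compose[OF sw splice_pred_prod[OF y]] by (simp_all add: case_prod_beta cong: if_cong)
    have "(\<lambda>x. (if S < snd x \<and> snd x \<le> T \<and> frozen_value S c y h (snd x, fst x) \<noteq> (if S < snd x then y (snd x, fst x) else 0) then 1 else 0) :: ennreal) \<in> borel_measurable (MM \<Otimes>\<^sub>M lborel)"
      by (rule measurable_if_differ[OF VY]) simp
    moreover have "(\<lambda>x. (if S < snd x \<and> snd x \<le> T \<and> frozen_value S c y h (snd x, fst x) \<noteq> (if S < snd x then y (snd x, fst x) else 0) then 1 else 0) :: ennreal) =
      (\<lambda>(w, r). if S < r \<and> r \<le> T \<and> frozen_value S c y h (r, w) \<noteq> y (r, w) then 1 else 0)"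
      by (auto simp: fun_eq_iff)
    ultimately show "(\<lambda>(w, r). (if S < r \<and> r \<le> T \<and> frozen_value S c y h (r, w) \<noteq> y (r, w) then 1 else 0) :: ennreal) \<in> borel_measurable (MM \<Otimes>\<^sub>M lborel)"
      by (simp only:)
  qed
  have VT: "(\<lambda>w. frozen_value S c y h (T, w)) \<in> borel_measurable MM"
  proof -
    have m: "Pair T \<in> measurable MM (borel \<Otimes>\<^sub>M MM)" by (rule measurable_Pair1') (simp add: space_borel)
    show ?thesis by (rule measurable_compose[OF m frozen_value_measurable])
  qed
  show ?thesis unfolding frozen_solves_def by (rule sets_Collect_conj4[OF F12 VT \<phi>_measurable F3])
qed

lemma section_measurable:
  assumes "w \<in> space MM"
  shows "(\<lambda>r. frozen_driver S y h (r, w)) \<in> borel_measurable borel" "(\<lambda>r. frozen_drift S h (r, w)) \<in> borel_measurable borel"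
    "(\<lambda>r. frozen_value S c y h (r, w)) \<in> borel_measurable borel" "(\<lambda>r. if S < r then y (r, w) else 0) \<in> borel_measurable borel"
proof -
  have m: "(\<lambda>r. (r, w)) \<in> measurable borel (borel \<Otimes>\<^sub>M MM)" using assms by (rule measurable_Pair2')
  show "(\<lambda>r. frozen_driver S y h (r, w)) \<in> borel_measurable borel" "(\<lambda>r. frozen_drift S h (r, w)) \<in> borel_measurable borel"
    "(\<lambda>r. frozen_value S c y h (r, w)) \<in> borel_measurable borel" "(\<lambda>r. if S < r then y (r, w) else 0) \<in> borel_measurable borel"
    using measurable_compose[OF m frozen_coefficients_measurable(1)] measurable_compose[OF m frozen_coefficients_measurable(2)]
      measurable_compose[OF m frozen_value_measurable] measurable_compose[OF m splice_pred_prod[OF y]] by (simp_all cong: if_cong)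
qed

lemma finite_nn_absolutely_integrable:
  fixes g :: "real \<Rightarrow> real"
  assumes g: "g \<in> borel_measurable borel" and fin: "(\<integral>\<^sup>+r. ennreal \<bar>g r\<bar> \<partial>lborel) < \<infinity>"
  shows "g absolutely_integrable_on {a..b}" "integral {a..b} g = (LINT r|lborel. indicator {a..b} r * g r)"
proof -
  have "integrable lborel g" using g fin by (simp add: integrable_iff_bounded)
  then have *: "set_integrable lborel {a..b} g"
    unfolding set_integrable_def by (intro integrable_mult_indicator) auto
  then show "g absolutely_integrable_on {a..b}"
    unfolding set_integrable_def using g by (subst integrable_completion) auto
  show "integral {a..b} g = (LINT r|lborel. indicator {a..b} r * g r)"
    using set_borel_integral_eq_integral(2)[OF *] by (simp add: set_lebesgue_integral_def)
qed

lemma frozen_solves_path: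
  assumes w: "w \<in> space MM" and frozen_solves: "frozen_solves S \<phi> c y h w"
  shows "(\<lambda>r. frozen_driver S y h (r, w)) absolutely_integrable_on {S..T}" "(\<lambda>r. frozen_drift S h (r, w)) absolutely_integrable_on {S..T}"
    "sol_path (\<lambda>t. X t (snd w)) (\<lambda>r. frozen_driver S y h (r, w) + frozen_drift S h (r, w)) (\<lambda>r. h (r, w)) S T (\<lambda>t. frozen_value S c y h (t, w))"
    "frozen_value S c y h (T, w) = \<phi> (X T (snd w))"
    "AE r in lborel. S < r \<longrightarrow> r \<le> T \<longrightarrow> frozen_value S c y h (r, w) = y (r, w)"
proof -
  let ?b = "\<lambda>r. frozen_driver S y h (r, w)" and ?m = "\<lambda>r. frozen_drift S h (r, w)"
  show "?b absolutely_integrable_on {S..T}" "?m absolutely_integrable_on {S..T}"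
    using finite_nn_absolutely_integrable(1)[OF section_measurable(1)[OF w]]
      finite_nn_absolutely_integrable(1)[OF section_measurable(2)[OF w]] frozen_solves by (simp_all add: frozen_solves_def)
  show "frozen_value S c y h (T, w) = \<phi> (X T (snd w))" using frozen_solves by (simp add: frozen_solves_def)
  have sum_fin: "(\<integral>\<^sup>+r. ennreal \<bar>?b r + ?m r\<bar> \<partial>lborel) < \<infinity>"
  proof -
    have "(\<integral>\<^sup>+r. ennreal \<bar>?b r + ?m r\<bar> \<partial>lborel) \<le> (\<integral>\<^sup>+r. ennreal \<bar>?b r\<bar> + ennreal \<bar>?m r\<bar> \<partial>lborel)"
      by (intro nn_integral_mono) (simp add: ennreal_plus[symmetric] del: ennreal_plus)
    also have "\<dots> = (\<integral>\<^sup>+r. ennreal \<bar>?b r\<bar> \<partial>lborel) + (\<integral>\<^sup>+r. ennreal \<bar>?m r\<bar> \<partial>lborel)"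
    proof -
      note [measurable] = section_measurable[OF w]
      show ?thesis by (intro nn_integral_add) measurable
    qed
    also have "\<dots> < \<infinity>" using frozen_solves by (simp add: frozen_solves_def)
    finally show ?thesis .
  qed
  have bm: "(\<lambda>r. ?b r + ?m r) \<in> borel_measurable borel" using section_measurable[OF w] by measurable
  note I = finite_nn_absolutely_integrable[OF bm sum_fin]
  have J: "jump_sum (\<lambda>t. X t (snd w)) (\<lambda>r. if S < r then h (r, w) else 0) S t = jump_sum (\<lambda>t. X t (snd w)) (\<lambda>r. h (r, w)) S t" for t
    by (rule jump_sum_cong) auto
  have V: "frozen_value S c y h (t, w) = c (fst w) - integral {S..t} (\<lambda>r. ?b r + ?m r) + jump_sum (\<lambda>t. X t (snd w)) (\<lambda>r. h (r, w)) S t"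
    if "S \<le> t" "t \<le> T" for t using that by (simp add: frozen_value_def I(2) J min_def cong: if_cong)
  have VS: "frozen_value S c y h (S, w) = c (fst w)" using V[of S] S by simp
  show "sol_path (\<lambda>t. X t (snd w)) (\<lambda>r. ?b r + ?m r) (\<lambda>r. h (r, w)) S T (\<lambda>t. frozen_value S c y h (t, w))"
    unfolding sol_path_def
  proof (intro conjI ballI)
    fix t assume "t \<in> {S..T}"
    then show "frozen_value S c y h (t, w) = frozen_value S c y h (S, w) - integral {S..t} (\<lambda>r. ?b r + ?m r) + jump_sum (\<lambda>t. X t (snd w)) (\<lambda>r. h (r, w)) S t"
      unfolding VS by (intro V) auto
  qed (rule I)
  have "AE r in lborel. (if S < r \<and> r \<le> T \<and> frozen_value S c y h (r, w) \<noteq> y (r, w) then 1 else 0 :: ennreal) = 0"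
  proof (rule nn_integral_0_iff_AE[THEN iffD1])
    have "(\<lambda>r. if S < r \<and> r \<le> T \<and> frozen_value S c y h (r, w) \<noteq> (if S < r then y (r, w) else 0) then 1 else 0 :: ennreal) \<in> borel_measurable lborel"
    proof (rule measurable_if_differ)
      show "(\<lambda>r. frozen_value S c y h (r, w)) \<in> borel_measurable lborel" "(\<lambda>r. if S < r then y (r, w) else 0) \<in> borel_measurable lborel"
        using section_measurable(3,4)[OF w] by (simp_all only: measurable_def sets_lborel space_lborel space_borel)
    qed simp
    moreover have "(\<lambda>r. if S < r \<and> r \<le> T \<and> frozen_value S c y h (r, w) \<noteq> (if S < r then y (r, w) else 0) then 1 else 0 :: ennreal) = (\<lambda>r. if S < r \<and> r \<le> T \<and> frozen_value S c y h (r, w) \<noteq> y (r, w) then 1 else 0)"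
      by (auto simp: fun_eq_iff)
    ultimately show "(\<lambda>r. if S < r \<and> r \<le> T \<and> frozen_value S c y h (r, w) \<noteq> y (r, w) then 1 else 0 :: ennreal) \<in> borel_measurable lborel" by (simp only:)
    show "(\<integral>\<^sup>+r. (if S < r \<and> r \<le> T \<and> frozen_value S c y h (r, w) \<noteq> y (r, w) then 1 else 0) \<partial>lborel) = 0"
      using frozen_solves by (simp add: frozen_solves_def)
  qed
  then show "AE r in lborel. S < r \<longrightarrow> r \<le> T \<longrightarrow> frozen_value S c y h (r, w) = y (r, w)"
    by eventually_elim (auto split: if_splits)
qed

lemma frozen_value_start: "frozen_value S c y h (S, w) = c (fst w)"
proof -
  have "indicator {S..S} r * (frozen_driver S y h (r, w) + frozen_drift S h (r, w)) = 0" for r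
    by (auto simp: indicator_def frozen_driver_def frozen_drift_def)
  then have "(LINT r|lborel. indicator {S..S} r * (frozen_driver S y h (r, w) + frozen_drift S h (r, w))) = 0" by (simp only: integral_zero)
  then show ?thesis using S by (simp add: frozen_value_def)
qed

end

end

section \<open>The Markov property of the solution\<close>

lemma abs_integrable_finite_nn:
  fixes g :: "real \<Rightarrow> real"
  assumes g: "g \<in> borel_measurable borel" and int: "g absolutely_integrable_on {a..b}" and z: "\<And>r. r \<notin> {a..b} \<Longrightarrow> g r = 0"
  shows "(\<integral>\<^sup>+r. ennreal \<bar>g r\<bar> \<partial>lborel) < \<infinity>"
proof -
  have "(\<lambda>r. indicator {a..b} r *\<^sub>R g r) = g" using z by (auto simp: fun_eq_iff indicator_def)
  then have "integrable lebesgue g" using int by (simp add: set_integrable_def)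
  then have "integrable lborel g" using g by (subst (asm) integrable_completion) auto
  then show ?thesis by (simp add: integrable_iff_bounded)
qed

context markov_chain
begin

lemma sum_ev_select:
  fixes g :: "'n \<Rightarrow> 'b::real_vector"
  assumes "\<omega> \<in> ev S j"
  shows "(\<Sum>k\<in>UNIV. indicator (ev S k) \<omega> *\<^sub>R g k) = g j"
proof -
  have "indicator (ev S k) \<omega> *\<^sub>R g k = (if k = j then g k else 0)" for k
    using assms by (auto simp: ev_def indicator_def axis_eq_axis)
  then show ?thesis by simp
qed

text \<open>With finitely many states the data are bounded.\<close>

lemma terminal_square_integrable:
  fixes \<phi> :: "real^'n \<Rightarrow> real"
  assumes "0 \<le> S" shows "square_integrable_data P X S (\<lambda>\<omega>. \<phi> (X S \<omega>))"
proof -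
  have eq: "\<phi> (X S \<omega>) = (\<Sum>k\<in>UNIV. indicator (ev S k) \<omega> * \<phi> (axis k 1))" if w: "\<omega> \<in> space P" for \<omega>
  proof -
    obtain j where j: "X S \<omega> = axis j 1" using state_X[OF assms w] by auto
    then have "\<omega> \<in> ev S j" using w by (simp add: ev_def)
    from sum_ev_select[OF this, of "\<lambda>k. \<phi> (axis k 1)"] j show ?thesis by simp
  qed
  have "(\<lambda>\<omega>. \<Sum>k\<in>UNIV. indicator (ev S k) \<omega> * \<phi> (axis k 1)) \<in> borel_measurable (completed_filtration P X S)"
  proof (intro borel_measurable_sum borel_measurable_times borel_measurable_indicator borel_measurable_const)
    fix k show "ev S k \<in> sets (completed_filtration P X S)"
      using ev_natural[OF assms order_refl] natural_sub_completed by blast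
  qed
  then have m: "(\<lambda>\<omega>. \<phi> (X S \<omega>)) \<in> borel_measurable (completed_filtration P X S)"
    by (rule measurable_cong[THEN iffD2, rotated]) (simp add: eq)
  have "(\<integral>\<^sup>+ \<omega>. ennreal ((\<phi> (X S \<omega>))\<^sup>2) \<partial>P) \<le> (\<integral>\<^sup>+ \<omega>. ennreal (\<Sum>k\<in>UNIV. (\<phi> (axis k 1))\<^sup>2) \<partial>P)"
  proof (intro nn_integral_mono ennreal_leI)
    fix \<omega> assume w: "\<omega> \<in> space P"
    obtain j where j: "X S \<omega> = axis j 1" using state_X[OF assms w] by auto
    show "(\<phi> (X S \<omega>))\<^sup>2 \<le> (\<Sum>k\<in>UNIV. (\<phi> (axis k 1))\<^sup>2)"
      unfolding j by (rule member_le_sum) auto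
  qed
  also have "\<dots> < \<infinity>" by (simp add: emeasure_space_1)
  finally show ?thesis using m by (simp add: square_integrable_data_def)
qed

end

context markov_bsde
begin

text \<open>A version of the left limits of \<open>Y\<close> that is predictable as it stands.
  \<open>Y\<close> is adapted only up to \<open>T\<close>, so later values are replaced by
  0.\<close>

definition YL :: "(real \<Rightarrow> 'a \<Rightarrow> real) \<Rightarrow> real \<Rightarrow> 'a \<Rightarrow> real" where
  "YL Y t \<omega> = (if 0 < t \<and> t \<le> T then lim (\<lambda>n. if dyad n t \<le> T then Y (dyad n t) \<omega> else 0) else 0)"

lemma YL_predictable:
  assumes "\<And>t. 0 \<le> t \<Longrightarrow> t \<le> T \<Longrightarrow> Y t \<in> borel_measurable (completed_filtration P X t)"
  shows "(\<lambda>(t, \<omega>). YL Y t \<omega>) \<in> borel_measurable (predictable_sigma P X)"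
proof -
  let ?W = "\<lambda>t \<omega>. if t \<le> T then Y t \<omega> else 0"
  have "?W t \<in> borel_measurable (completed_filtration P X t)" if "0 \<le> t" for t
    using assms[of t] that by (cases "t \<le> T") auto
  from comp_filt.pred_left_limit[OF this]
  have 1: "(\<lambda>(t, \<omega>). if 0 < t then lim (\<lambda>n. ?W (dyad n t) \<omega>) else 0) \<in> borel_measurable (predictable_sigma P X)"
    unfolding predictable_sigma_eq .
  have [measurable]: "fst \<in> borel_measurable (predictable_sigma P X)"
    unfolding predictable_sigma_eq by (rule comp_filt.pred_measurable_time)
  have "(\<lambda>z. if fst z \<le> T then (\<lambda>(t, \<omega>). if 0 < t then lim (\<lambda>n. ?W (dyad n t) \<omega>) else 0) z else 0) \<in> borel_measurable (predictable_sigma P X)"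
    by (rule measurable_If[OF 1]) auto
  moreover have "(\<lambda>z. if fst z \<le> T then (\<lambda>(t, \<omega>). if 0 < t then lim (\<lambda>n. ?W (dyad n t) \<omega>) else 0) z else 0) = (\<lambda>(t, \<omega>). YL Y t \<omega>)"
    by (auto simp: YL_def fun_eq_iff)
  ultimately show ?thesis by (simp only:)
qed

lemma YL_eq:
  assumes p: "bsde_path f T \<xi> Y Z \<omega>" and w: "\<omega> \<in> space P" and t: "0 < t" "t \<le> T"
  shows "YL Y t \<omega> = left_lim Y t \<omega>" "t \<notin> jumps (\<lambda>t. X t \<omega>) \<Longrightarrow> left_lim Y t \<omega> = Y t \<omega>"
proof -
  have sp: "sol_path (\<lambda>t. X t \<omega>) (\<lambda>r. f \<omega> r (left_lim Y r \<omega>) (Z r \<omega>) + drift (\<lambda>r. Z r \<omega>) \<omega> r) (\<lambda>r. Z r \<omega>) 0 T (\<lambda>t. Y t \<omega>)"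
    using p by (simp only: bsde_path_def)
  note l = sol_path_left[OF step_path_X[OF w] order_refl sp t]
  have "dyad n t \<le> T" for n using dyad_less[of n t] t by simp
  then show "YL Y t \<omega> = left_lim Y t \<omega>"
    using dyad_lim(2)[OF l(1)] l(2) t by (simp add: YL_def left_lim_def)
  show "left_lim Y t \<omega> = Y t \<omega>" if "t \<notin> jumps (\<lambda>t. X t \<omega>)"
    using sol_path_llim_eq[OF step_path_X[OF w] order_refl sp t that] by (simp add: left_lim_def)
qed

context
  fixes S :: real and c :: "'a \<Rightarrow> real" and y :: "real \<times> 'a \<times> 'a \<Rightarrow> real" and h :: "real \<times> 'a \<times> 'a \<Rightarrow> real^'n"
  assumes S: "0 < S" "S < T"
    and c: "c \<in> borel_measurable (natural_filtration P X S)"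
    and y: "y \<in> borel_measurable (splice_pred P X S)"
    and h: "h \<in> borel_measurable (splice_pred P X S)"
begin

text \<open>With past and future taken from the same point the functionals reproduce the given
  solution. \<open>Y\<close> agrees with its left limits off the jumps, which gives the almost
  everywhere equality with \<open>y\<close>.\<close>

lemma frozen_solves_diagonal:
  assumes w: "\<omega> \<in> space P" and path: "bsde_path f T (\<phi> (X T \<omega>)) Y Z \<omega>" and cS: "Y S \<omega> = c \<omega>"
    and yr: "\<forall>t\<in>{S<..}. YL Y t \<omega> = y (t, \<omega>, \<omega>)" and zr: "\<forall>t\<in>{S<..}. Z t \<omega> = h (t, \<omega>, \<omega>)"
    and ae: "AE r in lborel. 0 < r \<longrightarrow> r \<le> T \<longrightarrow> f \<omega> r (YL Y r \<omega>) (Z r \<omega>) = drv (XL r \<omega>) r (YL Y r \<omega>) (Z r \<omega>)"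
  shows "frozen_solves S \<phi> c y h (\<omega>, \<omega>)" "S \<le> t \<Longrightarrow> t \<le> T \<Longrightarrow> frozen_value S c y h (t, \<omega>, \<omega>) = Y t \<omega>"
proof -
  let ?x = "\<lambda>t. X t \<omega>" and ?b = "\<lambda>r. f \<omega> r (left_lim Y r \<omega>) (Z r \<omega>)" and ?m = "drift (\<lambda>r. Z r \<omega>) \<omega>"
  let ?gb = "\<lambda>r. frozen_driver S y h (r, \<omega>, \<omega>)" and ?gm = "\<lambda>r. frozen_drift S h (r, \<omega>, \<omega>)"
  have ww: "(\<omega>, \<omega>) \<in> space (splice_all P X S)" using w by (simp add: space_pair_measure)
  note meas = section_measurable[OF S c y h ww]
  have x: "step_path ?x" using w by (rule step_path_X)
  have sp: "sol_path ?x (\<lambda>r. ?b r + ?m r) (\<lambda>r. Z r \<omega>) 0 T (\<lambda>t. Y t \<omega>)" using path by (simp only: bsde_path_def)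
  have bE: "AE r in lborel. S < r \<longrightarrow> r \<le> T \<longrightarrow> ?b r = ?gb r"
    using ae
  proof eventually_elim
    case (elim r)
    show ?case
    proof (intro impI)
      assume r: "S < r" "r \<le> T"
      then have "0 < r" using S by simp
      have "?b r = f \<omega> r (YL Y r \<omega>) (Z r \<omega>)" using YL_eq(1)[OF path w \<open>0 < r\<close> r(2)] by simp
      also have "\<dots> = drv (XL r \<omega>) r (YL Y r \<omega>) (Z r \<omega>)" using elim \<open>0 < r\<close> r by simp
      also have "\<dots> = ?gb r" using yr zr r by (simp add: frozen_driver_def)
      finally show "?b r = ?gb r" .
    qed
  qed
  have mE: "AE r in lborel. S < r \<longrightarrow> r \<le> T \<longrightarrow> ?m r = ?gm r"
    using S zr by (intro AE_I2) (simp add: frozen_drift_def drift_eq_sum)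
  have b: "?b absolutely_integrable_on {0..T}" and m: "?m absolutely_integrable_on {0..T}"
    using path by (simp_all only: bsde_path_def)
  have bS: "?b absolutely_integrable_on {S..T}" and mS: "?m absolutely_integrable_on {S..T}"
    using S absolutely_integrable_Icc_subset[OF b] absolutely_integrable_Icc_subset[OF m] by auto
  have gbS: "?gb absolutely_integrable_on {S..T}" by (rule absolutely_integrable_AE_cong(1)[OF bS bE])
  have gmS: "?gm absolutely_integrable_on {S..T}" by (rule absolutely_integrable_AE_cong(1)[OF mS mE])
  have gS: "(\<lambda>r. ?gb r + ?gm r) absolutely_integrable_on {S..T}" using gbS gmS by (rule set_integral_add(1))
  have out: "?gb r = 0" "?gm r = 0" if "r \<notin> {S..T}" for r using that by (auto simp: frozen_driver_def frozen_drift_def)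
  have fin: "(\<integral>\<^sup>+r. ennreal \<bar>?gb r\<bar> \<partial>lborel) < \<infinity>" "(\<integral>\<^sup>+r. ennreal \<bar>?gm r\<bar> \<partial>lborel) < \<infinity>"
    "(\<integral>\<^sup>+r. ennreal \<bar>?gb r + ?gm r\<bar> \<partial>lborel) < \<infinity>"
    by (rule abs_integrable_finite_nn[OF meas(1) gbS out(1)], assumption)
      (rule abs_integrable_finite_nn[OF meas(2) gmS out(2)], assumption,
       rule abs_integrable_finite_nn[OF borel_measurable_add[OF meas(1,2)] gS], simp add: out)
  have V: "frozen_value S c y h (t, \<omega>, \<omega>) = Y t \<omega>" if t: "S \<le> t" "t \<le> T" for t
  proof -
    have sub: "(\<lambda>r. ?b r + ?m r) absolutely_integrable_on {S..t}"
      by (rule absolutely_integrable_Icc_subset[OF sol_path_abs[OF x order_refl sp]]) (use S t in auto)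
    have "AE r in lborel. S < r \<longrightarrow> r \<le> t \<longrightarrow> ?b r + ?m r = ?gb r + ?gm r"
      using bE mE by eventually_elim (use t in auto)
    then have I: "integral {S..t} (\<lambda>r. ?gb r + ?gm r) = integral {S..t} (\<lambda>r. ?b r + ?m r)"
      by (rule absolutely_integrable_AE_cong(2)[OF sub])
    have L: "(LINT r|lborel. indicator {S..t} r * (?gb r + ?gm r)) = integral {S..t} (\<lambda>r. ?gb r + ?gm r)"
      by (rule finite_nn_absolutely_integrable(2)[OF S c y h borel_measurable_add[OF meas(1,2)] fin(3), symmetric])
    have J: "jump_sum ?x (\<lambda>r. if S < r then h (r, \<omega>, \<omega>) else 0) S t = jump_sum ?x (\<lambda>r. Z r \<omega>) S t"
      by (rule jump_sum_cong) (use zr in auto)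
    have "Y t \<omega> - Y S \<omega> = - integral {S..t} (\<lambda>r. ?b r + ?m r) + jump_sum ?x (\<lambda>r. Z r \<omega>) S t"
      using sol_path_diff[OF x order_refl sp _ t] S by simp
    then show ?thesis using L I J cS t by (simp add: frozen_value_def min_def cong: if_cong)
  qed
  then show "S \<le> t \<Longrightarrow> t \<le> T \<Longrightarrow> frozen_value S c y h (t, \<omega>, \<omega>) = Y t \<omega>" .
  have vy: "AE r in lborel. (if S < r \<and> r \<le> T \<and> frozen_value S c y h (r, \<omega>, \<omega>) \<noteq> y (r, \<omega>, \<omega>) then 1 else 0 :: ennreal) = 0"
    using AE_not_jump[OF x]
  proof eventually_elim
    case (elim r)
    show ?case
    proof (cases "S < r \<and> r \<le> T")
      case True
      then have "0 < r" using S by simp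
      have "frozen_value S c y h (r, \<omega>, \<omega>) = Y r \<omega>" using V True by simp
      also have "\<dots> = YL Y r \<omega>" using YL_eq[OF path w \<open>0 < r\<close>] elim True by simp
      also have "\<dots> = y (r, \<omega>, \<omega>)" using yr True by simp
      finally show ?thesis by simp
    qed auto
  qed
  have "(\<integral>\<^sup>+r. (if S < r \<and> r \<le> T \<and> frozen_value S c y h (r, \<omega>, \<omega>) \<noteq> y (r, \<omega>, \<omega>) then 1 else 0) \<partial>lborel) = (\<integral>\<^sup>+r. 0 \<partial>(lborel :: real measure))"
    by (rule nn_integral_cong_AE[OF vy])
  moreover have "frozen_value S c y h (T, \<omega>, \<omega>) = \<phi> (X T \<omega>)" using V[of T] S path by (simp add: bsde_path_def)
  ultimately show "frozen_solves S \<phi> c y h (\<omega>, \<omega>)" using fin by (simp add: frozen_solves_def)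
qed

lemma frozen_predictable:
  assumes p: "p \<in> space P"
  shows "(\<lambda>z. if S < fst z then y (fst z, p, snd z) else 0) \<in> borel_measurable (nat_pred P X)"
    "(\<lambda>z. if S < fst z then h (fst z, p, snd z) else 0) \<in> borel_measurable (nat_pred P X)"
    "(\<lambda>z. frozen_driver S y h (fst z, p, snd z) + frozen_drift S h (fst z, p, snd z)) \<in> borel_measurable (nat_pred P X)"
proof -
  show ys[measurable]: "(\<lambda>z. if S < fst z then y (fst z, p, snd z) else 0) \<in> borel_measurable (nat_pred P X)"
    using S by (intro splice_pred_section[OF y p]) simp
  show hs[measurable]: "(\<lambda>z. if S < fst z then h (fst z, p, snd z) else 0) \<in> borel_measurable (nat_pred P X)"
    using S by (intro splice_pred_section[OF h p]) simp
  have [measurable]: "(\<lambda>z. XL (fst z) (snd z)) \<in> borel_measurable (nat_pred P X)" "fst \<in> borel_measurable (nat_pred P X)"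
    using XL_nat_pred nat_filt.pred_measurable_time[of P X] by (simp_all add: case_prod_unfold)
  have "(\<lambda>z. if S < fst z \<and> fst z \<le> T then drv (XL (fst z) (snd z)) (fst z) (if S < fst z then y (fst z, p, snd z) else 0) (if S < fst z then h (fst z, p, snd z) else 0)
      + (\<Sum>i\<in>UNIV. (if S < fst z then h (fst z, p, snd z) else 0) $ i * (\<Sum>k\<in>UNIV. rate i k (fst z) * XL (fst z) (snd z) $ k)) else 0) \<in> borel_measurable (nat_pred P X)"
    by measurable
  moreover have "(\<lambda>z. if S < fst z \<and> fst z \<le> T then drv (XL (fst z) (snd z)) (fst z) (if S < fst z then y (fst z, p, snd z) else 0) (if S < fst z then h (fst z, p, snd z) else 0)
      + (\<Sum>i\<in>UNIV. (if S < fst z then h (fst z, p, snd z) else 0) $ i * (\<Sum>k\<in>UNIV. rate i k (fst z) * XL (fst z) (snd z) $ k)) else 0)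
      = (\<lambda>z. frozen_driver S y h (fst z, p, snd z) + frozen_drift S h (fst z, p, snd z))"
    by (auto simp: frozen_driver_def frozen_drift_def drift_rate_def fun_eq_iff)
  ultimately show "(\<lambda>z. frozen_driver S y h (fst z, p, snd z) + frozen_drift S h (fst z, p, snd z)) \<in> borel_measurable (nat_pred P X)"
    by (simp only:)
qed

text \<open>All integrands are first cut off after \<open>t\<close>. They are then jointly
  measurable with respect to the filtration at \<open>t\<close>, and so are their integrals and jump
  sums.\<close>

lemma frozen_value_adapted:
  assumes p: "p \<in> space P" and t: "S \<le> t" "t \<le> T"
  shows "(\<lambda>\<omega>. frozen_value S c y h (t, p, \<omega>)) \<in> borel_measurable (natural_filtration P X t)"
proof -
  let ?F = "natural_filtration P X t"
  have joint: "(\<lambda>z. if fst z \<in> {0..t} then g z else 0) \<in> borel_measurable (borel \<Otimes>\<^sub>M ?F)"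
    if "g \<in> borel_measurable (nat_pred P X)" for g :: "real \<times> 'a \<Rightarrow> 'b::{real_normed_vector, second_countable_topology}"
  proof (rule nat_filt.pred_measurable_prod[OF that])
    fix s u :: real assume "s \<le> u" "u \<in> {0..t}"
    then show "sets (natural_filtration P X s) \<subseteq> sets ?F" by (intro natural_mono) auto
  qed auto
  have "(\<lambda>(u, \<omega>). LINT r|lborel. indicator {S..u} r * (\<lambda>z. if fst z \<in> {0..t} then frozen_driver S y h (fst z, p, snd z) + frozen_drift S h (fst z, p, snd z) else 0) (r, \<omega>)) \<in> borel_measurable (borel \<Otimes>\<^sub>M ?F)"
    by (rule integral_measurable_joint[OF joint[OF frozen_predictable(3)[OF p]]])
  from measurable_compose[OF measurable_Pair1'[of t borel ?F] this]
  have "(\<lambda>\<omega>. LINT r|lborel. indicator {S..t} r * (if r \<in> {0..t} then frozen_driver S y h (r, p, \<omega>) + frozen_drift S h (r, p, \<omega>) else 0)) \<in> borel_measurable ?F"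
    by (simp add: space_borel cong: if_cong)
  moreover have "(LINT r|lborel. indicator {S..t} r * (if r \<in> {0..t} then frozen_driver S y h (r, p, \<omega>) + frozen_drift S h (r, p, \<omega>) else 0)) =
      (LINT r|lborel. indicator {S..t} r * (frozen_driver S y h (r, p, \<omega>) + frozen_drift S h (r, p, \<omega>)))" for \<omega>
    using S by (intro Bochner_Integration.integral_cong) (auto simp: indicator_def)
  ultimately have 1: "(\<lambda>\<omega>. LINT r|lborel. indicator {S..t} r * (frozen_driver S y h (r, p, \<omega>) + frozen_drift S h (r, p, \<omega>))) \<in> borel_measurable ?F"
    by simp
  have "(\<lambda>\<omega>. jump_sum (\<lambda>t. X t \<omega>) (\<lambda>r. (\<lambda>z. if fst z \<in> {0..t} then (if S < fst z then h (fst z, p, snd z) else 0) else 0) (r, \<omega>)) S t) \<in> borel_measurable ?F"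
    by (rule jump_sum_measurable[OF _ _ t(1) _ joint[OF frozen_predictable(2)[OF p]]])
      (use S step_path_X in \<open>auto simp: natural_filtration_eq intro!: measurable_gen_sigma\<close>)
  moreover have "jump_sum (\<lambda>t. X t \<omega>) (\<lambda>r. (\<lambda>z. if fst z \<in> {0..t} then (if S < fst z then h (fst z, p, snd z) else 0) else 0) (r, \<omega>)) S t
      = jump_sum (\<lambda>t. X t \<omega>) (\<lambda>r. if S < r then h (r, p, \<omega>) else 0) S t" for \<omega>
    using S by (intro jump_sum_cong) auto
  ultimately have 2: "(\<lambda>\<omega>. jump_sum (\<lambda>t. X t \<omega>) (\<lambda>r. if S < r then h (r, p, \<omega>) else 0) S t) \<in> borel_measurable ?F"
    by (simp only:)
  have "(\<lambda>\<omega>. c p - (LINT r|lborel. indicator {S..t} r * (frozen_driver S y h (r, p, \<omega>) + frozen_drift S h (r, p, \<omega>))) + jump_sum (\<lambda>t. X t \<omega>) (\<lambda>r. if S < r then h (r, p, \<omega>) else 0) S t) \<in> borel_measurable ?F"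
    by (intro borel_measurable_add borel_measurable_diff borel_measurable_const 1 2)
  then show ?thesis using t by (simp add: frozen_value_def min_def cong: if_cong)
qed

text \<open>A strict excess at \<open>t\<close> would persist to the right by right-continuity and
  be met at a rational time. So the measurable supremum over rational times controls the one over
  all times.\<close>

lemma frozen_value_rational_bound:
  assumes w: "w \<in> space (splice_all P X S)" and frozen_solves: "frozen_solves S \<phi> c y h w"
    and q: "\<And>q. q \<in> \<rat> \<Longrightarrow> S < q \<Longrightarrow> q < T \<Longrightarrow> ennreal ((frozen_value S c y h (q, w))\<^sup>2) \<le> R"
    and t: "S \<le> t" "t < T"
  shows "ennreal ((frozen_value S c y h (t, w))\<^sup>2) \<le> R"
proof (rule ccontr)
  have x: "step_path (\<lambda>t. X t (snd w))" using w by (intro step_path_X) (auto simp: space_pair_measure)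
  assume "\<not> ennreal ((frozen_value S c y h (t, w))\<^sup>2) \<le> R"
  then have gt: "R < ennreal ((frozen_value S c y h (t, w))\<^sup>2)" by simp
  have "((\<lambda>r. frozen_value S c y h (r, w)) \<longlongrightarrow> frozen_value S c y h (t, w)) (at_right t)"
    using sol_path_right[OF x _ frozen_solves_path(3)[OF S c y h w frozen_solves] t] S by simp
  then have "((\<lambda>r. ennreal ((frozen_value S c y h (r, w))\<^sup>2)) \<longlongrightarrow> ennreal ((frozen_value S c y h (t, w))\<^sup>2)) (at_right t)"
    by (intro tendsto_ennrealI tendsto_power)
  from order_tendstoD(1)[OF this gt] obtain b where b: "t < b" "\<And>r. t < r \<Longrightarrow> r < b \<Longrightarrow> R < ennreal ((frozen_value S c y h (r, w))\<^sup>2)"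
    unfolding eventually_at_right_field by auto
  obtain r where r: "r \<in> \<rat>" "t < r" "r < min b T" using Rats_dense_in_real[of t "min b T"] b t by auto
  then have "R < ennreal ((frozen_value S c y h (r, w))\<^sup>2)" by (intro b(2)) auto
  moreover have "ennreal ((frozen_value S c y h (r, w))\<^sup>2) \<le> R" using r t by (intro q) auto
  ultimately show False by simp
qed

end

lemma predictable_nth:
  assumes "predictable P X Z" shows "(\<lambda>z. (case z of (t, \<omega>) \<Rightarrow> Z t \<omega> $ i)) \<in> borel_measurable (predictable_sigma P X)"
  using measurable_vec_nth[OF assms[unfolded predictable_def], of i] by (simp add: case_prod_unfold)

lemma predictable_ex_splice_vec:
  assumes Z: "predictable P X Z" and S: "0 \<le> S"
  shows "\<exists>h\<in>borel_measurable (splice_pred P X S). AE \<omega> in P. \<forall>t\<in>{S<..}. Z t \<omega> = h (t, \<omega>, \<omega>)"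
proof -
  have "\<forall>i. \<exists>h\<in>borel_measurable (splice_pred P X S). AE \<omega> in P. \<forall>t\<in>{S<..}. Z t \<omega> $ i = h (t, \<omega>, \<omega>)"
    using predictable_ex_splice[OF predictable_nth[OF Z] S] by simp
  then obtain H where H: "\<And>i. H i \<in> borel_measurable (splice_pred P X S)"
    "\<And>i. AE \<omega> in P. \<forall>t\<in>{S<..}. Z t \<omega> $ i = H i (t, \<omega>, \<omega>)"
    by (rule choice_obtain) (iprover intro: that)
  have "AE \<omega> in P. \<forall>i\<in>UNIV. \<forall>t\<in>{S<..}. Z t \<omega> $ i = H i (t, \<omega>, \<omega>)"
  proof (rule AE_finite_allI)
    show "AE \<omega> in P. \<forall>t\<in>{S<..}. Z t \<omega> $ i = H i (t, \<omega>, \<omega>)" for i by (rule H(2))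
  qed simp
  then have "AE \<omega> in P. \<forall>t\<in>{S<..}. Z t \<omega> = (\<chi> i. H i (t, \<omega>, \<omega>))"
    by eventually_elim (auto simp: vec_eq_iff)
  then show ?thesis using borel_measurable_vec_lambda[of H, OF H(1)] by (intro bexI[of _ "\<lambda>z. \<chi> i. H i z"])
qed

lemma glued_path:
  fixes \<phi> :: "real^'n \<Rightarrow> real"
  assumes S: "0 < S" "S < T" and w: "\<omega> \<in> space P" and j: "\<omega> \<in> ev S j" and p: "p \<in> space P"
    and c: "c \<in> borel_measurable (natural_filtration P X S)"
    and y: "y \<in> borel_measurable (splice_pred P X S)"
    and h: "h \<in> borel_measurable (splice_pred P X S)"
    and frozen_solves: "frozen_solves S \<phi> c y h (p, \<omega>)"
    and path2: "bsde_path f S (c p) Y2 Z2 \<omega>"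
    and ae: "AE r in lborel. 0 < r \<longrightarrow> r \<le> T \<longrightarrow> f \<omega> r (yp r \<omega>) (zp r \<omega>) = drv (XL r \<omega>) r (yp r \<omega>) (zp r \<omega>)"
    and yp: "\<And>r. S < r \<Longrightarrow> yp r \<omega> = y (r, p, \<omega>)" and zp: "\<And>r. S < r \<Longrightarrow> zp r \<omega> = h (r, p, \<omega>)"
    and Yh: "\<And>t. t < S \<Longrightarrow> Yh t \<omega> = Y2 t \<omega>" "\<And>t. S \<le> t \<Longrightarrow> Yh t \<omega> = frozen_value S c y h (t, p, \<omega>)"
    and Zh: "\<And>t. t \<le> S \<Longrightarrow> Zh t \<omega> = Z2 t \<omega>" "\<And>t. S < t \<Longrightarrow> Zh t \<omega> = zp t \<omega>"
  shows "bsde_path f T (\<phi> (X T \<omega>)) Yh Zh \<omega>"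
proof -
  let ?x = "\<lambda>t. X t \<omega>" and ?F = "\<lambda>r. f \<omega> r (left_lim Yh r \<omega>) (Zh r \<omega>)" and ?D = "drift (\<lambda>r. Zh r \<omega>) \<omega>"
  let ?v = "\<lambda>t. frozen_value S c y h (t, p, \<omega>)"
  have x: "step_path ?x" using w by (rule step_path_X)
  have ww: "(p, \<omega>) \<in> space (splice_all P X S)" using w p by (simp add: space_pair_measure)
  note P = frozen_solves_path[OF S c y h ww frozen_solves, simplified]
  have b2: "(\<lambda>r. f \<omega> r (left_lim Y2 r \<omega>) (Z2 r \<omega>)) absolutely_integrable_on {0..S}"
    and m2: "drift (\<lambda>r. Z2 r \<omega>) \<omega> absolutely_integrable_on {0..S}"
    and e2: "Y2 S \<omega> = c p"
    and s2: "sol_path ?x (\<lambda>r. f \<omega> r (left_lim Y2 r \<omega>) (Z2 r \<omega>) + drift (\<lambda>r. Z2 r \<omega>) \<omega> r) (\<lambda>r. Z2 r \<omega>) 0 S (\<lambda>t. Y2 t \<omega>)"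
    using path2 by (simp_all only: bsde_path_def)
  have l1: "left_lim Yh r \<omega> = left_lim Y2 r \<omega>" if "0 < r" "r \<le> S" for r
    unfolding left_lim_def using that by (intro llim_cong[of 0]) (auto simp: Yh)
  have l2: "left_lim Yh r \<omega> = llim ?v r" if "S < r" for r
    unfolding left_lim_def using that by (intro llim_cong[of S]) (auto simp: Yh)
  have F1: "AE r in lborel. 0 < r \<longrightarrow> r \<le> S \<longrightarrow> f \<omega> r (left_lim Y2 r \<omega>) (Z2 r \<omega>) = ?F r"
    by (intro AE_I2) (simp add: l1 Zh)
  have D1: "AE r in lborel. 0 < r \<longrightarrow> r \<le> S \<longrightarrow> drift (\<lambda>r. Z2 r \<omega>) \<omega> r = ?D r"
    by (intro AE_I2) (simp add: drift_def Zh)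
  have D2: "AE r in lborel. S < r \<longrightarrow> r \<le> T \<longrightarrow> frozen_drift S h (r, p, \<omega>) = ?D r"
    using S by (intro AE_I2) (simp add: frozen_drift_def drift_eq_sum Zh zp)
  have F2: "AE r in lborel. S < r \<longrightarrow> r \<le> T \<longrightarrow> frozen_driver S y h (r, p, \<omega>) = ?F r"
    using ae P(5) AE_not_jump[OF x]
  proof eventually_elim
    case (elim r)
    show ?case
    proof (intro impI)
      assume r: "S < r" "r \<le> T"
      have "llim ?v r = ?v r"
        using sol_path_llim_eq[OF x _ P(3) r elim(3)] S by simp
      then have L: "left_lim Yh r \<omega> = yp r \<omega>" using l2[OF r(1)] elim(2) r yp by simp
      have "?F r = f \<omega> r (yp r \<omega>) (zp r \<omega>)" using L Zh r by simp
      also have "\<dots> = drv (XL r \<omega>) r (yp r \<omega>) (zp r \<omega>)" using elim(1) r S by simp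
      also have "\<dots> = frozen_driver S y h (r, p, \<omega>)" using r yp zp by (simp add: frozen_driver_def)
      finally show "frozen_driver S y h (r, p, \<omega>) = ?F r" by simp
    qed
  qed
  have F: "?F absolutely_integrable_on {0..T}"
    using S by (intro absolutely_integrable_Icc_combine[OF absolutely_integrable_AE_cong(1)[OF b2 F1] absolutely_integrable_AE_cong(1)[OF P(1) F2]]) auto
  have D: "?D absolutely_integrable_on {0..T}"
    using S by (intro absolutely_integrable_Icc_combine[OF absolutely_integrable_AE_cong(1)[OF m2 D1] absolutely_integrable_AE_cong(1)[OF P(2) D2]]) auto
  have YS: "Yh S \<omega> = c p" using Yh(2)[of S] frozen_value_start[OF S c y h, of "(p, \<omega>)"] by simp
  have A1: "sol_path ?x (\<lambda>r. ?F r + ?D r) (\<lambda>r. Zh r \<omega>) 0 S (\<lambda>t. Yh t \<omega>)"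
  proof (rule sol_path_cong[OF s2])
    show "AE r in lborel. 0 < r \<longrightarrow> r \<le> S \<longrightarrow> f \<omega> r (left_lim Y2 r \<omega>) (Z2 r \<omega>) + drift (\<lambda>r. Z2 r \<omega>) \<omega> r = ?F r + ?D r"
      using F1 D1 by eventually_elim simp
    show "Y2 t \<omega> = Yh t \<omega>" if "0 \<le> t" "t \<le> S" for t
      using that Yh(1)[of t] YS e2 by (cases "t = S") auto
  qed (simp add: Zh)
  have A2: "sol_path ?x (\<lambda>r. ?F r + ?D r) (\<lambda>r. Zh r \<omega>) S T (\<lambda>t. Yh t \<omega>)"
  proof (rule sol_path_cong[OF P(3)])
    show "AE r in lborel. S < r \<longrightarrow> r \<le> T \<longrightarrow> frozen_driver S y h (r, p, \<omega>) + frozen_drift S h (r, p, \<omega>) = ?F r + ?D r"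
      using F2 D2 by eventually_elim simp
  qed (simp_all add: Zh zp Yh)
  have "sol_path ?x (\<lambda>r. ?F r + ?D r) (\<lambda>r. Zh r \<omega>) 0 T (\<lambda>t. Yh t \<omega>)"
    by (rule sol_path_combine[OF x order_refl _ _ A1 A2]) (use S in auto)
  moreover have "Yh T \<omega> = \<phi> (X T \<omega>)" using Yh(2)[of T] P(4) S by simp
  ultimately show ?thesis unfolding bsde_path_def using F D by blast
qed

theorem markov_value:
  fixes \<phi> :: "real^'n \<Rightarrow> real"
  assumes S: "0 < S" "S < T" and sol: "bsde_solution P X A f T (\<lambda>\<omega>. \<phi> (X T \<omega>)) Y Z"
  shows "\<exists>k. AE \<omega> in P. \<forall>j. X S \<omega> = axis j 1 \<longrightarrow> Y S \<omega> = k j"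
proof -
  have S0: "0 \<le> S" and T0: "0 \<le> T" using S by auto
  have adapted: "\<And>t. 0 \<le> t \<Longrightarrow> t \<le> T \<Longrightarrow> Y t \<in> borel_measurable (completed_filtration P X t)"
    and Zp: "predictable P X Z"
    and sup: "(\<integral>\<^sup>+ \<omega>. (\<Squnion>t\<in>{0..<T}. ennreal ((Y t \<omega>)\<^sup>2)) \<partial>P) < \<infinity>"
    and path: "AE \<omega> in P. bsde_path f T (\<phi> (X T \<omega>)) Y Z \<omega>"
    using sol unfolding bsde_solution_iff[OF T0] by auto
  obtain c where c: "c \<in> borel_measurable (natural_filtration P X S)" "AE \<omega> in P. Y S \<omega> = c \<omega>"
    using completed_ex_natural_fun[OF adapted[OF S0]] S by auto
  obtain y where y: "y \<in> borel_measurable (splice_pred P X S)" "AE \<omega> in P. \<forall>t\<in>{S<..}. YL Y t \<omega> = y (t, \<omega>, \<omega>)"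
    using predictable_ex_splice[OF YL_predictable[OF adapted] S0] by auto
  obtain h where h: "h \<in> borel_measurable (splice_pred P X S)" "AE \<omega> in P. \<forall>t\<in>{S<..}. Z t \<omega> = h (t, \<omega>, \<omega>)"
    using predictable_ex_splice_vec[OF Zp S0] by auto
  have drvYL: "AE \<omega> in P. AE t in lborel. 0 < t \<longrightarrow> t \<le> T \<longrightarrow> f \<omega> t (YL Y t \<omega>) (Z t \<omega>) = drv (XL t \<omega>) t (YL Y t \<omega>) (Z t \<omega>)"
    by (rule f_eq_drv[OF pred_progressive[OF YL_predictable[OF adapted]] Zp])
  note ctx = S c(1) y(1) h(1)
  define V where "V = frozen_value S c y h"
  define G where "G = frozen_solves S \<phi> c y h"
  define \<rho> where "\<rho> w = (SUP q\<in>\<rat> \<inter> {S<..<T}. ennreal ((V (q, w))\<^sup>2))" for w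
  have diag: "AE \<omega> in P. G (\<omega>, \<omega>) \<and> (\<forall>t. S \<le> t \<longrightarrow> t \<le> T \<longrightarrow> V (t, \<omega>, \<omega>) = Y t \<omega>)"
    using AE_space path c(2) y(2) h(2) drvYL
  proof eventually_elim
    case (elim \<omega>)
    show ?case unfolding G_def V_def
      using frozen_solves_diagonal[where \<phi>=\<phi> and Y=Y and Z=Z, OF ctx elim] by blast
  qed
  have Vsec: "(\<lambda>w. V (t, w)) \<in> borel_measurable (splice_all P X S)" for t
  proof -
    have m: "Pair t \<in> measurable (splice_all P X S) (borel \<Otimes>\<^sub>M splice_all P X S)" by (rule measurable_Pair1') (simp add: space_borel)
    show ?thesis unfolding V_def by (rule measurable_compose[OF m frozen_value_measurable[OF ctx]])
  qed
  have \<rho>_meas: "\<rho> \<in> borel_measurable (splice_all P X S)"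
  proof -
    have "countable (\<rat> \<inter> {S<..<T})" using countable_rat by auto
    moreover have "(\<lambda>w. ennreal ((V (q, w))\<^sup>2)) \<in> borel_measurable (splice_all P X S)" for q using Vsec[of q] by measurable
    ultimately show ?thesis unfolding \<rho>_def[abs_def] by (intro borel_measurable_SUP)
  qed
  have G_sets: "{w \<in> space (splice_all P X S). G w} \<in> sets (splice_all P X S)"
    unfolding G_def by (rule frozen_solves_sets[OF ctx])
  have "\<exists>p\<in>space P. (AE \<omega> in P. \<omega> \<in> ev S j \<longrightarrow> (p, \<omega>) \<in> {w \<in> space (splice_all P X S). G w}) \<and> (\<integral>\<^sup>+\<omega>. indicator (ev S j) \<omega> * \<rho> (p, \<omega>) \<partial>P) < \<infinity>" for j
  proof (rule freeze_past[OF S0 ev_pos[OF S(1)] G_sets \<rho>_meas])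
    show "AE \<omega> in P. \<omega> \<in> ev S j \<longrightarrow> (\<omega>, \<omega>) \<in> {w \<in> space (splice_all P X S). G w}"
      using diag AE_space by eventually_elim (simp add: space_pair_measure)
    have "(\<integral>\<^sup>+\<omega>. indicator (ev S j) \<omega> * \<rho> (\<omega>, \<omega>) \<partial>P) \<le> (\<integral>\<^sup>+ \<omega>. (\<Squnion>t\<in>{0..<T}. ennreal ((Y t \<omega>)\<^sup>2)) \<partial>P)"
    proof (rule nn_integral_mono_AE)
      show "AE \<omega> in P. indicator (ev S j) \<omega> * \<rho> (\<omega>, \<omega>) \<le> (\<Squnion>t\<in>{0..<T}. ennreal ((Y t \<omega>)\<^sup>2))"
        using diag
      proof eventually_elim
        case (elim \<omega>)
        have "\<rho> (\<omega>, \<omega>) \<le> (\<Squnion>t\<in>{0..<T}. ennreal ((Y t \<omega>)\<^sup>2))"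
          unfolding \<rho>_def
        proof (rule SUP_least)
          fix q assume "q \<in> \<rat> \<inter> {S<..<T}"
          then have q: "q \<in> {0..<T}" "V (q, \<omega>, \<omega>) = Y q \<omega>" using elim S by auto
          show "ennreal ((V (q, \<omega>, \<omega>))\<^sup>2) \<le> (\<Squnion>t\<in>{0..<T}. ennreal ((Y t \<omega>)\<^sup>2))"
            unfolding q(2) by (rule SUP_upper[OF q(1)])
        qed
        then show ?case by (auto simp: indicator_def)
      qed
    qed
    also have "\<dots> < \<infinity>" by (rule sup)
    finally show "(\<integral>\<^sup>+\<omega>. indicator (ev S j) \<omega> * \<rho> (\<omega>, \<omega>) \<partial>P) < \<infinity>" .
  qed
  then have "\<forall>j. \<exists>p\<in>space P. (AE \<omega> in P. \<omega> \<in> ev S j \<longrightarrow> G (p, \<omega>)) \<and> (\<integral>\<^sup>+\<omega>. indicator (ev S j) \<omega> * \<rho> (p, \<omega>) \<partial>P) < \<infinity>"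
    by (fastforce elim: eventually_mono)
  then obtain p where p: "\<And>j. p j \<in> space P"
    "\<And>j. (AE \<omega> in P. \<omega> \<in> ev S j \<longrightarrow> G (p j, \<omega>)) \<and> (\<integral>\<^sup>+\<omega>. indicator (ev S j) \<omega> * \<rho> (p j, \<omega>) \<partial>P) < \<infinity>"
    by (rule choice_obtain) (iprover intro: that)
  have pG: "AE \<omega> in P. \<forall>j\<in>UNIV. \<omega> \<in> ev S j \<longrightarrow> G (p j, \<omega>)"
  proof (rule AE_finite_allI)
    show "AE \<omega> in P. \<omega> \<in> ev S j \<longrightarrow> G (p j, \<omega>)" for j using p(2) by (rule conjunct1)
  qed simp
  \<comment> \<open>Patching over the states at time \<open>S\<close>: on \<open>ev S k\<close> the
    past \<open>p k\<close> is used. The indicators are known at \<open>S\<close>, so adaptedness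
    and predictability are kept.\<close>
  define Vp where "Vp t \<omega> = (\<Sum>k\<in>UNIV. indicator (ev S k) \<omega> *\<^sub>R V (t, p k, \<omega>))" for t \<omega>
  define yp where "yp t \<omega> = (\<Sum>k\<in>UNIV. indicator (ev S k) \<omega> *\<^sub>R (if S < t then y (t, p k, \<omega>) else 0))" for t \<omega>
  define zp where "zp t \<omega> = (\<Sum>k\<in>UNIV. indicator (ev S k) \<omega> *\<^sub>R (if S < t then h (t, p k, \<omega>) else 0))" for t \<omega>
  define R where "R \<omega> = (\<Sum>k\<in>UNIV. indicator (ev S k) \<omega> * \<rho> (p k, \<omega>))" for \<omega>
  have sel: "Vp t \<omega> = V (t, p j, \<omega>)" "yp t \<omega> = (if S < t then y (t, p j, \<omega>) else 0)" "zp t \<omega> = (if S < t then h (t, p j, \<omega>) else 0)"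
    if "\<omega> \<in> ev S j" for t \<omega> j
    unfolding Vp_def yp_def zp_def by (rule sum_ev_select[OF that])+
  have ev_pred: "{S<..} \<times> ev S k \<in> sets (nat_pred P X)" for k
    by (rule nat_filt.pred_tail[OF S0 ev_natural[OF S0 order_refl]])
  have yp_meas: "(\<lambda>(t, \<omega>). yp t \<omega>) \<in> borel_measurable (predictable_sigma P X)"
  proof -
    have "(\<lambda>z. \<Sum>k\<in>UNIV. indicator ({S<..} \<times> ev S k) z *\<^sub>R (if S < fst z then y (fst z, p k, snd z) else 0)) \<in> borel_measurable (nat_pred P X)"
      by (intro borel_measurable_sum borel_measurable_scaleR borel_measurable_indicator ev_pred frozen_predictable(1)[OF ctx p(1)])
    moreover have "(\<lambda>z. \<Sum>k\<in>UNIV. indicator ({S<..} \<times> ev S k) z *\<^sub>R (if S < fst z then y (fst z, p k, snd z) else 0)) = (\<lambda>(t, \<omega>). yp t \<omega>)"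
    proof -
      have "indicator ({S<..} \<times> ev S k) z *\<^sub>R (if S < fst z then y (fst z, p k, snd z) else 0) =
          indicator (ev S k) (snd z) *\<^sub>R (if S < fst z then y (fst z, p k, snd z) else 0)" for k z
        by (cases z) (simp add: indicator_def)
      then show ?thesis by (simp only: yp_def case_prod_unfold)
    qed
    ultimately show ?thesis by (simp only: nat_pred_predictable)
  qed
  have zp_meas: "(\<lambda>(t, \<omega>). zp t \<omega>) \<in> borel_measurable (predictable_sigma P X)"
  proof -
    have "(\<lambda>z. \<Sum>k\<in>UNIV. indicator ({S<..} \<times> ev S k) z *\<^sub>R (if S < fst z then h (fst z, p k, snd z) else 0)) \<in> borel_measurable (nat_pred P X)"
      by (intro borel_measurable_sum borel_measurable_scaleR borel_measurable_indicator ev_pred frozen_predictable(2)[OF ctx p(1)])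
    moreover have "(\<lambda>z. \<Sum>k\<in>UNIV. indicator ({S<..} \<times> ev S k) z *\<^sub>R (if S < fst z then h (fst z, p k, snd z) else 0)) = (\<lambda>(t, \<omega>). zp t \<omega>)"
    proof -
      have "indicator ({S<..} \<times> ev S k) z *\<^sub>R (if S < fst z then h (fst z, p k, snd z) else 0) =
          indicator (ev S k) (snd z) *\<^sub>R (if S < fst z then h (fst z, p k, snd z) else 0)" for k z
        by (cases z) (simp add: indicator_def)
      then show ?thesis by (simp only: zp_def case_prod_unfold)
    qed
    ultimately show ?thesis by (simp only: nat_pred_predictable)
  qed
  have Vp_adapted: "Vp t \<in> borel_measurable (completed_filtration P X t)" if "S \<le> t" "t \<le> T" for t
  proof -
    have "Vp t \<in> borel_measurable (natural_filtration P X t)"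
      unfolding Vp_def[abs_def] V_def using that
      by (intro borel_measurable_sum borel_measurable_scaleR borel_measurable_indicator ev_natural[OF S0] frozen_value_adapted[OF ctx p(1)])
    then show ?thesis by (rule measurable_from_subset) (simp_all add: natural_sub_completed)
  qed
  define \<xi> where "\<xi> = (\<lambda>x :: real^'n. \<Sum>k\<in>UNIV. x $ k * c (p k))"
  have \<xi>: "\<xi> (X S \<omega>) = c (p j)" if "\<omega> \<in> ev S j" for \<omega> j
  proof -
    have "axis j 1 $ k * c (p k) = (if k = j then c (p k) else 0)" for k by (simp add: axis_def)
    then show ?thesis using that by (simp add: \<xi>_def ev_def)
  qed
  obtain Y2 Z2 where sol2: "bsde_solution P X A f S (\<lambda>\<omega>. \<xi> (X S \<omega>)) Y2 Z2"
    using well_posed[OF S(1) less_imp_le[OF S(2)] terminal_square_integrable[OF S0, of \<xi>]]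
    unfolding bsde_uniquely_solvable_def by blast
  then have adapted2: "\<And>t. 0 \<le> t \<Longrightarrow> t \<le> S \<Longrightarrow> Y2 t \<in> borel_measurable (completed_filtration P X t)"
    and Z2p: "predictable P X Z2"
    and sup2: "(\<integral>\<^sup>+ \<omega>. (\<Squnion>t\<in>{0..<S}. ennreal ((Y2 t \<omega>)\<^sup>2)) \<partial>P) < \<infinity>"
    and path2: "AE \<omega> in P. bsde_path f S (\<xi> (X S \<omega>)) Y2 Z2 \<omega>"
    unfolding bsde_solution_iff[OF S0] by auto
  define Yh where "Yh t \<omega> = (if t < S then Y2 t \<omega> else Vp t \<omega>)" for t \<omega>
  define Zh where "Zh t \<omega> = (if t \<le> S then Z2 t \<omega> else zp t \<omega>)" for t \<omega>
  have "bsde_solution P X A f T (\<lambda>\<omega>. \<phi> (X T \<omega>)) Yh Zh"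
    unfolding bsde_solution_iff[OF T0]
  proof (intro conjI ballI)
    fix t assume t: "t \<in> {0..T}"
    show "Yh t \<in> borel_measurable (completed_filtration P X t)"
    proof (cases "t < S")
      case True
      then have "Yh t = Y2 t" by (auto simp: Yh_def fun_eq_iff)
      then show ?thesis using adapted2 t True by simp
    next
      case False
      then have "Yh t = Vp t" by (auto simp: Yh_def fun_eq_iff)
      then show ?thesis using Vp_adapted t False by simp
    qed
  next
    have [measurable]: "fst \<in> borel_measurable (predictable_sigma P X)"
      unfolding predictable_sigma_eq by (rule comp_filt.pred_measurable_time)
    have "(\<lambda>z. if fst z \<le> S then (\<lambda>(t, \<omega>). Z2 t \<omega>) z else (\<lambda>(t, \<omega>). zp t \<omega>) z) \<in> borel_measurable (predictable_sigma P X)"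
      by (rule measurable_If[OF Z2p[unfolded predictable_def] zp_meas]) measurable
    moreover have "(\<lambda>z. if fst z \<le> S then (\<lambda>(t, \<omega>). Z2 t \<omega>) z else (\<lambda>(t, \<omega>). zp t \<omega>) z) = (\<lambda>(t, \<omega>). Zh t \<omega>)"
      by (auto simp: Zh_def fun_eq_iff)
    ultimately show "predictable P X Zh" unfolding predictable_def by (simp only:)
  next
    have R_meas: "R \<in> borel_measurable P"
    proof -
      have "(\<lambda>\<omega>. \<rho> (p k, \<omega>)) \<in> borel_measurable P" for k
      proof -
        have m: "Pair (p k) \<in> measurable (gen_sigma P X {S..}) (splice_all P X S)"
          using p(1) by (intro measurable_Pair1') simp
        show ?thesis
          by (rule measurable_from_subset[OF measurable_compose[OF m \<rho>_meas] gen_sub]) (use S in auto)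
      qed
      then show ?thesis unfolding R_def[abs_def] using S0 by measurable
    qed
    have "(\<integral>\<^sup>+\<omega>. R \<omega> \<partial>P) = (\<Sum>k\<in>UNIV. \<integral>\<^sup>+\<omega>. indicator (ev S k) \<omega> * \<rho> (p k, \<omega>) \<partial>P)"
      unfolding R_def
    proof (rule nn_integral_sum)
      fix k
      have m: "Pair (p k) \<in> measurable (gen_sigma P X {S..}) (splice_all P X S)"
        using p(1) by (intro measurable_Pair1') simp
      have "(\<lambda>\<omega>. \<rho> (p k, \<omega>)) \<in> borel_measurable P"
        by (rule measurable_from_subset[OF measurable_compose[OF m \<rho>_meas] gen_sub]) (use S in auto)
      then show "(\<lambda>\<omega>. indicator (ev S k) \<omega> * \<rho> (p k, \<omega>)) \<in> borel_measurable P" using S0 by measurable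
    qed
    also have "\<dots> < \<infinity>" using p(2) by (simp add: less_top)
    finally have R_fin: "(\<integral>\<^sup>+\<omega>. R \<omega> \<partial>P) < \<infinity>" .
    have "(\<integral>\<^sup>+ \<omega>. (\<Squnion>t\<in>{0..<T}. ennreal ((Yh t \<omega>)\<^sup>2)) \<partial>P) \<le> (\<integral>\<^sup>+ \<omega>. (\<Squnion>t\<in>{0..<S}. ennreal ((Y2 t \<omega>)\<^sup>2)) + R \<omega> \<partial>P)"
    proof (rule nn_integral_mono_AE)
      show "AE \<omega> in P. (\<Squnion>t\<in>{0..<T}. ennreal ((Yh t \<omega>)\<^sup>2)) \<le> (\<Squnion>t\<in>{0..<S}. ennreal ((Y2 t \<omega>)\<^sup>2)) + R \<omega>"
        using pG AE_space
      proof eventually_elim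
        case (elim \<omega>)
        obtain j where j: "\<omega> \<in> ev S j" using ev_partition[OF S0 elim(2)] by blast
        then have G: "frozen_solves S \<phi> c y h (p j, \<omega>)" using elim(1) by (auto simp: G_def)
        have ww: "(p j, \<omega>) \<in> space (splice_all P X S)" using p(1) elim(2) by (simp add: space_pair_measure)
        have R: "\<rho> (p j, \<omega>) \<le> R \<omega>"
        proof -
          have "\<rho> (p j, \<omega>) = indicator (ev S j) \<omega> * \<rho> (p j, \<omega>)" using j by simp
          also have "\<dots> \<le> R \<omega>" unfolding R_def by (rule member_le_sum) auto
          finally show ?thesis .
        qed
        show ?case
        proof (rule SUP_least)
          fix t assume t: "t \<in> {0..<T}"
          show "ennreal ((Yh t \<omega>)\<^sup>2) \<le> (\<Squnion>t\<in>{0..<S}. ennreal ((Y2 t \<omega>)\<^sup>2)) + R \<omega>"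
          proof (cases "t < S")
            case True
            then have "ennreal ((Yh t \<omega>)\<^sup>2) \<le> (\<Squnion>t\<in>{0..<S}. ennreal ((Y2 t \<omega>)\<^sup>2))"
              using t by (auto simp: Yh_def intro!: SUP_upper)
            then show ?thesis by (rule order_trans) simp
          next
            case False
            have "ennreal ((frozen_value S c y h (t, p j, \<omega>))\<^sup>2) \<le> \<rho> (p j, \<omega>)"
            proof (rule frozen_value_rational_bound[OF ctx ww G])
              fix q :: real assume "q \<in> \<rat>" "S < q" "q < T"
              then show "ennreal ((frozen_value S c y h (q, p j, \<omega>))\<^sup>2) \<le> \<rho> (p j, \<omega>)"
                unfolding \<rho>_def V_def by (intro SUP_upper) auto
            qed (use False t in auto)
            then have "ennreal ((Yh t \<omega>)\<^sup>2) \<le> R \<omega>" using False R sel(1)[OF j] by (simp add: Yh_def V_def)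
            then show ?thesis by (rule order_trans) simp
          qed
        qed
      qed
    qed
    \<comment> \<open>The supremum of the squares of \<open>Y2\<close> may be nonmeasurable; only
      \<open>R\<close> has to be measurable here.\<close>
    also have "\<dots> \<le> (\<integral>\<^sup>+ \<omega>. (\<Squnion>t\<in>{0..<S}. ennreal ((Y2 t \<omega>)\<^sup>2)) \<partial>P) + (\<integral>\<^sup>+ \<omega>. R \<omega> \<partial>P)"
      by (rule nn_integral_add_le[OF R_meas])
    also have "\<dots> < \<infinity>" using sup2 R_fin by simp
    finally show "(\<integral>\<^sup>+ \<omega>. (\<Squnion>t\<in>{0..<T}. ennreal ((Yh t \<omega>)\<^sup>2)) \<partial>P) < \<infinity>" .
  next
    have drvp: "AE \<omega> in P. AE t in lborel. 0 < t \<longrightarrow> t \<le> T \<longrightarrow> f \<omega> t (yp t \<omega>) (zp t \<omega>) = drv (XL t \<omega>) t (yp t \<omega>) (zp t \<omega>)"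
      by (rule f_eq_drv[OF pred_progressive[OF yp_meas]]) (simp add: predictable_def zp_meas)
    show "AE \<omega> in P. bsde_path f T (\<phi> (X T \<omega>)) Yh Zh \<omega>"
      using pG path2 drvp AE_space
    proof eventually_elim
      case (elim \<omega>)
      obtain j where j: "\<omega> \<in> ev S j" using ev_partition[OF S0 elim(4)] by blast
      then have G: "frozen_solves S \<phi> c y h (p j, \<omega>)" using elim(1) by (auto simp: G_def)
      show ?case
      proof (rule glued_path[OF S elim(4) j p(1) c(1) y(1) h(1) G, where yp=yp and zp=zp and ?Y2.0=Y2 and ?Z2.0=Z2])
        show "bsde_path f S (c (p j)) Y2 Z2 \<omega>" using elim(2) \<xi>[OF j] by simp
        show "AE r in lborel. 0 < r \<longrightarrow> r \<le> T \<longrightarrow> f \<omega> r (yp r \<omega>) (zp r \<omega>) = drv (XL r \<omega>) r (yp r \<omega>) (zp r \<omega>)"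
          by (rule elim(3))
      qed (auto simp: sel[OF j] Yh_def Zh_def V_def)
    qed
  qed
  \<comment> \<open>Uniqueness. At time \<open>S\<close> the glued solution is
    \<open>c (p j)\<close> on \<open>ev S j\<close>, which is deterministic.\<close>
  then have "AE \<omega> in P. \<forall>t\<in>{0..T}. Y t \<omega> = Yh t \<omega>"
    using well_posed[OF T_pos order_refl terminal_square_integrable[OF T0, of \<phi>]] sol
    unfolding bsde_uniquely_solvable_def by blast
  then have "AE \<omega> in P. \<forall>j. X S \<omega> = axis j 1 \<longrightarrow> Y S \<omega> = c (p j)"
    using AE_space
  proof eventually_elim
    case (elim \<omega>)
    show ?case
    proof (intro allI impI)
      fix j assume "X S \<omega> = axis j 1"
      then have j: "\<omega> \<in> ev S j" using elim(2) by (simp add: ev_def)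
      have "Y S \<omega> = Yh S \<omega>" using elim(1) S by auto
      also have "\<dots> = c (p j)" using sel(1)[OF j, of S] frozen_value_start[OF ctx, of "(p j, \<omega>)"] by (simp add: Yh_def V_def)
      finally show "Y S \<omega> = c (p j)" .
    qed
  qed
  then show ?thesis by (intro exI[of _ "\<lambda>j. c (p j)"])
qed

end

section \<open>The value function\<close>

context prob_space
begin

lemma AE_dt_dP_omega:
  assumes "AE \<omega> in M. Q \<omega>" shows "AE (t, \<omega>) in dt_dP M S. Q \<omega>"
proof -
  interpret D: pair_sigma_finite "restrict_space lborel {0<..S::real}" M by (rule dt_dP_pair)
  obtain N where N: "{\<omega> \<in> space M. \<not> Q \<omega>} \<subseteq> N" "emeasure M N = 0" "N \<in> sets M" using AE_E[OF assms] by auto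
  have "AE x in restrict_space lborel {0<..S} \<Otimes>\<^sub>M M. snd x \<notin> N"
  proof (rule D.AE_pair_measure)
    show "{x \<in> space (restrict_space lborel {0<..S} \<Otimes>\<^sub>M M). snd x \<notin> N} \<in> sets (restrict_space lborel {0<..S} \<Otimes>\<^sub>M M)"
      using N(3) by measurable
    have "AE \<omega> in M. \<omega> \<notin> N" using N by (intro AE_not_in) auto
    then show "AE x in restrict_space lborel {0<..S}. AE y in M. snd (x, y) \<notin> N" by simp
  qed
  then have "AE x in dt_dP M S. Q (snd x)"
    unfolding dt_dP_def using AE_space
    by eventually_elim (use N(1) in \<open>auto simp: space_pair_measure\<close>)
  then show ?thesis by (simp add: case_prod_unfold)
qed

end

lemma eventually_rational_in:
  assumes "\<forall>\<^sub>F r in at_right t. Q r" "t < T"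
  obtains r :: real where "r \<in> \<rat>" "t < r" "r < T" "Q r"
proof -
  obtain b where b: "t < b" "\<And>r. t < r \<Longrightarrow> r < b \<Longrightarrow> Q r"
    using assms(1) unfolding eventually_at_right_field by auto
  obtain r where "r \<in> \<rat>" "t < r" "r < min b T" using Rats_dense_in_real[of t "min b T"] b assms(2) by auto
  then show thesis using b by (intro that[of r]) auto
qed

context markov_chain
begin

text \<open>When the squares on the right are expanded, the term with the square of
  \<open>z $ j\<close> drops out because the columns of \<open>A\<close> sum to zero.\<close>

lemma M_norm_sq_eq:
  assumes t: "0 < t" and j: "XL t \<omega> = axis j 1"
  shows "M_norm_sq X A t \<omega> z = (\<Sum>i\<in>UNIV. A t $ i $ j * (z $ i - z $ j)\<^sup>2)"
proof -
  have ll: "left_lim X t \<omega> = axis j 1" using j t by (simp add: XL_def)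
  have d: "(diag v *v y) $ i = v $ i * y $ i" for v y :: "real^'n" and i
  proof -
    have "diag v $ i $ k * y $ k = (if k = i then v $ i * y $ i else 0)" for k by (simp add: diag_def)
    then show ?thesis by (simp add: matrix_vector_mult_def)
  qed
  have ax: "axis j 1 $ i = (if i = j then 1 else 0 :: real)" for i by (simp add: axis_def)
  have axz: "axis j 1 $ k * z $ k = (if k = j then z $ j else 0)" for k by (simp add: axis_def)
  have e1: "((A t ** diag (axis j 1)) *v z) $ i = A t $ i $ j * z $ j" for i
    by (simp add: matrix_vector_mul_assoc[symmetric] d matrix_vector_mult_def[of "A t"] axz if_distrib cong: if_cong)
  have e2: "((diag (axis j 1) ** transpose (A t)) *v z) $ i = (if i = j then \<Sum>k\<in>UNIV. A t $ k $ j * z $ k else 0)" for i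
  proof -
    have "((diag (axis j 1) ** transpose (A t)) *v z) $ i = axis j 1 $ i * (transpose (A t) *v z) $ i"
      by (simp only: matrix_vector_mul_assoc[symmetric] d)
    then show ?thesis by (simp add: ax matrix_vector_mult_def transpose_def)
  qed
  have "M_norm_sq X A t \<omega> z = (\<Sum>i\<in>UNIV. z $ i * (A t $ i $ j * z $ i - A t $ i $ j * z $ j - (if i = j then \<Sum>k\<in>UNIV. A t $ k $ j * z $ k else 0)))"
    unfolding M_norm_sq_def bracket_density_def ll inner_vec_def
    by (simp add: matrix_vector_mult_diff_rdistrib d e1 e2 matrix_axis)
  also have "\<dots> = (\<Sum>i\<in>UNIV. A t $ i $ j * (z $ i * z $ i)) - z $ j * (\<Sum>i\<in>UNIV. A t $ i $ j * z $ i) - z $ j * (\<Sum>k\<in>UNIV. A t $ k $ j * z $ k)"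
  proof -
    have "(\<Sum>i\<in>UNIV. z $ i * (if i = j then \<Sum>k\<in>UNIV. A t $ k $ j * z $ k else 0)) = z $ j * (\<Sum>k\<in>UNIV. A t $ k $ j * z $ k)"
      by (simp add: if_distrib cong: if_cong)
    then show ?thesis
      by (simp only: right_diff_distrib sum_subtractf) (simp add: sum_distrib_left algebra_simps)
  qed
  also have "\<dots> = (\<Sum>i\<in>UNIV. A t $ i $ j * (z $ i - z $ j)\<^sup>2)"
  proof -
    have "(\<Sum>i\<in>UNIV. A t $ i $ j * (z $ i - z $ j)\<^sup>2) = (\<Sum>i\<in>UNIV. A t $ i $ j * (z $ i * z $ i)) - 2 * (z $ j * (\<Sum>i\<in>UNIV. A t $ i $ j * z $ i)) + (z $ j)\<^sup>2 * (\<Sum>i\<in>UNIV. A t $ i $ j)"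
      by (simp add: sum_distrib_left sum.distrib[symmetric] sum_subtractf[symmetric] power2_eq_square algebra_simps)
    then show ?thesis using column_sum_A[of t j] t by simp
  qed
  finally show ?thesis .
qed

lemma M_norm_sq_zero_iff:
  assumes t: "0 < t" and j: "XL t \<omega> = axis j 1"
  shows "M_norm_sq X A t \<omega> z = 0 \<longleftrightarrow> (\<forall>i. A t $ i $ j * (z $ i - z $ j) = 0)"
proof -
  have "0 \<le> A t $ i $ j * (z $ i - z $ j)\<^sup>2" for i
    using nonneg_A[of t i j] t by (cases "i = j") auto
  then show ?thesis unfolding M_norm_sq_eq[OF assms] by (subst sum_nonneg_eq_0_iff) auto
qed

text \<open>Since columns sum to zero, the drift sees only the differences
  \<open>z $ i - z $ j\<close> weighted by the rates, and these are what the seminorm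
  controls.\<close>

lemma inner_A_eq:
  assumes t: "0 < t" and j: "XL t \<omega> = axis j 1" and 0: "M_norm_sq X A t \<omega> (z - z') = 0"
  shows "z \<bullet> (A t *v left_lim X t \<omega>) = z' \<bullet> (A t *v left_lim X t \<omega>)"
proof -
  let ?d = "z - z'"
  have "(\<Sum>i\<in>UNIV. ?d $ i * A t $ i $ j) = (\<Sum>i\<in>UNIV. ?d $ j * A t $ i $ j)"
  proof (intro sum.cong refl)
    fix i
    have "A t $ i $ j * (?d $ i - ?d $ j) = 0" using 0 unfolding M_norm_sq_zero_iff[OF t j] by blast
    then show "?d $ i * A t $ i $ j = ?d $ j * A t $ i $ j" by (cases "A t $ i $ j = 0") simp_all
  qed
  also have "\<dots> = 0" using column_sum_A[of t j] t by (simp add: sum_distrib_left[symmetric])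
  finally have "?d \<bullet> (A t *v left_lim X t \<omega>) = 0" using inner_AXL[OF j t] by simp
  then show ?thesis by (simp add: inner_diff_left)
qed

lemma exists_in_ev:
  assumes "AE \<omega> in P. Q \<omega>" "0 < prob (ev t i)" "0 \<le> t"
  shows "\<exists>\<omega>\<in>ev t i. Q \<omega>"
proof (rule ccontr)
  assume "\<not> (\<exists>\<omega>\<in>ev t i. Q \<omega>)"
  with assms(1) have "AE \<omega> in P. \<omega> \<notin> ev t i" by (auto elim: eventually_mono)
  then have "prob (ev t i) = 0" using assms(3) by (subst prob_eq_0) auto
  then show False using assms(2) by simp
qed

end

locale markov_bsde_solution = markov_bsde P X A f ft T
  for P :: "'a measure" and X :: "real \<Rightarrow> 'a \<Rightarrow> real^'n" and A f ft T +
  fixes \<phi> :: "real^'n \<Rightarrow> real" and Y :: "real \<Rightarrow> 'a \<Rightarrow> real" and Z :: "real \<Rightarrow> 'a \<Rightarrow> real^'n"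
  assumes solution: "bsde_solution P X A f T (\<lambda>\<omega>. \<phi> (X T \<omega>)) Y Z"
begin

lemma T0: "0 \<le> T" using T_pos by simp

lemma sol_adapted: "0 \<le> t \<Longrightarrow> t \<le> T \<Longrightarrow> Y t \<in> borel_measurable (completed_filtration P X t)"
  and sol_Z: "predictable P X Z"
  and sol_AE: "AE \<omega> in P. bsde_path f T (\<phi> (X T \<omega>)) Y Z \<omega>"
  using solution unfolding bsde_solution_iff[OF T0] by auto

text \<open>For 0 < t < T the choice picks the almost sure value of \<open>Y t\<close> on {X t =
  e_i}. It exists by \<open>markov_value\<close> and is unique as the event has positive
  probability.\<close>

definition val :: "real \<Rightarrow> 'n \<Rightarrow> real" where
  "val t i = (if T \<le> t then \<phi> (axis i 1) else SOME k. AE \<omega> in P. X t \<omega> = axis i 1 \<longrightarrow> Y t \<omega> = k)"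

text \<open>At time \<open>0\<close> the limit exists for the initial state; for the other states it may be a junk
  value.\<close>

definition val_vec :: "real \<Rightarrow> real^'n" where
  "val_vec t = (\<chi> i. if t \<le> 0 then Lim (at_right 0) (\<lambda>s. val s i) else val t i)"

lemma val_vec_val: "0 < t \<Longrightarrow> val_vec t $ i = val t i"
  by (simp add: val_vec_def)

lemma val_vec_AE:
  assumes t: "0 < t" "t \<le> T" shows "AE \<omega> in P. \<forall>i. X t \<omega> = axis i 1 \<longrightarrow> Y t \<omega> = val_vec t $ i"
proof (cases "t = T")
  case True
  show ?thesis using sol_AE by eventually_elim (use T_pos True in \<open>auto simp: bsde_path_def val_vec_val val_def\<close>)
next
  case False
  then have "t < T" using t by simp
  then obtain k where k: "AE \<omega> in P. \<forall>j. X t \<omega> = axis j 1 \<longrightarrow> Y t \<omega> = k j"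
    using markov_value[OF t(1) _ solution] by blast
  have "AE \<omega> in P. X t \<omega> = axis i 1 \<longrightarrow> Y t \<omega> = val t i" for i
  proof -
    have "AE \<omega> in P. X t \<omega> = axis i 1 \<longrightarrow> Y t \<omega> = k i" using k by eventually_elim blast
    then have "AE \<omega> in P. X t \<omega> = axis i 1 \<longrightarrow> Y t \<omega> = (SOME k. AE \<omega> in P. X t \<omega> = axis i 1 \<longrightarrow> Y t \<omega> = k)" by (rule someI)
    then show ?thesis using \<open>t < T\<close> by (simp add: val_def)
  qed
  then have "AE \<omega> in P. \<forall>i\<in>UNIV. X t \<omega> = axis i 1 \<longrightarrow> Y t \<omega> = val t i" by (intro AE_finite_allI) simp_all
  then show ?thesis using t by (simp add: val_vec_val)
qed

text \<open>Paths outside a single null set. The values are demanded at rational times, where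
  countably many null sets occur; continuity extends them later.\<close>

definition good :: "'a \<Rightarrow> bool" where
  "good \<omega> \<longleftrightarrow> \<omega> \<in> space P \<and> bsde_path f T (\<phi> (X T \<omega>)) Y Z \<omega> \<and>
     (\<forall>q\<in>\<rat> \<inter> {0<..T}. \<forall>i. X q \<omega> = axis i 1 \<longrightarrow> Y q \<omega> = val_vec q $ i)"

lemma AE_good: "AE \<omega> in P. good \<omega>"
proof -
  have "AE \<omega> in P. \<forall>q\<in>\<rat> \<inter> {0<..T}. \<forall>i. X q \<omega> = axis i 1 \<longrightarrow> Y q \<omega> = val_vec q $ i"
    using val_vec_AE countable_rat by (subst AE_ball_countable) auto
  with sol_AE AE_space show ?thesis by eventually_elim (simp add: good_def)
qed

abbreviation "gg \<omega> r \<equiv> f \<omega> r (left_lim Y r \<omega>) (Z r \<omega>) + drift (\<lambda>r. Z r \<omega>) \<omega> r"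

lemma good_sol_path:
  assumes "good \<omega>" shows "step_path (\<lambda>t. X t \<omega>)" "sol_path (\<lambda>t. X t \<omega>) (gg \<omega>) (\<lambda>r. Z r \<omega>) 0 T (\<lambda>t. Y t \<omega>)"
  using assms step_path_X by (auto simp: good_def bsde_path_def)

lemma good_smooth:
  assumes "good \<omega>" and no: "\<And>r. s < r \<Longrightarrow> r \<le> t \<Longrightarrow> r \<notin> jumps (\<lambda>t. X t \<omega>)" and st: "0 \<le> s" "s \<le> t" "t \<le> T"
  shows "Y t \<omega> - Y s \<omega> = - integral {s..t} (gg \<omega>)"
proof -
  have "jumps (\<lambda>t. X t \<omega>) \<inter> {s<..t} = {}" using no by auto
  then have "jump_sum (\<lambda>t. X t \<omega>) (\<lambda>r. Z r \<omega>) s t = 0" by (simp add: jump_sum_def)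
  then show ?thesis
    using sol_path_diff[OF good_sol_path(1)[OF assms(1)] order_refl good_sol_path(2)[OF assms(1)] st] by simp
qed

text \<open>{X s = e_i} has positive probability and there is almost surely no jump at
  \<open>s\<close>, so any almost sure property holds on some path that sits in \<open>i\<close>
  just before and at \<open>s\<close>. Statements about \<open>val_vec\<close> are proved along such
  witnesses.\<close>

lemma good_exists:
  assumes s: "0 < s" "s \<le> T" and Q: "AE \<omega> in P. Q \<omega>"
  obtains \<omega> where "good \<omega>" "X s \<omega> = axis i 1" "XL s \<omega> = axis i 1" "Y s \<omega> = val_vec s $ i" "Q \<omega>"
proof -
  have "AE \<omega> in P. good \<omega> \<and> XL s \<omega> = X s \<omega> \<and> (\<forall>i. X s \<omega> = axis i 1 \<longrightarrow> Y s \<omega> = val_vec s $ i) \<and> Q \<omega>"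
    using AE_good no_fixed_jump[OF s(1)] val_vec_AE[OF s] Q by eventually_elim simp
  from exists_in_ev[OF this ev_pos[OF s(1)], of i] s
  obtain \<omega> where "\<omega> \<in> ev s i" "good \<omega> \<and> XL s \<omega> = X s \<omega> \<and> (\<forall>i. X s \<omega> = axis i 1 \<longrightarrow> Y s \<omega> = val_vec s $ i) \<and> Q \<omega>" by auto
  then show thesis by (intro that[of \<omega>]) (auto simp: ev_def)
qed

text \<open>Around \<open>s\<close> the witness stays in \<open>i\<close> without jumps. There
  \<open>Y\<close> is continuous and takes the values \<open>val_vec q $ i\<close> at rational
  \<open>q\<close>.\<close>

lemma val_vec_rational_limit:
  assumes s: "0 < s" "s \<le> T" and e: "0 < e"
  shows "\<exists>d>0. \<forall>q\<in>\<rat>. 0 < q \<longrightarrow> q \<le> T \<longrightarrow> \<bar>q - s\<bar> < d \<longrightarrow> \<bar>val_vec q $ i - val_vec s $ i\<bar> < e"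
proof -
  obtain \<omega> where w: "good \<omega>" "X s \<omega> = axis i 1" "XL s \<omega> = axis i 1" "Y s \<omega> = val_vec s $ i"
    using good_exists[OF s, of "\<lambda>_. True" i] by auto
  note x = good_sol_path(1)[OF w(1)] and sp = good_sol_path(2)[OF w(1)]
  obtain d1 where d1: "0 < d1" "d1 \<le> s" "\<And>r. \<bar>r - s\<bar> < d1 \<Longrightarrow> X r \<omega> = axis i 1" "\<And>r. \<bar>r - s\<bar> < d1 \<Longrightarrow> llim (\<lambda>t. X t \<omega>) r = axis i 1"
    by (rule constant_nearby[OF x s(1), of "axis i 1"]) (use w s in \<open>auto simp: XL_eq\<close>)
  have nojump: "r \<notin> jumps (\<lambda>t. X t \<omega>)" if "\<bar>r - s\<bar> < d1" for r using d1(3,4)[OF that] by (simp add: jumps_def)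
  have cont: "continuous_on {0..T} (\<lambda>t. integral {0..t} (gg \<omega>))"
    by (rule indefinite_integral_continuous_1[OF sol_path_integrable[OF x order_refl sp]])
  then obtain d2 where d2: "0 < d2" "\<And>r. r \<in> {0..T} \<Longrightarrow> \<bar>r - s\<bar> < d2 \<Longrightarrow> \<bar>integral {0..r} (gg \<omega>) - integral {0..s} (gg \<omega>)\<bar> < e"
    unfolding continuous_on_iff using s e by (force simp: dist_real_def)
  have split: "integral {0..b} (gg \<omega>) - integral {0..a} (gg \<omega>) = integral {a..b} (gg \<omega>)" if "0 \<le> a" "a \<le> b" "b \<le> T" for a b
  proof -
    have "gg \<omega> absolutely_integrable_on {0..b}"
      by (rule absolutely_integrable_Icc_subset[OF sol_path_abs[OF x order_refl sp]]) (use that in auto)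
    then show ?thesis using integrable_on_split_abs[OF _ that(1,2), of "gg \<omega>"] by simp
  qed
  show ?thesis
  proof (intro exI[of _ "min d1 d2"] conjI ballI impI)
    fix q assume q: "q \<in> \<rat>" "0 < q" "q \<le> T" "\<bar>q - s\<bar> < min d1 d2"
    have "Y q \<omega> = val_vec q $ i" using w(1) q d1(3)[of q] by (auto simp: good_def)
    moreover have "\<bar>Y q \<omega> - Y s \<omega>\<bar> < e"
    proof (cases "q \<le> s")
      case True
      have "Y s \<omega> - Y q \<omega> = - integral {q..s} (gg \<omega>)"
        by (rule good_smooth[OF w(1) nojump]) (use q True s in auto)
      then show ?thesis using d2(2)[of q] split[of q s] q s True by auto
    next
      case False
      have "Y q \<omega> - Y s \<omega> = - integral {s..q} (gg \<omega>)"
        by (rule good_smooth[OF w(1) nojump]) (use q False s in auto)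
      then show ?thesis using d2(2)[of q] split[of s q] q s False by auto
    qed
    ultimately show "\<bar>val_vec q $ i - val_vec s $ i\<bar> < e" using w(4) by simp
  qed (use d1 d2 in auto)
qed

lemma val_vec_continuous: "continuous_on {0<..T} val_vec"
proof -
  have "continuous_on {0<..T} (\<lambda>t. val_vec t $ i)" for i
    unfolding continuous_on_iff
  proof (intro ballI allI impI)
    fix s e :: real assume s: "s \<in> {0<..T}" and e: "0 < e"
    obtain d where d: "0 < d" "\<And>q. q \<in> \<rat> \<Longrightarrow> 0 < q \<Longrightarrow> q \<le> T \<Longrightarrow> \<bar>q - s\<bar> < d \<Longrightarrow> \<bar>val_vec q $ i - val_vec s $ i\<bar> < e/2"
      using val_vec_rational_limit[of s "e/2" i] s e by auto
    show "\<exists>d>0. \<forall>r\<in>{0<..T}. dist r s < d \<longrightarrow> dist (val_vec r $ i) (val_vec s $ i) < e"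
    proof (intro exI[of _ d] conjI ballI impI)
      fix r assume r: "r \<in> {0<..T}" "dist r s < d"
      obtain d' where d': "0 < d'" "\<And>q. q \<in> \<rat> \<Longrightarrow> 0 < q \<Longrightarrow> q \<le> T \<Longrightarrow> \<bar>q - r\<bar> < d' \<Longrightarrow> \<bar>val_vec q $ i - val_vec r $ i\<bar> < e/2"
        using val_vec_rational_limit[of r "e/2" i] r e by auto
      \<comment> \<open>A rational \<open>q\<close> just below \<open>r\<close> is close enough to
        \<open>r\<close> for the estimate at \<open>r\<close>, and lies between \<open>s - d\<close>
        and \<open>s + d\<close> for the estimate at \<open>s\<close>.\<close>
      have "max 0 (max (r - d') (s - d)) < r" using r d'(1) by (auto simp: dist_real_def)
      then obtain q where q: "q \<in> \<rat>" "max 0 (max (r - d') (s - d)) < q" "q < r" using Rats_dense_in_real by blast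
      have "\<bar>val_vec q $ i - val_vec s $ i\<bar> < e/2" using q r by (intro d(2)) (auto simp: dist_real_def)
      moreover have "\<bar>val_vec q $ i - val_vec r $ i\<bar> < e/2" using q r by (intro d'(2)) auto
      ultimately show "dist (val_vec r $ i) (val_vec s $ i) < e" unfolding dist_real_def by linarith
    qed (rule d)
  qed
  then have "continuous_on {0<..T} (\<lambda>t. \<chi> i. val_vec t $ i)" by (rule continuous_on_vec_lambda)
  then show ?thesis by simp
qed

lemma val_vec_tendsto:
  assumes "0 < s" "s \<le> T"
  shows "s < T \<Longrightarrow> ((\<lambda>r. val_vec r $ i) \<longlongrightarrow> val_vec s $ i) (at_right s)" "((\<lambda>r. val_vec r $ i) \<longlongrightarrow> val_vec s $ i) (at_left s)"
proof -
  have c: "continuous_on {0<..T} (\<lambda>r. val_vec r $ i)" by (intro continuous_intros val_vec_continuous)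
  show "((\<lambda>r. val_vec r $ i) \<longlongrightarrow> val_vec s $ i) (at_right s)" if "s < T"
  proof -
    have "((\<lambda>r. val_vec r $ i) \<longlongrightarrow> val_vec s $ i) (at s within {s..T})"
    proof -
      have "{s..T} \<subseteq> {0<..T}" using assms by auto
      then show ?thesis using continuous_on_subset[OF c] assms by (simp add: continuous_on_def)
    qed
    then show ?thesis using that by (simp add: at_within_Icc_at_right)
  qed
  have "((\<lambda>r. val_vec r $ i) \<longlongrightarrow> val_vec s $ i) (at s within {s/2..s})"
  proof -
    have "{s/2..s} \<subseteq> {0<..T}" using assms by auto
    then show ?thesis using continuous_on_subset[OF c] assms by (simp add: continuous_on_def)
  qed
  then show "((\<lambda>r. val_vec r $ i) \<longlongrightarrow> val_vec s $ i) (at_left s)" using assms by (simp add: at_within_Icc_at_left)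
qed

text \<open>Right-continuity of \<open>Y\<close> and continuity of \<open>val_vec\<close> extend the
  equality from rational times, on the interval to the right of \<open>t\<close> where the path
  stays in \<open>i\<close>.\<close>

lemma good_value:
  assumes w: "good \<omega>" and t: "0 < t" "t \<le> T" and i: "X t \<omega> = axis i 1"
  shows "Y t \<omega> = val_vec t $ i"
proof (cases "t = T")
  case True
  then show ?thesis using w i T_pos by (auto simp: good_def bsde_path_def val_vec_val val_def)
next
  case False
  then have tT: "t < T" using t by simp
  note x = good_sol_path(1)[OF w] and sp = good_sol_path(2)[OF w]
  show ?thesis
  proof (rule ccontr)
    assume ne: "Y t \<omega> \<noteq> val_vec t $ i"
    obtain d where d: "0 < d" "\<forall>s\<in>{t..<t+d}. X s \<omega> = X t \<omega>" using step_path_right[OF x less_imp_le[OF t(1)]] by blast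
    have "((\<lambda>r. Y r \<omega> - val_vec r $ i) \<longlongrightarrow> Y t \<omega> - val_vec t $ i) (at_right t)"
      by (intro tendsto_diff val_vec_tendsto(1)[OF t tT] sol_path_right[OF x order_refl sp]) (use t tT in auto)
    then have "\<forall>\<^sub>F r in at_right t. Y r \<omega> - val_vec r $ i \<noteq> 0"
      using ne by (intro tendsto_imp_eventually_ne) auto
    moreover have "\<forall>\<^sub>F r in at_right t. r < t + d" unfolding eventually_at_right_field using d by (intro exI[of _ "t + d"]) auto
    ultimately have "\<forall>\<^sub>F r in at_right t. Y r \<omega> - val_vec r $ i \<noteq> 0 \<and> r < t + d" by eventually_elim auto
    then obtain r where r: "r \<in> \<rat>" "t < r" "r < T" "Y r \<omega> - val_vec r $ i \<noteq> 0 \<and> r < t + d" using tT by (rule eventually_rational_in)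
    have "r \<in> {t..<t+d}" using r by auto
    then have "X r \<omega> = axis i 1" using d(2) i by metis
    then have "Y r \<omega> = val_vec r $ i" using w r t by (auto simp: good_def)
    then show False using r by simp
  qed
qed

lemma good_value_0:
  assumes w: "good \<omega>" and i: "X 0 \<omega> = axis i 1"
  shows "Y 0 \<omega> = val_vec 0 $ i"
proof -
  note x = good_sol_path(1)[OF w] and sp = good_sol_path(2)[OF w]
  obtain d where d: "0 < d" "\<forall>s\<in>{0..<0+d}. X s \<omega> = X 0 \<omega>" using step_path_right[OF x order_refl] by blast
  have "Y r \<omega> = val r i" if "0 < r" "r < min d T" for r
  proof -
    have "r \<in> {0..<0+d}" using that by auto
    then have "X r \<omega> = axis i 1" using d(2) i by metis
    then show ?thesis using good_value[OF w, of r i] that by (simp add: val_vec_val)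
  qed
  then have "\<forall>\<^sub>F r in at_right 0. Y r \<omega> = val r i"
    unfolding eventually_at_right_field using d T_pos by (intro exI[of _ "min d T"]) auto
  moreover have "((\<lambda>r. Y r \<omega>) \<longlongrightarrow> Y 0 \<omega>) (at_right 0)"
    by (rule sol_path_right[OF x order_refl sp]) (use T_pos in auto)
  ultimately have "((\<lambda>r. val r i) \<longlongrightarrow> Y 0 \<omega>) (at_right 0)" by (rule Lim_transform_eventually[rotated])
  then have "Lim (at_right 0) (\<lambda>r. val r i) = Y 0 \<omega>" by (intro tendsto_Lim) auto
  then show ?thesis by (simp add: val_vec_def)
qed

text \<open>The left limit of \<open>Y\<close> at the jump is computed twice: before
  \<open>r\<close> the path sits in \<open>j\<close> and \<open>Y\<close> follows the
  \<open>j\<close>-th component of \<open>val_vec\<close>, while the equation makes \<open>Y\<close>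
  jump by the inner product of \<open>Z\<close> with the jump of \<open>X\<close>.\<close>

lemma good_jump:
  assumes w: "good \<omega>" and r: "r \<in> JT T \<omega>" and i: "X r \<omega> = axis i 1" and j: "XL r \<omega> = axis j 1"
  shows "Z r \<omega> $ i - Z r \<omega> $ j = val_vec r $ i - val_vec r $ j"
proof -
  note x = good_sol_path(1)[OF w] and sp = good_sol_path(2)[OF w]
  have r': "0 < r" "r \<le> T" using r by auto
  have j': "llim (\<lambda>t. X t \<omega>) r = axis j 1" using j r' by (simp add: XL_eq)
  obtain d where d: "0 < d" "d \<le> r" "\<forall>s\<in>{r-d<..<r}. X s \<omega> = llim (\<lambda>t. X t \<omega>) r" using step_path_left(1)[OF x r'(1)] by blast
  have "Y s \<omega> = val_vec s $ j" if "r - d < s" "s < r" for s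
  proof (rule good_value[OF w])
    have "s \<in> {r-d<..<r}" using that by auto
    then show "X s \<omega> = axis j 1" using d(3) j' by metis
  qed (use that d r' in auto)
  then have "\<forall>\<^sub>F s in at_left r. val_vec s $ j = Y s \<omega>"
    unfolding eventually_at_left_field using d by (intro exI[of _ "r - d"]) auto
  from Lim_transform_eventually[OF val_vec_tendsto(2)[OF r'] this]
  have "((\<lambda>s. Y s \<omega>) \<longlongrightarrow> val_vec r $ j) (at_left r)" .
  moreover have "((\<lambda>s. Y s \<omega>) \<longlongrightarrow> Y r \<omega> - Z r \<omega> \<bullet> \<Delta> r \<omega>) (at_left r)"
    by (rule sol_path_left(1)[OF x order_refl sp r'])
  ultimately have "val_vec r $ j = Y r \<omega> - Z r \<omega> \<bullet> \<Delta> r \<omega>" by (intro tendsto_unique) auto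
  moreover have "Z r \<omega> \<bullet> \<Delta> r \<omega> = Z r \<omega> $ i - Z r \<omega> $ j"
    by (simp add: i j' inner_diff_right inner_axis)
  ultimately show ?thesis using good_value[OF w r' i] by simp
qed

section \<open>The integrand and the differential equation\<close>

lemma val_vec_measurable [measurable]: "val_vec \<in> borel_measurable borel"
proof -
  have [measurable]: "(\<lambda>t. indicator {0<..T} t *\<^sub>R val_vec t) \<in> borel_measurable borel"
    by (rule borel_measurable_continuous_on_indicator[OF _ val_vec_continuous]) simp
  have "(\<lambda>t. if t \<le> 0 then val_vec 0 else if t \<le> T then indicator {0<..T} t *\<^sub>R val_vec t else val_vec T) \<in> borel_measurable borel"
    by measurable
  moreover have "(\<lambda>t. if t \<le> 0 then val_vec 0 else if t \<le> T then indicator {0<..T} t *\<^sub>R val_vec t else val_vec T) = val_vec"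
    using T_pos by (auto simp: fun_eq_iff val_vec_def val_def vec_eq_iff)
  ultimately show ?thesis by (simp only:)
qed

lemma val_vec_predictable: "predictable P X (\<lambda>t \<omega>. val_vec t)"
  unfolding predictable_def predictable_sigma_eq by (rule comp_filt.pred_measurable_time_fun[OF val_vec_measurable])

text \<open>At each jump from \<open>j\<close> to \<open>i\<close> the differences of components of
  \<open>Z\<close> and of \<open>val_vec\<close> agree. The predictable set where they disagree is
  thus never hit by such a jump, and by \<open>compensator_null\<close> the rate vanishes on it;
  this is what the seminorm tests.\<close>

lemma Z_equiv: "M_equiv P X A T Z (\<lambda>t \<omega>. val_vec t)"
proof -
  \<comment> \<open>The compensator formula is proved for the natural filtration, so
    \<open>Z\<close> is replaced by an indistinguishable version.\<close>
  have "\<forall>i. \<exists>g\<in>borel_measurable (nat_pred P X). AE \<omega> in P. \<forall>t\<in>{0..}. Z t \<omega> $ i = g (t, \<omega>)"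
    using predictable_ex_natural[OF predictable_nth[OF sol_Z]] by simp
  then obtain H where H: "\<And>i. H i \<in> borel_measurable (nat_pred P X)"
    "\<And>i. AE \<omega> in P. \<forall>t\<in>{0..}. Z t \<omega> $ i = H i (t, \<omega>)"
    by (rule choice_obtain) (iprover intro: that)
  have HZ: "AE \<omega> in P. \<forall>i\<in>UNIV. \<forall>t\<in>{0..}. Z t \<omega> $ i = H i (t, \<omega>)"
  proof (rule AE_finite_allI)
    show "AE \<omega> in P. \<forall>t\<in>{0..}. Z t \<omega> $ i = H i (t, \<omega>)" for i by (rule H(2))
  qed simp
  have null: "AE z in LP. i \<noteq> j \<longrightarrow> 0 < fst z \<longrightarrow> fst z \<le> T \<longrightarrow> XL (fst z) (snd z) = axis j 1 \<longrightarrow>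
      H i z - H j z \<noteq> val_vec (fst z) $ i - val_vec (fst z) $ j \<longrightarrow> A (fst z) $ i $ j = 0" for i j
  proof (cases "i = j")
    case False
    define D where "D = {z \<in> space (nat_pred P X). H i z - H j z \<noteq> val_vec (fst z) $ i - val_vec (fst z) $ j}"
    have "(\<lambda>z. val_vec (fst z) $ k) \<in> borel_measurable (nat_pred P X)" for k
      using measurable_compose[OF nat_filt.pred_measurable_time[of P X] measurable_vec_nth[OF val_vec_measurable]] .
    then have D: "D \<in> sets (nat_pred P X)" unfolding D_def using H(1)[of i] H(1)[of j] by measurable
    have "AE \<omega> in P. \<forall>r\<in>JT T \<omega>. (r, \<omega>) \<in> D \<longrightarrow> XL r \<omega> = axis j 1 \<longrightarrow> X r \<omega> \<noteq> axis i 1"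
      using AE_good HZ
    proof eventually_elim
      case (elim \<omega>)
      show ?case
      proof (intro ballI impI notI)
        fix r assume r: "r \<in> JT T \<omega>" "(r, \<omega>) \<in> D" "XL r \<omega> = axis j 1" "X r \<omega> = axis i 1"
        have "Z r \<omega> $ i - Z r \<omega> $ j = val_vec r $ i - val_vec r $ j" by (rule good_jump[OF elim(1) r(1,4,3)])
        moreover have "Z r \<omega> $ k = H k (r, \<omega>)" for k using elim(2) r(1) by auto
        ultimately show False using r(2) by (simp add: D_def)
      qed
    qed
    from compensator_null[OF D False T0 this] AE_space show ?thesis
      by eventually_elim (auto simp: D_def nat_filt.space_pred space_pair_measure)
  qed simp
  have null_all: "AE z in LP. \<forall>i\<in>UNIV. \<forall>j\<in>UNIV. i \<noteq> j \<longrightarrow> 0 < fst z \<longrightarrow> fst z \<le> T \<longrightarrow> XL (fst z) (snd z) = axis j 1 \<longrightarrow>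
      H i z - H j z \<noteq> val_vec (fst z) $ i - val_vec (fst z) $ j \<longrightarrow> A (fst z) $ i $ j = 0"
    by (intro AE_finite_allI null) simp_all
  \<comment> \<open>Extension by 0 to negative times gives the joint measurability that the passage
    to \<open>dt_dP\<close> requires.\<close>
  define H' where "H' i z = (if fst z \<in> {0..} then H i z else 0)" for i z
  have [measurable]: "H' i \<in> borel_measurable (borel \<Otimes>\<^sub>M P)" for i
    unfolding H'_def[abs_def] by (rule nat_pred_joint[OF H(1)])
  define Q where "Q t \<omega> \<longleftrightarrow> (\<forall>i j. 0 < t \<longrightarrow> XL t \<omega> = axis j 1 \<longrightarrow> rate i j t * ((H' i (t, \<omega>) - H' j (t, \<omega>)) - (val_vec t $ i - val_vec t $ j)) = 0)" for t \<omega>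
  have Q: "AE (t, \<omega>) in dt_dP P T. Q t \<omega>"
  proof (rule AE_dt_dP_I)
    have "{z \<in> space (borel \<Otimes>\<^sub>M P). \<forall>i j. 0 < fst z \<longrightarrow> XL (fst z) (snd z) = axis j 1 \<longrightarrow> rate i j (fst z) * ((H' i z - H' j z) - (val_vec (fst z) $ i - val_vec (fst z) $ j)) = 0} \<in> sets (borel \<Otimes>\<^sub>M P)"
      by measurable
    then show "{z \<in> space (borel \<Otimes>\<^sub>M P). Q (fst z) (snd z)} \<in> sets (borel \<Otimes>\<^sub>M P)" by (simp add: Q_def)
    show "AE z in LP. 0 < fst z \<longrightarrow> fst z \<le> T \<longrightarrow> Q (fst z) (snd z)"
      using null_all
    proof eventually_elim
      case (elim z)
      show ?case
        unfolding Q_def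
      proof (intro impI allI)
        fix i j assume z: "0 < fst z" "fst z \<le> T" "XL (fst z) (snd z) = axis j 1"
        show "rate i j (fst z) * ((H' i (fst z, snd z) - H' j (fst z, snd z)) - (val_vec (fst z) $ i - val_vec (fst z) $ j)) = 0"
        proof (cases "i = j \<or> H i z - H j z = val_vec (fst z) $ i - val_vec (fst z) $ j")
          case True then show ?thesis using z by (auto simp: H'_def)
        next
          case False
          then have "A (fst z) $ i $ j = 0" using elim z by auto
          then show ?thesis by (simp add: rate_def)
        qed
      qed
    qed
  qed
  have "AE (t, \<omega>) in dt_dP P T. M_norm_sq X A t \<omega> (Z t \<omega> - val_vec t) = 0"
    using Q AE_dt_dP_omega[OF HZ, of T] AE_space
  proof eventually_elim
    case (elim z)
    obtain t \<omega> where z: "z = (t, \<omega>)" by (cases z)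
    have t: "0 < t" "\<omega> \<in> space P" using elim(3) unfolding z dt_dP_def by (auto simp: space_pair_measure space_restrict_space)
    obtain j where j: "XL t \<omega> = axis j 1" using XL_state[OF t] by blast
    have "A t $ i $ j * ((Z t \<omega> - val_vec t) $ i - (Z t \<omega> - val_vec t) $ j) = 0" for i
    proof -
      have "rate i j t * ((H' i (t, \<omega>) - H' j (t, \<omega>)) - (val_vec t $ i - val_vec t $ j)) = 0"
        using elim(1) j t unfolding z Q_def by auto
      moreover have "Z t \<omega> $ k = H' k (t, \<omega>)" for k using elim(2) t unfolding z by (auto simp: H'_def)
      ultimately show ?thesis using t by (auto simp: rate_def)
    qed
    then show ?case unfolding z by (simp only: prod.case M_norm_sq_zero_iff[OF t(1) j]) blast
  qed
  then show ?thesis unfolding M_equiv_def using sol_Z val_vec_predictable by blast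
qed

section \<open>The differential equation away from time 0\<close>

definition ode_rhs :: "'n \<Rightarrow> real \<Rightarrow> real" where
  "ode_rhs i r = driver_vec ft r (val_vec r) $ i + (transpose (A r) *v val_vec r) $ i"

text \<open>The claim is deterministic, so one witness path in state \<open>i\<close> around
  \<open>s0\<close> suffices. Along it there are no jumps, \<open>X\<close> is e_i, \<open>Y\<close>
  is the \<open>i\<close>-th component of \<open>val_vec\<close>, and \<open>Z\<close> may be
  exchanged for \<open>val_vec\<close>: in the driver by invariance, in the drift by
  \<open>inner_A_eq\<close>.\<close>

lemma local_ode:
  assumes s0: "0 < s0" "s0 \<le> T"
  shows "\<exists>d>0. \<forall>s t. 0 < s \<longrightarrow> s \<le> t \<longrightarrow> t \<le> T \<longrightarrow> \<bar>s - s0\<bar> < d \<longrightarrow> \<bar>t - s0\<bar> < d \<longrightarrow>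
     ode_rhs i absolutely_integrable_on {s..t} \<and> val_vec t $ i - val_vec s $ i = - integral {s..t} (ode_rhs i)"
proof -
  \<comment> \<open>Invariance is taken for all values of \<open>y\<close> at once, so that
    \<open>Z\<close> can be exchanged while the left limit of \<open>Y\<close> stays in
    place.\<close>
  have inv: "AE \<omega> in P. AE r in lborel. 0 < r \<longrightarrow> r \<le> T \<longrightarrow> (\<forall>yy. f \<omega> r yy (Z r \<omega>) = f \<omega> r yy (val_vec r))"
    using invariant Z_equiv unfolding respects_M_equiv_def by (intro AE_dt_dP_sections(2)) blast
  have mk: "AE \<omega> in P. AE r in lborel. 0 < r \<longrightarrow> r \<le> T \<longrightarrow> f \<omega> r (YL Y r \<omega>) (val_vec r) = ft (X r \<omega>) r (YL Y r \<omega>) (val_vec r)"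
    using markovian pred_progressive[OF YL_predictable[OF sol_adapted]] val_vec_predictable unfolding markovian_driver_def
    by (intro AE_dt_dP_sections(2)) blast
  have nz: "AE \<omega> in P. AE r in lborel. 0 < r \<longrightarrow> r \<le> T \<longrightarrow> M_norm_sq X A r \<omega> (Z r \<omega> - val_vec r) = 0"
    using Z_equiv unfolding M_equiv_def by (intro AE_dt_dP_sections(2)) blast
  have "AE \<omega> in P. AE r in lborel. 0 < r \<longrightarrow> r \<le> T \<longrightarrow> (\<forall>yy. f \<omega> r yy (Z r \<omega>) = f \<omega> r yy (val_vec r)) \<and>
      f \<omega> r (YL Y r \<omega>) (val_vec r) = ft (X r \<omega>) r (YL Y r \<omega>) (val_vec r) \<and> M_norm_sq X A r \<omega> (Z r \<omega> - val_vec r) = 0"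
    using inv mk nz
  proof eventually_elim
    case (elim \<omega>)
    then show ?case by eventually_elim blast
  qed
  then obtain \<omega> where w: "good \<omega>" "X s0 \<omega> = axis i 1" "XL s0 \<omega> = axis i 1"
    and ae: "AE r in lborel. 0 < r \<longrightarrow> r \<le> T \<longrightarrow> (\<forall>yy. f \<omega> r yy (Z r \<omega>) = f \<omega> r yy (val_vec r)) \<and>
      f \<omega> r (YL Y r \<omega>) (val_vec r) = ft (X r \<omega>) r (YL Y r \<omega>) (val_vec r) \<and> M_norm_sq X A r \<omega> (Z r \<omega> - val_vec r) = 0"
    by (rule good_exists[OF s0])
  note x = good_sol_path(1)[OF w(1)] and sp = good_sol_path(2)[OF w(1)]
  have path: "bsde_path f T (\<phi> (X T \<omega>)) Y Z \<omega>" and wP: "\<omega> \<in> space P" using w(1) by (simp_all add: good_def)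
  obtain d where d: "0 < d" "d \<le> s0" "\<And>r. \<bar>r - s0\<bar> < d \<Longrightarrow> X r \<omega> = axis i 1" "\<And>r. \<bar>r - s0\<bar> < d \<Longrightarrow> llim (\<lambda>t. X t \<omega>) r = axis i 1"
    by (rule constant_nearby[OF x s0(1), of "axis i 1"]) (use w s0 in \<open>auto simp: XL_eq\<close>)
  have nojump: "r \<notin> jumps (\<lambda>t. X t \<omega>)" if "\<bar>r - s0\<bar> < d" for r using d(3,4)[OF that] by (simp add: jumps_def)
  show ?thesis
  proof (intro exI[of _ d] conjI allI impI d(1))
    fix s t assume st: "0 < s" "s \<le> t" "t \<le> T" "\<bar>s - s0\<bar> < d" "\<bar>t - s0\<bar> < d"
    have near: "\<bar>r - s0\<bar> < d" if "s \<le> r" "r \<le> t" for r using that st by linarith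
    have eq: "AE r in lborel. s < r \<longrightarrow> r \<le> t \<longrightarrow> gg \<omega> r = ode_rhs i r"
      using ae
    proof eventually_elim
      case (elim r)
      show ?case
      proof (intro impI)
        assume r: "s < r" "r \<le> t"
        then have r': "0 < r" "r \<le> T" and nr: "\<bar>r - s0\<bar> < d" using st near by auto
        have Xr: "X r \<omega> = axis i 1" and XLr: "XL r \<omega> = axis i 1" using d(3,4)[OF nr] r' by (auto simp: XL_eq)
        have Yr: "YL Y r \<omega> = val_vec r $ i" "left_lim Y r \<omega> = val_vec r $ i"
          using YL_eq[OF path wP r'] nojump[OF nr] good_value[OF w(1) r' Xr] by simp_all
        have "f \<omega> r (left_lim Y r \<omega>) (Z r \<omega>) = driver_vec ft r (val_vec r) $ i"
          using elim r' Yr Xr by (simp add: driver_vec_def)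
        moreover have "drift (\<lambda>r. Z r \<omega>) \<omega> r = (transpose (A r) *v val_vec r) $ i"
        proof -
          have "drift (\<lambda>r. Z r \<omega>) \<omega> r = val_vec r \<bullet> (A r *v left_lim X r \<omega>)"
            unfolding drift_def using elim r' by (intro inner_A_eq[OF r'(1) XLr]) blast
          also have "\<dots> = (transpose (A r) *v val_vec r) $ i"
            unfolding inner_AXL[OF XLr r'(1)] by (simp add: matrix_vector_mult_def transpose_def mult.commute)
          finally show ?thesis .
        qed
        ultimately show "gg \<omega> r = ode_rhs i r" by (simp add: ode_rhs_def)
      qed
    qed
    have abs: "gg \<omega> absolutely_integrable_on {s..t}"
      by (rule absolutely_integrable_Icc_subset[OF sol_path_abs[OF x order_refl sp]]) (use st in auto)
    show "ode_rhs i absolutely_integrable_on {s..t}" by (rule absolutely_integrable_AE_cong(1)[OF abs eq])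
    have "Y t \<omega> - Y s \<omega> = - integral {s..t} (gg \<omega>)"
      by (rule good_smooth[OF w(1) nojump[OF near]]) (use st in auto)
    moreover have "Y t \<omega> = val_vec t $ i" "Y s \<omega> = val_vec s $ i"
      using st d(3)[OF st(4)] d(3)[OF st(5)] by (auto intro!: good_value[OF w(1)])
    ultimately show "val_vec t $ i - val_vec s $ i = - integral {s..t} (ode_rhs i)"
      using absolutely_integrable_AE_cong(2)[OF abs eq] by simp
  qed
qed

text \<open>Bolzano's principle again: the local equations add up over adjacent intervals.\<close>

lemma ode_component:
  assumes st: "0 < s" "s \<le> t" "t \<le> T"
  shows "ode_rhs i absolutely_integrable_on {s..t}" "val_vec t $ i - val_vec s $ i = - integral {s..t} (ode_rhs i)"
proof -
  define Q where "Q a b \<longleftrightarrow> (0 < a \<longrightarrow> b \<le> T \<longrightarrow> ode_rhs i absolutely_integrable_on {a..b} \<and> val_vec b $ i - val_vec a $ i = - integral {a..b} (ode_rhs i))" for a b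
  have "Q s t"
    using st(2)
  proof (induction rule: Bolzano)
    case (trans a b c)
    show ?case unfolding Q_def
    proof (intro impI)
      assume a: "0 < a" "c \<le> T"
      have ab: "ode_rhs i absolutely_integrable_on {a..b}" "val_vec b $ i - val_vec a $ i = - integral {a..b} (ode_rhs i)"
        using trans a unfolding Q_def by auto
      have bc: "ode_rhs i absolutely_integrable_on {b..c}" "val_vec c $ i - val_vec b $ i = - integral {b..c} (ode_rhs i)"
        using trans a unfolding Q_def by auto
      have acI: "ode_rhs i absolutely_integrable_on {a..c}"
        by (rule absolutely_integrable_Icc_combine[OF ab(1) bc(1)]) (use trans in auto)
      then show "ode_rhs i absolutely_integrable_on {a..c} \<and> val_vec c $ i - val_vec a $ i = - integral {a..c} (ode_rhs i)"
        using integrable_on_split_abs[OF acI, of b] trans ab(2) bc(2) by simp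
    qed
  next
    case (local x)
    then have x: "0 < x" "x \<le> T" using st by auto
    obtain d where d: "d > 0" "\<And>a b. 0 < a \<Longrightarrow> a \<le> b \<Longrightarrow> b \<le> T \<Longrightarrow> \<bar>a - x\<bar> < d \<Longrightarrow> \<bar>b - x\<bar> < d \<Longrightarrow>
       ode_rhs i absolutely_integrable_on {a..b} \<and> val_vec b $ i - val_vec a $ i = - integral {a..b} (ode_rhs i)"
      using local_ode[OF x, of i] by blast
    show ?case
    proof (intro exI[of _ d] conjI allI impI d(1))
      fix a b assume ab: "a \<le> x \<and> x \<le> b \<and> b - a < d"
      then have "a \<le> b" "\<bar>a - x\<bar> < d" "\<bar>b - x\<bar> < d" by auto
      then show "Q a b" unfolding Q_def using d(2)[of a b] by blast
    qed
  qed
  then show "ode_rhs i absolutely_integrable_on {s..t}" "val_vec t $ i - val_vec s $ i = - integral {s..t} (ode_rhs i)"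
    using st unfolding Q_def by auto
qed

lemma solves_from_components:
  assumes "\<And>s t i. s \<in> J \<Longrightarrow> t \<in> J \<Longrightarrow> s \<le> t \<Longrightarrow> ode_rhs i absolutely_integrable_on {s..t} \<and> val_vec t $ i - val_vec s $ i = - integral {s..t} (ode_rhs i)"
  shows "solves_ode_on J A ft val_vec"
  unfolding solves_ode_on_def
proof (intro ballI impI)
  fix s t assume st: "s \<in> J" "t \<in> J" "s \<le> t"
  let ?G = "\<lambda>r. driver_vec ft r (val_vec r) + transpose (A r) *v val_vec r"
  have G: "(\<lambda>r. ?G r $ i) = ode_rhs i" for i by (auto simp: ode_rhs_def fun_eq_iff)
  have abs: "?G absolutely_integrable_on {s..t}"
    unfolding absolutely_integrable_on_vec_iff G using assms[OF st] by blast
  have int: "?G integrable_on {s..t}" using abs by (rule set_lebesgue_integral_eq_integral(1))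
  have "(val_vec t - val_vec s) $ i = (- integral {s..t} ?G) $ i" for i
    using assms[OF st, of i] integral_component_eq_cart[OF int, of i] G[of i] by simp
  then show "?G absolutely_integrable_on {s..t} \<and> val_vec t - val_vec s = - integral {s..t} ?G"
    using abs by (simp only: vec_eq_iff) blast
qed

text \<open>Near \<open>0\<close> an integrable driver keeps the value vector bounded: on \<open>[s,\<delta>]\<close> its maximum \<open>w m\<close>
  satisfies \<open>w m \<le> C + w m / 2\<close> as soon as \<open>\<delta>\<close> is small.\<close>

lemma val_vec_bounded:
  assumes D: "(\<lambda>t. driver_vec ft t (val_vec t)) absolutely_integrable_on {0..T}"
  obtains B where "\<And>r. 0 < r \<Longrightarrow> r \<le> T \<Longrightarrow> (\<Sum>i\<in>UNIV. \<bar>val_vec r $ i\<bar>) \<le> B"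
proof -
  let ?w = "\<lambda>r. \<Sum>i\<in>UNIV. \<bar>val_vec r $ i\<bar>" and ?n = "real CARD('n)"
  define Dv where "Dv i r = driver_vec ft r (val_vec r) $ i" for i r
  have Dv: "Dv i absolutely_integrable_on {0..T}" for i
    using D unfolding absolutely_integrable_on_vec_iff Dv_def[abs_def] by blast
  have nDv: "(\<lambda>r. \<bar>Dv i r\<bar>) absolutely_integrable_on {0..T}" for i
    using set_integrable_abs[OF Dv] .
  define C where "C = (\<Sum>i\<in>UNIV. integral {0..T} (\<lambda>r. \<bar>Dv i r\<bar>))"
  \<comment> \<open>Chosen to make \<open>?n * K * \<delta>\<close> at most 1/2; the summand 1
    guards against a zero denominator when \<open>K = 0\<close>.\<close>
  define \<delta> where "\<delta> = min T (1 / (2 * (?n * K + 1)))"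
  have nK: "0 \<le> ?n * K" using K_nonneg by simp
  have \<delta>: "0 < \<delta>" "\<delta> \<le> T" using T_pos nK by (auto simp: \<delta>_def)
  have \<delta>K: "?n * K * \<delta> \<le> 1/2"
  proof -
    have "?n * K * \<delta> \<le> ?n * K * (1 / (2 * (?n * K + 1)))" using nK by (intro mult_left_mono) (auto simp: \<delta>_def)
    also have "\<dots> \<le> 1/2" using nK by (simp add: field_simps)
    finally show ?thesis .
  qed
  have wcont: "continuous_on {0<..T} ?w" by (intro continuous_intros val_vec_continuous)
  have small: "?w s \<le> 2 * (?w \<delta> + C)" if s: "0 < s" "s \<le> \<delta>" for s
  proof -
    have "{s..\<delta>} \<subseteq> {0<..T}" using s \<delta> by auto
    then have "continuous_on {s..\<delta>} ?w" by (rule continuous_on_subset[OF wcont])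
    then obtain m where m: "m \<in> {s..\<delta>}" "\<And>r. r \<in> {s..\<delta>} \<Longrightarrow> ?w r \<le> ?w m"
      using continuous_attains_sup[of "{s..\<delta>}" ?w] s by auto
    have m': "0 < m" "m \<le> \<delta>" using m s by auto
    have est: "\<bar>val_vec m $ i\<bar> \<le> \<bar>val_vec \<delta> $ i\<bar> + integral {0..T} (\<lambda>r. \<bar>Dv i r\<bar>) + K * ?w m * \<delta>" for i
    proof -
      note ode = ode_component[OF m' \<delta>(2), of i]
      have D1: "Dv i absolutely_integrable_on {m..\<delta>}"
        by (rule absolutely_integrable_Icc_subset[OF Dv]) (use m' \<delta> in auto)
      have A1: "(\<lambda>r. ode_rhs i r - Dv i r) absolutely_integrable_on {m..\<delta>}"
        using ode(1) D1 by (rule set_integral_diff(1))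
      have I: "integral {m..\<delta>} (ode_rhs i) = integral {m..\<delta>} (Dv i) + integral {m..\<delta>} (\<lambda>r. ode_rhs i r - Dv i r)"
        using integral_add[OF set_lebesgue_integral_eq_integral(1)[OF D1] set_lebesgue_integral_eq_integral(1)[OF A1]] by simp
      have b1: "\<bar>integral {m..\<delta>} (Dv i)\<bar> \<le> integral {0..T} (\<lambda>r. \<bar>Dv i r\<bar>)"
      proof -
        have n1: "(\<lambda>r. \<bar>Dv i r\<bar>) integrable_on {m..\<delta>}"
          by (rule set_lebesgue_integral_eq_integral(1)[OF set_integrable_abs[OF D1]])
        have "\<bar>integral {m..\<delta>} (Dv i)\<bar> \<le> integral {m..\<delta>} (\<lambda>r. \<bar>Dv i r\<bar>)"
          using integral_norm_bound_integral[OF set_lebesgue_integral_eq_integral(1)[OF D1] n1] by simp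
        also have "\<dots> \<le> integral {0..T} (\<lambda>r. \<bar>Dv i r\<bar>)"
          using m' \<delta> by (intro integral_subset_le n1 set_lebesgue_integral_eq_integral(1)[OF nDv]) auto
        finally show ?thesis .
      qed
      have b2: "\<bar>integral {m..\<delta>} (\<lambda>r. ode_rhs i r - Dv i r)\<bar> \<le> K * ?w m * (\<delta> - m)"
      proof -
        have bd: "norm (ode_rhs i r - Dv i r) \<le> K * ?w m" if "r \<in> {m..\<delta>}" for r
        proof -
          have r: "0 < r" using that m' by auto
          have "ode_rhs i r - Dv i r = (\<Sum>k\<in>UNIV. A r $ k $ i * val_vec r $ k)"
            by (simp add: ode_rhs_def Dv_def matrix_vector_mult_def transpose_def)
          also have "\<bar>\<dots>\<bar> \<le> (\<Sum>k\<in>UNIV. K * \<bar>val_vec r $ k\<bar>)"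
            using A_bound[of r _ i] r by (intro order_trans[OF sum_abs sum_mono]) (auto simp: abs_mult intro!: mult_right_mono)
          also have "\<dots> \<le> K * ?w m"
            unfolding sum_distrib_left[symmetric] using m(2)[of r] that m K_nonneg by (intro mult_left_mono) auto
          finally show ?thesis by simp
        qed
        have "norm (integral {m..\<delta>} (\<lambda>r. ode_rhs i r - Dv i r)) \<le> integral {m..\<delta>} (\<lambda>r. K * ?w m)"
          by (rule integral_norm_bound_integral[OF set_lebesgue_integral_eq_integral(1)[OF A1] _ bd]) auto
        then show ?thesis using m' by (simp add: mult_ac)
      qed
      have "K * ?w m * (\<delta> - m) \<le> K * ?w m * \<delta>"
        using K_nonneg m' by (intro mult_left_mono mult_nonneg_nonneg sum_nonneg) auto
      then show ?thesis using ode(2) I b1 b2 by linarith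
    qed
    have "?w m \<le> (\<Sum>i\<in>UNIV. \<bar>val_vec \<delta> $ i\<bar> + integral {0..T} (\<lambda>r. \<bar>Dv i r\<bar>) + K * ?w m * \<delta>)"
      by (intro sum_mono est)
    also have "\<dots> = ?w \<delta> + C + (?n * K * \<delta>) * ?w m" by (simp add: sum.distrib C_def)
    also have "\<dots> \<le> ?w \<delta> + C + 1/2 * ?w m" using \<delta>K by (intro add_left_mono mult_right_mono) (auto intro: sum_nonneg)
    finally have "?w m \<le> 2 * (?w \<delta> + C)" by simp
    then show ?thesis using m(2)[of s] s by auto
  qed
  have "{\<delta>..T} \<subseteq> {0<..T}" using \<delta> by auto
  then have "continuous_on {\<delta>..T} ?w" by (rule continuous_on_subset[OF wcont])
  moreover have "{\<delta>..T} \<noteq> {}" using \<delta> by simp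
  ultimately obtain m where m: "\<forall>r\<in>{\<delta>..T}. ?w r \<le> ?w m"
    using continuous_attains_sup[OF compact_Icc] by blast
  show thesis
  proof (rule that[of "max (2 * (?w \<delta> + C)) (?w m)"])
    fix r assume "0 < r" "r \<le> T"
    then show "?w r \<le> max (2 * (?w \<delta> + C)) (?w m)"
      using small[of r] m by (cases "r \<le> \<delta>") (auto simp: le_max_iff_disj)
  qed
qed

text \<open>Boundedness makes the linear part integrable down to 0, so every component has a limit
  at 0 from the right. \<open>val_vec 0\<close> is defined as that limit, and the equation extends
  to the closed interval.\<close>

lemma ode_closed:
  assumes D: "(\<lambda>t. driver_vec ft t (val_vec t)) absolutely_integrable_on {0..T}"
  shows "solves_ode_on {0..T} A ft val_vec" "continuous_on {0..T} val_vec"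
proof -
  obtain B where B: "\<And>r. 0 < r \<Longrightarrow> r \<le> T \<Longrightarrow> (\<Sum>i\<in>UNIV. \<bar>val_vec r $ i\<bar>) \<le> B" using val_vec_bounded[OF D] by blast
  have G: "ode_rhs i absolutely_integrable_on {0..T}" for i
  proof -
    have 1: "(\<lambda>r. driver_vec ft r (val_vec r) $ i) absolutely_integrable_on {0..T}"
      using D unfolding absolutely_integrable_on_vec_iff by blast
    have 2: "(\<lambda>r. \<Sum>k\<in>UNIV. rate k i r * val_vec r $ k) absolutely_integrable_on {0..T}"
    proof (rule bounded_absolutely_integrable(2)[where K="K * (max B (\<Sum>k\<in>UNIV. \<bar>val_vec 0 $ k\<bar>))"])
      fix r assume r: "0 \<le> r" "r \<le> T"
      have "\<bar>\<Sum>k\<in>UNIV. rate k i r * val_vec r $ k\<bar> \<le> (\<Sum>k\<in>UNIV. K * \<bar>val_vec r $ k\<bar>)"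
        by (rule order_trans[OF sum_abs sum_mono]) (auto simp: abs_mult intro!: mult_right_mono rate_bound)
      also have "\<dots> \<le> K * (max B (\<Sum>k\<in>UNIV. \<bar>val_vec 0 $ k\<bar>))"
        unfolding sum_distrib_left[symmetric] using B[of r] r K_nonneg
        by (cases "r = 0") (auto intro!: mult_left_mono simp: le_max_iff_disj)
      finally show "\<bar>\<Sum>k\<in>UNIV. rate k i r * val_vec r $ k\<bar> \<le> K * (max B (\<Sum>k\<in>UNIV. \<bar>val_vec 0 $ k\<bar>))" .
    qed measurable
    have 3: "(\<lambda>r. driver_vec ft r (val_vec r) $ i + (\<Sum>k\<in>UNIV. rate k i r * val_vec r $ k)) absolutely_integrable_on {0..T}"
      using 1 2 by (rule set_integral_add(1))
    show ?thesis
      by (rule absolutely_integrable_AE_cong(1)[OF 3])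
        (auto simp: ode_rhs_def matrix_vector_mult_def transpose_def rate_def)
  qed
  have cont: "continuous_on {0..T} (\<lambda>t. integral {0..t} (ode_rhs i))" for i
    by (rule indefinite_integral_continuous_1[OF set_lebesgue_integral_eq_integral(1)[OF G]])
  \<comment> \<open>The value at 0 that the integrated equation predicts, going backwards from
    \<open>T\<close>.\<close>
  define L where "L i = val_vec T $ i + integral {0..T} (ode_rhs i)" for i
  have pos: "val_vec t $ i = L i - integral {0..t} (ode_rhs i)" if t: "0 < t" "t \<le> T" for t i
    using ode_component(2)[OF t order_refl, of i] integrable_on_split_abs[OF G[of i], of t] t by (simp add: L_def)
  have zero: "val_vec 0 $ i = L i" for i
  proof -
    have "((\<lambda>t. L i - integral {0..t} (ode_rhs i)) \<longlongrightarrow> L i - integral {0..0} (ode_rhs i)) (at 0 within {0..T})"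
      using cont[of i, unfolded continuous_on_def, THEN bspec, of 0] T0 by (intro tendsto_intros) (simp only: atLeastAtMost_iff order_refl)
    then have "((\<lambda>t. L i - integral {0..t} (ode_rhs i)) \<longlongrightarrow> L i) (at_right 0)"
      using T_pos by (simp add: at_within_Icc_at_right)
    moreover have "\<forall>\<^sub>F t in at_right 0. L i - integral {0..t} (ode_rhs i) = val t i"
      unfolding eventually_at_right_field using T_pos pos[symmetric] by (intro exI[of _ T]) (auto simp: val_vec_val)
    ultimately have "((\<lambda>t. val t i) \<longlongrightarrow> L i) (at_right 0)" by (rule Lim_transform_eventually)
    then have "Lim (at_right 0) (\<lambda>t. val t i) = L i" by (intro tendsto_Lim) auto
    then show ?thesis by (simp add: val_vec_def)
  qed
  have all: "val_vec t $ i = L i - integral {0..t} (ode_rhs i)" if "0 \<le> t" "t \<le> T" for t i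
    using pos[of t i] zero[of i] that by (cases "t = 0") auto
  show "solves_ode_on {0..T} A ft val_vec"
  proof (rule solves_from_components, intro conjI)
    fix s t i assume st: "s \<in> {0..T}" "t \<in> {0..T}" "s \<le> t"
    show "ode_rhs i absolutely_integrable_on {s..t}" by (rule absolutely_integrable_Icc_subset[OF G]) (use st in auto)
    have "ode_rhs i absolutely_integrable_on {0..t}" by (rule absolutely_integrable_Icc_subset[OF G]) (use st in auto)
    from integrable_on_split_abs[OF this, of s] show "val_vec t $ i - val_vec s $ i = - integral {s..t} (ode_rhs i)"
      using all[of s i] all[of t i] st by simp
  qed
  have "continuous_on {0..T} (\<lambda>t. val_vec t $ i)" for i
  proof -
    have "continuous_on {0..T} (\<lambda>t. L i - integral {0..t} (ode_rhs i))" by (intro continuous_intros cont)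
    then show ?thesis by (rule continuous_on_cong[THEN iffD1, OF refl, rotated]) (simp add: all)
  qed
  then have "continuous_on {0..T} (\<lambda>t. \<chi> i. val_vec t $ i)" by (rule continuous_on_vec_lambda)
  then show "continuous_on {0..T} val_vec" by simp
qed

text \<open>At \<open>T\<close> the function has to be \<open>\<phi>\<close> on the whole space and
  not just on the states; before \<open>T\<close> its value off the unit vectors is
  arbitrary.\<close>

definition val_fun :: "real \<Rightarrow> real^'n \<Rightarrow> real" where
  "val_fun t x = (if T \<le> t then \<phi> x else val_vec t $ (THE i. x = axis i 1))"

lemma val_fun_axis: "t < T \<Longrightarrow> val_fun t (axis i 1) = val_vec t $ i"
  by (simp add: val_fun_def axis_eq_axis)

lemma value_vec_uu: "value_vec val_fun = val_vec"
proof
  fix t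
  show "value_vec val_fun t = val_vec t"
  proof (cases "t < T")
    case True
    then show ?thesis by (simp add: value_vec_def val_fun_axis)
  next
    case False
    then show ?thesis using T_pos by (simp add: value_vec_def val_fun_def vec_eq_iff val_vec_val val_def)
  qed
qed

lemma Y_eq_uu: "AE \<omega> in P. \<forall>t\<in>{0..<T}. Y t \<omega> = val_fun t (X t \<omega>)"
  using AE_good
proof eventually_elim
  case (elim \<omega>)
  show ?case
  proof
    fix t assume t: "t \<in> {0..<T}"
    then obtain i where i: "X t \<omega> = axis i 1" using state_X[of t \<omega>] elim by (auto simp: good_def)
    have "Y t \<omega> = val_vec t $ i"
      using good_value[OF elim, of t i] good_value_0[OF elim, of i] t i by (cases "t = 0") auto
    then show "Y t \<omega> = val_fun t (X t \<omega>)" using t i by (simp add: val_fun_axis)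
  qed
qed

lemma val_fun_T: "val_fun T = \<phi>"
  by (simp add: val_fun_def fun_eq_iff)

lemma ode_open: "solves_ode_on {0<..T} A ft val_vec"
  by (rule solves_from_components) (use ode_component in auto)

end

text \<open>\<open>well_posed\<close> ranges over all horizons up to \<open>T\<close> because the
  gluing argument solves a problem on [0,S]. The equation and the continuity reach time 0 when the
  driver vector is integrable there, since the deterministic start constrains the driver at one
  state only.\<close>

theorem corollary2:
  fixes P :: "'a measure"
    and X :: "real \<Rightarrow> 'a \<Rightarrow> real^'n"
    and A :: "real \<Rightarrow> real^'n^'n"
    and f :: "'a \<Rightarrow> real \<Rightarrow> real \<Rightarrow> real^'n \<Rightarrow> real"
    and ft :: "real^'n \<Rightarrow> real \<Rightarrow> real \<Rightarrow> real^'n \<Rightarrow> real"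
    and \<phi> :: "real^'n \<Rightarrow> real"
    and T :: real
    and Y :: "real \<Rightarrow> 'a \<Rightarrow> real"
    and Z :: "real \<Rightarrow> 'a \<Rightarrow> real^'n"
  assumes chain: "markov_chain P X A"
    and positive: "\<And>t i. 0 < t \<Longrightarrow> \<P>(\<omega> in P. X t \<omega> = axis i 1) > 0"
    and T_pos: "0 < T"
    and progressive: "progressive_driver P X f"
    and invariant: "respects_M_equiv P X A f T"
    and well_posed: "\<And>S \<xi>. 0 < S \<Longrightarrow> S \<le> T \<Longrightarrow> square_integrable_data P X S \<xi> \<Longrightarrow>
                       bsde_uniquely_solvable P X A f S \<xi>"
    and markovian: "markovian_driver P X f T ft"
    and solution: "bsde_solution P X A f T (\<lambda>\<omega>. \<phi> (X T \<omega>)) Y Z"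
  shows "\<exists>u :: real \<Rightarrow> real^'n \<Rightarrow> real.
           (AE \<omega> in P. \<forall>t\<in>{0..<T}. Y t \<omega> = u t (X t \<omega>)) \<and>
           u T = \<phi> \<and>
           solves_ode_on {0<..T} A ft (value_vec u) \<and>
           ((\<lambda>t. driver_vec ft t (value_vec u t)) absolutely_integrable_on {0..T} \<longrightarrow>
              solves_ode_on {0..T} A ft (value_vec u) \<and> continuous_on {0..T} (value_vec u)) \<and>
           M_equiv P X A T Z (\<lambda>t \<omega>. value_vec u t) \<and>
           continuous_on {0<..T} (value_vec u)"
proof -
  interpret markov_chain P X A by (rule chain)
  interpret markov_bsde_solution P X A f ft T \<phi> Y Z
    by unfold_locales (fact positive T_pos progressive invariant well_posed markovian solution)+
  show ?thesis
  proof (intro exI[of _ val_fun] conjI impI)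
    show "AE \<omega> in P. \<forall>t\<in>{0..<T}. Y t \<omega> = val_fun t (X t \<omega>)" by (rule Y_eq_uu)
    show "val_fun T = \<phi>" by (rule val_fun_T)
  qed (simp_all add: value_vec_uu ode_open ode_closed Z_equiv val_vec_continuous)
qed

end
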